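(* Let $G$ be one of the groups $SU(2)$, $SO(3)$, $SL(2)=SL(2,\mathbb{R})$, endowed with its $\mathbf{k}\oplus\mathbf{p}$ sub-Riemannian structure, and let $K_{\mathrm{Id}}$ be the cut locus starting from the identity. Then: (i) for $G=SU(2)$, $K_{\mathrm{Id}}$ is a maximal circle $S^1$ without one point (the identity); (ii) for $G=SO(3)$, $K_{\mathrm{Id}}$ is a stratified set made by two manifolds glued in one point (i.e. it is the union of two submanifolds whose intersection is exactly one point): the first manifold is (diffeomorphic to) the real projective plane $\mathbb{R}\mathbb{P}^2$, the second is a maximal circle $S^1$ without one point (the identity); (iii) for $G=SL(2)$, $K_{\mathrm{Id}}$ is a stratified set made by two manifolds glued in one point (i.e. it is the union of two submanifolds whose intersection is exactly one point): the first manifold is (diffeomorphic to) $\mathbb{R}^2$, the second is a circle $S^1$ without one point (the identity).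
   Context: Bases $\{p_1,p_2,k\}$ of the Lie algebras: - $su(2)$: $p_1=\frac12\begin{pmatrix}0&1\\-1&0\end{pmatrix}$, $p_2=\frac12\begin{pmatrix}0&i\\i&0\end{pmatrix}$, $k=\frac12\begin{pmatrix}i&0\\0&-i\end{pmatrix}$. - $so(3)$: $p_1=\begin{pmatrix}0&0&0\\0&0&-1\\0&1&0\end{pmatrix}$, $p_2=\begin{pmatrix}0&0&1\\0&0&0\\-1&0&0\end{pmatrix}$, $k=\begin{pmatrix}0&-1&0\\1&0&0\\0&0&0\end{pmatrix}$. - $sl(2)$: $p_1=\frac12\begin{pmatrix}1&0\\0&-1\end{pmatrix}$, $p_2=\frac12\begin{pmatrix}0&1\\1&0\end{pmatrix}$, $k=\frac12\begin{pmatrix}0&-1\\1&0\end{pmatrix}$. In each case $\mathbf{k}=\mathrm{span}\{k\}$, $\mathbf{p}=\mathrm{span}\{p_1,p_2\}$ (a Cartan decomposition). The $\mathbf{k}\oplus\mathbf{p}$ sub-Riemannian structure on $G$ is the left-invariant one with distribution $\Delta(g)=g\mathbf{p}$ and metric $\mathbf{g}_g(v_1,v_2)=\langle g^{-1}v_1,g^{-1}v_2\rangle$, where $\langle\cdot,\cdot\rangle$ is the inner product on $\mathbf{p}$ for which $\{p_1,p_2\}$ is orthonormal (this is $-\frac12$, resp. $+\frac12$, times the Killing form restricted to $\mathbf{p}$ for $SU(2)$ and $SO(3)$, resp. $SL(2)$). A Lipschitz curve $\gamma:[0,T]\to G$ is horizontal if $\dot\gamma(t)\in\Delta(\gamma(t))$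 for a.e. $t$; its length is $\int_0^T\sqrt{\mathbf{g}_{\gamma}(\dot\gamma,\dot\gamma)}\,dt$; the distance $d(q_0,q_1)$ is the infimum of lengths of horizontal curves joining $q_0$ to $q_1$. The geodesics starting from the identity and parametrized by arclength are the curves $t\mapsto \mathrm{Exp}(\theta,c,t)=e^{(\cos\theta\, p_1+\sin\theta\, p_2+ck)t}e^{-ckt}$, with $\theta\in\mathbb{R}/2\pi$, $c\in\mathbb{R}$. Such a geodesic is optimal on $[0,t]$ if its restriction to $[0,t]$ has minimal length among horizontal curves joining its endpoints, i.e. $d(\mathrm{Id},\mathrm{Exp}(\theta,c,t))=t$. The cut locus $K_{\mathrm{Id}}$ is the set of points reached optimally by more than one geodesic, i.e. the set of $q\in G$ for which there exist $(\theta_1,c_1)\ne(\theta_2,c_2)$ and $t>0$ with $q=\mathrm{Exp}(\theta_1,c_1,t)=\mathrm{Exp}(\theta_2,c_2,t)$ and both $\mathrm{Exp}(\theta_i,c_i,\cdot)$ optimal on $[0,t]$. $SU(2)$ is identified with $S^3\subset\mathbb{C}^2$ via $\begin{pmatrix}\alpha&\beta\\-\bar\beta&\bar\alpha\end{pmatrix}\mapsto(\alpha,\beta)$; a maximal circle of $SU(2)$ is a great circle of $S^3$, and a maximal circle of $SO(3)$ is the image of a great circle under the double covering $SU(2)\to SO(3)$. *)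

theory Defs
  imports "HOL-Analysis.Analysis"
begin

section \<open>Smooth maps and submanifolds of Euclidean spaces\<close>

text \<open>
  Smoothness on an open set is the existence and continuity of all iterated directional
  derivatives of total derivatives. A map on an arbitrary subset of a Euclidean space is smooth if
  it extends locally to smooth maps on open sets of the ambient space, and an embedded submanifold
  is a subset that is locally diffeomorphic to open sets of the model space.
\<close>

primrec Ck_on :: "nat \<Rightarrow> 'a::real_normed_vector set \<Rightarrow> ('a \<Rightarrow> 'b::real_normed_vector) \<Rightarrow> bool" where
  "Ck_on 0 U f \<longleftrightarrow> continuous_on U f"
| "Ck_on (Suc n) U f \<longleftrightarrow> (\<forall>x\<in>U. f differentiable (at x)) \<and>
     (\<forall>v. Ck_on n U (\<lambda>x. frechet_derivative f (at x) v))"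

definition smooth_map :: "'a::euclidean_space set \<Rightarrow> ('a \<Rightarrow> 'b::euclidean_space) \<Rightarrow> bool" where
  "smooth_map X f \<longleftrightarrow> (\<forall>x\<in>X. \<exists>U g. open U \<and> x \<in> U \<and> (\<forall>n. Ck_on n U g) \<and> (\<forall>y\<in>X \<inter> U. g y = f y))"

definition diffeomorphism ::
    "'a::euclidean_space set \<Rightarrow> 'b::euclidean_space set \<Rightarrow> ('a \<Rightarrow> 'b) \<Rightarrow> bool" where
  "diffeomorphism X Y f \<longleftrightarrow> bij_betw f X Y \<and> smooth_map X f \<and> smooth_map Y (inv_into X f)"

definition diffeomorphic :: "'a::euclidean_space set \<Rightarrow> 'b::euclidean_space set \<Rightarrow> bool" where
  "diffeomorphic X Y \<longleftrightarrow> (\<exists>f. diffeomorphism X Y f)"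

text \<open>The model space, and with it the dimension, is passed as a type.\<close>

definition smooth_submanifold :: "'d::euclidean_space itself \<Rightarrow> 'a::euclidean_space set \<Rightarrow> bool" where
  "smooth_submanifold _ M \<longleftrightarrow>
     (\<forall>x\<in>M. \<exists>W (U::'d set) f. openin (top_of_set M) W \<and> x \<in> W \<and> open U \<and> diffeomorphism U W f)"


section \<open>The real projective plane\<close>

text \<open>
  Points are lines through the origin of three-space; the smooth structure is given by
  the inverses of the three affine charts, each of which is defined on the whole plane.
\<close>

definition RP2 :: "(real^3) set set" where
  "RP2 = {L. subspace L \<and> dim L = 1}"

definition RP2_params :: "(real^2 \<Rightarrow> (real^3) set) set" where
  "RP2_params =
     {\<lambda>u. span {vector [1, u$1, u$2]},
      \<lambda>u. span {vector [u$1, 1, u$2]},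
      \<lambda>u. span {vector [u$1, u$2, 1]}}"

text \<open>
  A bijection from the projective plane to a subset of a Euclidean space is a diffeomorphism
  if it is one in each of the affine charts, and maps their (open) domains to open sets.
\<close>

definition diffeomorphic_RP2 :: "'a::euclidean_space set \<Rightarrow> bool" where
  "diffeomorphic_RP2 M \<longleftrightarrow>
     (\<exists>F. bij_betw F RP2 M \<and>
        (\<forall>\<psi>\<in>RP2_params. openin (top_of_set M) (range (F \<circ> \<psi>)) \<and>
           diffeomorphism UNIV (range (F \<circ> \<psi>)) (F \<circ> \<psi>)))"


section \<open>Left-invariant sub-Riemannian structures on matrix groups\<close>

definition matrix_exp :: "'a::real_normed_field^'n^'n \<Rightarrow> 'a^'n^'n" where
  "matrix_exp A = (\<Sum>n. (1 / fact n) *\<^sub>R ((\<lambda>X. A ** X) ^^ n) (mat 1))"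

definition p_inner ::
    "'a::real_normed_field^'n^'n \<Rightarrow> 'a^'n^'n \<Rightarrow> 'a^'n^'n \<Rightarrow> 'a^'n^'n \<Rightarrow> real" where
  "p_inner p1 p2 v w =
     (\<Sum>b\<in>{p1, p2}. representation {p1, p2} v b * representation {p1, p2} w b)"

definition distribution_at ::
    "'a::real_normed_field^'n^'n \<Rightarrow> 'a^'n^'n \<Rightarrow> 'a^'n^'n \<Rightarrow> ('a^'n^'n) set" where
  "distribution_at p1 p2 g = (\<lambda>v. g ** v) ` span {p1, p2}"

definition sr_metric ::
    "'a::real_normed_field^'n^'n \<Rightarrow> 'a^'n^'n \<Rightarrow> 'a^'n^'n \<Rightarrow> 'a^'n^'n \<Rightarrow> 'a^'n^'n \<Rightarrow> real" where
  "sr_metric p1 p2 g v w = p_inner p1 p2 (matrix_inv g ** v) (matrix_inv g ** w)"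

text \<open>
  Curves in the group are seen as curves in the ambient space of matrices: along the (compact)
  image of a curve, the norm distance and any Riemannian distance of the group are Lipschitz
  equivalent.
\<close>

definition horizontal ::
    "('a::real_normed_field^'n^'n) set \<Rightarrow> 'a^'n^'n \<Rightarrow> 'a^'n^'n \<Rightarrow> real \<Rightarrow> (real \<Rightarrow> 'a^'n^'n) \<Rightarrow> bool"
  where
  "horizontal G p1 p2 T \<gamma> \<longleftrightarrow> 0 \<le> T \<and> \<gamma> ` {0..T} \<subseteq> G \<and> (\<exists>L. L-lipschitz_on {0..T} \<gamma>) \<and>
     (AE t\<in>{0..T} in lebesgue.
        \<exists>v\<in>distribution_at p1 p2 (\<gamma> t). (\<gamma> has_vector_derivative v) (at t within {0..T}))"

text \<open>
  The integrand is almost everywhere defined, measurable and bounded for a horizontal curve, and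
  its values on a null set do not affect the integral.
\<close>

definition sr_length ::
    "'a::real_normed_field^'n^'n \<Rightarrow> 'a^'n^'n \<Rightarrow> real \<Rightarrow> (real \<Rightarrow> 'a^'n^'n) \<Rightarrow> real" where
  "sr_length p1 p2 T \<gamma> = integral {0..T} (\<lambda>t.
     let v = vector_derivative \<gamma> (at t within {0..T}) in sqrt (sr_metric p1 p2 (\<gamma> t) v v))"

definition sr_dist ::
    "('a::real_normed_field^'n^'n) set \<Rightarrow> 'a^'n^'n \<Rightarrow> 'a^'n^'n \<Rightarrow> 'a^'n^'n \<Rightarrow> 'a^'n^'n \<Rightarrow> real" where
  "sr_dist G p1 p2 q0 q1 =
     Inf {sr_length p1 p2 T \<gamma> | T \<gamma>. horizontal G p1 p2 T \<gamma> \<and> \<gamma> 0 = q0 \<and> \<gamma> T = q1}"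

definition Exp_geod ::
    "'a::real_normed_field^'n^'n \<Rightarrow> 'a^'n^'n \<Rightarrow> 'a^'n^'n \<Rightarrow> real \<Rightarrow> real \<Rightarrow> real \<Rightarrow> 'a^'n^'n" where
  "Exp_geod p1 p2 k \<theta> c t =
     matrix_exp (t *\<^sub>R (cos \<theta> *\<^sub>R p1 + sin \<theta> *\<^sub>R p2 + c *\<^sub>R k)) ** matrix_exp (- ((c * t) *\<^sub>R k))"

definition optimal ::
    "('a::real_normed_field^'n^'n) set \<Rightarrow> 'a^'n^'n \<Rightarrow> 'a^'n^'n \<Rightarrow> 'a^'n^'n \<Rightarrow>
     real \<Rightarrow> real \<Rightarrow> real \<Rightarrow> bool" where
  "optimal G p1 p2 k \<theta> c t \<longleftrightarrow> sr_dist G p1 p2 (mat 1) (Exp_geod p1 p2 k \<theta> c t) = t"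

text \<open>Angles are represented in \<open>[0, 2\<pi>)\<close>, so that distinct parameters are distinct geodesics.\<close>

definition cut_locus ::
    "('a::real_normed_field^'n^'n) set \<Rightarrow> 'a^'n^'n \<Rightarrow> 'a^'n^'n \<Rightarrow> 'a^'n^'n \<Rightarrow> ('a^'n^'n) set" where
  "cut_locus G p1 p2 k = {q \<in> G. \<exists>\<theta>1 c1 \<theta>2 c2 t.
     \<theta>1 \<in> {0..<2*pi} \<and> \<theta>2 \<in> {0..<2*pi} \<and> (\<theta>1, c1) \<noteq> (\<theta>2, c2) \<and> 0 < t \<and>
     q = Exp_geod p1 p2 k \<theta>1 c1 t \<and> q = Exp_geod p1 p2 k \<theta>2 c2 t \<and>
     optimal G p1 p2 k \<theta>1 c1 t \<and> optimal G p1 p2 k \<theta>2 c2 t}"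


section \<open>The three groups and the bases of their Lie algebras\<close>

definition conj_transpose :: "complex^'n^'m \<Rightarrow> complex^'m^'n" where
  "conj_transpose A = (\<chi> i j. cnj (A $ j $ i))"

definition SU2 :: "(complex^2^2) set" where
  "SU2 = {A. A ** conj_transpose A = mat 1 \<and> conj_transpose A ** A = mat 1 \<and> det A = 1}"

definition SO3 :: "(real^3^3) set" where
  "SO3 = {A. orthogonal_matrix A \<and> det A = 1}"

definition SL2 :: "(real^2^2) set" where
  "SL2 = {A. det A = 1}"

definition su2_p1 :: "complex^2^2" where
  "su2_p1 = (1/2) *\<^sub>R vector [vector [0, 1], vector [-1, 0]]"
definition su2_p2 :: "complex^2^2" where
  "su2_p2 = (1/2) *\<^sub>R vector [vector [0, \<i>], vector [\<i>, 0]]"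
definition su2_k :: "complex^2^2" where
  "su2_k = (1/2) *\<^sub>R vector [vector [\<i>, 0], vector [0, -\<i>]]"

definition so3_p1 :: "real^3^3" where
  "so3_p1 = vector [vector [0, 0, 0], vector [0, 0, -1], vector [0, 1, 0]]"
definition so3_p2 :: "real^3^3" where
  "so3_p2 = vector [vector [0, 0, 1], vector [0, 0, 0], vector [-1, 0, 0]]"
definition so3_k :: "real^3^3" where
  "so3_k = vector [vector [0, -1, 0], vector [1, 0, 0], vector [0, 0, 0]]"

definition sl2_p1 :: "real^2^2" where
  "sl2_p1 = (1/2) *\<^sub>R vector [vector [1, 0], vector [0, -1]]"
definition sl2_p2 :: "real^2^2" where
  "sl2_p2 = (1/2) *\<^sub>R vector [vector [0, 1], vector [1, 0]]"
definition sl2_k :: "real^2^2" where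
  "sl2_k = (1/2) *\<^sub>R vector [vector [0, -1], vector [1, 0]]"


section \<open>Maximal circles\<close>

text \<open>The subspace is a real one, of real dimension 2 in the four-dimensional space \<open>complex^2\<close>.\<close>

definition great_circle :: "(complex^2) set \<Rightarrow> bool" where
  "great_circle C \<longleftrightarrow> (\<exists>V. subspace V \<and> dim V = 2 \<and> C = sphere 0 1 \<inter> V)"

definition SU2_to_S3 :: "complex^2^2 \<Rightarrow> complex^2" where
  "SU2_to_S3 A = vector [A $ 1 $ 1, A $ 1 $ 2]"

definition maximal_circle_SU2 :: "(complex^2^2) set \<Rightarrow> bool" where
  "maximal_circle_SU2 C \<longleftrightarrow> C \<subseteq> SU2 \<and> great_circle (SU2_to_S3 ` C)"

text \<open>
  The double covering is the adjoint representation, written in the basis \<open>p1, p2, k\<close>; since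
  the two bases have the same structure constants, its differential maps one to the other.
\<close>

definition su2_basis :: "(complex^2^2)^3" where
  "su2_basis = vector [su2_p1, su2_p2, su2_k]"

definition SU2_to_SO3 :: "complex^2^2 \<Rightarrow> real^3^3" where
  "SU2_to_SO3 g = (\<chi> i j.
     representation {su2_p1, su2_p2, su2_k} (g ** su2_basis $ j ** matrix_inv g) (su2_basis $ i))"

definition maximal_circle_SO3 :: "(real^3^3) set \<Rightarrow> bool" where
  "maximal_circle_SO3 C \<longleftrightarrow> (\<exists>D. maximal_circle_SU2 D \<and> C = SU2_to_SO3 ` D)"

end

theory Submission
  imports Defs
begin

text \<open>
  In coordinates with \<open>|\<alpha>|\<^sup>2 + \<kappa> |\<beta>|\<^sup>2 = 1\<close>, multiplying a horizontal curve by the one-parameter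
  group of \<open>k\<close>, run at \<open>c\<close> times its arclength, removes the magnetic term and turns the geodesics of
  parameter \<open>c\<close> into one-parameter groups: geodesics of the round three-sphere for \<open>SU(2)\<close>, and of
  anti-de Sitter space for \<open>SL(2)\<close>. A competitor that is too short would then violate the triangle
  inequality of the sphere, respectively the reverse triangle inequality for timelike curves, so a
  geodesic is minimal until its image has covered half a great circle; in \<open>SL(2)\<close> the competitors also
  have to be separated by the winding of the phase of \<open>\<alpha>\<close>. The minimizers so found reach every
  point, and the equality case shows that two of them meet only on the circle \<open>\<beta> = 0\<close> or, when a
  point is joined by the two mirror images \<open>c\<close> and \<open>- c\<close> of the same geodesic, on the surface
  \<open>Re \<alpha> = 0\<close> of \<open>SO(3)\<close>, through the two lifts to \<open>SU(2)\<close>, or on \<open>\<alpha> < 0\<close> in \<open>SL(2)\<close>.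
\<close>

section \<open>Lipschitz curves\<close>

text \<open>The obstacle to the comparison is that a competitor of length \<open>L < t\<close>
  arrives rotated by \<open>c * L / 2\<close> instead of \<open>c * t / 2\<close>, so its rotated
  end point is not that of the geodesic. A drift \<open>d\<close> repairs this: the rotation runs
  along \<open>hlength 0 t u + d * t\<close>, with \<open>d\<close> such that the total at the end
  is the length of the geodesic. On the sphere the padding costs at most \<open>|c| / 2\<close> per
  unit, less than \<open>sqrt (c\<^sup>2 + 1) / 2\<close>; in anti-de Sitter space it gains at least
  \<open>c / 2\<close>, more than \<open>sqrt (c\<^sup>2 - 1) / 2\<close>. Either way the final
  inequality becomes strict. For \<open>|c| \<le> 1\<close> in SL(2) the rotated curve need not be
  timelike, and the logarithm of one well-chosen row of the matrix is measured instead. Minimizers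
  come from the intermediate value theorem, by solving for the phase of \<open>\<alpha>\<close> at
  given \<open>cmod \<beta>\<close>. Conjugate points are never studied: an optimal geodesic has the
  length of the minimizer constructed to its end point, and rigidity of the comparison then gives
  both the same \<open>c\<^sup>2\<close>.\<close>

lemma has_vector_derivative_iff_remainder:
  "(f has_vector_derivative D) (at t within S) \<longleftrightarrow>
     ((\<lambda>y. (f y - f t - (y - t) *\<^sub>R D) /\<^sub>R norm (y - t)) \<longlongrightarrow> 0) (at t within S)"
  by (simp only: has_vector_derivative_def has_derivative_within bounded_linear_scaleR_left
      diff_diff_eq inverse_eq_divide simp_thms)

text \<open>The right difference quotients are bounded by \<open>K\<close> and converge almost
  everywhere, so dominated convergence applies; after a translation their integrals reduce to short
  averages of \<open>f\<close> at \<open>b\<close> and at \<open>a\<close>. Integrability of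
  \<open>f'\<close> is part of what the limit delivers.\<close>

lemma lipschitz_has_integral_right_derivative:
  fixes f :: "real \<Rightarrow> 'a::euclidean_space"
  assumes "a \<le> b" and lip: "K-lipschitz_on {a..b} f" and N: "negligible N"
    and der: "\<And>t. t \<in> {a..<b} - N \<Longrightarrow> (f has_vector_derivative f' t) (at t within {t..b})"
  shows "(f' has_integral f b - f a) {a..b}"
proof (cases "a = b")
  case True
  then show ?thesis by (simp add: has_integral_refl)
next
  case False
  with assms have ab: "a < b" by simp
  \<comment> \<open>Constant extension beyond both ends keeps the Lipschitz constant and gives the
    quotients with step \<open>h n\<close> a meaning up to \<open>b\<close>.\<close>
  define g where "g t = f (min b (max a t))" for t
  have K0: "K \<ge> 0" using lip lipschitz_on_nonneg by blast
  have gl: "norm (g s - g t) \<le> K * \<bar>s - t\<bar>" for s t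
  proof -
    have "dist (f (min b (max a s))) (f (min b (max a t))) \<le> K * dist (min b (max a s)) (min b (max a t))"
      by (rule lipschitz_onD[OF lip]) (use ab in auto)
    also have "\<dots> \<le> K * \<bar>s - t\<bar>"
      by (rule mult_left_mono[OF _ K0]) (auto simp: dist_real_def min_def max_def)
    finally show ?thesis by (simp add: g_def dist_norm)
  qed
  have gc: "continuous_on S g" for S
  proof -
    have "K-lipschitz_on UNIV g"
      by (rule lipschitz_onI) (use gl K0 in \<open>auto simp: dist_norm dist_real_def\<close>)
    then show ?thesis using lipschitz_on_continuous_on continuous_on_subset by blast
  qed
  have gi: "g integrable_on {x..y}" for x y
    by (rule integrable_continuous_real[OF gc])
  define h where "h n = 1 / real (Suc n)" for n
  have h0: "h n > 0" for n by (simp add: h_def)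
  have hlim: "h \<longlonglongrightarrow> 0" unfolding h_def by (rule LIMSEQ_Suc[OF lim_const_over_n])
  define q where "q n t = (g (t + h n) - g t) /\<^sub>R h n" for n t
  \<comment> \<open>The end point \<open>b\<close> joins the exceptional set, since
    \<open>{t..b}\<close> leaves no room to its right.\<close>
  define N' where "N' = insert b N"
  have N': "negligible N'" using N by (simp add: N'_def)
  define F where "F t = (if t \<in> N' then 0 else f' t)" for t
  define Q where "Q n t = (if t \<in> N' then 0 else q n t)" for n t
  have qc: "continuous_on {a..b} (q n)" for n
    unfolding q_def
    by (intro continuous_intros continuous_on_compose2[OF gc[of UNIV]]) auto
  have qi: "q n integrable_on {a..b}" for n
    using integrable_continuous_real[OF qc] .
  have Qi: "Q n integrable_on {a..b}" for n
    by (rule integrable_spike[OF qi N']) (auto simp: Q_def)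
  have Qint: "integral {a..b} (Q n) = integral {a..b} (q n)" for n
    by (rule integral_spike[OF N']) (auto simp: Q_def)
  have bound: "norm (Q n t) \<le> K" for n t
  proof -
    have "norm (q n t) = norm (g (t + h n) - g t) / h n"
      using h0[of n] by (simp add: q_def divide_inverse)
    also have "\<dots> \<le> K" using gl[of "t + h n" t] h0[of n] by (simp add: field_simps)
    finally show ?thesis using K0 by (simp add: Q_def)
  qed
  have conv: "(\<lambda>n. Q n t) \<longlonglongrightarrow> F t" if t: "t \<in> {a..b}" for t
  proof (cases "t \<in> N'")
    case True then show ?thesis by (simp add: Q_def F_def)
  next
    case False
    then have tb: "t \<in> {a..<b} - N" using t by (auto simp: N'_def)
    have "((\<lambda>y. (f y - f t - (y - t) *\<^sub>R f' t) /\<^sub>R norm (y - t)) \<longlongrightarrow> 0) (at t within {t..b})"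
      using der[OF tb] by (simp only: has_vector_derivative_iff_remainder)
    then have lim: "((\<lambda>y. (f y - f t - (y - t) *\<^sub>R f' t) /\<^sub>R norm (y - t)) \<longlongrightarrow> 0) (at t within {t..b})" .
    have fl: "filterlim (\<lambda>n. t + h n) (at t within {t..b}) sequentially"
    proof (rule filterlim_at_withinI)
      show "(\<lambda>n. t + h n) \<longlonglongrightarrow> t" using tendsto_add[OF tendsto_const hlim, of t] by simp
      have "eventually (\<lambda>n. h n < b - t) sequentially"
        by (rule order_tendstoD(2)[OF hlim]) (use tb in auto)
      then show "\<forall>\<^sub>F n in sequentially. t + h n \<in> {t..b} - {t}"
      proof eventually_elim
        case (elim n) then show ?case using h0[of n] by auto
      qed
    qed
    have l2: "(\<lambda>n. (f (t + h n) - f t - h n *\<^sub>R f' t) /\<^sub>R norm (h n)) \<longlonglongrightarrow> 0"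
      using filterlim_compose[OF lim fl] by simp
    have ev: "eventually (\<lambda>n. h n < b - t) sequentially"
      by (rule order_tendstoD(2)[OF hlim]) (use tb in auto)
    have "eventually (\<lambda>n. (f (t + h n) - f t - h n *\<^sub>R f' t) /\<^sub>R norm (h n) + f' t = Q n t) sequentially"
      using ev
    proof eventually_elim
      case (elim n)
      have "g (t + h n) = f (t + h n)" "g t = f t"
        using elim h0[of n] tb by (auto simp: g_def min_def max_def)
      then show ?case using False h0[of n] by (simp add: Q_def q_def scaleR_diff_right)
    qed
    moreover have "(\<lambda>n. (f (t + h n) - f t - h n *\<^sub>R f' t) /\<^sub>R norm (h n) + f' t) \<longlonglongrightarrow> 0 + f' t"
      by (intro tendsto_intros l2)
    ultimately show ?thesis
      using False by (simp add: F_def filterlim_cong)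
  qed
  have Fi: "F integrable_on {a..b}" and lim1: "(\<lambda>n. integral {a..b} (Q n)) \<longlonglongrightarrow> integral {a..b} F"
    using dominated_convergence[of Q "{a..b}" "\<lambda>_. K" F, OF Qi] bound conv by auto
  \<comment> \<open>Shifting the variable by \<open>h n\<close> cancels the common middle part of
    the two integrals; only windows of width \<open>h n\<close> at \<open>b\<close> and
    \<open>a\<close> survive.\<close>
  have qint: "integral {a..b} (q n) = (integral {b..b + h n} g - integral {a..a + h n} g) /\<^sub>R h n" for n
  proof -
    have 1: "integral {a..b} (\<lambda>t. g (t + h n)) = integral {a + h n..b + h n} g"
      using integral_shift_Icc_real[of a b g "h n"] gc by (simp add: o_def add.commute)
    have i1: "(\<lambda>t. g (t + h n)) integrable_on {a..b}"
      by (intro integrable_continuous_real continuous_on_compose2[OF gc[of UNIV]] continuous_intros) auto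
    have "integral {a..b} (q n) = (integral {a + h n..b + h n} g - integral {a..b} g) /\<^sub>R h n"
      using gi i1 unfolding q_def by (simp add: 1 integral_diff)
    moreover have "integral {a + h n..b + h n} g - integral {a..b} g = integral {b..b + h n} g - integral {a..a + h n} g"
    proof -
      have "integral {a..a + h n} g + integral {a + h n..b + h n} g = integral {a..b + h n} g"
        by (rule Henstock_Kurzweil_Integration.integral_combine) (use h0[of n] ab gi in auto)
      moreover have "integral {a..b} g + integral {b..b + h n} g = integral {a..b + h n} g"
        by (rule Henstock_Kurzweil_Integration.integral_combine) (use h0[of n] ab gi in auto)
      ultimately show ?thesis by (simp add: algebra_simps)
    qed
    ultimately show ?thesis by simp
  qed
  have avg: "(\<lambda>n. integral {x..x + h n} g /\<^sub>R h n) \<longlonglongrightarrow> g x" for x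
  proof -
    have "norm (integral {x..x + h n} g /\<^sub>R h n - g x) \<le> K * h n" for n
    proof -
      have "norm (integral {x..x + h n} (\<lambda>y. g y - g x)) \<le> (K * h n) * (x + h n - x)"
      proof (rule integral_bound)
        show "continuous_on {x..x + h n} (\<lambda>y. g y - g x)" by (intro continuous_intros gc)
        fix y assume y: "y \<in> {x..x + h n}"
        have "norm (g y - g x) \<le> K * \<bar>y - x\<bar>" by (rule gl)
        also have "\<dots> \<le> K * h n" by (rule mult_left_mono[OF _ K0]) (use y in auto)
        finally show "norm (g y - g x) \<le> K * h n" .
      qed (use h0[of n] in auto)
      moreover have "integral {x..x + h n} (\<lambda>y. g y - g x) = integral {x..x + h n} g - h n *\<^sub>R g x"
        using gi h0[of n] by (subst integral_diff) auto
      ultimately have 1: "norm (integral {x..x + h n} g - h n *\<^sub>R g x) / h n \<le> K * h n"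
        using h0[of n] by (simp add: pos_divide_le_eq)
      have "integral {x..x + h n} g /\<^sub>R h n - g x = (integral {x..x + h n} g - h n *\<^sub>R g x) /\<^sub>R h n"
        using h0[of n] by (simp add: scaleR_diff_right)
      then have "norm (integral {x..x + h n} g /\<^sub>R h n - g x) = norm (integral {x..x + h n} g - h n *\<^sub>R g x) / h n"
        using h0[of n] by (simp only:) (simp add: divide_inverse_commute)
      with 1 show ?thesis by (simp only:)
    qed
    then have "\<forall>\<^sub>F n in sequentially. norm (integral {x..x + h n} g /\<^sub>R h n - g x) \<le> K * h n"
      by (simp only: always_eventually simp_thms)
    then have "(\<lambda>n. integral {x..x + h n} g /\<^sub>R h n - g x) \<longlonglongrightarrow> 0"
      by (rule Lim_null_comparison[OF _ tendsto_mult_right_zero[OF hlim]])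
    then show ?thesis by (rule LIM_zero_cancel)
  qed
  have "(\<lambda>n. integral {a..b} (Q n)) \<longlonglongrightarrow> g b - g a"
    unfolding Qint qint scaleR_diff_right by (rule tendsto_diff[OF avg avg])
  then have "integral {a..b} F = g b - g a" using LIMSEQ_unique lim1 by blast
  then have "(F has_integral f b - f a) {a..b}"
    using Fi ab by (auto simp: g_def has_integral_iff)
  then show ?thesis
    by (rule has_integral_spike[OF N', rotated]) (auto simp: F_def)
qed

text \<open>The derivatives are chosen pointwise, without regard to measurability; the preceding
  fundamental theorem makes them integrable all the same, so the bound can be integrated.\<close>

lemma lipschitz_increment_le:
  fixes f :: "real \<Rightarrow> real"
  assumes "a \<le> b" and lip: "K-lipschitz_on {a..b} f" and N: "negligible N"
    and der: "\<And>t. t \<in> {a..<b} - N \<Longrightarrow>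
      \<exists>D. (f has_vector_derivative D) (at t within {t..b}) \<and> D \<le> g t"
    and g: "g integrable_on {a..b}"
  shows "f b - f a \<le> integral {a..b} g"
proof -
  obtain D where D: "\<And>t. t \<in> {a..<b} - N \<Longrightarrow> (f has_vector_derivative D t) (at t within {t..b}) \<and> D t \<le> g t"
    using der by metis
  define N' where "N' = insert b N"
  have N': "negligible N'" using N by (simp add: N'_def)
  \<comment> \<open>On the exceptional set the value \<open>g t\<close> is inserted, so that the
    comparison with \<open>g\<close> holds everywhere.\<close>
  define F where "F t = (if t \<in> N' then g t else D t)" for t
  have "(D has_integral f b - f a) {a..b}"
    by (rule lipschitz_has_integral_right_derivative[OF assms(1) lip N]) (use D in blast)
  then have "(F has_integral f b - f a) {a..b}"
    by (rule has_integral_spike[OF N', rotated]) (auto simp: F_def)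
  then show ?thesis
    by (rule has_integral_le[OF _ integrable_integral[OF g]]) (use D in \<open>auto simp: F_def N'_def\<close>)
qed

lemma lipschitz_integral_function:
  fixes g :: "real \<Rightarrow> real"
  assumes g: "g integrable_on {a..b}" and bound: "\<And>t. t \<in> {a..b} \<Longrightarrow> \<bar>g t\<bar> \<le> K" and "0 \<le> K"
  shows "K-lipschitz_on {a..b} (\<lambda>t. integral {a..t} g)"
proof (rule lipschitz_on_leI)
  fix x y assume xy: "x \<in> {a..b}" "y \<in> {a..b}" "x \<le> y"
  have gi: "g integrable_on {p..q}" if "{p..q} \<subseteq> {a..b}" for p q
    by (rule integrable_on_subinterval[OF g that])
  have "integral {a..x} g + integral {x..y} g = integral {a..y} g"
    by (rule Henstock_Kurzweil_Integration.integral_combine) (use xy gi in auto)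
  moreover have "norm (integral {x..y} g) \<le> integral {x..y} (\<lambda>_. K)"
    by (rule integral_norm_bound_integral) (use xy gi bound in auto)
  ultimately show "dist (integral {a..x} g) (integral {a..y} g) \<le> K * dist x y"
    using xy by (simp add: dist_real_def mult.commute)
qed (use assms in auto)

text \<open>Lebesgue differentiation over the one-sided intervals \<open>{x..x + h}\<close>. It
  yields a right derivative, which fixes the form of all later differential statements.\<close>

lemma integral_function_right_derivative:
  fixes g :: "real \<Rightarrow> real"
  assumes g: "g integrable_on {a..b}" 
  obtains N where "negligible N" "\<And>t. t \<in> {a..<b} - N \<Longrightarrow>
     ((\<lambda>t. integral {a..t} g) has_vector_derivative g t) (at t within {t..b})"
proof -
  \<comment> \<open>Extension by zero lets the averages run over intervals that leave
    \<open>{a..b}\<close>.\<close>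
  define G where "G t = (if t \<in> {a..b} then g t else 0)" for t
  have "G integrable_on UNIV" unfolding G_def using g by (simp only: integrable_restrict_UNIV)
  then have Gi: "G integrable_on cbox x y" for x y
    using integrable_on_subcbox by blast
  obtain N where N: "negligible N" and
    lim: "\<And>x e. \<lbrakk>x \<notin> N; 0 < e\<rbrakk> \<Longrightarrow> \<exists>d>0. \<forall>h. 0 < h \<and> h < d \<longrightarrow>
                         norm(integral (cbox x (x + h *\<^sub>R One)) G /\<^sub>R h ^ DIM(real) - G x) < e"
    using integrable_ccontinuous_explicit[OF Gi] by blast
  show thesis
  proof (rule that[OF N])
    fix t assume t: "t \<in> {a..<b} - N"
    let ?I = "\<lambda>t. integral {a..t} g"
    have "((\<lambda>y. (?I y - ?I t - (y - t) *\<^sub>R g t) /\<^sub>R norm (y - t)) \<longlongrightarrow> 0) (at t within {t..b})"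
      unfolding tendsto_iff eventually_at
    proof (intro allI impI)
      fix e :: real assume "e > 0"
      obtain d where d: "d > 0" "\<And>h. 0 < h \<Longrightarrow> h < d \<Longrightarrow> \<bar>integral {t..t + h} G / h - G t\<bar> < e"
        using lim[of t e] t \<open>e > 0\<close> by (auto simp: divide_inverse mult.commute)
      show "\<exists>d>0. \<forall>x\<in>{t..b}. x \<noteq> t \<and> dist x t < d \<longrightarrow>
              dist ((?I x - ?I t - (x - t) *\<^sub>R g t) /\<^sub>R norm (x - t)) 0 < e"
      proof (intro exI[of _ d] conjI d ballI impI)
        fix x assume x: "x \<in> {t..b}" "x \<noteq> t \<and> dist x t < d"
        have "?I t + integral {t..x} g = ?I x"
          by (rule Henstock_Kurzweil_Integration.integral_combine)
             (use x t in \<open>auto intro: integrable_on_subinterval[OF g]\<close>)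
        moreover have "integral {t..x} g = integral {t..x} G"
          by (rule integral_cong) (use x t in \<open>auto simp: G_def\<close>)
        ultimately have I: "?I x - ?I t = integral {t..x} G" by linarith
        have Gt: "G t = g t" using t by (auto simp: G_def)
        have less: "\<bar>integral {t..t + (x - t)} G / (x - t) - G t\<bar> < e"
          by (rule d) (use x in \<open>auto simp: dist_real_def\<close>)
        have "(?I x - ?I t - (x - t) *\<^sub>R g t) /\<^sub>R norm (x - t) = integral {t..x} G / (x - t) - g t"
        proof -
          have *: "(J - r *\<^sub>R w) /\<^sub>R norm r = J / r - w" if "r > 0" for r J w :: real
            using that by (simp add: field_simps)
          show ?thesis unfolding I by (rule *) (use x in auto)
        qed
        then show "dist ((?I x - ?I t - (x - t) *\<^sub>R g t) /\<^sub>R norm (x - t)) 0 < e"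
          using less Gt by simp
      qed
    qed
    then show "(?I has_vector_derivative g t) (at t within {t..b})"
      by (simp only: has_vector_derivative_iff_remainder)
  qed
qed

text \<open>The derivative is integrable by the fundamental theorem and bounded by the Lipschitz
  constant, hence absolutely integrable. This is where measurability of the speed of a curve comes
  from.\<close>

lemma lipschitz_integrable_norm_right_derivative:
  fixes f :: "real \<Rightarrow> 'a::euclidean_space"
  assumes "a \<le> b" and lip: "K-lipschitz_on {a..b} f" and N: "negligible N"
    and der: "\<And>t. t \<in> {a..<b} - N \<Longrightarrow> (f has_vector_derivative f' t) (at t within {t..b})"
  shows "(\<lambda>t. norm (f' t)) absolutely_integrable_on {a..b}"
    and "\<And>t. t \<in> {a..<b} - N \<Longrightarrow> norm (f' t) \<le> K"
proof -
  show bnd: "norm (f' t) \<le> K" if t: "t \<in> {a..<b} - N" for t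
  proof -
    have "((\<lambda>y. (f y - f t) /\<^sub>R (y - t)) \<longlongrightarrow> f' t) (at t within {t..b})"
    proof (rule Lim_transform_within[of _ _ _ _ 1])
      have "((\<lambda>y. (f y - f t - (y - t) *\<^sub>R f' t) /\<^sub>R norm (y - t)) \<longlongrightarrow> 0) (at t within {t..b})"
        using der[OF t] by (simp only: has_vector_derivative_iff_remainder)
      from tendsto_add[OF this tendsto_const[of "f' t"]]
      show "((\<lambda>y. (f y - f t - (y - t) *\<^sub>R f' t) /\<^sub>R norm (y - t) + f' t) \<longlongrightarrow> f' t) (at t within {t..b})"
        by simp
    qed (auto simp: scaleR_diff_right)
    then have "((\<lambda>y. norm ((f y - f t) /\<^sub>R (y - t))) \<longlongrightarrow> norm (f' t)) (at t within {t..b})"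
      by (rule tendsto_norm)
    then show ?thesis
    proof (rule tendsto_upperbound)
      show "\<forall>\<^sub>F y in at t within {t..b}. norm ((f y - f t) /\<^sub>R (y - t)) \<le> K"
        unfolding eventually_at
      proof (intro exI[of _ 1] conjI ballI impI)
        fix y assume y: "y \<in> {t..b}" "y \<noteq> t \<and> dist y t < 1"
        have "dist (f y) (f t) \<le> K * dist y t"
          by (rule lipschitz_onD[OF lip]) (use t y in auto)
        then have "norm (f y - f t) / (y - t) \<le> K"
          using y by (simp add: dist_norm pos_divide_le_eq)
        then show "norm ((f y - f t) /\<^sub>R (y - t)) \<le> K"
          using y by (simp add: divide_inverse_commute)
      qed simp
      show "at t within {t..b} \<noteq> bot"
        using t by (simp add: at_within_Icc_at_right)
    qed
  qed
  define N' where "N' = insert b N"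
  have N': "negligible N'" using N by (simp add: N'_def)
  define F where "F t = (if t \<in> N' then 0 else f' t)" for t
  have "(f' has_integral f b - f a) {a..b}"
    by (rule lipschitz_has_integral_right_derivative[OF assms(1) lip N der])
  then have "(F has_integral f b - f a) {a..b}"
    by (rule has_integral_spike[OF N', rotated]) (auto simp: F_def)
  then have "F absolutely_integrable_on {a..b}"
    by (intro absolutely_integrable_integrable_bound[of _ _ "\<lambda>_. K"])
       (use bnd lipschitz_on_nonneg[OF lip] in \<open>auto simp: F_def N'_def\<close>)
  then have "(\<lambda>t. norm (F t)) absolutely_integrable_on {a..b}"
    by (rule absolutely_integrable_norm[unfolded o_def])
  then show "(\<lambda>t. norm (f' t)) absolutely_integrable_on {a..b}"
    by (rule absolutely_integrable_spike[OF _ N']) (auto simp: F_def)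
qed

section \<open>Closure properties of Lipschitz maps\<close>

definition lip_on :: "'a::metric_space set \<Rightarrow> ('a \<Rightarrow> 'b::metric_space) \<Rightarrow> bool" where
  "lip_on S f \<longleftrightarrow> (\<exists>K. K-lipschitz_on S f)"

lemma lip_onI: "K-lipschitz_on S f \<Longrightarrow> lip_on S f"
  by (auto simp: lip_on_def)

lemma lip_on_const: "lip_on S (\<lambda>_. c)"
  using lip_onI[OF lipschitz_on_constant] .

lemma lip_on_id: "lip_on S (\<lambda>x. x)"
  using lip_onI[OF lipschitz_on_id] .

lemma lip_on_subset: "lip_on S f \<Longrightarrow> T \<subseteq> S \<Longrightarrow> lip_on T f"
  unfolding lip_on_def using lipschitz_on_subset by blast

lemma lip_on_continuous: "lip_on S f \<Longrightarrow> continuous_on S f"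
  unfolding lip_on_def using lipschitz_on_continuous_on by blast

lemma lip_on_add:
  fixes f g :: "_ \<Rightarrow> 'b::real_normed_vector"
  shows "lip_on S f \<Longrightarrow> lip_on S g \<Longrightarrow> lip_on S (\<lambda>x. f x + g x)"
  unfolding lip_on_def using lipschitz_on_add by blast

lemma lip_on_compose:
  "lip_on S f \<Longrightarrow> f ` S \<subseteq> T \<Longrightarrow> lip_on T g \<Longrightarrow> lip_on S (\<lambda>x. g (f x))"
proof -
  assume f: "lip_on S f" and sub: "f ` S \<subseteq> T" and g: "lip_on T g"
  obtain K where K: "K-lipschitz_on S f" using f by (auto simp: lip_on_def)
  obtain L where "L-lipschitz_on T g" using g by (auto simp: lip_on_def)
  then have "L-lipschitz_on (f ` S) g" using sub lipschitz_on_subset by blast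
  from lipschitz_on_compose[OF K this] show ?thesis
    unfolding o_def by (rule lip_onI)
qed

lemma lip_on_bounded_linear:
  assumes "bounded_linear g" "lip_on S f"
  shows "lip_on S (\<lambda>x. g (f x))"
proof -
  from assms(1) obtain B where B: "\<And>x. norm (g x) \<le> norm x * B" "B \<ge> 0"
    using bounded_linear.nonneg_bounded by blast
  have "B-lipschitz_on UNIV g"
  proof (rule lipschitz_onI)
    fix x y
    have "dist (g x) (g y) = norm (g (x - y))"
      unfolding dist_norm linear_diff[OF bounded_linear.linear[OF assms(1)]] ..
    also have "\<dots> \<le> norm (x - y) * B" by (rule B)
    finally show "dist (g x) (g y) \<le> B * dist x y" by (simp only: dist_norm mult.commute)
  qed (rule B)
  then have g: "lip_on UNIV g" by (rule lip_onI)
  show ?thesis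
    by (rule lip_on_compose[where g = g and f = f and T = UNIV, OF assms(2) subset_UNIV g])
qed

lemma lip_on_Pair:
  assumes "lip_on S f" "lip_on S g"
  shows "lip_on S (\<lambda>x. (f x, g x))"
proof -
  from assms obtain K L where "K-lipschitz_on S f" "L-lipschitz_on S g" by (auto simp: lip_on_def)
  from lipschitz_on_Pair[OF this] show ?thesis by (rule lip_onI)
qed

text \<open>Compactness bounds both factors, which is what a product of Lipschitz maps
  requires.\<close>

lemma lip_on_mult:
  fixes f g :: "'a::metric_space \<Rightarrow> 'b::real_normed_algebra"
  assumes S: "compact S" and f: "lip_on S f" and g: "lip_on S g"
  shows "lip_on S (\<lambda>x. f x * g x)"
proof -
  obtain K L where K: "K-lipschitz_on S f" and L: "L-lipschitz_on S g"
    using f g by (auto simp: lip_on_def)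
  have "bounded (f ` S)" "bounded (g ` S)"
    using S f g by (auto intro!: compact_imp_bounded compact_continuous_image lip_on_continuous)
  then obtain B C where B: "B > 0" "\<And>x. x \<in> S \<Longrightarrow> norm (f x) \<le> B"
    and C: "C > 0" "\<And>x. x \<in> S \<Longrightarrow> norm (g x) \<le> C"
    by (auto simp: bounded_pos)
  have K0: "K \<ge> 0" "L \<ge> 0" using K L lipschitz_on_nonneg by auto
  have "(B * L + C * K)-lipschitz_on S (\<lambda>x. f x * g x)"
  proof (rule lipschitz_onI)
    fix x y assume xy: "x \<in> S" "y \<in> S"
    have "f x * g x - f y * g y = f x * (g x - g y) + (f x - f y) * g y" by (simp add: algebra_simps)
    then have "norm (f x * g x - f y * g y) \<le> norm (f x) * norm (g x - g y) + norm (f x - f y) * norm (g y)"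
      by (metis norm_triangle_le norm_mult_ineq add_mono)
    also have "\<dots> \<le> B * (L * dist x y) + (K * dist x y) * C"
      by (intro add_mono mult_mono)
         (use xy B C K0 lipschitz_onD[OF K xy] lipschitz_onD[OF L xy] in \<open>auto simp: dist_norm\<close>)
    finally show "dist (f x * g x) (f y * g y) \<le> (B * L + C * K) * dist x y"
      by (simp add: dist_norm algebra_simps)
  qed (use B C K0 in auto)
  then show ?thesis by (rule lip_onI)
qed

lemma lip_on_C1:
  fixes g :: "real \<Rightarrow> real"
  assumes S: "convex S" and D: "\<And>x. x \<in> S \<Longrightarrow> (g has_real_derivative g' x) (at x within S)"
    and B: "\<And>x. x \<in> S \<Longrightarrow> \<bar>g' x\<bar> \<le> C" and "0 \<le> C"
  shows "lip_on S g"
proof (rule lip_onI[OF bounded_derivative_imp_lipschitz[OF _ S _ \<open>0 \<le> C\<close>]])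
  show "(g has_derivative (*) (g' x)) (at x within S)" if "x \<in> S" for x
    using D[OF that] by (simp add: has_field_derivative_def)
  show "onorm ((*) (g' x)) \<le> C" if "x \<in> S" for x
    using B[OF that] by (intro onorm_bound) (auto simp: abs_mult mult_right_mono \<open>0 \<le> C\<close>)
qed

lemma lip_on_cis: "lip_on S cis"
proof -
  have "1-lipschitz_on UNIV cis"
  proof (rule bounded_derivative_imp_lipschitz)
    show "(cis has_derivative (\<lambda>t. t *\<^sub>R (\<i> * cis x))) (at x within UNIV)" for x
      using has_derivative_cis[OF has_derivative_ident] .
    show "onorm (\<lambda>t. t *\<^sub>R (\<i> * cis x)) \<le> 1" for x
      by (rule onorm_bound) (auto simp: norm_mult)
  qed auto
  then show ?thesis using lip_onI lip_on_subset by blast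
qed

lemma has_vector_derivative_cis_compose:
  assumes "(f has_vector_derivative D) (at t within S)"
  shows "((\<lambda>t. cis (f t)) has_vector_derivative (D *\<^sub>R (\<i> * cis (f t)))) (at t within S)"
  using has_derivative_cis[OF assms[unfolded has_vector_derivative_def]]
  by (simp add: has_vector_derivative_def)

section \<open>Horizontal curves in coordinates\<close>

text \<open>
  A matrix of \<open>SU(2)\<close> (\<open>\<kappa> = 1\<close>) or of \<open>SU(1,1)\<close> (\<open>\<kappa> = -1\<close>) is given by its first row
  \<open>(\<alpha>, \<beta>)\<close>; the control \<open>u\<close> stands for the velocity \<open>Re u p1 + Im u p2\<close>. Only right
  derivatives are required, since this is what arclength is known to have almost everywhere.
\<close>

definition hcurve ::
  "real \<Rightarrow> real \<Rightarrow> real \<Rightarrow> (real \<Rightarrow> complex) \<Rightarrow> (real \<Rightarrow> complex) \<Rightarrow> (real \<Rightarrow> complex) \<Rightarrow> bool" where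
  "hcurve \<kappa> a b \<alpha> \<beta> u \<longleftrightarrow> a \<le> b \<and> lip_on {a..b} \<alpha> \<and> lip_on {a..b} \<beta> \<and>
     (\<forall>t\<in>{a..b}. (cmod (\<alpha> t))\<^sup>2 + \<kappa> * (cmod (\<beta> t))\<^sup>2 = 1) \<and>
     (\<exists>N. negligible N \<and> (\<forall>t\<in>{a..<b} - N.
        (\<alpha> has_vector_derivative of_real (- (\<kappa> / 2)) * \<beta> t * cnj (u t)) (at t within {t..b}) \<and>
        (\<beta> has_vector_derivative (1 / 2) * \<alpha> t * u t) (at t within {t..b})))"

definition hlength :: "real \<Rightarrow> real \<Rightarrow> (real \<Rightarrow> complex) \<Rightarrow> real" where
  "hlength a b u = integral {a..b} (\<lambda>t. cmod (u t))"

text \<open>Keeps the Euclidean norm of \<open>(\<alpha>, \<beta>)\<close> away from 0, so that the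
  speed of the control can be recovered by a division.\<close>

lemma hcurve_norm_ge:
  assumes "\<kappa> = 1 \<or> \<kappa> = -1" "(cmod x)\<^sup>2 + \<kappa> * (cmod y)\<^sup>2 = 1"
  shows "1 \<le> norm (x, y)"
proof -
  have "1 \<le> (cmod x)\<^sup>2 + (cmod y)\<^sup>2"
    using assms(1)
  proof
    assume "\<kappa> = -1"
    then show ?thesis using assms(2) zero_le_power2[of "cmod y"] by (simp, linarith)
  qed (use assms(2) in simp)
  then show ?thesis by (simp add: norm_Pair)
qed

text \<open>The control comes without measurability. Since \<open>|\<kappa>| = 1\<close>, the
  Euclidean speed of \<open>(\<alpha>, \<beta>)\<close> is \<open>cmod (u t) / 2\<close> times the
  norm of \<open>(\<alpha>, \<beta>)\<close>; thus \<open>cmod (u t)\<close> is almost everywhere an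
  absolutely integrable function times a continuous one.\<close>

lemma hcurve_speed:
  assumes \<kappa>: "\<kappa> = 1 \<or> \<kappa> = -1" and h: "hcurve \<kappa> a b \<alpha> \<beta> u"
  shows "(\<lambda>t. cmod (u t)) integrable_on {a..b}"
    and "\<exists>N K. negligible N \<and> 0 \<le> K \<and> (\<forall>t\<in>{a..b} - N. cmod (u t) \<le> K)"
proof -
  from h have ab: "a \<le> b" and la: "lip_on {a..b} \<alpha>" and lb: "lip_on {a..b} \<beta>"
    and n: "\<And>t. t \<in> {a..b} \<Longrightarrow> (cmod (\<alpha> t))\<^sup>2 + \<kappa> * (cmod (\<beta> t))\<^sup>2 = 1" by (auto simp: hcurve_def)
  obtain N where N: "negligible N" and
    D: "\<And>t. t \<in> {a..<b} - N \<Longrightarrow> (\<alpha> has_vector_derivative of_real (- (\<kappa> / 2)) * \<beta> t * cnj (u t)) (at t within {t..b})"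
      "\<And>t. t \<in> {a..<b} - N \<Longrightarrow> (\<beta> has_vector_derivative (1 / 2) * \<alpha> t * u t) (at t within {t..b})"
    using h by (auto simp: hcurve_def)
  define p where "p t = (\<alpha> t, \<beta> t)" for t
  define p' where "p' t = (of_real (- (\<kappa> / 2)) * \<beta> t * cnj (u t), (1 / 2) * \<alpha> t * u t)" for t
  have "lip_on {a..b} p" unfolding p_def by (intro lip_on_Pair la lb)
  then obtain K where K: "K-lipschitz_on {a..b} p" by (auto simp: lip_on_def)
  have Dp: "(p has_vector_derivative p' t) (at t within {t..b})" if "t \<in> {a..<b} - N" for t
    unfolding p_def p'_def by (intro has_vector_derivative_Pair D that)
  note I = lipschitz_integrable_norm_right_derivative[OF ab K N Dp]
  have np: "1 \<le> norm (p t)" if "t \<in> {a..b}" for t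
    unfolding p_def using hcurve_norm_ge[OF \<kappa> n[OF that]] .
  have sp: "norm (p' t) = 1 / 2 * cmod (u t) * norm (p t)" for t
  proof -
    have k2: "(cmod (complex_of_real \<kappa>))\<^sup>2 = 1" using \<kappa> by auto
    have "(norm (p' t))\<^sup>2 = (1 / 2 * cmod (u t) * norm (p t))\<^sup>2"
      unfolding p'_def p_def norm_Pair real_sqrt_pow2_iff power_mult_distrib
      using k2 by (simp add: norm_mult norm_divide power_mult_distrib power_divide algebra_simps)
    then show ?thesis by (rule power2_eq_imp_eq) auto
  qed
  have cont: "continuous_on {a..b} (\<lambda>t. 2 / norm (p t))"
    using np lipschitz_on_continuous_on[OF K] by (intro continuous_intros) force+
  have AI: "(\<lambda>t. 2 / norm (p t) * norm (p' t)) absolutely_integrable_on {a..b}"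
    by (rule absolutely_integrable_bounded_measurable_product_real[OF _ _ _ I(1)])
       (auto intro!: continuous_imp_measurable_on_sets_lebesgue cont compact_imp_bounded compact_continuous_image)
  have eq: "2 / norm (p t) * norm (p' t) = cmod (u t)" if "t \<in> {a..b}" for t
    using np[OF that] by (auto simp: sp)
  have "(\<lambda>t. cmod (u t)) absolutely_integrable_on {a..b}"
    by (rule absolutely_integrable_spike[OF AI negligible_empty eq[symmetric, OF DiffD1]])
  then show "(\<lambda>t. cmod (u t)) integrable_on {a..b}"
    by (simp add: absolutely_integrable_on_def)
  have "cmod (u t) \<le> 2 * K" if t: "t \<in> {a..b} - insert b N" for t
  proof -
    have "norm (p' t) \<le> K" by (rule I(2)) (use t in auto)
    then have "cmod (u t) * norm (p t) \<le> 2 * K" by (simp add: sp)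
    moreover have "cmod (u t) * 1 \<le> cmod (u t) * norm (p t)" using np[of t] t by (intro mult_left_mono) auto
    ultimately show ?thesis by simp
  qed
  then show "\<exists>N K. negligible N \<and> 0 \<le> K \<and> (\<forall>t\<in>{a..b} - N. cmod (u t) \<le> K)"
    using N lipschitz_on_nonneg[OF K] by (intro exI[of _ "insert b N"] exI[of _ "2 * K"]) auto
qed

lemma hcurve_arclength:
  assumes \<kappa>: "\<kappa> = 1 \<or> \<kappa> = -1" and h: "hcurve \<kappa> a b \<alpha> \<beta> u"
  shows "lip_on {a..b} (\<lambda>t. hlength a t u)"
    and "\<exists>N. negligible N \<and> (\<forall>t\<in>{a..<b} - N.
       ((\<lambda>t. hlength a t u) has_vector_derivative cmod (u t)) (at t within {t..b}))"
proof -
  note sp = hcurve_speed[OF assms]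
  show "\<exists>N. negligible N \<and> (\<forall>t\<in>{a..<b} - N.
       ((\<lambda>t. hlength a t u) has_vector_derivative cmod (u t)) (at t within {t..b}))"
    unfolding hlength_def using integral_function_right_derivative[OF sp(1)] by metis
  obtain N K where N: "negligible N" "0 \<le> K" "\<And>t. t\<in>{a..b} - N \<Longrightarrow> cmod (u t) \<le> K" using sp(2) by auto
  \<comment> \<open>The bound on the speed holds off a null set only; resetting the speed to 0 there
    changes no integral and gives a bound everywhere.\<close>
  define v where "v t = (if t \<in> N then 0 else cmod (u t))" for t
  have "K-lipschitz_on {a..b} (\<lambda>t. integral {a..t} v)"
  proof (rule lipschitz_integral_function)
    show "v integrable_on {a..b}"
      by (rule integrable_spike[OF sp(1) N(1)]) (auto simp: v_def)
  qed (use N in \<open>auto simp: v_def\<close>)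
  moreover have "integral {a..t} v = hlength a t u" for t
    unfolding hlength_def by (rule integral_spike[OF N(1)]) (auto simp: v_def)
  ultimately show "lip_on {a..b} (\<lambda>t. hlength a t u)"
    by (auto simp: lip_on_def)
qed

lemma hcurve_subinterval:
  assumes h: "hcurve \<kappa> a b \<alpha> \<beta> u" and pq: "a \<le> p" "p \<le> q" "q \<le> b"
  shows "hcurve \<kappa> p q \<alpha> \<beta> u"
proof -
  obtain N where N: "negligible N" and
    D: "\<And>t. t \<in> {a..<b} - N \<Longrightarrow> (\<alpha> has_vector_derivative of_real (- (\<kappa> / 2)) * \<beta> t * cnj (u t)) (at t within {t..b})"
      "\<And>t. t \<in> {a..<b} - N \<Longrightarrow> (\<beta> has_vector_derivative (1 / 2) * \<alpha> t * u t) (at t within {t..b})"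
    using h by (auto simp: hcurve_def)
  have "(\<alpha> has_vector_derivative of_real (- (\<kappa> / 2)) * \<beta> t * cnj (u t)) (at t within {t..q}) \<and>
        (\<beta> has_vector_derivative (1 / 2) * \<alpha> t * u t) (at t within {t..q})" if "t \<in> {p..<q} - N" for t
    using D[of t] that pq by (auto intro: has_vector_derivative_within_subset)
  then show ?thesis
    using h N pq by (auto simp: hcurve_def intro: lip_on_subset)
qed

text \<open>Conjugation is the symmetry that exchanges \<open>c\<close> and \<open>- c\<close>; it
  reduces statements to one sign of the phase of \<open>\<alpha>\<close>.\<close>

lemma hcurve_cnj:
  assumes h: "hcurve \<kappa> a b \<alpha> \<beta> u"
  shows "hcurve \<kappa> a b (\<lambda>t. cnj (\<alpha> t)) (\<lambda>t. cnj (\<beta> t)) (\<lambda>t. cnj (u t))"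
proof -
  obtain N where N: "negligible N" and
    D: "\<And>t. t \<in> {a..<b} - N \<Longrightarrow> (\<alpha> has_vector_derivative of_real (- (\<kappa> / 2)) * \<beta> t * cnj (u t)) (at t within {t..b})"
      "\<And>t. t \<in> {a..<b} - N \<Longrightarrow> (\<beta> has_vector_derivative (1 / 2) * \<alpha> t * u t) (at t within {t..b})"
    using h by (auto simp: hcurve_def)
  note bl = bounded_linear.has_vector_derivative[OF bounded_linear_cnj]
  show ?thesis
    using h N bl[OF D(1)] bl[OF D(2)]
    by (auto simp: hcurve_def intro!: lip_on_bounded_linear[OF bounded_linear_cnj] exI[of _ N])
qed

lemma hlength_combine:
  assumes \<kappa>: "\<kappa> = 1 \<or> \<kappa> = -1" and h: "hcurve \<kappa> a b \<alpha> \<beta> u" and pq: "a \<le> p" "p \<le> b"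
  shows "hlength a p u + hlength p b u = hlength a b u"
  unfolding hlength_def
  by (rule Henstock_Kurzweil_Integration.integral_combine) (use pq hcurve_speed(1)[OF \<kappa> h] in auto)

lemma hlength_nonneg: "0 \<le> hlength a b u"
  unfolding hlength_def by (cases "(\<lambda>t. cmod (u t)) integrable_on {a..b}")
    (auto intro: integral_nonneg simp: not_integrable_integral)

section \<open>The compact case\<close>

text \<open>\<open>arccos\<close> is not Lipschitz at the ends of its domain, so the estimate is
  proved for \<open>r * f\<close> with \<open>r < 1\<close> and then \<open>r\<close> tends to 1.
  Shrinking is harmless because \<open>r * sqrt (1 - f\<^sup>2) \<le> sqrt (1 - r\<^sup>2 *
  f\<^sup>2)\<close>.\<close>

lemma arccos_increment_le:
  fixes f :: "real \<Rightarrow> real"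
  assumes ab: "a \<le> b" and lip: "lip_on {a..b} f" and N: "negligible N"
    and f1: "\<And>t. t \<in> {a..b} \<Longrightarrow> \<bar>f t\<bar> \<le> 1"
    and der: "\<And>t. t \<in> {a..<b} - N \<Longrightarrow>
      \<exists>D. (f has_vector_derivative D) (at t within {t..b}) \<and> - D \<le> g t * sqrt (1 - (f t)\<^sup>2)"
    and g: "g integrable_on {a..b}" and g0: "\<And>t. t \<in> {a..b} \<Longrightarrow> 0 \<le> g t"
  shows "arccos (f b) - arccos (f a) \<le> integral {a..b} g"
proof -
  have step: "arccos (r * f b) - arccos (r * f a) \<le> integral {a..b} g" if r: "0 < r" "r < 1" for r
  proof -
    have rng: "r * f t \<in> {-r..r}" if "t \<in> {a..b}" for t
      using f1[OF that] r mult_left_mono[of "-1" "f t" r] mult_left_mono[of "f t" 1 r] by (auto simp: abs_le_iff)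
    have sq: "1 - r\<^sup>2 > 0" using r by (simp add: power_less_one_iff abs_square_less_1)
    have dac: "(arccos has_real_derivative - (1 / sqrt (1 - x\<^sup>2))) (at x within S)" if "x \<in> {-r..r}" for x S
      using DERIV_arccos[of x] that r by (auto intro: has_field_derivative_at_within simp: divide_inverse)
    have ac: "lip_on {-r..r} arccos"
    proof (rule lip_on_C1[of _ _ "\<lambda>x. - (1 / sqrt (1 - x\<^sup>2))" "1 / sqrt (1 - r\<^sup>2)"])
      fix x assume x: "x \<in> {-r..r}"
      show "(arccos has_real_derivative - (1 / sqrt (1 - x\<^sup>2))) (at x within {-r..r})" using dac[OF x] .
      have "x\<^sup>2 \<le> r\<^sup>2" using x by (auto intro: power2_le_iff_abs_le[THEN iffD2] simp: abs_le_iff)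
      then have "sqrt (1 - r\<^sup>2) \<le> sqrt (1 - x\<^sup>2)" "0 < sqrt (1 - r\<^sup>2)" using sq by auto
      then show "\<bar>- (1 / sqrt (1 - x\<^sup>2))\<bar> \<le> 1 / sqrt (1 - r\<^sup>2)"
        by (auto simp: frac_le)
    qed (use sq in auto)
    have rf: "lip_on {a..b} (\<lambda>t. r * f t)"
      using lip_on_bounded_linear[OF bounded_linear_mult_right lip] .
    have "lip_on {a..b} (\<lambda>t. arccos (r * f t))"
      by (rule lip_on_compose[OF rf _ ac]) (use rng in auto)
    then obtain K where K: "K-lipschitz_on {a..b} (\<lambda>t. arccos (r * f t))" by (auto simp: lip_on_def)
    show ?thesis
    proof (rule lipschitz_increment_le[OF ab K N _ g])
      fix t assume t: "t \<in> {a..<b} - N"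
      obtain D where D: "(f has_vector_derivative D) (at t within {t..b})" "- D \<le> g t * sqrt (1 - (f t)\<^sup>2)"
        using der[OF t] by blast
      let ?D = "(r * D) * - (1 / sqrt (1 - (r * f t)\<^sup>2))"
      have rt: "r * f t \<in> {-r..r}" using rng t by auto
      have "((\<lambda>t. r * f t) has_vector_derivative r * D) (at t within {t..b})"
        using has_vector_derivative_mult_right[OF D(1)] .
      then have "((arccos \<circ> (\<lambda>t. r * f t)) has_vector_derivative ?D) (at t within {t..b})"
        by (rule field_vector_diff_chain_within) (rule dac[OF rt])
      moreover have "?D \<le> g t"
      proof -
        have f1': "(f t)\<^sup>2 \<le> 1" using f1[of t] t by (auto simp: abs_square_le_1)
        have "(r * f t)\<^sup>2 \<le> r\<^sup>2 * 1" using f1' by (simp add: power_mult_distrib mult_left_le)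
        then have pos: "0 < sqrt (1 - (r * f t)\<^sup>2)" using sq by auto
        have "r\<^sup>2 * (f t)\<^sup>2 \<le> (f t)\<^sup>2" using r by (intro mult_left_le_one_le) (auto simp: power_le_one)
        then have le: "sqrt (1 - (f t)\<^sup>2) \<le> sqrt (1 - (r * f t)\<^sup>2)" by (simp add: power_mult_distrib)
        have gt: "0 \<le> g t" using g0[of t] t by auto
        have "r * (- D) \<le> r * (g t * sqrt (1 - (f t)\<^sup>2))" using D(2) r by (intro mult_left_mono) auto
        also have "\<dots> \<le> 1 * (g t * sqrt (1 - (r * f t)\<^sup>2))"
          using r gt le f1' by (intro mult_mono) auto
        finally show ?thesis using pos by (simp add: field_simps)
      qed
      ultimately show "\<exists>D. ((\<lambda>t. arccos (r * f t)) has_vector_derivative D) (at t within {t..b}) \<and> D \<le> g t"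
        by (auto simp: o_def)
    qed
  qed
  have lim: "((\<lambda>r. arccos (r * f x)) \<longlongrightarrow> arccos (f x)) (at_left 1)" if "x \<in> {a..b}" for x
  proof -
    have "continuous_on {0..1} (\<lambda>r. arccos (r * f x))"
    proof (rule continuous_on_compose2[OF continuous_on_arccos'])
      show "(\<lambda>r. r * f x) ` {0..1} \<subseteq> {-1..1}"
      proof clarsimp
        fix r :: real assume r: "0 \<le> r" "r \<le> 1"
        have "\<bar>r * f x\<bar> \<le> 1" using mult_mono[of "\<bar>r\<bar>" 1 "\<bar>f x\<bar>" 1] f1[OF that] r by (simp add: abs_mult)
        then show "- 1 \<le> r * f x \<and> r * f x \<le> 1" by (simp add: abs_le_iff)
      qed
    qed (intro continuous_intros)
    then have "((\<lambda>r. arccos (r * f x)) \<longlongrightarrow> arccos (1 * f x)) (at 1 within {0..1})"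
      unfolding continuous_on_def by (rule bspec) simp
    then show ?thesis by (simp add: at_within_Icc_at_left)
  qed
  have "((\<lambda>r. arccos (r * f b) - arccos (r * f a)) \<longlongrightarrow> arccos (f b) - arccos (f a)) (at_left 1)"
    using ab by (intro tendsto_diff lim) auto
  then show ?thesis
  proof (rule tendsto_upperbound)
    show "\<forall>\<^sub>F r in at_left 1. arccos (r * f b) - arccos (r * f a) \<le> integral {a..b} g"
      using eventually_at_left_real[of 0 "1::real"] by (auto elim!: eventually_mono intro: step)
  qed auto
qed

text \<open>The drift \<open>d\<close> pads the arclength: a curve shorter than the geodesic is
  still rotated by the full angle of the geodesic at its end. With \<open>d = 0\<close> it is plain
  arclength, as the uniqueness proofs use it.\<close>

lemma arclength_cis_derivative:
  fixes c d :: real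
  assumes \<kappa>: "\<kappa> = 1 \<or> \<kappa> = -1" and h: "hcurve \<kappa> 0 T \<alpha> \<beta> u"
  defines "m t \<equiv> hlength 0 t u + d * t"
  defines "A t \<equiv> \<alpha> t * cis (c * m t / 2)"
  shows "lip_on {0..T} m" "lip_on {0..T} A"
    "\<exists>N. negligible N \<and> (\<forall>t\<in>{0..<T} - N.
       (m has_vector_derivative cmod (u t) + d) (at t within {t..T}) \<and>
       (\<alpha> has_vector_derivative of_real (- (\<kappa> / 2)) * \<beta> t * cnj (u t)) (at t within {t..T}) \<and>
       (\<beta> has_vector_derivative (1 / 2) * \<alpha> t * u t) (at t within {t..T}) \<and>
       (A has_vector_derivative
         (of_real (- (\<kappa> / 2)) * (\<beta> t * cis (c * m t / 2)) * cnj (u t) + of_real (c * (cmod (u t) + d) / 2) * \<i> * A t))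
       (at t within {t..T}))"
proof -
  note al = hcurve_arclength[OF \<kappa> h]
  show lm: "lip_on {0..T} m"
    unfolding m_def by (intro lip_on_add al(1) lip_on_bounded_linear[OF bounded_linear_mult_right] lip_on_id)
  have "lip_on {0..T} (\<lambda>t. c / 2 * m t)"
    by (intro lip_on_bounded_linear[OF bounded_linear_mult_right] lm)
  then have "lip_on {0..T} (\<lambda>t. cis (c / 2 * m t))"
    by (rule lip_on_compose[OF _ subset_UNIV lip_on_cis])
  then show "lip_on {0..T} A"
    unfolding A_def using h by (intro lip_on_mult) (auto simp: hcurve_def)
  obtain N1 where N1: "negligible N1" "\<And>t. t \<in> {0..<T} - N1 \<Longrightarrow>
     ((\<lambda>t. hlength 0 t u) has_vector_derivative cmod (u t)) (at t within {t..T})"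
    using al(2) by auto
  obtain N2 where N2: "negligible N2" and
    D: "\<And>t. t \<in> {0..<T} - N2 \<Longrightarrow> (\<alpha> has_vector_derivative of_real (- (\<kappa> / 2)) * \<beta> t * cnj (u t)) (at t within {t..T})"
      "\<And>t. t \<in> {0..<T} - N2 \<Longrightarrow> (\<beta> has_vector_derivative (1 / 2) * \<alpha> t * u t) (at t within {t..T})"
    using h by (auto simp: hcurve_def)
  show "\<exists>N. negligible N \<and> (\<forall>t\<in>{0..<T} - N.
       (m has_vector_derivative cmod (u t) + d) (at t within {t..T}) \<and>
       (\<alpha> has_vector_derivative of_real (- (\<kappa> / 2)) * \<beta> t * cnj (u t)) (at t within {t..T}) \<and>
       (\<beta> has_vector_derivative (1 / 2) * \<alpha> t * u t) (at t within {t..T}) \<and>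
       (A has_vector_derivative
         (of_real (- (\<kappa> / 2)) * (\<beta> t * cis (c * m t / 2)) * cnj (u t) + of_real (c * (cmod (u t) + d) / 2) * \<i> * A t))
       (at t within {t..T}))"
  proof (intro exI[of _ "N1 \<union> N2"] conjI ballI)
    fix t assume t: "t \<in> {0..<T} - (N1 \<union> N2)"
    have dd: "((\<lambda>t. d * t) has_vector_derivative d) (at t within {t..T})"
      using has_vector_derivative_mult_right[OF has_vector_derivative_id, of d] by simp
    show dm: "(m has_vector_derivative cmod (u t) + d) (at t within {t..T})"
      unfolding m_def by (intro has_vector_derivative_add N1 dd) (use t in auto)
    have "((\<lambda>t. c / 2 * m t) has_vector_derivative c / 2 * (cmod (u t) + d)) (at t within {t..T})"
      by (rule has_vector_derivative_mult_right[OF dm])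
    from has_vector_derivative_cis_compose[OF this]
    have dc: "((\<lambda>t. cis (c * m t / 2)) has_vector_derivative
       ((c / 2 * (cmod (u t) + d)) *\<^sub>R (\<i> * cis (c * m t / 2)))) (at t within {t..T})" by simp
    show da: "(\<alpha> has_vector_derivative of_real (- (\<kappa> / 2)) * \<beta> t * cnj (u t)) (at t within {t..T})"
      using D t by auto
    show "(\<beta> has_vector_derivative (1 / 2) * \<alpha> t * u t) (at t within {t..T})" using D t by auto
    have "(A has_vector_derivative (\<alpha> t * ((c / 2 * (cmod (u t) + d)) *\<^sub>R (\<i> * cis (c * m t / 2)))
        + (of_real (- (\<kappa> / 2)) * \<beta> t * cnj (u t)) * cis (c * m t / 2))) (at t within {t..T})"
      unfolding A_def by (rule has_vector_derivative_mult[OF da dc])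
    then show "(A has_vector_derivative
         (of_real (- (\<kappa> / 2)) * (\<beta> t * cis (c * m t / 2)) * cnj (u t) + of_real (c * (cmod (u t) + d) / 2) * \<i> * A t))
       (at t within {t..T})"
      by (simp add: A_def scaleR_conv_of_real algebra_simps)
  qed (use N1 N2 in auto)
qed

text \<open>
  Multiplying the curve by the one-parameter group of \<open>k\<close>, run at \<open>c\<close> times arclength, gives a curve
  of the round three-sphere, along which the spherical distance from the identity,
  \<open>arccos (Re A)\<close>, grows at most as fast as its Riemannian length.
\<close>

lemma hcurve_angle_le:
  fixes c d :: real
  assumes h: "hcurve 1 0 T \<alpha> \<beta> u" and pq: "0 \<le> p" "p \<le> q" "q \<le> T"
  defines "f t \<equiv> Re (\<alpha> t * cis (c * (hlength 0 t u + d * t) / 2))"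
  shows "arccos (f q) - arccos (f p) \<le> 1 / 2 * (sqrt (c\<^sup>2 + 1) * hlength p q u + \<bar>c\<bar> * \<bar>d\<bar> * (q - p))"
proof -
  define m where "m t = hlength 0 t u + d * t" for t
  define A where "A t = \<alpha> t * cis (c * m t / 2)" for t
  have k: "(1::real) = 1 \<or> (1::real) = -1" by simp
  note F2 = arclength_cis_derivative(2)[OF k h, where c = c and d = d, folded m_def, folded A_def]
  note F3 = arclength_cis_derivative(3)[OF k h, where c = c and d = d, folded m_def, folded A_def]
  define s where "s = sqrt (c\<^sup>2 + 1)"
  define g where "g t = 1 / 2 * (s * cmod (u t) + \<bar>c\<bar> * \<bar>d\<bar>)" for t
  have fA: "f t = Re (A t)" for t by (simp add: f_def A_def m_def)
  have lf: "lip_on {p..q} f"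
    unfolding fA[abs_def] using pq by (intro lip_on_bounded_linear[OF bounded_linear_Re] lip_on_subset[OF F2]) auto
  obtain N where N: "negligible N" and D: "\<And>t. t\<in>{0..<T} - N \<Longrightarrow>
       (A has_vector_derivative
         (of_real (- (1 / 2)) * (\<beta> t * cis (c * m t / 2)) * cnj (u t) + of_real (c * (cmod (u t) + d) / 2) * \<i> * A t))
       (at t within {t..T})"
    using F3 by auto
  have n: "(cmod (\<beta> t))\<^sup>2 + (Im (A t))\<^sup>2 = 1 - (f t)\<^sup>2" if "t \<in> {0..T}" for t
  proof -
    have "(cmod (A t))\<^sup>2 + (cmod (\<beta> t))\<^sup>2 = 1"
      using h that by (auto simp: hcurve_def A_def norm_mult)
    then show ?thesis by (simp add: fA cmod_power2)
  qed
  have ui: "(\<lambda>t. cmod (u t)) integrable_on {p..q}"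
    using hcurve_speed(1)[OF k h] by (rule integrable_on_subinterval) (use pq in auto)
  have I: "(g has_integral 1 / 2 * (s * hlength p q u + (q - p) * (\<bar>c\<bar> * \<bar>d\<bar>))) {p..q}"
    unfolding hlength_def g_def[abs_def]
    using pq has_integral_const_real[of "\<bar>c\<bar> * \<bar>d\<bar>" p q]
    by (intro has_integral_mult_right has_integral_add integrable_integral ui) auto
  have "arccos (f q) - arccos (f p) \<le> integral {p..q} g"
  proof (rule arccos_increment_le[OF pq(2) lf N])
    show "\<bar>f t\<bar> \<le> 1" if "t \<in> {p..q}" for t
    proof -
      have "(f t)\<^sup>2 \<le> 1" using n[of t] that pq by (smt (verit) atLeastAtMost_iff zero_le_power2)
      then show ?thesis by (simp add: abs_square_le_1)
    qed
    show "\<exists>D. (f has_vector_derivative D) (at t within {t..q}) \<and> - D \<le> g t * sqrt (1 - (f t)\<^sup>2)"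
      if t: "t \<in> {p..<q} - N" for t
    proof -
      let ?z = "\<beta> t * cis (c * m t / 2) * cnj (u t)"
      let ?D = "Re (of_real (- (1 / 2)) * (\<beta> t * cis (c * m t / 2)) * cnj (u t) + of_real (c * (cmod (u t) + d) / 2) * \<i> * A t)"
      have "(A has_vector_derivative
         (of_real (- (1 / 2)) * (\<beta> t * cis (c * m t / 2)) * cnj (u t) + of_real (c * (cmod (u t) + d) / 2) * \<i> * A t))
       (at t within {t..q})"
        by (rule has_vector_derivative_within_subset[OF D]) (use t pq in auto)
      then have d1: "(f has_vector_derivative ?D) (at t within {t..q})"
        unfolding fA[abs_def] by (rule bounded_linear.has_vector_derivative[OF bounded_linear_Re])
      define R where "R = sqrt (1 - (f t)\<^sup>2)"
      have nt: "(cmod (\<beta> t))\<^sup>2 + (Im (A t))\<^sup>2 = R\<^sup>2" "R \<ge> 0"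
        using n[of t] t pq by (auto simp: R_def) (smt (verit) real_sqrt_pow2 zero_le_power2)+
      have I: "\<bar>Im (A t)\<bar> \<le> R" by (rule abs_le_square_iff[THEN iffD2, of _ R, simplified abs_of_nonneg[OF nt(2)]]) (use nt in \<open>smt (verit) zero_le_power2\<close>)
      \<comment> \<open>Cauchy-Schwarz for \<open>(1, |c|)\<close> and
        \<open>(cmod (\<beta> t), |Im (A t)|)\<close>; the first vector has norm \<open>s\<close>
        and the second has norm \<open>R\<close>.\<close>
      have cs: "cmod (\<beta> t) + \<bar>c\<bar> * \<bar>Im (A t)\<bar> \<le> s * R"
      proof (rule power2_le_imp_le)
        have "(cmod (\<beta> t) + \<bar>c\<bar> * \<bar>Im (A t)\<bar>)\<^sup>2 + (\<bar>c\<bar> * cmod (\<beta> t) - \<bar>Im (A t)\<bar>)\<^sup>2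
          = (c\<^sup>2 + 1) * ((cmod (\<beta> t))\<^sup>2 + (Im (A t))\<^sup>2)"
          by (simp add: power2_eq_square algebra_simps)
        then show "(cmod (\<beta> t) + \<bar>c\<bar> * \<bar>Im (A t)\<bar>)\<^sup>2 \<le> (s * R)\<^sup>2"
          using nt(1) by (simp add: power_mult_distrib s_def) (smt (verit) zero_le_power2)
      qed (use nt in \<open>auto simp: s_def\<close>)
      have "Re ?z \<le> cmod ?z" by (rule complex_Re_le_cmod)
      then have z: "Re ?z \<le> cmod (\<beta> t) * cmod (u t)" by (simp add: norm_mult)
      have "- ?D = 1 / 2 * (Re ?z + c * (cmod (u t) + d) * Im (A t))"
        by (simp add: field_simps)
      also have "\<dots> \<le> 1 / 2 * (cmod (\<beta> t) * cmod (u t) + \<bar>c\<bar> * (cmod (u t) + \<bar>d\<bar>) * \<bar>Im (A t)\<bar>)"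
      proof -
        have "c * (cmod (u t) + d) * Im (A t) \<le> \<bar>c\<bar> * \<bar>cmod (u t) + d\<bar> * \<bar>Im (A t)\<bar>"
          by (metis abs_ge_self abs_mult)
        also have "\<dots> \<le> \<bar>c\<bar> * (cmod (u t) + \<bar>d\<bar>) * \<bar>Im (A t)\<bar>"
          using abs_triangle_ineq[of "cmod (u t)" d] by (intro mult_right_mono mult_left_mono) auto
        finally show ?thesis using z by simp
      qed
      also have "\<dots> = 1 / 2 * (cmod (u t) * (cmod (\<beta> t) + \<bar>c\<bar> * \<bar>Im (A t)\<bar>) + \<bar>c\<bar> * \<bar>d\<bar> * \<bar>Im (A t)\<bar>)"
        by (simp add: algebra_simps)
      \<comment> \<open>The drift alone contributes at most \<open>|c| * |d| / 2\<close> to the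
        spherical speed, because \<open>|Im (A t)| \<le> R\<close>.\<close>
      also have "\<dots> \<le> 1 / 2 * (cmod (u t) * (s * R) + \<bar>c\<bar> * \<bar>d\<bar> * R)"
        by (intro mult_left_mono add_mono cs I) auto
      also have "\<dots> = g t * R" by (simp add: g_def algebra_simps)
      finally show ?thesis using d1 unfolding R_def by blast
    qed
    show "g integrable_on {p..q}" using I by (rule has_integral_integrable)
    show "0 \<le> g t" for t by (simp add: g_def s_def)
  qed
  also have "integral {p..q} g = 1 / 2 * (s * hlength p q u + \<bar>c\<bar> * \<bar>d\<bar> * (q - p))"
    using integral_unique[OF I] by (simp only: mult.commute)
  finally show ?thesis by (simp add: s_def)
qed

section \<open>Generalized sine and cosine, and the geodesics in coordinates\<close>

definition cosq :: "real \<Rightarrow> real \<Rightarrow> real" where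
  "cosq y t = (if 0 < y then cos (sqrt y * t) else if y < 0 then cosh (sqrt (- y) * t) else 1)"

text \<open>\<open>cosq y\<close> and \<open>sinq y\<close> are the solutions of
  \<open>f'' = - y * f\<close> with initial data \<open>(1, 0)\<close> and \<open>(0, 1)\<close>.
  One pair of functions thus serves elliptic, parabolic and hyperbolic geodesics:
  \<open>y = (c\<^sup>2 + \<kappa>) / 4\<close> takes every sign in SL(2).\<close>

definition sinq :: "real \<Rightarrow> real \<Rightarrow> real" where
  "sinq y t = (if 0 < y then sin (sqrt y * t) / sqrt y
     else if y < 0 then sinh (sqrt (- y) * t) / sqrt (- y) else t)"

lemma cosq_0 [simp]: "cosq y 0 = 1" and sinq_0 [simp]: "sinq y 0 = 0"
  by (auto simp: cosq_def sinq_def)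

lemma cosq_sinq: "(cosq y t)\<^sup>2 + y * (sinq y t)\<^sup>2 = 1"
proof -
  consider "y > 0" | "y < 0" | "y = 0" by linarith
  then show ?thesis
  proof cases
    case 1 then show ?thesis by (simp add: cosq_def sinq_def power_divide)
  next
    case 2 then show ?thesis by (simp add: cosq_def sinq_def power_divide cosh_square_eq)
  qed (simp add: cosq_def sinq_def)
qed

lemma has_real_derivative_cosq: "(cosq y has_real_derivative - y * sinq y t) (at t within S)"
proof -
  consider "y > 0" | "y < 0" | "y = 0" by linarith
  then show ?thesis
  proof cases
    case 1
    have "((\<lambda>t. cos (sqrt y * t)) has_real_derivative - y * (sin (sqrt y * t) / sqrt y)) (at t within S)"
      using 1 by (auto intro!: derivative_eq_intros simp: field_simps)
    then show ?thesis using 1 by (simp add: cosq_def[abs_def] sinq_def)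
  next
    case 2
    have "((\<lambda>t. cosh (sqrt (-y) * t)) has_real_derivative - y * (sinh (sqrt (-y) * t) / sqrt (-y))) (at t within S)"
    proof -
      define r where "r = sqrt (- y)"
      have r: "r > 0" "y = - (r * r)" using 2 by (auto simp: r_def)
      show ?thesis unfolding r_def[symmetric] using r(1)
        by (auto intro!: derivative_eq_intros simp: field_simps r(2))
    qed
    then show ?thesis using 2 by (simp add: cosq_def[abs_def] sinq_def)
  qed (simp add: cosq_def[abs_def] sinq_def)
qed

lemma has_real_derivative_sinq: "(sinq y has_real_derivative cosq y t) (at t within S)"
proof -
  consider "y > 0" | "y < 0" | "y = 0" by linarith
  then show ?thesis
  proof cases
    case 1
    have "((\<lambda>t. sin (sqrt y * t) / sqrt y) has_real_derivative cos (sqrt y * t)) (at t within S)"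
      using 1 by (auto intro!: derivative_eq_intros simp: field_simps)
    then show ?thesis using 1 by (simp add: sinq_def[abs_def] cosq_def)
  next
    case 2
    have "((\<lambda>t. sinh (sqrt (-y) * t) / sqrt (-y)) has_real_derivative cosh (sqrt (-y) * t)) (at t within S)"
    proof -
      define r where "r = sqrt (- y)"
      have r: "r > 0" using 2 by (auto simp: r_def)
      show ?thesis unfolding r_def[symmetric] using r
        by (auto intro!: derivative_eq_intros simp: field_simps)
    qed
    then show ?thesis using 2 by (simp add: sinq_def[abs_def] cosq_def)
  qed (simp add: cosq_def sinq_def[abs_def])
qed

text \<open>The geodesic with parameters \<open>w = e^(i\<theta>)\<close> and \<open>c\<close>, in the coordinates \<open>(\<alpha>, \<beta>)\<close>.\<close>

definition geoA :: "real \<Rightarrow> real \<Rightarrow> real \<Rightarrow> complex" where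
  "geoA \<kappa> c t = Complex (cosq ((c\<^sup>2 + \<kappa>) / 4) t) (c / 2 * sinq ((c\<^sup>2 + \<kappa>) / 4) t) * cis (- (c * t / 2))"

definition geoB :: "real \<Rightarrow> real \<Rightarrow> complex \<Rightarrow> real \<Rightarrow> complex" where
  "geoB \<kappa> c w t = of_real (sinq ((c\<^sup>2 + \<kappa>) / 4) t / 2) * (w * cis (c * t / 2))"

lemma geo_0 [simp]: "geoA \<kappa> c 0 = 1" "geoB \<kappa> c w 0 = 0"
  by (auto simp: geoA_def geoB_def complex_eq_iff)

lemma geo_norm:
  assumes "cmod w = 1"
  shows "(cmod (geoA \<kappa> c t))\<^sup>2 + \<kappa> * (cmod (geoB \<kappa> c w t))\<^sup>2 = 1"
proof -
  let ?y = "(c\<^sup>2 + \<kappa>) / 4"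
  have 1: "(cmod (geoA \<kappa> c t))\<^sup>2 = (cosq ?y t)\<^sup>2 + (c / 2 * sinq ?y t)\<^sup>2"
    by (simp add: geoA_def norm_mult cmod_power2)
  have 2: "(cmod (geoB \<kappa> c w t))\<^sup>2 = (sinq ?y t / 2)\<^sup>2"
    using assms by (simp add: geoB_def norm_mult power_divide)
  have "(cmod (geoA \<kappa> c t))\<^sup>2 + \<kappa> * (cmod (geoB \<kappa> c w t))\<^sup>2 = (cosq ?y t)\<^sup>2 + ?y * (sinq ?y t)\<^sup>2"
    unfolding 1 2 by (simp add: power_mult_distrib power_divide field_simps)
  then show ?thesis by (simp only: cosq_sinq)
qed

lemma lip_on_vector_derivative:
  fixes f :: "real \<Rightarrow> 'a::real_normed_vector"
  assumes D: "\<And>t. t \<in> {a..b} \<Longrightarrow> (f has_vector_derivative f' t) (at t within {a..b})"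
    and c: "continuous_on {a..b} f'"
  shows "lip_on {a..b} f"
proof -
  have "bounded (f' ` {a..b})" by (intro compact_imp_bounded compact_continuous_image c compact_Icc)
  then obtain K where K: "K > 0" "\<And>t. t \<in> {a..b} \<Longrightarrow> norm (f' t) \<le> K" by (auto simp: bounded_pos)
  show ?thesis
  proof (rule lip_onI[OF bounded_derivative_imp_lipschitz])
    show "(f has_derivative (\<lambda>x. x *\<^sub>R f' t)) (at t within {a..b})" if "t \<in> {a..b}" for t
      using D[OF that] by (simp add: has_vector_derivative_def)
    show "onorm (\<lambda>x. x *\<^sub>R f' t) \<le> K" if "t \<in> {a..b}" for t
      using K(2)[OF that] K(1) by (intro onorm_bound) (auto simp: mult.commute[of K] mult_left_mono)
  qed (use K in auto)
qed

text \<open>The constant \<open>w\<close> cancels against \<open>cnj w\<close>; it is carried along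
  so that the derivative has the form demanded by \<open>hcurve\<close>, with control
  \<open>w * cis (c * t)\<close>.\<close>

lemma has_vector_derivative_geoA:
  assumes "cmod w = 1"
  shows "(geoA \<kappa> c has_vector_derivative of_real (- (\<kappa> / 2)) * geoB \<kappa> c w t * cnj (w * cis (c * t))) (at t within S)"
proof -
  let ?y = "(c\<^sup>2 + \<kappa>) / 4"
  have ww: "w * cnj w = 1" using assms by (simp add: complex_norm_square[symmetric])
  have d1: "((\<lambda>t. Complex (cosq ?y t) (c / 2 * sinq ?y t)) has_vector_derivative
      Complex (- ?y * sinq ?y t) (c / 2 * cosq ?y t)) (at t within S)"
    unfolding has_vector_derivative_complex_iff
    using has_real_derivative_cosq[of ?y t S] DERIV_cmult[OF has_real_derivative_sinq[of ?y t S], of "c / 2"]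
    by (simp add: has_real_derivative_iff_has_vector_derivative)
  have "((\<lambda>t. - (c * t / 2)) has_vector_derivative - (c / 2)) (at t within S)"
    by (auto intro!: derivative_eq_intros)
  from has_vector_derivative_mult[OF d1 has_vector_derivative_cis_compose[OF this]]
  have "(geoA \<kappa> c has_vector_derivative
     Complex (cosq ?y t) (c / 2 * sinq ?y t) * ((- (c / 2)) *\<^sub>R (\<i> * cis (- (c * t / 2)))) +
     Complex (- ?y * sinq ?y t) (c / 2 * cosq ?y t) * cis (- (c * t / 2))) (at t within S)"
    unfolding geoA_def[abs_def] .
  moreover have "Complex (cosq ?y t) (c / 2 * sinq ?y t) * ((- (c / 2)) *\<^sub>R (\<i> * cis (- (c * t / 2)))) +
     Complex (- ?y * sinq ?y t) (c / 2 * cosq ?y t) * cis (- (c * t / 2))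
     = of_real (- (\<kappa> / 4) * sinq ?y t) * cis (- (c * t / 2))"
  proof -
    have "Complex (cosq ?y t) (c / 2 * sinq ?y t) * (of_real (- (c / 2)) * \<i>) +
     Complex (- ?y * sinq ?y t) (c / 2 * cosq ?y t) = of_real (- (\<kappa> / 4) * sinq ?y t)"
      by (simp add: complex_eq_iff field_simps power2_eq_square)
    from arg_cong[OF this, of "\<lambda>z. z * cis (- (c * t / 2))"] show ?thesis
      by (simp add: scaleR_conv_of_real algebra_simps)
  qed
  moreover have "of_real (- (\<kappa> / 2)) * geoB \<kappa> c w t * cnj (w * cis (c * t))
     = of_real (- (\<kappa> / 4) * sinq ?y t) * cis (- (c * t / 2))"
  proof -
    have "of_real (- (\<kappa> / 2)) * geoB \<kappa> c w t * cnj (w * cis (c * t)) =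
      of_real (- (\<kappa> / 4) * sinq ?y t) * (w * cnj w) * (cis (c * t / 2) * cis (- (c * t)))"
      by (simp add: geoB_def cis_cnj)
    also have "cis (c * t / 2) * cis (- (c * t)) = cis (- (c * t / 2))" by (simp add: cis_mult)
    finally show ?thesis by (simp add: ww)
  qed
  ultimately show ?thesis by (simp only:)
qed

lemma has_vector_derivative_geoB:
  "(geoB \<kappa> c w has_vector_derivative (1 / 2) * geoA \<kappa> c t * (w * cis (c * t))) (at t within S)"
proof -
  let ?y = "(c\<^sup>2 + \<kappa>) / 4"
  have d1: "((\<lambda>t. of_real (sinq ?y t / 2) :: complex) has_vector_derivative of_real (cosq ?y t / 2)) (at t within S)"
    using has_vector_derivative_of_real[OF DERIV_cdivide[OF has_real_derivative_sinq[of ?y t S], of 2]] .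
  have "((\<lambda>t. c * t / 2) has_vector_derivative c / 2) (at t within S)"
    by (auto intro!: derivative_eq_intros)
  from has_vector_derivative_mult[OF d1 has_vector_derivative_mult_right[OF has_vector_derivative_cis_compose[OF this], of w]]
  have "(geoB \<kappa> c w has_vector_derivative
     of_real (sinq ?y t / 2) * (w * ((c / 2) *\<^sub>R (\<i> * cis (c * t / 2)))) +
     of_real (cosq ?y t / 2) * (w * cis (c * t / 2))) (at t within S)"
    unfolding geoB_def[abs_def] .
  moreover have "of_real (sinq ?y t / 2) * (w * ((c / 2) *\<^sub>R (\<i> * cis (c * t / 2)))) +
     of_real (cosq ?y t / 2) * (w * cis (c * t / 2)) = (1 / 2) * geoA \<kappa> c t * (w * cis (c * t))"
  proof -
    have "(1 / 2) * geoA \<kappa> c t * (w * cis (c * t)) =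
      1 / 2 * Complex (cosq ?y t) (c / 2 * sinq ?y t) * w * (cis (- (c * t / 2)) * cis (c * t))"
      by (simp add: geoA_def)
    also have "cis (- (c * t / 2)) * cis (c * t) = cis (c * t / 2)" by (simp add: cis_mult)
    finally show ?thesis
      by (simp add: Complex_eq scaleR_conv_of_real algebra_simps)
  qed
  ultimately show ?thesis by (simp only:)
qed

lemma hcurve_geo:
  assumes w: "cmod w = 1" and T: "0 \<le> T"
  shows "hcurve \<kappa> 0 T (geoA \<kappa> c) (geoB \<kappa> c w) (\<lambda>t. w * cis (c * t))"
proof -
  have cA: "continuous_on S (geoA \<kappa> c)" and cB: "continuous_on S (geoB \<kappa> c w)" for S
    using has_vector_derivative_continuous[OF has_vector_derivative_geoA[OF w]]
      has_vector_derivative_continuous[OF has_vector_derivative_geoB]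
    by (auto simp: continuous_on_eq_continuous_within)
  have ci: "continuous_on S (\<lambda>t. cis (c * t))" for S
    by (intro continuous_on_cis continuous_intros)
  have "lip_on {0..T} (geoA \<kappa> c)"
    by (rule lip_on_vector_derivative[OF has_vector_derivative_geoA[OF w]])
       (intro continuous_intros cB ci)
  moreover have "lip_on {0..T} (geoB \<kappa> c w)"
    by (rule lip_on_vector_derivative[OF has_vector_derivative_geoB])
       (intro continuous_intros cA ci)
  ultimately show ?thesis
    unfolding hcurve_def using T geo_norm[OF w] has_vector_derivative_geoA[OF w] has_vector_derivative_geoB
    by (auto intro!: exI[of _ "{}"])
qed

lemma hlength_geo: "cmod w = 1 \<Longrightarrow> a \<le> b \<Longrightarrow> hlength a b (\<lambda>t. w * cis (c * t)) = b - a"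
  by (simp add: hlength_def norm_mult)

text \<open>The number \<open>sqrt (c\<^sup>2 + 1) * t / 2\<close> is the spherical distance of the
  rotated end point as long as it does not exceed \<open>pi\<close>, hence the bound
  \<open>2 * pi\<close>. The missing length \<open>t - L\<close> is counted at the smaller rate
  \<open>|c| / 2\<close>, so a competitor with \<open>L < t\<close> would cover less than this
  distance. Only \<open>\<alpha> T\<close> is compared, since the distance is read off from the real
  part of the rotated \<open>\<alpha> T\<close>.\<close>

theorem su2_geodesic_minimal:
  assumes h: "hcurve 1 0 T \<alpha> \<beta> u" and T: "0 < T" and start: "\<alpha> 0 = 1"
    and fin: "\<alpha> T = geoA 1 c t" and t: "0 < t" "sqrt (c\<^sup>2 + 1) * t \<le> 2 * pi"
  shows "t \<le> hlength 0 T u"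
proof (rule ccontr)
  assume "\<not> ?thesis"
  define L where "L = hlength 0 T u"
  with \<open>\<not> ?thesis\<close> have L: "L < t" by simp
  define s where "s = sqrt (c\<^sup>2 + 1)"
  \<comment> \<open>Chosen so that the rotation has run for exactly \<open>t\<close> when the
    competitor arrives.\<close>
  define d where "d = (t - L) / T"
  have s: "\<bar>c\<bar> < s" unfolding s_def by (rule real_less_rsqrt) simp
  have dT: "d * T = t - L" using T by (simp add: d_def)
  have d0: "0 < d" using L T by (simp add: d_def)
  have "arccos (Re (\<alpha> T * cis (c * (hlength 0 T u + d * T) / 2))) -
      arccos (Re (\<alpha> 0 * cis (c * (hlength 0 0 u + d * 0) / 2)))
      \<le> 1 / 2 * (s * hlength 0 T u + \<bar>c\<bar> * \<bar>d\<bar> * (T - 0))"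
    unfolding s_def by (rule hcurve_angle_le[OF h]) (use T in auto)
  moreover have "hlength 0 T u + d * T = t" by (simp add: dT L_def)
  moreover have "Re (\<alpha> T * cis (c * t / 2)) = cos (s * t / 2)"
  proof -
    have "\<alpha> T * cis (c * t / 2) = Complex (cosq ((c\<^sup>2 + 1) / 4) t) (c / 2 * sinq ((c\<^sup>2 + 1) / 4) t)"
      by (simp add: fin geoA_def mult.assoc cis_mult)
    then have "Re (\<alpha> T * cis (c * t / 2)) = cosq ((c\<^sup>2 + 1) / 4) t" by simp
    moreover have "(c\<^sup>2 + 1) / 4 > 0" using zero_le_power2[of c] by (simp add: add_nonneg_pos)
    ultimately show ?thesis by (simp add: cosq_def real_sqrt_divide s_def)
  qed
  moreover have "arccos (cos (s * t / 2)) = s * t / 2"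
    by (rule arccos_cos) (use t s in \<open>auto simp: s_def\<close>)
  ultimately have "s * t / 2 \<le> 1 / 2 * (s * L + \<bar>c\<bar> * \<bar>d\<bar> * T)"
    by (simp add: start hlength_def L_def)
  then have "s * t \<le> s * L + \<bar>c\<bar> * (t - L)"
    using d0 dT by (simp add: mult.assoc)
  then have "(s - \<bar>c\<bar>) * (t - L) \<le> 0" by (simp add: algebra_simps)
  with s L show False by (simp add: mult_le_0_iff)
qed

section \<open>The noncompact case\<close>

lemma lip_on_locally:
  fixes f :: "real \<Rightarrow> 'a::metric_space"
  assumes "0 < \<delta>" "0 \<le> K"
    and loc: "\<And>s t. s \<in> {a..b} \<Longrightarrow> t \<in> {a..b} \<Longrightarrow> \<bar>s - t\<bar> < \<delta> \<Longrightarrow> dist (f s) (f t) \<le> K * \<bar>s - t\<bar>"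
  shows "lip_on {a..b} f"
proof -
  \<comment> \<open>Half of \<open>\<delta>\<close>, so that a closed cell of this width has
    diameter strictly below \<open>\<delta>\<close>.\<close>
  define \<eta> where "\<eta> = \<delta> / 2"
  have \<eta>: "0 < \<eta>" "\<eta> < \<delta>" using assms by (auto simp: \<eta>_def)
  define U where "U i = {a..b} \<inter> {a + real i * \<eta> .. a + (real i + 1) * \<eta>}" for i
  define n where "n = nat \<lfloor>(b - a) / \<eta>\<rfloor>"
  have "K-lipschitz_on {a..b} f"
  proof (rule lipschitz_on_closed_Union[where I = "{..n}" and U = U])
    show "K-lipschitz_on (U i) f" for i
    proof (rule lipschitz_onI)
      fix s t assume st: "s \<in> U i" "t \<in> U i"
      then have "\<bar>s - t\<bar> \<le> \<eta>" by (auto simp: U_def algebra_simps abs_le_iff)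
      then have "\<bar>s - t\<bar> < \<delta>" using \<eta> by linarith
      then show "dist (f s) (f t) \<le> K * dist s t"
        using loc[of s t] st by (simp add: U_def dist_real_def)
    qed fact
    show "closed (U i)" for i by (simp add: U_def closed_Int)
    show "{a..b} \<subseteq> (\<Union>i\<in>{..n}. U i)"
    proof
      fix x assume x: "x \<in> {a..b}"
      define i where "i = nat \<lfloor>(x - a) / \<eta>\<rfloor>"
      have "\<lfloor>(x - a) / \<eta>\<rfloor> \<le> \<lfloor>(b - a) / \<eta>\<rfloor>" using x \<eta> by (intro floor_mono divide_right_mono) auto
      then have "i \<le> n" by (auto simp: i_def n_def)
      have "0 \<le> (x - a) / \<eta>" using x \<eta> by auto
      then have "real i \<le> (x - a) / \<eta>" "(x - a) / \<eta> < real i + 1" unfolding i_def by linarith+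
      then have "x \<in> U i" using x \<eta> by (auto simp: U_def field_simps)
      with \<open>i \<le> n\<close> show "x \<in> (\<Union>i\<in>{..n}. U i)" by auto
    qed
  qed (use assms in auto)
  then show ?thesis by (rule lip_onI)
qed

text \<open>Uniform continuity keeps the increments of \<open>l\<close> below 1, well inside the
  strip on which the principal logarithm inverts \<open>exp\<close>.\<close>

lemma continuous_log_difference:
  fixes l :: "real \<Rightarrow> complex"
  assumes c: "continuous_on {a..b} l" and e: "\<And>t. t \<in> {a..b} \<Longrightarrow> exp (l t) = p t"
  obtains \<delta> where "0 < \<delta>"
    "\<And>s t. s \<in> {a..b} \<Longrightarrow> t \<in> {a..b} \<Longrightarrow> \<bar>s - t\<bar> < \<delta> \<Longrightarrow> l s - l t = Ln (p s / p t)"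
proof -
  have "uniformly_continuous_on {a..b} l"
    by (rule compact_uniformly_continuous[OF c]) simp
  then obtain \<delta> where \<delta>: "0 < \<delta>" "\<And>s t. s \<in> {a..b} \<Longrightarrow> t \<in> {a..b} \<Longrightarrow> dist s t < \<delta> \<Longrightarrow> dist (l s) (l t) < 1"
    unfolding uniformly_continuous_on_def by (metis zero_less_one)
  show thesis
  proof (rule that[OF \<delta>(1)])
    fix s t assume st: "s \<in> {a..b}" "t \<in> {a..b}" "\<bar>s - t\<bar> < \<delta>"
    then have "cmod (l s - l t) < 1" using \<delta>(2)[of s t] by (simp add: dist_norm)
    then have "\<bar>Im (l s - l t)\<bar> < 1" using abs_Im_le_cmod order_le_less_trans by blast
    then have "Ln (exp (l s - l t)) = l s - l t" using pi_gt3 by (intro Ln_exp) auto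
    then show "l s - l t = Ln (p s / p t)" using e st by (simp add: exp_diff)
  qed
qed

text \<open>On a compact interval \<open>cmod p\<close> stays above some \<open>m > 0\<close>, so
  nearby values of \<open>p\<close> have a ratio \<open>1 + z\<close> with
  \<open>cmod z < 1 / 2\<close>, and there
  \<open>cmod (Ln (1 + z)) \<le> 2 * cmod z\<close>.\<close>

lemma lip_on_continuous_log:
  fixes l :: "real \<Rightarrow> complex"
  assumes c: "continuous_on {a..b} l" and e: "\<And>t. t \<in> {a..b} \<Longrightarrow> exp (l t) = p t"
    and p: "lip_on {a..b} p"
  shows "lip_on {a..b} l"
proof (cases "a \<le> b")
  case False then show ?thesis by (intro lip_onI[of 0]) simp
next
  case True
  obtain K where K: "K-lipschitz_on {a..b} p" using p by (auto simp: lip_on_def)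
  have K0: "0 \<le> K" using lipschitz_on_nonneg[OF K] .
  have "continuous_on {a..b} (\<lambda>t. cmod (p t))"
    by (intro continuous_intros lip_on_continuous p)
  then obtain t0 where t0: "t0 \<in> {a..b}" "\<And>t. t \<in> {a..b} \<Longrightarrow> cmod (p t0) \<le> cmod (p t)"
    using continuous_attains_inf[of "{a..b}" "\<lambda>t. cmod (p t)"] True by auto
  define m where "m = cmod (p t0)"
  have m: "0 < m" "\<And>t. t \<in> {a..b} \<Longrightarrow> m \<le> cmod (p t)"
    using t0 e[of t0, symmetric] by (auto simp: m_def)
  obtain \<delta>1 where \<delta>1: "0 < \<delta>1"
    "\<And>s t. s \<in> {a..b} \<Longrightarrow> t \<in> {a..b} \<Longrightarrow> \<bar>s - t\<bar> < \<delta>1 \<Longrightarrow> l s - l t = Ln (p s / p t)"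
    using continuous_log_difference[OF c e] by metis
  define \<delta> where "\<delta> = min \<delta>1 (m / (2 * (K + 1)))"
  show ?thesis
  proof (rule lip_on_locally[of \<delta> "2 * (K / m)"])
    show "0 < \<delta>" using \<delta>1 m K0 by (auto simp: \<delta>_def)
    show "0 \<le> 2 * (K / m)" using K0 m by simp
    fix s t assume st: "s \<in> {a..b}" "t \<in> {a..b}" "\<bar>s - t\<bar> < \<delta>"
    have pt: "m \<le> cmod (p t)" "0 < cmod (p t)" using m(1) m(2)[OF st(2)] by linarith+
    define z where "z = (p s - p t) / p t"
    have z: "p s / p t = 1 + z" using pt by (simp add: z_def field_simps)
    have "cmod (p s - p t) \<le> K * \<bar>s - t\<bar>" using lipschitz_onD[OF K st(1,2)] by (simp add: dist_norm)
    then have nz: "cmod z \<le> K * \<bar>s - t\<bar> / m" unfolding z_def norm_divide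
      using pt m K0 by (intro frac_le) auto
    have "K * \<bar>s - t\<bar> \<le> K * (m / (2 * (K + 1)))" using st K0 by (intro mult_left_mono) (auto simp: \<delta>_def)
    also have "\<dots> < m / 2" using K0 m by (simp add: field_simps)
    finally have "K * \<bar>s - t\<bar> / m < 1 / 2" using m by (simp add: field_simps)
    with nz have "cmod z < 1 / 2" by linarith
    then have "cmod (Ln (1 + z)) \<le> 2 * cmod z" by (rule norm_Ln_le)
    also have "\<dots> \<le> 2 * (K / m) * \<bar>s - t\<bar>" using nz by simp
    finally show "dist (l s) (l t) \<le> 2 * (K / m) * \<bar>s - t\<bar>"
      using \<delta>1(2)[OF st(1,2)] st(3) z by (simp add: \<delta>_def dist_norm)
  qed
qed

lemma continuous_log_right_derivative:
  fixes l :: "real \<Rightarrow> complex"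
  assumes c: "continuous_on {a..b} l" and e: "\<And>t. t \<in> {a..b} \<Longrightarrow> exp (l t) = p t"
    and t: "t \<in> {a..<b}" and D: "(p has_vector_derivative D) (at t within {t..b})"
  shows "(l has_vector_derivative D / p t) (at t within {t..b})"
proof -
  obtain \<delta> where \<delta>: "0 < \<delta>"
    "\<And>s t. s \<in> {a..b} \<Longrightarrow> t \<in> {a..b} \<Longrightarrow> \<bar>s - t\<bar> < \<delta> \<Longrightarrow> l s - l t = Ln (p s / p t)"
    using continuous_log_difference[OF c e] by metis
  have pt: "p t \<noteq> 0" using e[of t, symmetric] t by simp
  have 1: "((\<lambda>s. p s / p t) has_vector_derivative D / p t) (at t within {t..b})"
    using has_vector_derivative_mult_left[OF D, of "inverse (p t)"] by (simp add: divide_inverse)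
  have "(Ln has_field_derivative inverse (p t / p t)) (at (p t / p t) within (\<lambda>s. p s / p t) ` {t..b})"
    by (rule has_field_derivative_at_within, rule has_field_derivative_Ln) (use pt in auto)
  then have "(Ln has_field_derivative 1) (at (p t / p t) within (\<lambda>s. p s / p t) ` {t..b})"
    using pt by simp
  from field_vector_diff_chain_within[OF 1 this]
  have "((\<lambda>s. Ln (p s / p t)) has_vector_derivative D / p t) (at t within {t..b})"
    by (simp add: o_def)
  from has_vector_derivative_add_const[THEN iffD2, OF this, of "l t"]
  have "((\<lambda>s. Ln (p s / p t) + l t) has_vector_derivative D / p t) (at t within {t..b})" .
  then show ?thesis
  proof (rule has_vector_derivative_transform_within[OF _ \<delta>(1)])
    show "Ln (p s / p t) + l t = l s" if "s \<in> {t..b}" "dist s t < \<delta>" for s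
    proof -
      have "l s - l t = Ln (p s / p t)" by (rule \<delta>(2)) (use that t in \<open>auto simp: dist_real_def\<close>)
      then show ?thesis by (metis diff_add_cancel)
    qed
  qed (use t in auto)
qed

lemma su11_alpha_gt:
  assumes "(cmod x)\<^sup>2 + (-1) * (cmod y)\<^sup>2 = 1"
  shows "cmod y < cmod x" "x \<noteq> 0" "1 \<le> cmod x"
proof -
  have *: "(cmod x)\<^sup>2 = 1 + (cmod y)\<^sup>2" using assms by simp
  show "cmod y < cmod x" by (rule power2_less_imp_less) (use * in auto)
  then show "x \<noteq> 0" by auto
  show "1 \<le> cmod x" by (rule power2_le_imp_le) (use * in auto)
qed

text \<open>\<open>\<alpha>\<close> never vanishes in SU(1,1), so it has a continuous phase
  \<open>Im l\<close>. Its value at \<open>T\<close> distinguishes the lifts of the end point to the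
  universal cover; minimality is proved relative to it.\<close>

lemma su11_phase_exists:
  assumes h: "hcurve (-1) 0 T \<alpha> \<beta> u" and start: "\<alpha> 0 = 1"
  obtains l where "continuous_on {0..T} l" "\<And>t. t \<in> {0..T} \<Longrightarrow> exp (l t) = \<alpha> t" "l 0 = 0"
proof -
  have c: "continuous_on {0..T} \<alpha>" and T: "0 \<le> T" using h by (auto simp: hcurve_def lip_on_continuous)
  have nz: "\<alpha> t \<noteq> 0" if "t \<in> {0..T}" for t
    using h that su11_alpha_gt(2)[of "\<alpha> t" "\<beta> t"] unfolding hcurve_def by blast
  obtain g where g: "continuous_on {0..T} g" "\<And>t. t \<in> {0..T} \<Longrightarrow> \<alpha> t = exp (g t)"
    using continuous_logarithm_on_contractible[OF c convex_imp_contractible nz] by auto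
  have "exp (g 0) = 1" using g(2)[of 0] T start by simp
  then show thesis
    by (intro that[of "\<lambda>t. g t - g 0"]) (use g in \<open>auto intro!: continuous_intros simp: exp_diff\<close>)
qed

text \<open>
  The rows of the corresponding matrix of \<open>SL(2,\<real>)\<close>, seen as complex numbers and divided by their
  initial value, are \<open>\<alpha> + e cnj \<beta>\<close> with \<open>|e| = 1\<close>. Their logarithm has speed exactly \<open>|u|/2\<close>.
\<close>

context
  fixes T :: real and \<alpha> \<beta> u l
  assumes h: "hcurve (-1) 0 T \<alpha> \<beta> u" and T: "0 < T"
    and start: "\<alpha> 0 = 1" "\<beta> 0 = 0"
    and l: "continuous_on {0..T} l" "\<And>t. t \<in> {0..T} \<Longrightarrow> exp (l t) = \<alpha> t" "l 0 = 0"
begin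

lemma ab_norm: "t \<in> {0..T} \<Longrightarrow> (cmod (\<alpha> t))\<^sup>2 + (-1) * (cmod (\<beta> t))\<^sup>2 = 1"
  using h unfolding hcurve_def by blast

definition row :: "complex \<Rightarrow> real \<Rightarrow> complex" where
  "row e t = \<alpha> t + e * cnj (\<beta> t)"

text \<open>For \<open>cmod e = 1\<close> the argument of \<open>Ln\<close> lies in the right
  half-plane. The sum is therefore the branch that starts at 0, and \<open>Im (rowlog e t)\<close>
  stays within \<open>pi / 2\<close> of \<open>Im (l t)\<close>.\<close>

definition rowlog :: "complex \<Rightarrow> real \<Rightarrow> complex" where
  "rowlog e t = l t + Ln (1 + e * cnj (\<beta> t) / \<alpha> t)"

lemma row_quotient_Re_pos:
  assumes "t \<in> {0..T}" "cmod e = 1"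
  shows "0 < Re (1 + e * cnj (\<beta> t) / \<alpha> t)"
proof -
  have "cmod (e * cnj (\<beta> t) / \<alpha> t) < 1"
    using su11_alpha_gt[OF ab_norm[OF assms(1)]] assms(2) by (simp add: norm_mult norm_divide)
  then show ?thesis using abs_Re_le_cmod[of "e * cnj (\<beta> t) / \<alpha> t"] by simp
qed

lemma exp_rowlog:
  assumes "t \<in> {0..T}" "cmod e = 1"
  shows "exp (rowlog e t) = row e t"
proof -
  have "1 + e * cnj (\<beta> t) / \<alpha> t \<noteq> 0" using row_quotient_Re_pos[OF assms] by force
  then show ?thesis
    using su11_alpha_gt(2)[OF ab_norm[OF assms(1)]] l(2)[OF assms(1)]
    by (simp add: rowlog_def row_def exp_add field_simps)
qed

lemma rowlog_0: "rowlog e 0 = 0"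
  by (simp add: rowlog_def start l)

lemma continuous_rowlog:
  assumes "cmod e = 1"
  shows "continuous_on {0..T} (rowlog e)"
proof -
  have "continuous_on {0..T} \<alpha>" "continuous_on {0..T} \<beta>"
    using h by (auto simp: hcurve_def lip_on_continuous)
  moreover have "1 + e * cnj (\<beta> t) / \<alpha> t \<notin> \<real>\<^sub>\<le>\<^sub>0" if "t \<in> {0..T}" for t
    using row_quotient_Re_pos[OF that assms] by (auto simp: complex_nonpos_Reals_iff)
  ultimately show ?thesis unfolding rowlog_def
    using su11_alpha_gt(2)[OF ab_norm] by (intro continuous_intros l) auto
qed

lemma lip_on_rowlog:
  assumes e: "cmod e = 1"
  shows "lip_on {0..T} (rowlog e)"
proof (rule lip_on_continuous_log[OF continuous_rowlog[OF e] exp_rowlog[OF _ e]])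
  show "lip_on {0..T} (row e)"
    unfolding row_def using h
    by (intro lip_on_add lip_on_bounded_linear[OF bounded_linear_mult_right]
        lip_on_bounded_linear[OF bounded_linear_cnj]) (auto simp: hcurve_def)
qed

lemma rowlog_derivative:
  assumes e: "cmod e = 1"
  shows "\<exists>N. negligible N \<and> (\<forall>t\<in>{0..<T} - N. \<exists>D.
    (rowlog e has_vector_derivative D) (at t within {t..T}) \<and> cmod D \<le> cmod (u t) / 2)"
proof -
  obtain N where N: "negligible N" and
    D: "\<And>t. t \<in> {0..<T} - N \<Longrightarrow> (\<alpha> has_vector_derivative of_real (- (-1 / 2)) * \<beta> t * cnj (u t)) (at t within {t..T})"
      "\<And>t. t \<in> {0..<T} - N \<Longrightarrow> (\<beta> has_vector_derivative (1 / 2) * \<alpha> t * u t) (at t within {t..T})"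
    using h unfolding hcurve_def by blast
  show ?thesis
  proof (intro exI[of _ N] conjI ballI N)
    fix t assume t: "t \<in> {0..<T} - N"
    have ee: "e * cnj e = 1" using e by (simp add: complex_norm_square[symmetric])
    let ?D = "1 / 2 * cnj (u t) * (e * cnj (row e t))"
    have "(row e has_vector_derivative of_real (- (-1 / 2)) * \<beta> t * cnj (u t) + e * cnj ((1 / 2) * \<alpha> t * u t)) (at t within {t..T})"
      unfolding row_def[abs_def]
      by (intro has_vector_derivative_add D t has_vector_derivative_mult_right
          bounded_linear.has_vector_derivative[OF bounded_linear_cnj])
    \<comment> \<open>The relation \<open>e * cnj e = 1\<close> turns the derivative into a multiple
      of \<open>cnj (row e t)\<close>, which has the modulus of the row itself; division by the row
      leaves \<open>cmod (u t) / 2\<close>.\<close>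
    also have "of_real (- (-1 / 2)) * \<beta> t * cnj (u t) + e * cnj ((1 / 2) * \<alpha> t * u t) = ?D"
    proof -
      have "?D = 1 / 2 * cnj (u t) * (e * cnj (\<alpha> t) + (e * cnj e) * \<beta> t)" by (simp add: row_def algebra_simps)
      then show ?thesis by (simp add: ee algebra_simps)
    qed
    finally have "(rowlog e has_vector_derivative ?D / row e t) (at t within {t..T})"
      by (intro continuous_log_right_derivative[OF continuous_rowlog[OF e] exp_rowlog[OF _ e]]) (use t in auto)
    moreover have "cmod (?D / row e t) \<le> cmod (u t) / 2"
      using e by (simp add: norm_mult norm_divide)
    ultimately show "\<exists>D. (rowlog e has_vector_derivative D) (at t within {t..T}) \<and> cmod D \<le> cmod (u t) / 2"
      by blast
  qed
qed

text \<open>A plane curve that starts at 0 is at least as long as the distance of its end point from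
  0.\<close>

lemma rowlog_le_length:
  assumes e: "cmod e = 1"
  shows "cmod (rowlog e T) \<le> hlength 0 T u / 2"
proof (cases "rowlog e T = 0")
  case True then show ?thesis by (simp add: hlength_nonneg)
next
  case False
  define z where "z = rowlog e T"
  \<comment> \<open>The unit factor that turns \<open>z\<close> to the positive real axis; only the
    growth of the real part after this turn is integrated.\<close>
  define \<omega> where "\<omega> = cnj z / cmod z"
  have \<omega>: "cmod \<omega> = 1" using False by (simp add: \<omega>_def z_def norm_divide)
  have bl: "bounded_linear (\<lambda>x. Re (\<omega> * x))"
    by (intro bounded_linear_compose[OF bounded_linear_Re] bounded_linear_mult_right)
  define f where "f t = Re (\<omega> * rowlog e t)" for t
  have "lip_on {0..T} f" unfolding f_def
    by (rule lip_on_bounded_linear[OF bl lip_on_rowlog[OF e]])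
  then obtain K where K: "K-lipschitz_on {0..T} f" by (auto simp: lip_on_def)
  obtain N where N: "negligible N" "\<And>t. t\<in>{0..<T} - N \<Longrightarrow> \<exists>D.
    (rowlog e has_vector_derivative D) (at t within {t..T}) \<and> cmod D \<le> cmod (u t) / 2"
    using rowlog_derivative[OF e] by auto
  have ui: "(\<lambda>t. cmod (u t)) integrable_on {0..T}" by (rule hcurve_speed[OF _ h]) simp
  have "f T - f 0 \<le> integral {0..T} (\<lambda>t. cmod (u t) / 2)"
  proof (rule lipschitz_increment_le[OF _ K N(1)])
    fix t assume t: "t \<in> {0..<T} - N"
    obtain D where D: "(rowlog e has_vector_derivative D) (at t within {t..T})" "cmod D \<le> cmod (u t) / 2"
      using N(2)[OF t] by blast
    have "(f has_vector_derivative Re (\<omega> * D)) (at t within {t..T})"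
      unfolding f_def[abs_def] by (rule bounded_linear.has_vector_derivative[OF bl D(1)])
    moreover have "Re (\<omega> * D) \<le> cmod (u t) / 2"
      using complex_Re_le_cmod[of "\<omega> * D"] D(2) \<omega> by (simp add: norm_mult)
    ultimately show "\<exists>D. (f has_vector_derivative D) (at t within {t..T}) \<and> D \<le> cmod (u t) / 2" by blast
  qed (use T ui in auto)
  moreover have "f T = cmod z"
    using False by (simp add: f_def \<omega>_def z_def[symmetric] complex_mult_cnj cmod_def power2_eq_square real_div_sqrt flip: complex_norm_square)
  ultimately show ?thesis by (simp add: f_def rowlog_0 z_def hlength_def)
qed

text \<open>A row angle loses at most \<open>cmod (u t) / 2\<close> per unit of time, while the
  rotation adds \<open>c * (cmod (u t) + d) / 2\<close>, and the difference is at least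
  \<open>\<eta> / 2\<close>. The increment estimate is applied to the negated angle.\<close>

lemma row_angle_increment:
  assumes e: "cmod e = 1" and \<eta>: "\<And>t. t \<in> {0..T} \<Longrightarrow> \<eta> \<le> c * (cmod (u t) + d) - cmod (u t)"
    and pq: "0 \<le> p" "p \<le> q" "q \<le> T"
  defines "\<theta> t \<equiv> Im (rowlog e t) + c * (hlength 0 t u + d * t) / 2"
  shows "\<eta> / 2 * (q - p) \<le> \<theta> q - \<theta> p"
proof -
  have k: "-1 = (1::real) \<or> -1 = (-1::real)" by simp
  define m where "m t = hlength 0 t u + d * t" for t
  have lm: "lip_on {0..T} m"
    unfolding m_def by (rule arclength_cis_derivative(1)[OF k h])
  obtain N1 where N1: "negligible N1" "\<And>t. t\<in>{0..<T} - N1 \<Longrightarrow> (m has_vector_derivative cmod (u t) + d) (at t within {t..T})"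
    using arclength_cis_derivative(3)[OF k h, where d = d and c = 0, folded m_def] by auto
  obtain N2 where N2: "negligible N2" "\<And>t. t\<in>{0..<T} - N2 \<Longrightarrow> \<exists>D.
    (rowlog e has_vector_derivative D) (at t within {t..T}) \<and> cmod D \<le> cmod (u t) / 2"
    using rowlog_derivative[OF e] by auto
  define g where "g t = - Im (rowlog e t) + (- (c / 2)) * m t" for t
  have "lip_on {0..T} (\<lambda>t. - Im (rowlog e t) + (- (c / 2)) * m t)"
    by (intro lip_on_add lip_on_bounded_linear[OF bounded_linear_mult_right] lm
        lip_on_bounded_linear[OF bounded_linear_minus[OF bounded_linear_Im]] lip_on_rowlog e)
  then have "lip_on {p..q} g" unfolding g_def using pq by (elim lip_on_subset) auto
  then obtain K where K: "K-lipschitz_on {p..q} g" by (auto simp: lip_on_def)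
  have "g q - g p \<le> integral {p..q} (\<lambda>t. - (\<eta> / 2))"
  proof (rule lipschitz_increment_le[OF pq(2) K negligible_Un[OF N1(1) N2(1)]])
    fix t assume t: "t \<in> {p..<q} - (N1 \<union> N2)"
    then have t1: "t \<in> {0..<T} - N1" and t2: "t \<in> {0..<T} - N2" using pq by auto
    obtain D where D: "(rowlog e has_vector_derivative D) (at t within {t..T})" "cmod D \<le> cmod (u t) / 2"
      using N2(2)[OF t2] by blast
    have "(g has_vector_derivative - Im D + (- (c / 2)) * (cmod (u t) + d)) (at t within {t..T})"
      unfolding g_def[abs_def]
      by (intro has_vector_derivative_add has_vector_derivative_mult_right N1(2) t1
          bounded_linear.has_vector_derivative[OF bounded_linear_minus[OF bounded_linear_Im]] D)
    then have "(g has_vector_derivative - Im D + (- (c / 2)) * (cmod (u t) + d)) (at t within {t..q})"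
      by (rule has_vector_derivative_within_subset) (use pq in auto)
    moreover have "- Im D + (- (c / 2)) * (cmod (u t) + d) \<le> - (\<eta> / 2)"
      using abs_Im_le_cmod[of D] D(2) \<eta>[of t] t pq by (simp add: algebra_simps)
    ultimately show "\<exists>D. (g has_vector_derivative D) (at t within {t..q}) \<and> D \<le> - (\<eta> / 2)" by blast
  qed auto
  then show ?thesis using pq by (simp add: g_def \<theta>_def m_def algebra_simps add_divide_distrib)
qed


text \<open>Every rotated row starts at angle 0 and turns strictly forward; if none ends beyond
  \<open>pi\<close>, all have positive imaginary part in between. Taking the row in which
  \<open>\<beta>\<close> counts most negatively gives \<open>cmod (\<beta> t) < Im A\<close>, and
  this is the timelike condition \<open>(Re A)\<^sup>2 < 1\<close> on the branch with
  \<open>Im A > 0\<close>, where \<open>A\<close> is the rotated \<open>\<alpha> t\<close>.\<close>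

lemma row_angle_bounds:
  assumes \<eta>: "\<And>t. t \<in> {0..T} \<Longrightarrow> \<eta> \<le> c * (cmod (u t) + d) - cmod (u t)" "0 < \<eta>"
  defines "m t \<equiv> hlength 0 t u + d * t"
  assumes end1: "Im (l T) + c * m T / 2 \<le> pi"
    and end2: "0 < Im (l T) + c * m T / 2 \<Longrightarrow> cmod (\<beta> T) \<le> Im (\<alpha> T * cis (c * m T / 2))"
  shows "\<And>t. t \<in> {0<..<T} \<Longrightarrow> cmod (\<beta> t) < Im (\<alpha> t * cis (c * m t / 2))"
    and "0 < Im (l T) + c * m T / 2"
proof -
  define \<theta> where "\<theta> e t = Im (rowlog e t) + c * m t / 2" for e t
  have mono: "\<eta> / 2 * (q - p) \<le> \<theta> e q - \<theta> e p" if "cmod e = 1" "0 \<le> p" "p \<le> q" "q \<le> T" for e p q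
    using row_angle_increment[OF that(1) \<eta>(1) that(2-4)] by (simp add: \<theta>_def m_def)
  have th0: "\<theta> e 0 = 0" for e by (simp add: \<theta>_def rowlog_0 m_def hlength_def)
  have strict: "\<theta> e p < \<theta> e q" if "cmod e = 1" "0 \<le> p" "p < q" "q \<le> T" for e p q
  proof -
    have "0 < \<eta> / 2 * (q - p)" using \<eta>(2) that by simp
    then show ?thesis using mono[of e p q] that by simp
  qed
  have rot: "Im ((\<alpha> t + e * cnj (\<beta> t)) * cis (c * m t / 2)) = exp (Re (rowlog e t)) * sin (\<theta> e t)"
    if "cmod e = 1" "t \<in> {0..T}" for e t
  proof -
    have "(\<alpha> t + e * cnj (\<beta> t)) * cis (c * m t / 2) = exp (rowlog e t + \<i> * (c * m t / 2))"
      using exp_rowlog[OF that(2,1)] by (simp add: exp_add row_def cis_conv_exp)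
    then show ?thesis by (simp add: Im_exp \<theta>_def)
  qed
  have phase: "\<exists>e. cmod e = 1 \<and> e * w = r * cmod w" if "cmod r = 1" for w r :: complex
  proof (cases "w = 0")
    case True then show ?thesis by (intro exI[of _ 1]) auto
  next
    case False
    then show ?thesis using that
      by (intro exI[of _ "r * cmod w / w"]) (auto simp: norm_mult norm_divide)
  qed
  have Tin: "T \<in> {0..T}" using T by simp
  show pos: "0 < Im (l T) + c * m T / 2"
  proof -
    \<comment> \<open>The row aligned with \<open>\<alpha> T\<close> has the same argument, so its
      angle is the phase of \<open>\<alpha> T\<close>.\<close>
    obtain e where e: "cmod e = 1" "e * (cnj (\<beta> T) / \<alpha> T) = 1 * cmod (cnj (\<beta> T) / \<alpha> T)"
      using phase[of 1 "cnj (\<beta> T) / \<alpha> T"] by auto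
    have "Ln (1 + e * cnj (\<beta> T) / \<alpha> T) = of_real (ln (1 + cmod (cnj (\<beta> T) / \<alpha> T)))"
      using e(2) by (subst Ln_of_real[symmetric]) (auto simp: add_pos_nonneg)
    then have "\<theta> e T = Im (l T) + c * m T / 2" by (simp add: \<theta>_def rowlog_def)
    moreover have "\<theta> e 0 < \<theta> e T" by (rule strict) (use e T in auto)
    ultimately show ?thesis by (simp add: th0)
  qed
  \<comment> \<open>A row differs from \<open>\<alpha> T\<close> by less than a right angle, so an
    angle above \<open>pi\<close> would still lie below \<open>3 * pi / 2\<close> and have a
    negative sine, against \<open>end2\<close>.\<close>
  have le_pi: "\<theta> e T \<le> pi" if e: "cmod e = 1" for e
  proof (rule ccontr)
    assume gt: "\<not> ?thesis"
    have "0 < Re (1 + e * cnj (\<beta> T) / \<alpha> T)" by (rule row_quotient_Re_pos[OF Tin e])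
    then have "\<bar>Im (Ln (1 + e * cnj (\<beta> T) / \<alpha> T))\<bar> < pi / 2"
      using Re_Ln_pos_lt[of "1 + e * cnj (\<beta> T) / \<alpha> T"] by fastforce
    then have "\<theta> e T < pi + pi / 2" using end1 by (simp add: \<theta>_def rowlog_def)
    then have "sin (\<theta> e T) < 0" using gt pi_gt_zero by (intro sin_lt_zero) auto
    then have "Im ((\<alpha> T + e * cnj (\<beta> T)) * cis (c * m T / 2)) < 0"
      unfolding rot[OF e Tin] by (intro mult_pos_neg) auto
    moreover have "\<bar>Im (e * cnj (\<beta> T) * cis (c * m T / 2))\<bar> \<le> cmod (\<beta> T)"
      using abs_Im_le_cmod[of "e * cnj (\<beta> T) * cis (c * m T / 2)"] e by (simp add: norm_mult)
    ultimately show False using end2[OF pos] unfolding distrib_right plus_complex.sel by linarith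
  qed
  show "cmod (\<beta> t) < Im (\<alpha> t * cis (c * m t / 2))" if t: "t \<in> {0<..<T}" for t
  proof -
    \<comment> \<open>This \<open>e\<close> makes the \<open>\<beta>\<close> term equal to
      \<open>- \<i> * cmod (\<beta> t)\<close>, the worst case for the imaginary part.\<close>
    obtain e where e: "cmod e = 1" "e * (cnj (\<beta> t) * cis (c * m t / 2)) = - \<i> * cmod (cnj (\<beta> t) * cis (c * m t / 2))"
      using phase[of "- \<i>"] by auto
    have "\<theta> e 0 < \<theta> e t" "\<theta> e t < \<theta> e T" using t e by (auto intro!: strict)
    with le_pi[OF e(1)] have "0 < sin (\<theta> e t)" by (intro sin_gt_zero) (auto simp: th0)
    then have "0 < Im ((\<alpha> t + e * cnj (\<beta> t)) * cis (c * m t / 2))"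
      by (subst rot[OF e(1)]) (use t in auto)
    moreover have "e * cnj (\<beta> t) * cis (c * m t / 2) = - \<i> * cmod (\<beta> t)"
      using e(2) by (simp add: norm_mult mult.assoc)
    ultimately show ?thesis unfolding distrib_right plus_complex.sel by simp
  qed
qed

text \<open>
  Multiplying by the one-parameter group of \<open>k\<close> now gives a timelike curve of anti-de Sitter space.
  As the rows turn by at most \<open>\<pi>\<close>, it stays in the region where the Lorentzian distance from the
  identity is \<open>arccos (Re A)\<close>, and that distance grows at least as fast as proper time.
\<close>

lemma su11_angle_ge:
  assumes c: "1 < c" and d: "0 \<le> d"
    and \<eta>: "\<And>t. t \<in> {0..T} \<Longrightarrow> \<eta> \<le> c * (cmod (u t) + d) - cmod (u t)" "0 < \<eta>"
  defines "m t \<equiv> hlength 0 t u + d * t"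
  defines "f t \<equiv> Re (\<alpha> t * cis (c * m t / 2))"
  assumes end1: "Im (l T) + c * m T / 2 \<le> pi"
    and end2: "0 < Im (l T) + c * m T / 2 \<Longrightarrow> cmod (\<beta> T) \<le> Im (\<alpha> T * cis (c * m T / 2))"
  shows "\<And>p q. 0 \<le> p \<Longrightarrow> p \<le> q \<Longrightarrow> q \<le> T \<Longrightarrow>
      1 / 2 * (sqrt (c\<^sup>2 - 1) * hlength p q u + c * d * (q - p)) \<le> arccos (f q) - arccos (f p)"
    and "\<And>t. t \<in> {0..T} \<Longrightarrow> f t \<in> {-1..1}"
proof -
  have k: "-1 = (1::real) \<or> -1 = (-1::real)" by simp
  define A where "A t = \<alpha> t * cis (c * m t / 2)" for t
  have fA: "f t = Re (A t)" for t by (simp add: f_def A_def)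
  define s where "s = sqrt (c\<^sup>2 - 1)"
  have s0: "0 \<le> s" "s\<^sup>2 = c\<^sup>2 - 1" using c by (auto simp: s_def)
  note F2 = arclength_cis_derivative(2)[OF k h, where c = c and d = d, folded m_def, folded A_def]
  note F3 = arclength_cis_derivative(3)[OF k h, where c = c and d = d, folded m_def, folded A_def]
  obtain N where N: "negligible N" and D: "\<And>t. t\<in>{0..<T} - N \<Longrightarrow>
       (A has_vector_derivative
         (of_real (- (- 1 / 2)) * (\<beta> t * cis (c * m t / 2)) * cnj (u t) + of_real (c * (cmod (u t) + d) / 2) * \<i> * A t))
       (at t within {t..T})"
    using F3 by auto
  have lf: "lip_on {0..T} f" unfolding fA[abs_def] by (rule lip_on_bounded_linear[OF bounded_linear_Re F2])
  have ui: "(\<lambda>t. cmod (u t)) integrable_on {0..T}" by (rule hcurve_speed[OF _ h]) simp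
  have R: "cmod (\<beta> t) < Im (A t)" if "t \<in> {0<..<T}" for t
    using that unfolding A_def m_def
    by (intro row_angle_bounds(1)[where \<eta> = \<eta> and c = c and d = d])
       (use \<eta> end1 end2 in \<open>auto simp: m_def\<close>)
  have n: "1 - (f t)\<^sup>2 = (Im (A t))\<^sup>2 - (cmod (\<beta> t))\<^sup>2" if "t \<in> {0..T}" for t
  proof -
    have "(cmod (A t))\<^sup>2 - (cmod (\<beta> t))\<^sup>2 = 1"
      using ab_norm[OF that] by (simp add: A_def norm_mult)
    then show ?thesis by (simp add: fA cmod_power2)
  qed
  have f1: "\<bar>f t\<bar> < 1" if t: "t \<in> {0<..<T}" for t
  proof -
    have "(cmod (\<beta> t))\<^sup>2 < (Im (A t))\<^sup>2" using R[OF t] by (intro power_strict_mono) auto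
    then have "(f t)\<^sup>2 < 1" using n[of t] t by auto
    then show ?thesis by (simp add: abs_square_less_1)
  qed
  define \<Phi> where "\<Phi> t = arccos (f t) - 1 / 2 * (s * hlength 0 t u + c * d * t)" for t
  \<comment> \<open>On a compact part of the open interval \<open>|f|\<close> stays below some
    \<open>r < 1\<close>, where \<open>arccos\<close> is Lipschitz; the two end points are added by
    continuity afterwards.\<close>
  have inner: "\<Phi> p \<le> \<Phi> q" if pq: "0 < p" "p \<le> q" "q < T" for p q
  proof -
    have sub: "{p..q} \<subseteq> {0<..<T}" using pq by auto
    have cf: "continuous_on {p..q} (\<lambda>t. \<bar>f t\<bar>)"
      by (intro continuous_intros lip_on_continuous lip_on_subset[OF lf]) (use pq in auto)
    obtain t0 where t0: "t0 \<in> {p..q}" "\<And>t. t \<in> {p..q} \<Longrightarrow> \<bar>f t\<bar> \<le> \<bar>f t0\<bar>"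
      using continuous_attains_sup[OF compact_Icc _ cf] pq by auto
    define r where "r = \<bar>f t0\<bar>"
    have r: "0 \<le> r" "r < 1" using f1[of t0] t0 sub by (auto simp: r_def)
    have r2: "0 < 1 - r\<^sup>2" using r by (simp add: abs_square_less_1)
    have dac: "(arccos has_real_derivative - (1 / sqrt (1 - x\<^sup>2))) (at x within S)" if "\<bar>x\<bar> < 1" for x S
      using DERIV_arccos[of x] that by (auto intro: has_field_derivative_at_within simp: divide_inverse)
    have ac: "lip_on {-r..r} arccos"
    proof (rule lip_on_C1[of _ _ "\<lambda>x. - (1 / sqrt (1 - x\<^sup>2))" "1 / sqrt (1 - r\<^sup>2)"])
      fix x assume x: "x \<in> {-r..r}"
      then show "(arccos has_real_derivative - (1 / sqrt (1 - x\<^sup>2))) (at x within {-r..r})"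
        using r by (intro dac) auto
      have "x\<^sup>2 \<le> r\<^sup>2" using x r by (auto intro: power2_le_iff_abs_le[THEN iffD2] simp: abs_le_iff)
      then have "sqrt (1 - r\<^sup>2) \<le> sqrt (1 - x\<^sup>2)" "0 < sqrt (1 - r\<^sup>2)" using r2 by auto
      then show "\<bar>- (1 / sqrt (1 - x\<^sup>2))\<bar> \<le> 1 / sqrt (1 - r\<^sup>2)" by (auto simp: frac_le)
    qed (use r2 in auto)
    have rng: "f ` {p..q} \<subseteq> {-r..r}" using t0(2) by (force simp: r_def abs_le_iff)
    have lfp: "lip_on {p..q} f" by (rule lip_on_subset[OF lf]) (use pq in auto)
    have "lip_on {p..q} (\<lambda>t. arccos (f t))" by (rule lip_on_compose[OF lfp rng ac])
    then have "lip_on {p..q} (\<lambda>t. - arccos (f t))"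
      by (rule lip_on_bounded_linear[OF bounded_linear_minus[OF bounded_linear_ident]])
    then obtain K where K: "K-lipschitz_on {p..q} (\<lambda>t. - arccos (f t))" by (auto simp: lip_on_def)
    define g where "g t = - (1 / 2) * (s * cmod (u t) + c * d)" for t
    have I: "(g has_integral - (1 / 2) * (s * hlength p q u + (q - p) * (c * d))) {p..q}"
      unfolding hlength_def g_def[abs_def]
      using pq has_integral_const_real[of "c * d" p q] integrable_on_subinterval[OF ui, of p q]
      by (intro has_integral_mult_right has_integral_add integrable_integral) auto
    have "- arccos (f q) - - arccos (f p) \<le> integral {p..q} g"
    proof (rule lipschitz_increment_le[OF pq(2) K N _ has_integral_integrable[OF I]])
      fix t assume t: "t \<in> {p..<q} - N"
      let ?z = "\<beta> t * cis (c * m t / 2) * cnj (u t)"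
      let ?D = "Re (of_real (- (- 1 / 2)) * (\<beta> t * cis (c * m t / 2)) * cnj (u t) + of_real (c * (cmod (u t) + d) / 2) * \<i> * A t)"
      have "(A has_vector_derivative
         (of_real (- (- 1 / 2)) * (\<beta> t * cis (c * m t / 2)) * cnj (u t) + of_real (c * (cmod (u t) + d) / 2) * \<i> * A t))
       (at t within {t..q})"
        by (rule has_vector_derivative_within_subset[OF D]) (use t pq in auto)
      then have d1: "(f has_vector_derivative ?D) (at t within {t..q})"
        unfolding fA[abs_def] by (rule bounded_linear.has_vector_derivative[OF bounded_linear_Re])
      have ft: "\<bar>f t\<bar> < 1" using t pq by (intro f1) auto
      have "((arccos \<circ> f) has_vector_derivative (?D * - (1 / sqrt (1 - (f t)\<^sup>2)))) (at t within {t..q})"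
        by (rule field_vector_diff_chain_within[OF d1]) (rule dac[OF ft])
      then have d2: "((\<lambda>t. - arccos (f t)) has_vector_derivative - (?D * - (1 / sqrt (1 - (f t)\<^sup>2)))) (at t within {t..q})"
        unfolding o_def by (rule has_vector_derivative_minus)
      define R' where "R' = sqrt (1 - (f t)\<^sup>2)"
      have R'0: "0 < R'" using ft by (simp add: R'_def abs_square_less_1)
      have It: "cmod (\<beta> t) < Im (A t)" using t pq by (intro R) auto
      have R'2: "R'\<^sup>2 = (Im (A t))\<^sup>2 - (cmod (\<beta> t))\<^sup>2" 
      proof -
        have "R'\<^sup>2 = 1 - (f t)\<^sup>2" unfolding R'_def using ft
          by (intro real_sqrt_pow2) (simp add: abs_square_le_1)
        also have "\<dots> = (Im (A t))\<^sup>2 - (cmod (\<beta> t))\<^sup>2" by (rule n) (use t pq in auto)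
        finally show ?thesis .
      qed
      have IR: "R' \<le> Im (A t)"
      proof (rule power2_le_imp_le)
        show "R'\<^sup>2 \<le> (Im (A t))\<^sup>2" by (simp add: R'2)
        show "0 \<le> Im (A t)" using It norm_ge_zero[of "\<beta> t"] by linarith
      qed
      \<comment> \<open>Reverse Cauchy-Schwarz for the timelike vectors \<open>(c, 1)\<close> and
        \<open>(Im (A t), cmod (\<beta> t))\<close>; the defect is the square
        \<open>(Im (A t) - c * cmod (\<beta> t))\<^sup>2\<close>.\<close>
      have cs: "s * R' \<le> c * Im (A t) - cmod (\<beta> t)"
      proof (rule power2_le_imp_le)
        have "(c * Im (A t) - cmod (\<beta> t))\<^sup>2 - (c\<^sup>2 - 1) * ((Im (A t))\<^sup>2 - (cmod (\<beta> t))\<^sup>2)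
           = (Im (A t) - c * cmod (\<beta> t))\<^sup>2"
          by (simp add: power2_eq_square algebra_simps)
        then show "(s * R')\<^sup>2 \<le> (c * Im (A t) - cmod (\<beta> t))\<^sup>2"
          unfolding power_mult_distrib R'2 s0(2) using zero_le_power2[of "Im (A t) - c * cmod (\<beta> t)"] by linarith
        have "1 * Im (A t) \<le> c * Im (A t)" 
          using c It norm_ge_zero[of "\<beta> t"] by (intro mult_right_mono) linarith+
        then show "0 \<le> c * Im (A t) - cmod (\<beta> t)" using It by simp
      qed
      have "Re ?z \<le> cmod ?z" by (rule complex_Re_le_cmod)
      then have z: "Re ?z \<le> cmod (\<beta> t) * cmod (u t)" by (simp add: norm_mult)
      have "?D = 1 / 2 * (Re ?z - c * (cmod (u t) + d) * Im (A t))"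
        by (simp add: field_simps)
      also have "\<dots> \<le> 1 / 2 * (cmod (\<beta> t) * cmod (u t) - c * (cmod (u t) + d) * Im (A t))"
        using z by simp
      also have "\<dots> = - (1 / 2) * (cmod (u t) * (c * Im (A t) - cmod (\<beta> t)) + c * d * Im (A t))"
        by (simp add: algebra_simps)
      also have "\<dots> \<le> - (1 / 2) * (cmod (u t) * (s * R') + c * d * R')"

      proof -
        have "cmod (u t) * (s * R') + c * d * R' \<le> cmod (u t) * (c * Im (A t) - cmod (\<beta> t)) + c * d * Im (A t)"
          using c d by (intro add_mono mult_left_mono[OF cs] mult_left_mono[OF IR]) auto
        then show ?thesis by simp
      qed
      also have "\<dots> = g t * R'" by (simp add: g_def algebra_simps)
      finally have "?D / R' \<le> g t" using R'0 by (simp add: pos_divide_le_eq)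
      then show "\<exists>D. ((\<lambda>t. - arccos (f t)) has_vector_derivative D) (at t within {t..q}) \<and> D \<le> g t"
        using d2 unfolding R'_def mult_minus_right minus_minus times_divide_eq_right mult_1_right by blast
    qed
    moreover have "hlength 0 p u + hlength p q u = hlength 0 q u"
      by (rule hlength_combine[OF k hcurve_subinterval[OF h]]) (use pq in auto)
    then have "hlength p q u = hlength 0 q u - hlength 0 p u" by simp
    ultimately show ?thesis using integral_unique[OF I] by (simp add: \<Phi>_def algebra_simps)
  qed
  show f1': "f t \<in> {-1..1}" if t: "t \<in> {0..T}" for t
  proof -
    have "f ` closure {0<..<T} \<subseteq> {-1..1}"
    proof (rule image_closure_subset)
      show "continuous_on (closure {0<..<T}) f" using T lip_on_continuous[OF lf] by simp
      show "f ` {0<..<T} \<subseteq> {-1..1}" using f1 by (force simp: abs_less_iff)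
    qed simp
    then have "f ` {0..T} \<subseteq> {-1..1}" using T by simp
    then show ?thesis using imageI[OF t, of f] by blast
  qed
  have c\<Phi>: "continuous_on {0..T} \<Phi>"
    unfolding \<Phi>_def
    by (intro continuous_intros continuous_on_compose2[OF continuous_on_arccos' lip_on_continuous[OF lf]]
        lip_on_continuous[OF hcurve_arclength(1)[OF k h]]) (use f1' in auto)
  fix p q assume pq: "0 \<le> p" "p \<le> q" "q \<le> T"
  have "\<Phi> p \<le> \<Phi> q"
  proof -
    \<comment> \<open>Moving a point a fraction \<open>\<epsilon>\<close> of the way towards
      \<open>T / 2\<close> brings it into the open interval and preserves the order of two
      points.\<close>
    have lim: "((\<lambda>\<epsilon>. \<Phi> ((1 - \<epsilon>) * x + \<epsilon> * (T / 2))) \<longlongrightarrow> \<Phi> x) (at_right 0)" if x: "x \<in> {0..T}" for x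
    proof -
      have "continuous_on {0..1} (\<lambda>\<epsilon>. \<Phi> ((1 - \<epsilon>) * x + \<epsilon> * (T / 2)))"
      proof (rule continuous_on_compose2[OF c\<Phi>])
        show "(\<lambda>\<epsilon>. (1 - \<epsilon>) * x + \<epsilon> * (T / 2)) ` {0..1} \<subseteq> {0..T}"
          using x T convex_bound_le[of x T "T / 2"] by (auto intro!: add_nonneg_nonneg)
      qed (intro continuous_intros)
      then have "((\<lambda>\<epsilon>. \<Phi> ((1 - \<epsilon>) * x + \<epsilon> * (T / 2))) \<longlongrightarrow> \<Phi> ((1 - 0) * x + 0 * (T / 2))) (at 0 within {0..1})"
        unfolding continuous_on_def by (rule bspec) simp
      then show ?thesis by (simp add: at_within_Icc_at_right)
    qed
    have lp: "((\<lambda>\<epsilon>. \<Phi> ((1 - \<epsilon>) * p + \<epsilon> * (T / 2))) \<longlongrightarrow> \<Phi> p) (at_right 0)"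
      by (rule lim) (use pq in auto)
    have lq: "((\<lambda>\<epsilon>. \<Phi> ((1 - \<epsilon>) * q + \<epsilon> * (T / 2))) \<longlongrightarrow> \<Phi> q) (at_right 0)"
      by (rule lim) (use pq in auto)
    show ?thesis
    proof (rule tendsto_le[OF _ lq lp])
      show "\<forall>\<^sub>F \<epsilon> in at_right 0. \<Phi> ((1 - \<epsilon>) * p + \<epsilon> * (T / 2)) \<le> \<Phi> ((1 - \<epsilon>) * q + \<epsilon> * (T / 2))"
        using eventually_at_right_real[of 0 "1::real"]
      proof (rule eventually_mono)
        fix \<epsilon> :: real assume \<epsilon>: "\<epsilon> \<in> {0<..<1}"
        have 1: "0 < (1 - \<epsilon>) * p + \<epsilon> * (T / 2)" using \<epsilon> pq T by (intro add_nonneg_pos) auto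
        have 2: "(1 - \<epsilon>) * p \<le> (1 - \<epsilon>) * q" using \<epsilon> pq by (intro mult_left_mono) auto
        have "(1 - \<epsilon>) * q \<le> (1 - \<epsilon>) * T" "\<epsilon> * (T / 2) < \<epsilon> * T"
          using \<epsilon> pq T by (auto intro: mult_left_mono)
        then have 3: "(1 - \<epsilon>) * q + \<epsilon> * (T / 2) < T" by (simp add: algebra_simps)
        show "\<Phi> ((1 - \<epsilon>) * p + \<epsilon> * (T / 2)) \<le> \<Phi> ((1 - \<epsilon>) * q + \<epsilon> * (T / 2))"
          by (rule inner[OF 1 _ 3]) (use 2 in simp)
      qed simp
    qed simp
  qed
  moreover have "hlength 0 p u + hlength p q u = hlength 0 q u"
    by (rule hlength_combine[OF k hcurve_subinterval[OF h]]) (use pq in auto)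
  then have dd: "hlength p q u = hlength 0 q u - hlength 0 p u" by simp
  ultimately show "1 / 2 * (sqrt (c\<^sup>2 - 1) * hlength p q u + c * d * (q - p)) \<le> arccos (f q) - arccos (f p)"
    unfolding dd \<Phi>_def s_def by (simp add: algebra_simps)
qed

text \<open>Time reverses the compact argument: the padding adds proper time at the rate
  \<open>c / 2\<close>, so a short competitor would accumulate more than the Lorentzian distance of
  its end point. The end conditions are inequalities in order to cover end points whose phase is
  below that of the geodesic. They are asked for only at a positive final phase, because
  \<open>row_angle_bounds\<close> shows that the phase of a short competitor is positive.\<close>

theorem su11_minimal_elliptic:
  assumes c: "1 < c" and t: "0 < t" "sqrt (c\<^sup>2 - 1) * t \<le> 2 * pi"
    and end1: "Im (l T) + c * t / 2 \<le> pi"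
    and end2: "0 < Im (l T) + c * t / 2 \<Longrightarrow> cmod (\<beta> T) \<le> Im (\<alpha> T * cis (c * t / 2))"
    and end3: "0 < Im (l T) + c * t / 2 \<Longrightarrow> cos (sqrt (c\<^sup>2 - 1) * t / 2) \<le> Re (\<alpha> T * cis (c * t / 2))"
  shows "t \<le> hlength 0 T u"
proof (rule ccontr)
  assume "\<not> ?thesis"
  define L where "L = hlength 0 T u"
  with \<open>\<not> ?thesis\<close> have L: "L < t" by simp
  define s where "s = sqrt (c\<^sup>2 - 1)"
  define d where "d = (t - L) / T"
  have s: "s < c" unfolding s_def using c by (intro real_less_lsqrt) auto
  have s0: "0 \<le> s" using c by (simp add: s_def)
  have dT: "d * T = t - L" using T by (simp add: d_def)
  have d0: "0 < d" using L T by (simp add: d_def)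
  have mT: "hlength 0 T u + d * T = t" by (simp add: dT L_def)
  have \<eta>: "c * d \<le> c * (cmod (u t) + d) - cmod (u t)" for t
    using c mult_right_mono[of 1 c "cmod (u t)"] by (simp add: algebra_simps)
  have cd: "0 < c * d" using c d0 by simp
  have pos: "0 < Im (l T) + c * t / 2"
    using row_angle_bounds(2)[OF \<eta> cd, unfolded mT, OF end1 end2] by simp
  have "1 / 2 * (s * hlength 0 T u + c * d * (T - 0)) \<le>
     arccos (Re (\<alpha> T * cis (c * (hlength 0 T u + d * T) / 2))) -
     arccos (Re (\<alpha> 0 * cis (c * (hlength 0 0 u + d * 0) / 2)))"
    unfolding s_def
    by (rule su11_angle_ge(1)[OF c less_imp_le[OF d0] \<eta> cd]) (use T end1 end2 in \<open>auto simp: mT\<close>)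
  moreover have "arccos (Re (\<alpha> T * cis (c * t / 2))) \<le> s * t / 2"
  proof -
    have 1: "cos (s * t / 2) \<le> Re (\<alpha> T * cis (c * t / 2))" using end3[OF pos] by (simp add: s_def)
    have "(Re (\<alpha> T * cis (c * t / 2)))\<^sup>2 + (Im (\<alpha> T * cis (c * t / 2)))\<^sup>2 = 1 + (cmod (\<beta> T))\<^sup>2"
      unfolding cmod_power2[symmetric] norm_mult using ab_norm[of T] T by simp
    moreover have "(cmod (\<beta> T))\<^sup>2 \<le> (Im (\<alpha> T * cis (c * t / 2)))\<^sup>2"
      using end2[OF pos] by (intro power_mono) auto
    ultimately have "(Re (\<alpha> T * cis (c * t / 2)))\<^sup>2 \<le> 1" by linarith
    then have "\<bar>Re (\<alpha> T * cis (c * t / 2))\<bar> \<le> 1" by (simp only: abs_square_le_1)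
    then have "arccos (Re (\<alpha> T * cis (c * t / 2))) \<le> arccos (cos (s * t / 2))"
      using 1 by (intro arccos_le_arccos) (auto simp: abs_le_iff)
    also have "\<dots> = s * t / 2" by (rule arccos_cos) (use t s0 in \<open>auto simp: s_def\<close>)
    finally show ?thesis .
  qed
  ultimately have "s * L + c * (d * T) \<le> s * t"
    unfolding mT by (simp add: start hlength_def L_def mult.assoc)
  then have "(c - s) * (t - L) \<le> 0" unfolding dT by (simp add: algebra_simps)
  with s L show False by (simp add: mult_le_0_iff)
qed

text \<open>For \<open>c \<le> 1\<close> a single row suffices. With
  \<open>e = w * Complex s (- c)\<close> the row logarithm of the geodesic is the straight segment
  from 0 to \<open>t / 2 * Complex s (- c)\<close>, of length \<open>t / 2\<close>. A competitor
  ends with the same real part and an imaginary part at least as negative, hence at least as far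
  from 0.\<close>

theorem su11_minimal_hyperbolic:
  assumes c: "0 \<le> c" "c \<le> 1" and w: "cmod w = 1" and t: "0 < t"
    and fin: "\<alpha> T = geoA (-1) c t" "\<beta> T = geoB (-1) c w t"
    and phase: "Im (l T) \<le> arccos (cosq ((c\<^sup>2 - 1) / 4) t / cmod (\<alpha> T)) - c * t / 2"
  shows "t \<le> hlength 0 T u"
proof -
  define y where "y = (c\<^sup>2 - 1) / 4"
  define C where "C = cosq y t"
  define S where "S = sinq y t"
  define s where "s = sqrt (1 - c\<^sup>2)"
  have c2: "c\<^sup>2 \<le> 1" using c by (simp add: power_le_one)
  have s2: "s\<^sup>2 = 1 - c\<^sup>2" "0 \<le> s" using c2 by (auto simp: s_def)
  have y0: "y \<le> 0" using c2 by (simp add: y_def)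
  have sy: "sqrt (- y) = s / 2"
  proof -
    have "- y = (1 - c\<^sup>2) / 4" by (simp add: y_def field_simps)
    then have "sqrt (- y) = sqrt ((1 - c\<^sup>2) / 4)" by (rule arg_cong)
    then show ?thesis by (simp only: s_def real_sqrt_divide real_sqrt_four)
  qed
  have E: "C + s / 2 * S = exp (s * t / 2)" and C1: "1 \<le> C" and S0: "0 \<le> S"
  proof -
    have "C + s / 2 * S = exp (s * t / 2) \<and> 1 \<le> C \<and> 0 \<le> S"
    proof (cases "y = 0")
      case True
      then have "s = 0" using sy by simp
      then show ?thesis using True t by (simp add: C_def S_def cosq_def sinq_def)
    next
      case False
      then have y: "y < 0" using y0 by simp
      then have sp: "0 < s" using sy by (metis half_gt_zero_iff neg_0_less_iff_less real_sqrt_gt_zero)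
      have "C = cosh (s * t / 2)" using y by (simp add: C_def cosq_def sy)
      moreover have "S = 2 * sinh (s * t / 2) / s" using y by (simp add: S_def sinq_def sy)
      moreover have "cosh (s * t / 2) + s / 2 * (2 * sinh (s * t / 2) / s) = exp (s * t / 2)"
        using sp by (simp add: cosh_def sinh_def field_simps)
      moreover have "1 \<le> cosh (s * t / 2)" by (rule cosh_real_ge_1)
      moreover have "0 \<le> 2 * sinh (s * t / 2) / s" using sp t by simp
      ultimately show ?thesis by (simp only:)
    qed
    then show "C + s / 2 * S = exp (s * t / 2)" "1 \<le> C" "0 \<le> S" by auto
  qed
  define a where "a = cmod (\<alpha> T)"
  define Z where "Z = Complex C (c / 2 * S)"
  have aT: "\<alpha> T = Z * cis (- (c * t / 2))" by (simp add: fin geoA_def Z_def C_def S_def y_def)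
  have aZ: "a = cmod Z" by (simp add: a_def aT norm_mult)
  have a0: "0 < a" using C1 unfolding aZ Z_def by (simp add: complex_eq_iff)
  \<comment> \<open>The argument of \<open>Z\<close>, so that the geodesic ends with phase
    \<open>\<phi> - c * t / 2\<close>, the bound imposed on \<open>Im (l T)\<close>.\<close>
  define \<phi> where "\<phi> = arccos (C / a)"
  have Ca: "C \<le> a" unfolding aZ using complex_Re_le_cmod[of Z] by (simp add: Z_def)
  have Zphi: "Z = of_real a * cis \<phi>"
  proof -
    have cos: "cos \<phi> = C / a" unfolding \<phi>_def using C1 Ca a0 by (intro cos_arccos) (auto simp: field_simps)
    have "sin \<phi> = sqrt (1 - (C / a)\<^sup>2)" unfolding \<phi>_def
      using C1 Ca a0 by (intro sin_arccos) (auto simp: field_simps)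
    also have "1 - (C / a)\<^sup>2 = (c / 2 * S / a)\<^sup>2"
    proof -
      have "a\<^sup>2 = C\<^sup>2 + (c / 2 * S)\<^sup>2" unfolding aZ by (simp add: Z_def cmod_power2)
      then have "1 - (C / a)\<^sup>2 = (c / 2 * S)\<^sup>2 / a\<^sup>2"
        using a0 by (simp add: power_divide divide_simps)
      then show ?thesis by (simp add: power_divide)
    qed
    also have "sqrt ((c / 2 * S / a)\<^sup>2) = c / 2 * S / a" using c S0 a0 by simp
    finally show ?thesis using cos a0 by (simp add: Z_def complex_eq_iff)
  qed
  have phi: "0 \<le> \<phi>" "\<phi> \<le> pi" unfolding \<phi>_def using C1 Ca a0 by (auto intro!: arccos_lbound arccos_ubound simp: field_simps)
  have phipi: "\<phi> < pi"
  proof (rule ccontr)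
    assume "\<not> \<phi> < pi"
    then have "\<phi> = pi" using phi by simp
    then have "Re Z < 0" using a0 by (simp add: Zphi)
    then show False using C1 by (simp add: Z_def)
  qed
  define e where "e = w * Complex s (- c)"
  have e1: "cmod e = 1" 
  proof -
    have "cmod (Complex s (- c)) = 1" using s2 by (simp add: cmod_def)
    then show ?thesis by (simp only: e_def norm_mult w mult_1)
  qed
  define X where "X = exp (s * t / 2)"
  have X0: "0 < X" by (simp add: X_def)
  have rT: "row e T = X * cis (- (c * t / 2))"
  proof -
    have ww: "w * cnj w = 1" using w by (simp add: complex_norm_square[symmetric])
    have "row e T = (Z + (w * cnj w) * Complex s (- c) * of_real (S / 2)) * cis (- (c * t / 2))"
      by (simp add: row_def aT e_def fin(2) geoB_def cis_cnj S_def y_def algebra_simps)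
    also have "Z + (w * cnj w) * Complex s (- c) * of_real (S / 2) = of_real (C + s / 2 * S)"
      unfolding ww by (simp add: Z_def complex_eq_iff)
    finally show ?thesis by (simp only: E X_def)
  qed
  have Tin: "T \<in> {0..T}" using T by simp
  have "1 + e * cnj (\<beta> T) / \<alpha> T = row e T / \<alpha> T"
    using su11_alpha_gt(2)[OF ab_norm[OF Tin]] by (simp add: row_def field_simps)
  also have "\<dots> = of_real (X / a) * cis (- \<phi>)"
    unfolding rT aT Zphi using a0 by (simp add: field_simps cis_mult)
  also have "\<dots> = exp (Complex (ln (X / a)) (- \<phi>))"
    using X0 a0 by (simp add: exp_eq_polar)
  finally have "Ln (1 + e * cnj (\<beta> T) / \<alpha> T) = Complex (ln (X / a)) (- \<phi>)"
    using phi phipi by (simp add: Ln_exp)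
  then have "Im (rowlog e T) = Im (l T) - \<phi>" by (simp add: rowlog_def)
  then have im: "Im (rowlog e T) \<le> - (c * t / 2)"
    using phase by (simp add: \<phi>_def C_def y_def a_def)
  have "exp (Re (rowlog e T)) = cmod (row e T)" using exp_rowlog[OF Tin e1] by (metis norm_exp_eq_Re)
  also have "\<dots> = exp (s * t / 2)" using X0 by (simp add: rT norm_mult X_def)
  finally have re: "Re (rowlog e T) = s * t / 2" by simp
  have "(t / 2)\<^sup>2 \<le> (cmod (rowlog e T))\<^sup>2"
  proof -
    have "(s * t / 2)\<^sup>2 + (c * t / 2)\<^sup>2 = (s\<^sup>2 + c\<^sup>2) * (t / 2)\<^sup>2"
      by (simp add: power_mult_distrib power_divide field_simps)
    then have "(t / 2)\<^sup>2 = (s * t / 2)\<^sup>2 + (c * t / 2)\<^sup>2" using s2 by simp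
    moreover have "(c * t / 2)\<^sup>2 \<le> (Im (rowlog e T))\<^sup>2"

    proof -
      have "(c * t / 2)\<^sup>2 \<le> (- Im (rowlog e T))\<^sup>2" using im c t by (intro power_mono) auto
      then show ?thesis by simp
    qed
    ultimately show ?thesis unfolding cmod_power2 re by linarith
  qed
  then have "t / 2 \<le> cmod (rowlog e T)" by (rule power2_le_imp_le) simp
  then show ?thesis using rowlog_le_length[OF e1] by simp
qed

end

section \<open>Existence and uniqueness of minimizing geodesics\<close>

lemma sin_div_strict_antimono:
  fixes x y :: real
  assumes "0 < x" "x < y" "y \<le> pi"
  shows "sin y / y < sin x / x"
proof (rule DERIV_neg_imp_decreasing[OF assms(2)])
  fix z assume z: "x \<le> z" "z \<le> y"
  have pos: "0 < sin z - z * cos z"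
  proof -
    have "sin 0 - 0 * cos 0 < sin z - z * cos z"
    proof (rule DERIV_pos_imp_increasing_open[of 0 z])
      show "0 < z" using assms z by simp
      fix v assume v: "0 < v" "v < z"
      have "((\<lambda>v. sin v - v * cos v) has_real_derivative v * sin v) (at v)"
        by (auto intro!: derivative_eq_intros)
      moreover have "0 < v * sin v" using v z assms by (intro mult_pos_pos sin_gt_zero) auto
      ultimately show "\<exists>y. ((\<lambda>v. sin v - v * cos v) has_real_derivative y) (at v) \<and> 0 < y" by blast
    qed (intro continuous_intros)
    then show ?thesis by simp
  qed
  have "((\<lambda>v. sin v / v) has_real_derivative (cos z * z - sin z * 1) / (z * z)) (at z)"
    using z assms by (auto intro!: derivative_eq_intros)
  moreover have "(cos z * z - sin z * 1) / (z * z) < 0"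
    using pos z assms by (intro divide_neg_pos) (auto simp: mult.commute)
  ultimately show "\<exists>l. ((\<lambda>v. sin v / v) has_real_derivative l) (at z) \<and> l < 0" by blast
qed

lemma sinh_div_strict_mono:
  fixes x y :: real
  assumes "0 < x" "x < y"
  shows "sinh x / x < sinh y / y"
proof (rule DERIV_pos_imp_increasing[OF assms(2)])
  fix z assume z: "x \<le> z" "z \<le> y"
  have pos: "0 < z * cosh z - sinh z"
  proof -
    have "0 * cosh 0 - sinh 0 < z * cosh z - sinh z"
    proof (rule DERIV_pos_imp_increasing_open[of 0 z])
      show "0 < z" using assms z by simp
      fix v assume v: "0 < v" "v < z"
      have "((\<lambda>v. v * cosh v - sinh v) has_real_derivative v * sinh v) (at v)"
        by (auto intro!: derivative_eq_intros)
      moreover have "0 < v * sinh v" using v by simp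
      ultimately show "\<exists>y. ((\<lambda>v. v * cosh v - sinh v) has_real_derivative y) (at v) \<and> 0 < y" by blast
    qed (intro continuous_intros)
    then show ?thesis by simp
  qed
  have "((\<lambda>v. sinh v / v) has_real_derivative (cosh z * z - sinh z * 1) / (z * z)) (at z)"
    using z assms by (auto intro!: derivative_eq_intros)
  moreover have "0 < (cosh z * z - sinh z * 1) / (z * z)"
    using pos z assms by (intro divide_pos_pos) (auto simp: mult.commute)
  ultimately show "\<exists>l. ((\<lambda>v. sinh v / v) has_real_derivative l) (at z) \<and> 0 < l" by blast
qed

lemma sin_less_self: "0 < x \<Longrightarrow> sin x < (x::real)"
proof -
  assume x: "0 < x"
  show "sin x < x"
  proof (cases "x \<le> pi")
    case True
    have "sin x / x < sin (x/2) / (x/2)" using x True by (intro sin_div_strict_antimono) auto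
    also have "\<dots> \<le> 1" using sin_x_le_x[of "x/2"] x by simp
    finally show ?thesis using x by simp
  next
    case False then show ?thesis using sin_le_one[of x] pi_gt3 by linarith
  qed
qed

lemma abs_sin_less_self: "0 < x \<Longrightarrow> \<bar>sin x\<bar> < (x::real)"
proof (cases "x \<le> pi")
  case True
  assume "0 < x"
  then show ?thesis using sin_less_self[of x] sin_ge_zero[of x] True by simp
next
  case False then show ?thesis using abs_sin_le_one[of x] pi_gt3 by linarith
qed

lemma self_less_sinh: "0 < x \<Longrightarrow> x < sinh (x::real)"
proof -
  assume x: "0 < x"
  have "sinh 0 - 0 < sinh x - x"
  proof (rule DERIV_pos_imp_increasing_open[OF x])
    fix v assume v: "0 < v" "v < x"
    have "((\<lambda>v. sinh v - v) has_real_derivative cosh v - 1) (at v)"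
      by (auto intro!: derivative_eq_intros)
    moreover have "0 < cosh v - 1"
      using v cosh_real_strict_mono[of 0 v] by simp
    ultimately show "\<exists>y. ((\<lambda>v. sinh v - v) has_real_derivative y) (at v) \<and> 0 < y" by blast
  qed (intro continuous_intros)
  then show ?thesis by simp
qed

text \<open>Since \<open>cmod \<beta>\<close> is \<open>|sinq y t| / 2\<close> along a geodesic,
  strict monotonicity lets the end point determine \<open>y\<close>, and so
  \<open>c\<^sup>2\<close>, as long as \<open>sqrt y * t\<close> does not pass \<open>pi\<close>.
  The value \<open>sinq 0 t = t\<close> separates the two signs of \<open>y\<close>.\<close>

lemma sinq_strict_antimono:
  assumes t: "0 < t" and y: "y1 < y2" "y2 \<le> 0 \<or> sqrt y2 * t \<le> pi"
  shows "sinq y2 t < sinq y1 t"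
proof -
  have pos: "sinq y t = t * (sin (sqrt y * t) / (sqrt y * t))" if "0 < y" for y
    using that t by (simp add: sinq_def)
  have neg: "sinq y t = t * (sinh (sqrt (- y) * t) / (sqrt (- y) * t))" if "y < 0" for y
    using that t by (simp add: sinq_def)
  have lt: "sinq y t < t" if "0 < y" for y
    using sin_less_self[of "sqrt y * t"] that t by (simp add: sinq_def pos_divide_less_eq mult.commute)
  have gt: "t < sinq y t" if "y < 0" for y
    using self_less_sinh[of "sqrt (- y) * t"] that t by (simp add: sinq_def pos_less_divide_eq mult.commute)
  have z: "sinq 0 t = t" by (simp add: sinq_def)
  consider "0 < y1" | "y1 \<le> 0" "0 < y2" | "y2 \<le> 0" by linarith
  then show ?thesis
  proof cases
    case 1
    then have "sqrt y1 * t < sqrt y2 * t" "0 < sqrt y1 * t" "sqrt y2 * t \<le> pi" "0 < y2" using y t by auto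
    then show ?thesis unfolding pos[OF 1] pos[OF \<open>0 < y2\<close>]
      by (intro mult_strict_left_mono sin_div_strict_antimono t)
  next
    case 2
    then show ?thesis using lt[of y2] gt[of y1] z by (cases "y1 = 0") auto
  next
    case 3
    show ?thesis
    proof (cases "y2 = 0")
      case True then show ?thesis using gt[of y1] y z by simp
    next
      case False
      then have *: "y2 < 0" "y1 < 0" using 3 y by auto
      then have "sqrt (- y2) * t < sqrt (- y1) * t" "0 < sqrt (- y2) * t" using y t by auto
      then show ?thesis unfolding neg[OF *(1)] neg[OF *(2)]
        by (intro mult_strict_left_mono sinh_div_strict_mono t)
    qed
  qed
qed

lemma sinq_inj:
  assumes "0 < t" "y1 \<le> 0 \<or> sqrt y1 * t \<le> pi" "y2 \<le> 0 \<or> sqrt y2 * t \<le> pi" "sinq y1 t = sinq y2 t"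
  shows "y1 = y2"
  using sinq_strict_antimono[OF assms(1)] assms by (metis linorder_neqE_linordered_idom less_irrefl)

lemma sinq_pos:
  assumes "0 < t" "y \<le> 0 \<or> sqrt y * t < pi"
  shows "0 < sinq y t"
proof -
  consider "y < 0" | "y = 0" | "0 < y" by linarith
  then show ?thesis
    by cases (use assms in \<open>auto simp: sinq_def intro!: divide_pos_pos sin_gt_zero\<close>)
qed

lemma complex_polar_upper:
  assumes "0 \<le> Im z" "z \<noteq> 0"
  shows "z = of_real (cmod z) * cis (arccos (Re z / cmod z))"
proof -
  have r: "0 < cmod z" using assms by simp
  have "\<bar>Re z / cmod z\<bar> \<le> 1" using abs_Re_le_cmod[of z] r by (simp add: abs_divide)
  then have b: "-1 \<le> Re z / cmod z" "Re z / cmod z \<le> 1" by (simp_all only: abs_le_iff) linarith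
  have "sin (arccos (Re z / cmod z)) = sqrt (1 - (Re z / cmod z)\<^sup>2)"
    by (intro sin_arccos b)
  also have "1 - (Re z / cmod z)\<^sup>2 = (Im z / cmod z)\<^sup>2"
  proof -
    have "(Im z)\<^sup>2 = (cmod z)\<^sup>2 - (Re z)\<^sup>2" by (simp add: cmod_power2)
    then show ?thesis using r by (simp add: power_divide diff_divide_distrib)
  qed
  finally have "sin (arccos (Re z / cmod z)) = Im z / cmod z" using assms r by simp
  moreover have "cos (arccos (Re z / cmod z)) = Re z / cmod z"
    by (intro cos_arccos b)
  ultimately show ?thesis using r by (simp add: complex_eq_iff)
qed

lemma geoA_cnj: "geoA \<kappa> (- c) t = cnj (geoA \<kappa> c t)"
  by (simp add: geoA_def cis_cnj complex_eq_iff)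

lemma geoB_cnj: "geoB \<kappa> (- c) (cnj w) t = cnj (geoB \<kappa> c w t)"
  by (simp add: geoB_def cis_cnj)

lemma geoB_surj:
  assumes "sinq ((c\<^sup>2 + \<kappa>) / 4) t = 2 * cmod \<beta>" "\<beta> \<noteq> 0"
  shows "\<exists>w. cmod w = 1 \<and> geoB \<kappa> c w t = \<beta>"
proof (intro exI conjI)
  let ?w = "\<beta> / (of_real (cmod \<beta>) * cis (c * t / 2))"
  show "cmod ?w = 1" using assms by (simp add: norm_divide norm_mult)
  show "geoB \<kappa> c ?w t = \<beta>" using assms by (simp add: geoB_def)
qed

lemma geoB_inj:
  assumes "sinq ((c\<^sup>2 + \<kappa>) / 4) t \<noteq> 0" "geoB \<kappa> c w t = geoB \<kappa> c w' t"
  shows "w = w'"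
  using assms by (simp add: geoB_def)

text \<open>The free parameter \<open>x\<close> is half the angle \<open>2 sqrt y t\<close> covered on the projected circle.\<close>

lemma geo_of_angle:
  fixes \<kappa> b x :: real
  assumes b: "0 < b" and x: "0 < x" "x < pi" and k: "\<kappa> * b\<^sup>2 \<le> (sin x)\<^sup>2" and k1: "\<kappa> * b\<^sup>2 < 1"
  defines "y \<equiv> (sin x / (2 * b))\<^sup>2"
  defines "t \<equiv> 2 * b * x / sin x"
  defines "c \<equiv> 2 * sqrt (y - \<kappa> / 4)"
  shows "0 \<le> c" "0 < t" "(c\<^sup>2 + \<kappa>) / 4 = y" "sqrt y * t = x" "0 < y"
    "sinq y t = 2 * b" "cosq y t = cos x"
    "geoA \<kappa> c t = of_real (sqrt (1 - \<kappa> * b\<^sup>2)) *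
       cis (arccos (cos x / sqrt (1 - \<kappa> * b\<^sup>2)) - x * sqrt (1 - \<kappa> * b\<^sup>2 / (sin x)\<^sup>2))"
proof -
  have s: "0 < sin x" using x by (intro sin_gt_zero)
  have y: "y = (sin x)\<^sup>2 / (4 * b\<^sup>2)" by (simp add: y_def power_divide power_mult_distrib)
  have yk: "0 \<le> y - \<kappa> / 4" unfolding y using k b by (simp add: field_simps)
  have sy: "sqrt y = sin x / (2 * b)" using s b by (simp add: y_def)
  show "0 \<le> c" using yk by (simp add: c_def)
  have t0: "0 < t" using s b x by (simp add: t_def)
  then show "0 < t" .
  have c2: "c\<^sup>2 = 4 * (y - \<kappa> / 4)" using yk by (simp add: c_def power_mult_distrib)
  \<comment> \<open>\<open>y\<close> and \<open>t\<close> solve \<open>sqrt y * t = x\<close> and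
    \<open>sinq y t = 2 * b\<close>, and \<open>c\<close> solves
    \<open>(c\<^sup>2 + \<kappa>) / 4 = y\<close>.\<close>
  show cy: "(c\<^sup>2 + \<kappa>) / 4 = y" unfolding c2 by simp
  show x': "sqrt y * t = x" using s b by (simp add: sy t_def)
  show y0: "0 < y" using s b by (simp add: y_def)
  have "sinq y t = sin (sqrt y * t) / sqrt y" using y0 by (simp add: sinq_def)
  then show sq: "sinq y t = 2 * b" unfolding x' unfolding sy using s b by simp
  show cq: "cosq y t = cos x" using y0 by (simp add: cosq_def x')
  define a where "a = sqrt (1 - \<kappa> * b\<^sup>2)"
  have a: "0 < a" "a\<^sup>2 = 1 - \<kappa> * b\<^sup>2" using k1 by (auto simp: a_def)
  define Z where "Z = Complex (cos x) (c * b)"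
  have Za: "cmod Z = a"
  proof -
    have "(cmod Z)\<^sup>2 = (cos x)\<^sup>2 + c\<^sup>2 * b\<^sup>2" by (simp add: Z_def cmod_power2 power_mult_distrib)
    also have "c\<^sup>2 * b\<^sup>2 = (sin x)\<^sup>2 - \<kappa> * b\<^sup>2" unfolding c2 y using b by (simp add: field_simps)
    finally have "(cmod Z)\<^sup>2 = a\<^sup>2" unfolding a(2) by (simp add: sin_squared_eq)
    then show ?thesis by (rule power2_eq_imp_eq) (use a in auto)
  qed
  have "Z = of_real (cmod Z) * cis (arccos (Re Z / cmod Z))"
    by (rule complex_polar_upper) (use \<open>0 \<le> c\<close> b Za a in \<open>auto simp: Z_def\<close>)
  then have Zp: "Z = of_real a * cis (arccos (cos x / a))" by (simp add: Za) (simp add: Z_def)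
  have ct: "c * t / 2 = x * sqrt (1 - \<kappa> * b\<^sup>2 / (sin x)\<^sup>2)"
  proof -
    have "1 - \<kappa> * b\<^sup>2 / (sin x)\<^sup>2 = (y - \<kappa> / 4) * (2 * b / sin x)\<^sup>2"
      unfolding y using s b by (simp add: field_simps power_mult_distrib power_divide)
    then have "sqrt (1 - \<kappa> * b\<^sup>2 / (sin x)\<^sup>2) = c / 2 * (2 * b / sin x)"
      using s b by (simp add: real_sqrt_mult c_def)
    then show ?thesis by (simp add: t_def)
  qed
  have "geoA \<kappa> c t = Z * cis (- (c * t / 2))"
    by (simp add: geoA_def cy sq cq Z_def)
  then show "geoA \<kappa> c t = of_real (sqrt (1 - \<kappa> * b\<^sup>2)) *
       cis (arccos (cos x / sqrt (1 - \<kappa> * b\<^sup>2)) - x * sqrt (1 - \<kappa> * b\<^sup>2 / (sin x)\<^sup>2))"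
    unfolding ct Zp a_def[symmetric] by (simp add: cis_mult)
qed

text \<open>With \<open>b = cmod \<beta>\<close> fixed, the angle \<open>x\<close> runs from
  \<open>arcsin b\<close> to \<open>pi - arcsin b\<close>. At both ends \<open>c = 0\<close>, and
  the phase of \<open>\<alpha>\<close> is 0 and \<open>pi\<close> respectively; the intermediate
  value theorem supplies the phases between, and conjugation the negative ones.\<close>

lemma su2_geodesic_exists:
  assumes n: "(cmod \<alpha>)\<^sup>2 + (cmod \<beta>)\<^sup>2 = 1" and nz: "\<alpha> \<noteq> 0" "\<beta> \<noteq> 0"
  obtains c w t where "cmod w = 1" "0 < t" "sqrt ((c\<^sup>2 + 1) / 4) * t < pi" "geoA 1 c t = \<alpha>" "geoB 1 c w t = \<beta>"
proof -
  define b where "b = cmod \<beta>"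
  define a where "a = sqrt (1 - 1 * b\<^sup>2)"
  have b: "0 < b" "b < 1"
  proof -
    show "0 < b" using nz by (simp add: b_def)
    have "0 < (cmod \<alpha>)\<^sup>2" using nz by simp
    then have "b\<^sup>2 < 1" using n unfolding b_def by linarith
    then show "b < 1" using \<open>0 < b\<close> by (simp add: abs_square_less_1)
  qed
  have aa: "a = cmod \<alpha>"
  proof -
    have "1 - 1 * b\<^sup>2 = (cmod \<alpha>)\<^sup>2" using n by (simp add: b_def)
    then show ?thesis by (simp add: a_def)
  qed
  have a0: "0 < a" using aa nz by simp
  have a2: "a\<^sup>2 = 1 - b\<^sup>2" using n by (simp add: aa b_def)
  have upper: "\<exists>c t. 0 < t \<and> sqrt ((c\<^sup>2 + 1) / 4) * t < pi \<and> sinq ((c\<^sup>2 + 1) / 4) t = 2 * b \<and> geoA 1 c t = of_real a * cis \<Phi>"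
    if \<Phi>: "0 \<le> \<Phi>" "\<Phi> \<le> pi" for \<Phi>
  proof -
    \<comment> \<open>The phase of \<open>geoA 1 c t\<close> according to
      \<open>geo_of_angle\<close>.\<close>
    define f where "f x = arccos (cos x / a) - x * sqrt (1 - 1 * b\<^sup>2 / (sin x)\<^sup>2)" for x
    define x0 where "x0 = arcsin b"
    have x0: "0 < x0" "x0 < pi / 2" "sin x0 = b" "cos x0 = a"
    proof -
      have "arcsin 0 < arcsin b" using b by (intro arcsin_less_arcsin) auto
      then show "0 < x0" by (simp add: x0_def)
      have "arcsin b < arcsin 1" using b by (intro arcsin_less_arcsin) auto
      then show "x0 < pi / 2" by (simp add: x0_def)
      show "sin x0 = b" "cos x0 = a" using b by (auto simp: x0_def cos_arcsin a_def)
    qed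
    have ge: "b \<le> sin x" if "x \<in> {x0..pi - x0}" for x
    proof (cases "x \<le> pi / 2")
      case True
      then have "sin x0 \<le> sin x" using that x0 by (intro sin_monotone_2pi_le) auto
      then show ?thesis by (simp add: x0)
    next
      case False
      then have "sin x0 \<le> sin (pi - x)" using that x0 by (intro sin_monotone_2pi_le) auto
      then show ?thesis by (simp add: x0)
    qed
    have cosle: "\<bar>cos x / a\<bar> \<le> 1" if "x \<in> {x0..pi - x0}" for x
    proof -
      have "b\<^sup>2 \<le> (sin x)\<^sup>2" using ge[OF that] b by (intro power_mono) auto
      then have "(cos x)\<^sup>2 \<le> a\<^sup>2" unfolding a2 by (simp add: cos_squared_eq)
      then have "\<bar>cos x\<bar> \<le> a" using a0 by (metis abs_le_square_iff abs_of_pos)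
      then show ?thesis using a0 by (simp add: abs_divide)
    qed
    have rng: "-1 \<le> cos x / a \<and> cos x / a \<le> 1" if "x \<in> {x0..pi - x0}" for x
      using abs_le_D1[OF cosle[OF that]] abs_le_D2[OF cosle[OF that]] by linarith
    have sn: "sin x \<noteq> 0" if "x \<in> {x0..pi - x0}" for x
      using ge[OF that] b by auto
    have cont: "continuous_on {x0..pi - x0} f" unfolding f_def
      by (intro continuous_intros continuous_on_compose2[OF continuous_on_arccos'])
         (use a0 rng sn in auto)
    have "f x0 \<le> \<Phi>" "\<Phi> \<le> f (pi - x0)" using x0 \<Phi> a0 b by (auto simp: f_def)
    then obtain x where x: "x0 \<le> x" "x \<le> pi - x0" "f x = \<Phi>"
      using IVT'[of f x0 \<Phi> "pi - x0"] cont x0 by force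
    have "b\<^sup>2 \<le> (sin x)\<^sup>2" using ge[of x] x b by (intro power_mono) auto
    moreover have "b\<^sup>2 < 1" using b by (simp add: power_less_one_iff)
    ultimately have k: "1 * b\<^sup>2 \<le> (sin x)\<^sup>2" "1 * b\<^sup>2 < 1" by auto
    have xx: "0 < x" "x < pi" using x x0 by auto
    note G = geo_of_angle[OF b(1) xx k]
    show ?thesis
      by (rule exI, rule exI[of _ "2 * b * x / sin x"], intro conjI G(2))
        (use G xx x(3) in \<open>auto simp: f_def a_def\<close>)
  qed
  have "\<exists>c t. 0 < t \<and> sqrt ((c\<^sup>2 + 1) / 4) * t < pi \<and> sinq ((c\<^sup>2 + 1) / 4) t = 2 * b \<and> geoA 1 c t = \<alpha>"
  proof (cases "0 \<le> Im \<alpha>")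
    case True
    have "0 \<le> arccos (Re \<alpha> / cmod \<alpha>)" "arccos (Re \<alpha> / cmod \<alpha>) \<le> pi"
      using abs_Re_le_cmod[of \<alpha>] nz by (auto intro!: arccos_lbound arccos_ubound simp: abs_le_iff field_simps)
    from upper[OF this] show ?thesis using complex_polar_upper[OF True nz(1)] by (simp add: aa)
  next
    case False
    then have i: "0 \<le> Im (cnj \<alpha>)" "cnj \<alpha> \<noteq> 0" using nz by auto
    have "0 \<le> arccos (Re (cnj \<alpha>) / cmod (cnj \<alpha>))" "arccos (Re (cnj \<alpha>) / cmod (cnj \<alpha>)) \<le> pi"
      using abs_Re_le_cmod[of \<alpha>] nz by (auto intro!: arccos_lbound arccos_ubound simp: abs_le_iff field_simps)
    from upper[OF this] obtain c t where "0 < t" "sqrt ((c\<^sup>2 + 1) / 4) * t < pi"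
      "sinq ((c\<^sup>2 + 1) / 4) t = 2 * b" "geoA 1 c t = cnj \<alpha>"
      using complex_polar_upper[OF i] by (auto simp: aa)
    then show ?thesis
      by (intro exI[of _ "- c"] exI[of _ t]) (simp add: geoA_cnj)
  qed
  then show thesis using geoB_surj[of _ 1 _ \<beta>] nz that by (metis b_def)
qed

text \<open>Three regimes meet at \<open>c = 1\<close>, where the phase is
  \<open>arccos (1 / a) - b\<close>: larger phases are found with \<open>c < 1\<close> and smaller
  ones with \<open>c > 1\<close>, each by the intermediate value theorem starting near the limit
  \<open>c \<rightarrow> 1\<close>. The other end is the phase 0 at \<open>c = 0\<close>, or an
  angle so close to \<open>pi\<close> that the phase drops below the prescribed one.\<close>

lemma su11_geodesic_exists:
  assumes b: "0 < b" and \<Phi>: "\<Phi> \<le> 0"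
  obtains c t where "0 \<le> c" "0 < t" "c \<le> 1 \<or> sqrt ((c\<^sup>2 - 1) / 4) * t < pi"
    "sinq ((c\<^sup>2 - 1) / 4) t = 2 * b" "geoA (-1) c t = of_real (sqrt (1 + b\<^sup>2)) * cis \<Phi>"
    "\<Phi> = arccos (cosq ((c\<^sup>2 - 1) / 4) t / sqrt (1 + b\<^sup>2)) - c * t / 2"
proof -
  define a where "a = sqrt (1 + b\<^sup>2)"
  have a: "1 < a" "a\<^sup>2 = 1 + b\<^sup>2" using b by (auto simp: a_def add_nonneg_nonneg)
  have "\<exists>c t. 0 \<le> c \<and> 0 < t \<and> (c \<le> 1 \<or> sqrt ((c\<^sup>2 - 1) / 4) * t < pi) \<and>
    sinq ((c\<^sup>2 - 1) / 4) t = 2 * b \<and> \<Phi> = arccos (cosq ((c\<^sup>2 - 1) / 4) t / a) - c * t / 2"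
  proof (cases "\<Phi> < arccos (1 / a) - b")
    case True
    define f where "f x = arccos (cos x / a) - x * sqrt (1 - (-1) * b\<^sup>2 / (sin x)\<^sup>2)" for x
    have "(f \<longlongrightarrow> arccos (cos 0 / a) - b) (at_right 0)"
    proof -
      have 1: "((\<lambda>x. cos x / a) \<longlongrightarrow> cos 0 / a) (at_right 0)"
        by (intro tendsto_intros) (use a in auto)
      have "continuous_on {-1..1} arccos" by (rule continuous_on_arccos')
      have i: "isCont arccos (cos 0 / a)" by (rule isCont_arccos) (use a in \<open>auto simp: field_simps\<close>)
      have 2: "((\<lambda>x. arccos (cos x / a)) \<longlongrightarrow> arccos (cos 0 / a)) (at_right 0)"
        by (rule isCont_tendsto_compose[OF i 1])
      have 3: "((\<lambda>x::real. x * sqrt (1 - (-1) * b\<^sup>2 / (sin x)\<^sup>2)) \<longlongrightarrow> b) (at_right 0)"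
      proof -
        have "((\<lambda>x::real. sin x / x) \<longlongrightarrow> 1) (at 0)" using DERIV_sin[of "0::real"] by (simp add: DERIV_def)
        then have "((\<lambda>x::real. sin x / x) \<longlongrightarrow> 1) (at_right 0)" by (rule tendsto_within_subset) simp
        from tendsto_inverse[OF this] have q: "((\<lambda>x::real. x / sin x) \<longlongrightarrow> 1) (at_right 0)" by simp
        have "((\<lambda>x. sqrt (x\<^sup>2 + b\<^sup>2 * (x / sin x)\<^sup>2)) \<longlongrightarrow> sqrt (0\<^sup>2 + b\<^sup>2 * 1\<^sup>2)) (at_right 0)"
          by (intro tendsto_intros q)
        then have "((\<lambda>x. sqrt (x\<^sup>2 + b\<^sup>2 * (x / sin x)\<^sup>2)) \<longlongrightarrow> b) (at_right 0)" using b by simp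
        moreover have "\<forall>\<^sub>F x in at_right 0. sqrt (x\<^sup>2 + b\<^sup>2 * (x / sin x)\<^sup>2) = x * sqrt (1 - (-1) * b\<^sup>2 / (sin x)\<^sup>2)"
          using eventually_at_right_real[of 0 "1::real"]
        proof (rule eventually_mono)
          fix x :: real assume x: "x \<in> {0<..<1}"
          have "x\<^sup>2 + b\<^sup>2 * (x / sin x)\<^sup>2 = x\<^sup>2 * (1 - (-1) * b\<^sup>2 / (sin x)\<^sup>2)"
            by (simp add: power_divide algebra_simps)
          then show "sqrt (x\<^sup>2 + b\<^sup>2 * (x / sin x)\<^sup>2) = x * sqrt (1 - (-1) * b\<^sup>2 / (sin x)\<^sup>2)"
            using x by (simp only: real_sqrt_mult real_sqrt_abs) simp
        qed simp
        ultimately show ?thesis by (rule Lim_transform_eventually)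
      qed
      show ?thesis unfolding f_def by (rule tendsto_diff[OF 2 3])
    qed
    then have "\<forall>\<^sub>F x in at_right 0. \<Phi> < f x"
      by (rule order_tendstoD) (use True in simp)
    moreover have "\<forall>\<^sub>F x in at_right 0. x \<in> {0<..<pi / 2}"
      by (rule eventually_at_right_real) simp
    ultimately have "\<forall>\<^sub>F x in at_right 0. \<Phi> < f x \<and> x \<in> {0<..<pi / 2}" by (rule eventually_conj)
    then obtain x0 where x0: "\<Phi> < f x0" "0 < x0" "x0 < pi / 2"
      using eventually_happens[of _ "at_right (0::real)"] by (auto simp: trivial_limit_at_right_real)
    \<comment> \<open>Small enough that \<open>pi / 2 * (b / \<delta>)\<close> is at least
      \<open>pi - \<Phi>\<close>; with \<open>sin x1 = \<delta>\<close> this brings the phase at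
      \<open>x1\<close> down to \<open>\<Phi>\<close> or below.\<close>
    define \<delta> where "\<delta> = min 1 (pi / 2 * b / (pi - \<Phi>))"
    have pf: "0 < pi - \<Phi>" using \<Phi> pi_gt_zero by linarith
    have \<delta>: "0 < \<delta>" "\<delta> \<le> 1" using b pf by (auto simp: \<delta>_def)
    define x1 where "x1 = pi - arcsin \<delta>"
    have x1: "pi / 2 \<le> x1" "x1 < pi" "sin x1 = \<delta>"
    proof -
      have "arcsin 0 < arcsin \<delta>" using \<delta> by (intro arcsin_less_arcsin) auto
      then show "x1 < pi" by (simp add: x1_def)
      show "pi / 2 \<le> x1" using arcsin_ubound[of \<delta>] \<delta> by (simp add: x1_def)
      show "sin x1 = \<delta>" using \<delta> by (simp add: x1_def)
    qed
    have fx1: "f x1 \<le> \<Phi>"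
    proof -
      have "b / \<delta> = sqrt (b\<^sup>2 / \<delta>\<^sup>2)" using b \<delta> by (simp add: real_sqrt_divide)
      also have "\<dots> \<le> sqrt (1 - (-1) * b\<^sup>2 / (sin x1)\<^sup>2)" by (simp add: x1)
      finally have 1: "b / \<delta> \<le> sqrt (1 - (-1) * b\<^sup>2 / (sin x1)\<^sup>2)" .
      have "pi - \<Phi> \<le> pi / 2 * (b / \<delta>)"
      proof -
        have "\<delta> \<le> pi / 2 * b / (pi - \<Phi>)" by (simp only: \<delta>_def min.cobounded2)
        then have "\<delta> * (pi - \<Phi>) \<le> pi / 2 * b" by (simp only: pos_le_divide_eq[OF pf])
        then show ?thesis using \<delta> by (simp add: field_simps)
      qed
      also have "\<dots> \<le> x1 * sqrt (1 - (-1) * b\<^sup>2 / (sin x1)\<^sup>2)"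
        using 1 x1 b \<delta> by (intro mult_mono) auto
      finally have "pi - \<Phi> \<le> x1 * sqrt (1 - (-1) * b\<^sup>2 / (sin x1)\<^sup>2)" .
      moreover have "arccos (cos x1 / a) \<le> pi"
      proof (rule arccos_ubound)
        show "-1 \<le> cos x1 / a" "cos x1 / a \<le> 1"
          using a cos_ge_minus_one[of x1] cos_le_one[of x1] by (simp_all add: pos_le_divide_eq pos_divide_le_eq del: cos_ge_minus_one cos_le_one)
      qed
      ultimately show ?thesis by (simp add: f_def)
    qed
    have rng: "-1 \<le> cos x / a \<and> cos x / a \<le> 1" for x
    proof -
      have "\<bar>cos x\<bar> \<le> a" using abs_cos_le_one[of x] a by linarith
      then have "\<bar>cos x / a\<bar> \<le> 1" using a by (simp add: abs_divide)
      then show ?thesis using abs_le_D1[of "cos x / a" 1] abs_le_D2[of "cos x / a" 1] by linarith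
    qed
    have sn: "sin x \<noteq> 0" if "x \<in> {x0..x1}" for x
      using sin_gt_zero[of x] that x0 x1 by auto
    have cont: "continuous_on {x0..x1} f" unfolding f_def
      by (intro continuous_intros continuous_on_compose2[OF continuous_on_arccos'])
         (use a rng sn in auto)
    obtain x where x: "x0 \<le> x" "x \<le> x1" "f x = \<Phi>"
      using IVT2'[of f x1 \<Phi> x0] cont fx1 x0 x1 by force
    have xx: "0 < x" "x < pi" using x x0 x1 by auto
    have k: "-1 * b\<^sup>2 \<le> (sin x)\<^sup>2" "-1 * b\<^sup>2 < 1"
      using zero_le_power2[of "sin x"] zero_le_power2[of b] by linarith+
    note G = geo_of_angle[OF b xx k]
    define y where "y = (sin x / (2 * b))\<^sup>2"
    define c where "c = 2 * sqrt (y - -1 / 4)"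
    define t where "t = 2 * b * x / sin x"
    note G = G[folded y_def, folded c_def t_def]
    have y: "(c\<^sup>2 - 1) / 4 = y" using G(3) by simp
    have s: "0 < sin x" using xx by (intro sin_gt_zero)
    have "c * t / 2 = x * sqrt (1 - (-1) * b\<^sup>2 / (sin x)\<^sup>2)"
    proof -
      have "1 - (-1) * b\<^sup>2 / (sin x)\<^sup>2 = (y - -1 / 4) * (2 * b / sin x)\<^sup>2"
        using s b by (simp add: y_def field_simps power_mult_distrib power_divide)
      then have "sqrt (1 - (-1) * b\<^sup>2 / (sin x)\<^sup>2) = c / 2 * (2 * b / sin x)"
        using s b by (simp add: real_sqrt_mult c_def)
      then show ?thesis by (simp add: t_def)
    qed
    then show ?thesis
      by (intro exI[of _ c] exI[of _ t]) (use G y x xx in \<open>auto simp: f_def\<close>)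
  next
    case False
    show ?thesis
    proof (cases "\<Phi> = arccos (1 / a) - b")
      case True
      show ?thesis
        by (intro exI[of _ 1] exI[of _ "2 * b"]) (use True b in \<open>auto simp: sinq_def cosq_def\<close>)
    next
      case neq: False
      \<comment> \<open>The parameter is \<open>s = sqrt (1 - c\<^sup>2)\<close>. The equation
        \<open>sinq y t = 2 * b\<close> is solved by \<open>t = 2 * (arsinh (s * b) / s)\<close>,
        and \<open>f s\<close> is the resulting phase.\<close>
      define f where "f s = arccos (sqrt (1 + (s * b)\<^sup>2) / a) - sqrt (1 - s\<^sup>2) * (arsinh (s * b) / s)" for s
      have "(f \<longlongrightarrow> arccos (sqrt (1 + (0 * b)\<^sup>2) / a) - b) (at_right 0)"
      proof -
        have 1: "((\<lambda>s. sqrt (1 + (s * b)\<^sup>2) / a) \<longlongrightarrow> sqrt (1 + (0 * b)\<^sup>2) / a) (at_right 0)"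
          by (intro tendsto_intros) (use a in auto)
        have i: "isCont arccos (sqrt (1 + (0 * b)\<^sup>2) / a)" by (rule isCont_arccos) (use a in \<open>auto simp: field_simps\<close>)
        have 2: "((\<lambda>s. arccos (sqrt (1 + (s * b)\<^sup>2) / a)) \<longlongrightarrow> arccos (sqrt (1 + (0 * b)\<^sup>2) / a)) (at_right 0)"
          by (rule isCont_tendsto_compose[OF i 1])
        have 3: "((\<lambda>s::real. sqrt (1 - s\<^sup>2) * (arsinh (s * b) / s)) \<longlongrightarrow> b) (at_right 0)"
        proof -
          have "((\<lambda>s. arsinh (s * b)) has_real_derivative b) (at 0)"
          proof -
            have "((\<lambda>s. s * b) has_real_derivative b) (at 0)"
              by (auto intro!: derivative_eq_intros)
            from DERIV_chain2[OF arsinh_real_has_field_derivative this] show ?thesis by simp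
          qed
          then have "((\<lambda>s. arsinh (s * b) / s) \<longlongrightarrow> b) (at 0)" by (simp add: DERIV_def)
          then have q: "((\<lambda>s. arsinh (s * b) / s) \<longlongrightarrow> b) (at_right 0)" by (rule tendsto_within_subset) simp
          have "((\<lambda>s. sqrt (1 - s\<^sup>2) * (arsinh (s * b) / s)) \<longlongrightarrow> sqrt (1 - 0\<^sup>2) * b) (at_right 0)"
            by (intro tendsto_intros q)
          then show ?thesis by simp
        qed
        show ?thesis unfolding f_def by (rule tendsto_diff[OF 2 3])
      qed
      then have "\<forall>\<^sub>F x in at_right 0. f x < \<Phi>"
        by (rule order_tendstoD) (use False neq in simp)
      moreover have "\<forall>\<^sub>F x in at_right 0. x \<in> {0<..<1::real}"
        by (rule eventually_at_right_real) simp
      ultimately have "\<forall>\<^sub>F x in at_right 0. f x < \<Phi> \<and> x \<in> {0<..<1}" by (rule eventually_conj)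
      then obtain s0 where s0: "f s0 < \<Phi>" "0 < s0" "s0 < 1"
        using eventually_happens[of _ "at_right (0::real)"] by (auto simp: trivial_limit_at_right_real)
      have f1: "f 1 = 0" using a by (simp add: f_def a_def[symmetric])
      have rng: "-1 \<le> sqrt (1 + (s * b)\<^sup>2) / a \<and> sqrt (1 + (s * b)\<^sup>2) / a \<le> 1" if "s \<in> {s0..1}" for s
      proof -
        have "(s * b)\<^sup>2 \<le> b\<^sup>2" using that s0 b by (intro power_mono) (auto simp: mult_left_le_one_le)
        then have "sqrt (1 + (s * b)\<^sup>2) \<le> a" by (simp add: a_def)
        then have "sqrt (1 + (s * b)\<^sup>2) / a \<le> 1" "0 \<le> sqrt (1 + (s * b)\<^sup>2) / a" using a by auto
        then show ?thesis by linarith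
      qed
      have cont: "continuous_on {s0..1} f" unfolding f_def
        by (intro continuous_intros continuous_on_compose2[OF continuous_on_arccos'])
           (use a rng s0 in auto)
      obtain s where s: "s0 \<le> s" "s \<le> 1" "f s = \<Phi>"
        using IVT'[of f s0 \<Phi> 1] cont f1 s0 \<Phi> by force
      have sp: "0 < s" using s s0 by simp
      define c where "c = sqrt (1 - s\<^sup>2)"
      define t where "t = 2 * (arsinh (s * b) / s)"
      have c2: "c\<^sup>2 = 1 - s\<^sup>2" using s sp by (simp add: c_def power_le_one)
      have y: "(c\<^sup>2 - 1) / 4 = - (s / 2)\<^sup>2" unfolding c2 by (simp add: power_divide)
      have sy: "sqrt (- ((c\<^sup>2 - 1) / 4)) = s / 2" unfolding y using sp by simp
      have yn: "(c\<^sup>2 - 1) / 4 < 0" unfolding y using sp by simp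
      have ar: "0 < arsinh (s * b)" using sp b by simp
      have st: "s / 2 * t = arsinh (s * b)" using sp by (simp add: t_def)
      have S: "sinq ((c\<^sup>2 - 1) / 4) t = 2 * b"
        using yn sp unfolding sinq_def sy st by simp
      have C: "cosq ((c\<^sup>2 - 1) / 4) t = sqrt (1 + (s * b)\<^sup>2)"
        using yn unfolding cosq_def sy st by (simp add: cosh_arsinh_real add.commute)
      have "c \<le> 1" "0 \<le> c" using s sp by (auto simp: c_def power_le_one)
      moreover have "\<Phi> = arccos (cosq ((c\<^sup>2 - 1) / 4) t / a) - c * t / 2"
        unfolding C using s(3) by (simp add: f_def c_def t_def)
      moreover have "0 < t" using ar sp by (simp add: t_def)
      ultimately show ?thesis using S by blast
    qed
  qed
  then obtain c t where *: "0 \<le> c" "0 < t" "c \<le> 1 \<or> sqrt ((c\<^sup>2 - 1) / 4) * t < pi"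
    "sinq ((c\<^sup>2 - 1) / 4) t = 2 * b" "\<Phi> = arccos (cosq ((c\<^sup>2 - 1) / 4) t / a) - c * t / 2"
    by blast
  have "geoA (-1) c t = of_real a * cis \<Phi>"
  proof -
    define Z where "Z = Complex (cosq ((c\<^sup>2 - 1) / 4) t) (c * b)"
    have "(cmod Z)\<^sup>2 = a\<^sup>2"
      using cosq_sinq[of "(c\<^sup>2 - 1) / 4" t] by (simp add: Z_def cmod_power2 *(4) a power_mult_distrib field_simps)
    then have Za: "cmod Z = a" by (rule power2_eq_imp_eq) (use a in auto)
    have "Z = of_real (cmod Z) * cis (arccos (Re Z / cmod Z))"
      by (rule complex_polar_upper) (use * b Za a in \<open>auto simp: Z_def\<close>)
    then have "Z = of_real a * cis (arccos (cosq ((c\<^sup>2 - 1) / 4) t / a))" unfolding Za by (simp add: Z_def)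
    moreover have "geoA (-1) c t = Z * cis (- (c * t / 2))" by (simp add: geoA_def *(4) Z_def)
    ultimately have "geoA (-1) c t = of_real a * cis (arccos (cosq ((c\<^sup>2 - 1) / 4) t / a) + - (c * t / 2))"
      by (simp add: mult.assoc cis_mult)
    then show ?thesis by (simp only: *(5) diff_conv_add_uminus)
  qed
  with * show thesis using that by (simp add: a_def)
qed

lemma deriv_zero_on_interval:
  fixes F :: "real \<Rightarrow> real"
  assumes "\<And>x. x \<in> {a<..<b} \<Longrightarrow> F x = 0" "\<And>x. (F has_real_derivative F' x) (at x)"
  shows "\<And>x. x \<in> {a<..<b} \<Longrightarrow> F' x = 0"
proof -
  fix x assume x: "x \<in> {a<..<b}"
  have "(F has_real_derivative 0) (at x)"
    by (rule has_field_derivative_transform_within_open[of "\<lambda>_. 0" _ _ "{a<..<b}"]) (use x assms(1) in auto)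
  then show "F' x = 0" using assms(2) DERIV_unique by blast
qed

text \<open>Comparison of the second and fourth derivatives at 0.\<close>

lemma cos_combination_unique:
  fixes A B D p :: real
  assumes \<epsilon>: "0 < \<epsilon>" and eq: "\<And>x. x \<in> {0<..<\<epsilon>} \<Longrightarrow> cos (A * x) = p * cos (B * x) + (1 - p) * cos (D * x)"
    and p: "p * (1 - p) \<noteq> 0"
  shows "B\<^sup>2 = D\<^sup>2"
proof -
  define F0 where "F0 x = cos (A * x) - p * cos (B * x) - (1 - p) * cos (D * x)" for x
  define F1 where "F1 x = - A * sin (A * x) + p * B * sin (B * x) + (1 - p) * D * sin (D * x)" for x
  define F2 where "F2 x = - A\<^sup>2 * cos (A * x) + p * B\<^sup>2 * cos (B * x) + (1 - p) * D\<^sup>2 * cos (D * x)" for x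
  define F3 where "F3 x = A ^ 3 * sin (A * x) - p * B ^ 3 * sin (B * x) - (1 - p) * D ^ 3 * sin (D * x)" for x
  define F4 where "F4 x = A ^ 4 * cos (A * x) - p * B ^ 4 * cos (B * x) - (1 - p) * D ^ 4 * cos (D * x)" for x
  have d: "(F0 has_real_derivative F1 x) (at x)" "(F1 has_real_derivative F2 x) (at x)"
    "(F2 has_real_derivative F3 x) (at x)" "(F3 has_real_derivative F4 x) (at x)" for x
    unfolding F0_def[abs_def] F1_def[abs_def] F2_def[abs_def] F3_def[abs_def] F4_def
    by (auto intro!: derivative_eq_intros simp: power2_eq_square power3_eq_cube power4_eq_xxxx algebra_simps)
  have z0: "F0 x = 0" if "x \<in> {0<..<\<epsilon>}" for x using eq[OF that] by (simp add: F0_def)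
  note z1 = deriv_zero_on_interval[OF z0 d(1)]
  note z2 = deriv_zero_on_interval[OF z1 d(2)]
  note z3 = deriv_zero_on_interval[OF z2 d(3)]
  note z4 = deriv_zero_on_interval[OF z3 d(4)]
  have 0: "0 \<in> closure {0<..<\<epsilon>}" using \<epsilon> by simp
  have "F2 0 = 0"
    by (rule continuous_constant_on_closure[OF _ _ 0]) (use z2 in \<open>auto simp: F2_def intro!: continuous_intros\<close>)
  moreover have "F4 0 = 0"
    by (rule continuous_constant_on_closure[OF _ _ 0]) (use z4 in \<open>auto simp: F4_def intro!: continuous_intros\<close>)
  ultimately have 2: "A\<^sup>2 = p * B\<^sup>2 + (1 - p) * D\<^sup>2" and 4: "(A\<^sup>2)\<^sup>2 = p * (B\<^sup>2)\<^sup>2 + (1 - p) * (D\<^sup>2)\<^sup>2"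
    by (simp_all add: F2_def F4_def)
  \<comment> \<open>Formally the variance of the values \<open>B\<^sup>2\<close> and
    \<open>D\<^sup>2\<close> with weights \<open>p\<close> and \<open>1 - p\<close>. It vanishes
    because \<open>A\<^sup>2\<close> is their mean and \<open>(A\<^sup>2)\<^sup>2\<close> the mean
    of their squares.\<close>
  have "p * (1 - p) * (B\<^sup>2 - D\<^sup>2)\<^sup>2 = p * (B\<^sup>2)\<^sup>2 + (1 - p) * (D\<^sup>2)\<^sup>2 - (p * B\<^sup>2 + (1 - p) * D\<^sup>2)\<^sup>2"
    by (simp add: power2_eq_square algebra_simps)
  also have "\<dots> = 0" using 2 4 by simp
  finally show ?thesis using p by simp
qed

text \<open>
  If two geodesics of the same length have the same endpoint, then multiplying one by the
  one-parameter group belonging to the other gives the equality case of the length comparison.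
\<close>

lemma geo_rotated_Re:
  assumes c1: "0 < c1\<^sup>2 + \<kappa>" and c: "0 < c\<^sup>2 + \<kappa>" and t: "0 < t"
    and eq: "\<And>x. x \<in> {0<..<t} \<Longrightarrow> Re (geoA \<kappa> c1 x * cis (c * x / 2)) = cos (sqrt (c\<^sup>2 + \<kappa>) * x / 2)"
    and \<kappa>: "\<kappa> \<noteq> 0"
  shows "c = c1"
proof -
  define s where "s = sqrt (c1\<^sup>2 + \<kappa>)"
  define k where "k = c1 / s"
  have s: "0 < s" "s\<^sup>2 = c1\<^sup>2 + \<kappa>" using c1 by (auto simp: s_def)
  have sq: "sqrt ((c1\<^sup>2 + \<kappa>) / 4) = s / 2" by (simp add: s_def real_sqrt_divide)
  have geo: "Re (geoA \<kappa> c1 x * cis (c * x / 2)) =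
      (1 + k) / 2 * cos ((s + (c - c1)) / 2 * x) + (1 - (1 + k) / 2) * cos ((s - (c - c1)) / 2 * x)" for x
  proof -
    have C: "cosq ((c1\<^sup>2 + \<kappa>) / 4) x = cos (s / 2 * x)" "c1 / 2 * sinq ((c1\<^sup>2 + \<kappa>) / 4) x = k * sin (s / 2 * x)"
      using c1 s by (simp_all add: cosq_def sinq_def sq k_def)
    have "geoA \<kappa> c1 x * cis (c * x / 2) = Complex (cos (s / 2 * x)) (k * sin (s / 2 * x)) * cis ((c - c1) / 2 * x)"
      unfolding geoA_def C by (simp add: cis_mult mult.assoc algebra_simps diff_divide_distrib)
    then have "Re (geoA \<kappa> c1 x * cis (c * x / 2)) =
       cos (s / 2 * x) * cos ((c - c1) / 2 * x) - k * (sin (s / 2 * x) * sin ((c - c1) / 2 * x))" by simp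
    also have "\<dots> = (1 + k) / 2 * cos (s / 2 * x + (c - c1) / 2 * x) + (1 - (1 + k) / 2) * cos (s / 2 * x - (c - c1) / 2 * x)"
      unfolding cos_add cos_diff by (simp add: field_simps)
    finally show ?thesis by (simp add: algebra_simps add_divide_distrib diff_divide_distrib)
  qed
  \<comment> \<open>Product-to-sum has split the rotated curve into these two frequencies; equality
    of their squares leaves only \<open>c = c1\<close>, because \<open>s > 0\<close>.\<close>
  have "((s + (c - c1)) / 2)\<^sup>2 = ((s - (c - c1)) / 2)\<^sup>2"
  proof (rule cos_combination_unique[OF t, where A = "sqrt (c\<^sup>2 + \<kappa>) / 2" and p = "(1 + k) / 2"])
    show "cos (sqrt (c\<^sup>2 + \<kappa>) / 2 * x) = (1 + k) / 2 * cos ((s + (c - c1)) / 2 * x)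
        + (1 - (1 + k) / 2) * cos ((s - (c - c1)) / 2 * x)" if "x \<in> {0<..<t}" for x
      using eq[OF that] geo[of x] by simp
    \<comment> \<open>Both weights are nonzero because \<open>s\<^sup>2\<close> and
      \<open>c1\<^sup>2\<close> differ by \<open>\<kappa>\<close>.\<close>
    have "k\<^sup>2 \<noteq> 1"
    proof
      assume "k\<^sup>2 = 1"
      then have "c1\<^sup>2 = s\<^sup>2" using s by (simp add: k_def power_divide)
      then show False using s \<kappa> by simp
    qed
    then show "(1 + k) / 2 * (1 - (1 + k) / 2) \<noteq> 0" by (auto simp: field_simps power2_eq_square)
  qed
  then have "s * (c - c1) = 0" by (simp add: power2_eq_square field_simps)
  then show ?thesis using s by simp
qed

text \<open>The bounds on \<open>{0..x}\<close> and \<open>{x..t}\<close> add up to exactly the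
  distance of the end point, so both are equalities and \<open>f x\<close> must be
  \<open>cos (s * x / 2)\<close> throughout.\<close>

lemma su2_geodesic_unique:
  assumes t: "0 < t" "sqrt ((c\<^sup>2 + 1) / 4) * t \<le> pi" and eq: "geoA 1 c1 t = geoA 1 c t"
  shows "c1 = c"
proof -
  define s where "s = sqrt (c\<^sup>2 + 1)"
  have pos: "0 < x\<^sup>2 + (1::real)" for x by (simp add: add_nonneg_pos)
  have s0: "0 < s" "sqrt ((c\<^sup>2 + 1) / 4) = s / 2" using pos[of c] by (auto simp: s_def real_sqrt_divide)
  have h: "hcurve 1 0 t (geoA 1 c1) (geoB 1 c1 1) (\<lambda>x. cis (c1 * x))"
    using hcurve_geo[of 1 t 1 c1] t by simp
  have L: "hlength p q (\<lambda>x. cis (c1 * x)) = q - p" if "p \<le> q" for p q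
    using hlength_geo[of 1 p q c1] that by simp
  define f where "f x = Re (geoA 1 c1 x * cis (c * x / 2))" for x
  have le: "arccos (f q) - arccos (f p) \<le> s * (q - p) / 2" if "0 \<le> p" "p \<le> q" "q \<le> t" for p q
    using hcurve_angle_le[OF h that, of c 0] that by (simp add: L s_def f_def)
  have ft: "f t = cos (s * t / 2)"
  proof -
    have "geoA 1 c1 t * cis (c * t / 2) = Complex (cosq ((c\<^sup>2 + 1) / 4) t) (c / 2 * sinq ((c\<^sup>2 + 1) / 4) t)"
      unfolding eq by (simp add: geoA_def mult.assoc cis_mult)
    then show ?thesis using pos[of c] by (simp add: f_def cosq_def s0)
  qed
  have "f x = cos (s * x / 2)" if x: "x \<in> {0<..<t}" for x
  proof -
    have f1: "\<bar>f x\<bar> \<le> 1"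
    proof -
      have "(cmod (geoA 1 c1 x))\<^sup>2 \<le> 1" using geo_norm[of 1 1 c1 x] zero_le_power2[of "cmod (geoB 1 c1 1 x)"]
        by (simp only: norm_one mult_1_left) linarith
      then have "cmod (geoA 1 c1 x) \<le> 1" by (simp add: power_le_one_iff)
      then show ?thesis using abs_Re_le_cmod[of "geoA 1 c1 x * cis (c * x / 2)"] by (simp add: f_def norm_mult)
    qed
    have "arccos (f x) \<le> s * x / 2" using le[of 0 x] x by (simp add: f_def)
    moreover have "s * t / 2 - arccos (f x) \<le> s * (t - x) / 2"
    proof -
      have "arccos (f t) = s * t / 2" unfolding ft by (rule arccos_cos) (use t s0 in auto)
      then show ?thesis using le[of x t] x by simp
    qed
    ultimately have "arccos (f x) = s * x / 2" by (simp add: field_simps)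
    then show ?thesis using f1 by (metis cos_arccos_abs)
  qed
  then show ?thesis
    using geo_rotated_Re[of c1 1 c t] pos t by (simp add: f_def s_def)
qed

text \<open>The reversed inequalities leave the same equality case. The phase hypothesis keeps the
  final rotated phase below \<open>pi\<close>, as the Lorentzian comparison requires.\<close>

lemma su11_geodesic_unique_elliptic:
  assumes t: "0 < t" and c: "1 < c" "sqrt ((c\<^sup>2 - 1) / 4) * t < pi" and c1: "1 < c1\<^sup>2"
    and eq: "geoA (-1) c1 t = geoA (-1) c t"
    and l: "continuous_on {0..t} l" "\<And>x. x \<in> {0..t} \<Longrightarrow> exp (l x) = geoA (-1) c1 x" "l 0 = 0"
    and phase: "Im (l t) = arccos (cosq ((c\<^sup>2 - 1) / 4) t / cmod (geoA (-1) c t)) - c * t / 2"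
    and eqB: "cmod (geoB (-1) c1 1 t) = cmod (geoB (-1) c 1 t)"
  shows "c1 = c"
proof -
  define s where "s = sqrt (c\<^sup>2 - 1)"
  have cc: "1 < c\<^sup>2" using c(1) by (simp add: power2_eq_square less_1_mult)
  have s0: "0 < s" "sqrt ((c\<^sup>2 - 1) / 4) = s / 2" using cc by (auto simp: s_def real_sqrt_divide)
  have h: "hcurve (-1) 0 t (geoA (-1) c1) (geoB (-1) c1 1) (\<lambda>x. cis (c1 * x))"
    using hcurve_geo[of 1 t "-1" c1] t by simp
  have L: "hlength p q (\<lambda>x. cis (c1 * x)) = q - p" if "p \<le> q" for p q
    using hlength_geo[of 1 p q c1] that by simp
  have Lt: "hlength 0 x (\<lambda>x. cis (c1 * x)) + 0 * x = x" if "x \<in> {0..t}" for x using L[of 0 x] that by simp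
  define f where "f x = Re (geoA (-1) c1 x * cis (c * x / 2))" for x
  define S where "S = sinq ((c\<^sup>2 - 1) / 4) t"
  have S0: "0 < S" unfolding S_def by (rule sinq_pos) (use t c in auto)
  have A: "geoA (-1) c1 t * cis (c * t / 2) = Complex (cosq ((c\<^sup>2 - 1) / 4) t) (c / 2 * S)"
    unfolding eq S_def by (simp add: geoA_def mult.assoc cis_mult)
  have B: "cmod (geoB (-1) c1 1 t) = S / 2" unfolding eqB using S0 by (simp add: geoB_def S_def norm_mult)
  have n: "1 \<le> cmod (geoA (-1) c t)"
    using geo_norm[of 1 "-1" c t] by (intro su11_alpha_gt(3)[of _ "geoB (-1) c 1 t"]) simp
  have Cle: "\<bar>cosq ((c\<^sup>2 - 1) / 4) t\<bar> \<le> cmod (geoA (-1) c t)"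
  proof -
    have "cmod (geoA (-1) c t) = cmod (geoA (-1) c1 t * cis (c * t / 2))" by (simp add: eq norm_mult)
    then show ?thesis unfolding A using abs_Re_le_cmod by (metis complex.sel(1))
  qed
  have end1: "Im (l t) + c * (hlength 0 t (\<lambda>x. cis (c1 * x)) + 0 * t) / 2 \<le> pi"
  proof -
    have "\<bar>cosq ((c\<^sup>2 - 1) / 4) t / cmod (geoA (-1) c t)\<bar> \<le> 1" using Cle n by (simp add: abs_divide divide_le_eq)
    then have "arccos (cosq ((c\<^sup>2 - 1) / 4) t / cmod (geoA (-1) c t)) \<le> pi"
      using abs_le_D1 abs_le_D2 by (intro arccos_ubound) fastforce+
    then show ?thesis using Lt[of t] t by (simp only: phase) simp
  qed
  have end2: "cmod (geoB (-1) c1 1 t) \<le> Im (geoA (-1) c1 t * cis (c * (hlength 0 t (\<lambda>x. cis (c1 * x)) + 0 * t) / 2))"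
  proof -
    have "1 * S \<le> c * S" using c S0 by (intro mult_right_mono) auto
    then show ?thesis using Lt[of t] t by (simp only: A B atLeastAtMost_iff order_refl less_imp_le) simp
  qed
  have g0: "geoA (-1) c1 0 = 1" "geoB (-1) c1 1 0 = 0" by simp_all
  have \<eta>: "c - 1 \<le> c * (cmod (cis (c1 * x)) + 0) - cmod (cis (c1 * x))" "0 < c - 1" for x
    using c by (auto simp: norm_mult)
  have ge1: "1 / 2 * (sqrt (c\<^sup>2 - 1) * hlength p q (\<lambda>x. cis (c1 * x)) + c * 0 * (q - p))
      \<le> arccos (Re (geoA (-1) c1 q * cis (c * (hlength 0 q (\<lambda>x. cis (c1 * x)) + 0 * q) / 2)))
       - arccos (Re (geoA (-1) c1 p * cis (c * (hlength 0 p (\<lambda>x. cis (c1 * x)) + 0 * p) / 2)))"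
    if "0 \<le> p" "p \<le> q" "q \<le> t" for p q
    by (rule su11_angle_ge(1)[OF h t g0 l c(1) order_refl \<eta> end1 end2]) (use that in auto)
  have ge2: "Re (geoA (-1) c1 x * cis (c * (hlength 0 x (\<lambda>x. cis (c1 * x)) + 0 * x) / 2)) \<in> {-1..1}"
    if "x \<in> {0..t}" for x
    by (rule su11_angle_ge(2)[OF h t g0 l c(1) order_refl \<eta> end1 end2]) (use that in auto)
  have fx: "f x = Re (geoA (-1) c1 x * cis (c * (hlength 0 x (\<lambda>x. cis (c1 * x)) + 0 * x) / 2))" if "x \<in> {0..t}" for x
    using Lt[OF that] by (simp only: f_def)
  have le: "s * (q - p) / 2 \<le> arccos (f q) - arccos (f p)" if "0 \<le> p" "p \<le> q" "q \<le> t" for p q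
    using ge1[OF that] fx[of p] fx[of q] that by (simp add: L s_def)
  have ft: "f t = cos (s * t / 2)"
    using cc by (simp add: f_def A cosq_def s0)
  have "f x = cos (s * x / 2)" if x: "x \<in> {0<..<t}" for x
  proof -
    have f1: "\<bar>f x\<bar> \<le> 1"
      using ge2[of x] fx[of x] x by (simp add: abs_le_iff)
    have "s * x / 2 \<le> arccos (f x)" using le[of 0 x] x by (simp add: f_def)
    moreover have "s * (t - x) / 2 \<le> s * t / 2 - arccos (f x)"
    proof -
      have "arccos (f t) = s * t / 2" unfolding ft by (rule arccos_cos) (use t c s0 in auto)
      then show ?thesis using le[of x t] x by simp
    qed
    ultimately have "arccos (f x) = s * x / 2" by (simp add: field_simps)
    then show ?thesis using f1 by (metis cos_arccos_abs)
  qed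
  then have "c = c1"
    using geo_rotated_Re[of c1 "-1" c t] c1 cc t by (simp add: f_def s_def)
  then show ?thesis by simp
qed

text \<open>Comparing \<open>|sinq y1 t|\<close> with \<open>t\<close> tells the sign of
  \<open>y1\<close>: it is below \<open>t\<close> for \<open>y1 > 0\<close> and at least
  \<open>t\<close> otherwise. For \<open>c \<le> 1\<close> monotonicity then gives
  \<open>y1 = y\<close>; for \<open>c > 1\<close> the other geodesic is elliptic too, and rigidity
  applies.\<close>

lemma su11_geodesic_unique:
  assumes t: "0 < t" and c: "0 \<le> c" "c \<le> 1 \<or> sqrt ((c\<^sup>2 - 1) / 4) * t < pi"
    and eq: "geoA (-1) c1 t = geoA (-1) c t"
    and l: "continuous_on {0..t} l" "\<And>x. x \<in> {0..t} \<Longrightarrow> exp (l x) = geoA (-1) c1 x" "l 0 = 0"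
    and phase: "Im (l t) = arccos (cosq ((c\<^sup>2 - 1) / 4) t / cmod (geoA (-1) c t)) - c * t / 2"
    and eqB: "cmod (geoB (-1) c1 1 t) = cmod (geoB (-1) c 1 t)"
  shows "c1\<^sup>2 = c\<^sup>2"
proof -
  define y where "y = (c\<^sup>2 - 1) / 4"
  define y1 where "y1 = (c1\<^sup>2 - 1) / 4"
  have good: "y \<le> 0 \<or> sqrt y * t < pi" using c by (auto simp: y_def power_le_one)
  have S0: "0 < sinq y t" by (rule sinq_pos[OF t good])
  have SS: "\<bar>sinq y1 t\<bar> = sinq y t"
    using eqB S0 by (simp add: geoB_def norm_mult y_def y1_def)
  have lt: "\<bar>sinq y1 t\<bar> < t" if "0 < y1"
  proof -
    have "0 < sqrt y1 * t" using that t by simp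
    then have "\<bar>sin (sqrt y1 * t)\<bar> < sqrt y1 * t"
      by (rule abs_sin_less_self)
    then show ?thesis using that by (simp add: sinq_def abs_divide divide_less_eq mult.commute)
  qed
  have z: "sinq 0 t = t" by (simp add: sinq_def)
  show ?thesis
  proof (cases "y \<le> 0")
    case True
    have "t \<le> sinq y t" using sinq_strict_antimono[OF t, of y 0] True z by (cases "y = 0") auto
    then have y1: "y1 \<le> 0" using lt SS by linarith
    have "sinq y1 t = sinq y t" using SS sinq_pos[OF t, of y1] y1 by simp
    then have "y1 = y" using sinq_inj[OF t, of y1 y] True y1 by simp
    then show ?thesis by (simp add: y_def y1_def)
  next
    case False
    then have yp: "0 < y" "sqrt y * t < pi" using good by auto
    then have c1': "1 < c" using c(1) by (simp add: y_def) (smt (verit) one_less_power power_le_one pos2)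
    have "sinq y t < t" using sinq_strict_antimono[OF t, of 0 y] yp z by simp
    then have "0 < y1" using SS sinq_strict_antimono[OF t, of y1 0] z by (cases "y1 < 0"; cases "y1 = 0") auto
    then have "1 < c1\<^sup>2" by (simp add: y1_def)
    from su11_geodesic_unique_elliptic[OF t c1' _ this eq l phase eqB] yp
    show ?thesis by (simp add: y_def)
  qed
qed

section \<open>Matrix groups\<close>

lemma span_pair: "x \<in> span {p, q} \<longleftrightarrow> (\<exists>a b. x = a *\<^sub>R p + b *\<^sub>R q)"
  for p q x :: "'a::real_vector"
  by (simp add: span_insert span_singleton) (metis add.commute diff_add_cancel add_diff_cancel_right')

lemma matrix_inv_mult_cancel:
  fixes g :: "'a::real_normed_field^'n^'n"
  assumes "invertible g"
  shows "matrix_inv g ** (g ** w) = w"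
proof -
  have "g ** matrix_inv g = mat 1 \<and> matrix_inv g ** g = mat 1"
    unfolding matrix_inv_def by (rule someI_ex) (use assms in \<open>simp add: invertible_def\<close>)
  then show ?thesis by (simp add: matrix_mul_assoc)
qed

lemma p_inner_same:
  fixes p1 p2 :: "'a::real_normed_field^'n^'n"
  assumes ind: "\<And>a b. a *\<^sub>R p1 + b *\<^sub>R p2 = 0 \<Longrightarrow> a = 0 \<and> b = 0"
  defines "w a b \<equiv> a *\<^sub>R p1 + b *\<^sub>R p2"
  shows "p_inner p1 p2 (w a b) (w a b) = a\<^sup>2 + b\<^sup>2"
proof -
  have ne: "p1 \<noteq> p2" using ind[of 1 "-1"] by auto
  have "p2 \<noteq> 0" using ind[of 0 1] by auto
  moreover have "p1 \<notin> span {p2}"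
  proof
    assume "p1 \<in> span {p2}"
    then obtain k where "p1 = k *\<^sub>R p2" by (auto simp: span_singleton)
    then show False using ind[of 1 "-k"] by auto
  qed
  ultimately have I: "independent {p1, p2}" using ne by (simp add: independent_insert)
  have s: "p1 \<in> span {p1, p2}" "p2 \<in> span {p1, p2}" by (auto intro: span_base)
  have "representation {p1, p2} (w a b) = (\<lambda>v. a * (if v = p1 then 1 else 0) + b * (if v = p2 then 1 else 0))"
    unfolding w_def using s
    by (simp add: representation_add[OF I] span_scale representation_scale[OF I] representation_basis[OF I])
  then show ?thesis using ne by (simp add: p_inner_def power2_eq_square)
qed

locale kp_algebra =
  fixes G :: "('a::real_normed_field^'n^'n) set" and p1 p2 :: "'a^'n^'n"
  assumes ind: "\<And>a b. a *\<^sub>R p1 + b *\<^sub>R p2 = 0 \<Longrightarrow> a = 0 \<and> b = 0"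
    and inv: "\<And>g. g \<in> G \<Longrightarrow> invertible g"
begin

definition vel :: "complex \<Rightarrow> 'a^'n^'n" where
  "vel u = Re u *\<^sub>R p1 + Im u *\<^sub>R p2"

lemma sr_metric_vel: "g \<in> G \<Longrightarrow> sqrt (sr_metric p1 p2 g (g ** vel u) (g ** vel u)) = cmod u"
  using p_inner_same[OF ind, where a = "Re u" and b = "Im u"]
  by (simp add: sr_metric_def matrix_inv_mult_cancel[OF inv] vel_def cmod_def)

lemma horizontal_control:
  assumes h: "horizontal G p1 p2 T \<gamma>" and T: "0 < T"
  obtains u N where "negligible N"
    "\<And>t. t \<in> {0..T} - N \<Longrightarrow> (\<gamma> has_vector_derivative \<gamma> t ** vel (u t)) (at t within {0..T})"
    "sr_length p1 p2 T \<gamma> = hlength 0 T u"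
proof -
  have "AE t in lebesgue. t \<in> {0..T} \<longrightarrow> (\<exists>v\<in>distribution_at p1 p2 (\<gamma> t). (\<gamma> has_vector_derivative v) (at t within {0..T}))"
    using h by (simp add: horizontal_def)
  then obtain N where N: "N \<in> null_sets lebesgue"
    "{t \<in> space lebesgue. \<not> (t \<in> {0..T} \<longrightarrow> (\<exists>v\<in>distribution_at p1 p2 (\<gamma> t). (\<gamma> has_vector_derivative v) (at t within {0..T})))} \<subseteq> N"
    unfolding eventually_ae_filter by blast
  have n: "negligible N" using N(1) by (simp add: negligible_iff_null_sets)
  have "\<exists>u. (\<gamma> has_vector_derivative \<gamma> t ** vel u) (at t within {0..T})" if t: "t \<in> {0..T} - N" for t
  proof -
    obtain v where v: "v \<in> distribution_at p1 p2 (\<gamma> t)" "(\<gamma> has_vector_derivative v) (at t within {0..T})"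
      using N(2) t by auto
    then obtain a b where "v = \<gamma> t ** (a *\<^sub>R p1 + b *\<^sub>R p2)"
      by (auto simp: distribution_at_def span_pair)
    then show ?thesis using v(2) by (intro exI[of _ "Complex a b"]) (simp add: vel_def)
  qed
  then obtain u where u: "\<And>t. t \<in> {0..T} - N \<Longrightarrow> (\<gamma> has_vector_derivative \<gamma> t ** vel (u t)) (at t within {0..T})"
    by metis
  have "sr_length p1 p2 T \<gamma> = hlength 0 T u"
    unfolding sr_length_def hlength_def
  proof (rule integral_spike[OF n])
    fix t assume t: "t \<in> {0..T} - N"
    \<comment> \<open>Since \<open>0 < T\<close>, derivatives within \<open>{0..T}\<close> are
      unique, so \<open>vector_derivative\<close> returns the horizontal velocity.\<close>
    have "vector_derivative \<gamma> (at t within {0..T}) = \<gamma> t ** vel (u t)"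
      using vector_derivative_within_cbox[of 0 T t \<gamma>] u[OF t] T t by simp
    moreover have "\<gamma> t \<in> G" using h t by (auto simp: horizontal_def)
    ultimately show "cmod (u t) = (let v = vector_derivative \<gamma> (at t within {0..T}) in sqrt (sr_metric p1 p2 (\<gamma> t) v v))"
      by (simp add: Let_def sr_metric_vel)
  qed
  then show thesis using that n u by blast
qed

lemma horizontalI:
  assumes T: "0 \<le> T" and G: "\<And>t. t \<in> {0..T} \<Longrightarrow> \<gamma> t \<in> G" and lip: "lip_on {0..T} \<gamma>"
    and D: "\<And>t. t \<in> {0..T} \<Longrightarrow> (\<gamma> has_vector_derivative \<gamma> t ** vel (u t)) (at t within {0..T})"
  shows "horizontal G p1 p2 T \<gamma>" "sr_length p1 p2 T \<gamma> = hlength 0 T u"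
proof -
  have dist: "\<gamma> t ** vel (u t) \<in> distribution_at p1 p2 (\<gamma> t)" for t
    unfolding distribution_at_def vel_def by (rule imageI, unfold span_pair, blast)
  show "horizontal G p1 p2 T \<gamma>"
    unfolding horizontal_def using T G lip D dist by (auto simp: lip_on_def intro!: AE_I2)
  show "sr_length p1 p2 T \<gamma> = hlength 0 T u"
  proof (cases "T = 0")
    case True then show ?thesis by (simp add: sr_length_def hlength_def)
  next
    case False
    show ?thesis unfolding sr_length_def hlength_def
    proof (rule integral_cong)
      fix t assume t: "t \<in> {0..T}"
      have "vector_derivative \<gamma> (at t within {0..T}) = \<gamma> t ** vel (u t)"
        using vector_derivative_within_cbox[of 0 T t \<gamma>] D[OF t] T False t by simp
      then show "(let v = vector_derivative \<gamma> (at t within {0..T}) in sqrt (sr_metric p1 p2 (\<gamma> t) v v)) = cmod (u t)"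
        using G[OF t] by (simp add: Let_def sr_metric_vel)
    qed
  qed
qed

end

lemma hcurve_const: "hcurve \<kappa> 0 1 (\<lambda>_. 1) (\<lambda>_. 0) (\<lambda>_. 0)"
  by (auto simp: hcurve_def lip_on_const intro!: exI[of _ "{}"])

text \<open>
  \<open>Mat\<close> is the map from coordinates to the group; for \<open>SO(3)\<close> it is the double covering.
\<close>

locale kp_group = kp_algebra G p1 p2
  for G :: "('a::real_normed_field^'n^'n) set" and p1 p2 +
  fixes k :: "'a^'n^'n" and \<kappa> :: real and Mat :: "complex \<Rightarrow> complex \<Rightarrow> 'a^'n^'n"
  assumes Mat_one: "Mat 1 0 = mat 1"
    and Mat_in: "\<And>\<alpha> \<beta>. (cmod \<alpha>)\<^sup>2 + \<kappa> * (cmod \<beta>)\<^sup>2 = 1 \<Longrightarrow> Mat \<alpha> \<beta> \<in> G"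
    and Mat_derivative: "\<And>\<alpha> \<beta> u t S. (\<alpha> has_vector_derivative of_real (- (\<kappa> / 2)) * \<beta> t * cnj u) (at t within S) \<Longrightarrow>
      (\<beta> has_vector_derivative (1 / 2) * \<alpha> t * u) (at t within S) \<Longrightarrow>
      ((\<lambda>t. Mat (\<alpha> t) (\<beta> t)) has_vector_derivative Mat (\<alpha> t) (\<beta> t) ** vel u) (at t within S)"
    and Mat_continuous: "\<And>\<alpha> \<beta> S. continuous_on S \<alpha> \<Longrightarrow> continuous_on S \<beta> \<Longrightarrow> continuous_on S (\<lambda>t::real. Mat (\<alpha> t) (\<beta> t))"
    and Exp_Mat: "\<And>\<theta> c t. Exp_geod p1 p2 k \<theta> c t = Mat (geoA \<kappa> c t) (geoB \<kappa> c (cis \<theta>) t)"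
    and lift: "\<And>T \<gamma>. 0 < T \<Longrightarrow> horizontal G p1 p2 T \<gamma> \<Longrightarrow> \<gamma> 0 = mat 1 \<Longrightarrow>
      \<exists>\<alpha> \<beta> u. hcurve \<kappa> 0 T \<alpha> \<beta> u \<and> \<alpha> 0 = 1 \<and> \<beta> 0 = 0 \<and> Mat (\<alpha> T) (\<beta> T) = \<gamma> T \<and>
        hlength 0 T u = sr_length p1 p2 T \<gamma>"
begin

lemma coordinates_exist:
  assumes h: "horizontal G p1 p2 T \<gamma>" "\<gamma> 0 = mat 1"
  obtains T' \<alpha> \<beta> u where "0 < T'" "hcurve \<kappa> 0 T' \<alpha> \<beta> u" "\<alpha> 0 = 1" "\<beta> 0 = 0"
    "Mat (\<alpha> T') (\<beta> T') = \<gamma> T" "hlength 0 T' u = sr_length p1 p2 T \<gamma>"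
proof (cases "T = 0")
  \<comment> \<open>For \<open>T = 0\<close> the curve is a point; the constant coordinate curve on
    \<open>{0..1}\<close> stands in for it, with the same length 0.\<close>
  case True
  show thesis
    by (rule that[OF _ hcurve_const]) (use True h Mat_one in \<open>auto simp: hlength_def sr_length_def\<close>)
next
  case False
  then have "0 < T" using h by (simp add: horizontal_def)
  from lift[OF this h] show thesis using that \<open>0 < T\<close> by blast
qed

lemma vel_continuous: "continuous_on S f \<Longrightarrow> continuous_on S (\<lambda>t. vel (f t))"
  unfolding vel_def by (intro continuous_intros)

lemma geodesic_horizontal:
  fixes c :: real
  assumes w: "cmod w = 1" and t: "0 \<le> t"
  defines "\<gamma> s \<equiv> Mat (geoA \<kappa> c s) (geoB \<kappa> c w s)"
  shows "horizontal G p1 p2 t \<gamma>" "sr_length p1 p2 t \<gamma> = t"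
proof -
  define u where "u s = w * cis (c * s)" for s
  have h: "hcurve \<kappa> 0 t (geoA \<kappa> c) (geoB \<kappa> c w) u" unfolding u_def by (rule hcurve_geo[OF w t])
  have D: "(\<gamma> has_vector_derivative \<gamma> s ** vel (u s)) (at s within S)" for s S
    unfolding \<gamma>_def u_def by (intro Mat_derivative has_vector_derivative_geoA has_vector_derivative_geoB w)
  have cg: "continuous_on {0..t} \<gamma>" unfolding \<gamma>_def
    using h by (intro Mat_continuous) (auto simp: hcurve_def lip_on_continuous)
  have cu: "continuous_on {0..t} (\<lambda>s. vel (u s))" unfolding u_def
    by (intro vel_continuous continuous_intros continuous_on_cis)
  have "continuous_on {0..t} (\<lambda>s. \<gamma> s ** vel (u s))"
    unfolding matrix_matrix_mult_def
    by (intro continuous_on_vec_lambda continuous_intros cg cu)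
  then have lip: "lip_on {0..t} \<gamma>" by (rule lip_on_vector_derivative[OF D])
  have G: "\<gamma> s \<in> G" for s unfolding \<gamma>_def by (intro Mat_in geo_norm w)
  from horizontalI[OF t G lip D] show "horizontal G p1 p2 t \<gamma>" "sr_length p1 p2 t \<gamma> = t"
    using hlength_geo[OF w t, of c] by (auto simp: u_def)
qed

abbreviation lengths_to :: "'a^'n^'n \<Rightarrow> real set" where
  "lengths_to q \<equiv> {sr_length p1 p2 T \<gamma> | T \<gamma>. horizontal G p1 p2 T \<gamma> \<and> \<gamma> 0 = mat 1 \<and> \<gamma> T = q}"

lemma geodesic_in_lengths:
  assumes "cmod w = 1" "0 \<le> t"
  shows "t \<in> lengths_to (Mat (geoA \<kappa> c t) (geoB \<kappa> c w t))"
  using geodesic_horizontal[OF assms, of c] Mat_one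
  by (intro CollectI exI[of _ t] exI[of _ "\<lambda>s. Mat (geoA \<kappa> c s) (geoB \<kappa> c w s)"]) auto

text \<open>The competitors are all coordinate curves whose end point has the same image under
  \<open>Mat\<close>; this is how the two lifts of a rotation enter.\<close>

lemma optimal_intro:
  assumes t: "0 \<le> t"
    and lb: "\<And>T \<alpha> \<beta> u. 0 < T \<Longrightarrow> hcurve \<kappa> 0 T \<alpha> \<beta> u \<Longrightarrow> \<alpha> 0 = 1 \<Longrightarrow> \<beta> 0 = 0 \<Longrightarrow>
      Mat (\<alpha> T) (\<beta> T) = Mat (geoA \<kappa> c t) (geoB \<kappa> c (cis \<theta>) t) \<Longrightarrow> t \<le> hlength 0 T u"
  shows "optimal G p1 p2 k \<theta> c t"
proof -
  let ?q = "Mat (geoA \<kappa> c t) (geoB \<kappa> c (cis \<theta>) t)"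
  have "Inf (lengths_to ?q) = t"
  proof (rule cInf_eq_minimum)
    show "t \<in> lengths_to ?q" by (rule geodesic_in_lengths) (use t in auto)
    fix x assume "x \<in> lengths_to ?q"
    then obtain T \<gamma> where g: "x = sr_length p1 p2 T \<gamma>" "horizontal G p1 p2 T \<gamma>" "\<gamma> 0 = mat 1" "\<gamma> T = ?q" by auto
    obtain T' \<alpha> \<beta> u where "0 < T'" "hcurve \<kappa> 0 T' \<alpha> \<beta> u" "\<alpha> 0 = 1" "\<beta> 0 = 0"
      "Mat (\<alpha> T') (\<beta> T') = \<gamma> T" "hlength 0 T' u = sr_length p1 p2 T \<gamma>"
      using coordinates_exist[OF g(2,3)] by blast
    then show "t \<le> x" using lb[of T' \<alpha> \<beta> u] g by simp
  qed
  then show ?thesis by (simp add: optimal_def sr_dist_def Exp_Mat)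
qed

lemma optimal_dest:
  assumes opt: "optimal G p1 p2 k \<theta> c t" and w: "cmod w = 1" and t': "0 \<le> t'"
    and eq: "Mat (geoA \<kappa> c' t') (geoB \<kappa> c' w t') = Mat (geoA \<kappa> c t) (geoB \<kappa> c (cis \<theta>) t)"
  shows "t \<le> t'"
proof -
  let ?q = "Mat (geoA \<kappa> c t) (geoB \<kappa> c (cis \<theta>) t)"
  have "Inf (lengths_to ?q) = t" using opt by (simp add: optimal_def sr_dist_def Exp_Mat)
  moreover have "Inf (lengths_to ?q) \<le> t'"
  proof (rule cInf_lower)
    show "t' \<in> lengths_to ?q" using geodesic_in_lengths[OF w t', of c'] by (simp only: eq)
    \<comment> \<open>\<open>Inf\<close> is a lower bound of the lengths only because they are
      bounded below, here by 0.\<close>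
    show "bdd_below (lengths_to ?q)"
    proof (rule bdd_belowI[of _ 0])
      fix x assume "x \<in> lengths_to ?q"
      then obtain T \<gamma> where g: "x = sr_length p1 p2 T \<gamma>" "horizontal G p1 p2 T \<gamma>" "\<gamma> 0 = mat 1" by auto
      from coordinates_exist[OF g(2,3)] show "0 \<le> x" using g(1) hlength_nonneg by metis
    qed
  qed
  ultimately show ?thesis by simp
qed

lemma cut_locus_iff:
  "q \<in> cut_locus G p1 p2 k \<longleftrightarrow> (\<exists>\<theta>1 c1 \<theta>2 c2 t. \<theta>1 \<in> {0..<2*pi} \<and> \<theta>2 \<in> {0..<2*pi} \<and> (\<theta>1, c1) \<noteq> (\<theta>2, c2) \<and> 0 < t \<and>
     q = Mat (geoA \<kappa> c1 t) (geoB \<kappa> c1 (cis \<theta>1) t) \<and> q = Mat (geoA \<kappa> c2 t) (geoB \<kappa> c2 (cis \<theta>2) t) \<and>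
     optimal G p1 p2 k \<theta>1 c1 t \<and> optimal G p1 p2 k \<theta>2 c2 t)" (is "_ \<longleftrightarrow> ?R")
proof -
  have "Mat (geoA \<kappa> c t) (geoB \<kappa> c (cis \<theta>) t) \<in> G" for c t \<theta>
    by (intro Mat_in geo_norm) simp
  then have "q \<in> G" if ?R using that by (elim exE conjE) simp
  then have "(q \<in> G \<and> ?R) = ?R" by argo
  then show ?thesis unfolding cut_locus_def Exp_Mat mem_Collect_eq .
qed

end

lemma cis_angle_exists:
  assumes "cmod w = 1"
  obtains \<theta> where "\<theta> \<in> {0..<2*pi}" "cis \<theta> = w"
proof -
  have "w \<noteq> 0" using assms by auto
  have "w = cis (Arg2pi w)" using Arg2pi_eq[of w] assms by (simp add: cis_conv_exp)
  then show thesis using that[of "Arg2pi w"] Arg2pi_ge_0 Arg2pi_lt_2pi by auto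
qed

lemma cis_angle_unique:
  assumes "a \<in> {0..<2*pi}" "b \<in> {0..<2*pi}" "cis a = cis b"
  shows "a = b"
proof -
  have "exp (\<i> * of_real a) = exp (\<i> * of_real b)" using assms(3) by (simp add: cis_conv_exp)
  then obtain n :: int where "\<i> * of_real a = \<i> * of_real b + (of_int (2 * n) * pi) * \<i>"
    unfolding exp_eq by auto
  then have "Im (\<i> * of_real a) = Im (\<i> * of_real b + (of_int (2 * n) * pi) * \<i>)" by simp
  then have ab: "a = b + 2 * real_of_int n * pi" by simp
  then have "real_of_int n * pi < 1 * pi" "(-1) * pi < real_of_int n * pi"
    using assms(1,2) unfolding atLeastLessThan_iff by linarith+
  then have "real_of_int n < 1" "-1 < real_of_int n" using pi_gt_zero by (simp_all only: mult_less_cancel_right_pos)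
  then have "n = 0" by linarith
  then show ?thesis using ab by simp
qed

section \<open>Exponentials\<close>

lemma matrix_scaleR_left: "(c *\<^sub>R A) ** B = c *\<^sub>R (A ** B)" for A :: "'a::real_algebra_1^'m^'n"
  using scalar_matrix_assoc by metis

text \<open>Three series are provided for, since exponentials in SO(3) have a term in
  \<open>X ** X\<close> besides those in \<open>mat 1\<close> and \<open>X\<close>.\<close>

lemma sums_matrix_exp:
  fixes A B C D :: "'a::real_normed_field^'n^'n"
  assumes "\<And>n. (1 / fact n) *\<^sub>R ((\<lambda>X. A ** X) ^^ n) (mat 1) = a n *\<^sub>R B + b n *\<^sub>R C + c n *\<^sub>R D"
    and "a sums x" "b sums y" "c sums z"
  shows "matrix_exp A = x *\<^sub>R B + y *\<^sub>R C + z *\<^sub>R D"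
proof -
  have "(\<lambda>n. a n *\<^sub>R B + b n *\<^sub>R C + c n *\<^sub>R D) sums (x *\<^sub>R B + y *\<^sub>R C + z *\<^sub>R D)"
    using assms by (intro sums_add sums_scaleR_left)
  then show ?thesis unfolding matrix_exp_def assms(1) by (rule sums_unique[symmetric])
qed

lemma sums_cosq: "(\<lambda>n. if even n then (- y) ^ (n div 2) * t ^ n / fact n else 0) sums cosq y t"
proof -
  consider "0 < y" | "y < 0" | "y = 0" by linarith
  then show ?thesis
  proof cases
    case 1
    have "cos_coeff n *\<^sub>R (sqrt y * t) ^ n = (if even n then (- y) ^ (n div 2) * t ^ n / fact n else 0)" for n
    proof (cases "even n")
      case True
      then obtain m where m: "n = 2 * m" by blast
      have "(sqrt y) ^ (2 * m) = y ^ m" using 1 by (simp add: power_mult)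
      then show ?thesis using m by (simp add: cos_coeff_def power_mult_distrib power_minus[of y])
    qed (simp add: cos_coeff_def)
    then show ?thesis using cos_converges[of "sqrt y * t"] 1 by (simp add: cosq_def)
  next
    case 2
    have "(if even n then (sqrt (- y) * t) ^ n /\<^sub>R fact n else 0) = (if even n then (- y) ^ (n div 2) * t ^ n / fact n else 0)" for n
    proof (cases "even n")
      case True
      then obtain m where m: "n = 2 * m" by blast
      have "(sqrt (- y)) ^ (2 * m) = (- y) ^ m" using 2 by (simp add: power_mult)
      then show ?thesis using m by (simp add: power_mult_distrib divide_inverse mult_ac)
    qed simp
    then show ?thesis using cosh_converges[of "sqrt (- y) * t"] 2 by (simp add: cosq_def)
  next
    case 3
    have "(\<lambda>n. if n = 0 then 1 else 0) sums (1::real)" using sums_single[of 0 "\<lambda>_. 1::real"] by simp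
    moreover have "(if even n then (- y) ^ (n div 2) * t ^ n / fact n else 0) = (if n = 0 then 1 else 0)" for n
      using 3 by (auto simp: power_0_left elim!: evenE)
    ultimately show ?thesis using 3 by (simp add: cosq_def)
  qed
qed

lemma sums_sinq: "(\<lambda>n. if even n then 0 else (- y) ^ (n div 2) * t ^ n / fact n) sums sinq y t"
proof -
  consider "0 < y" | "y < 0" | "y = 0" by linarith
  then show ?thesis
  proof cases
    case 1
    have "sin_coeff n *\<^sub>R (sqrt y * t) ^ n / sqrt y = (if even n then 0 else (- y) ^ (n div 2) * t ^ n / fact n)" for n
    proof (cases "even n")
      case False
      then obtain m where m: "n = 2 * m + 1" by (auto elim: oddE)
      have "(sqrt y) ^ n = y ^ m * sqrt y" using 1 by (simp add: m power_mult)
      then show ?thesis using m 1 by (simp add: sin_coeff_def power_mult_distrib power_minus[of y])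
    qed (simp add: sin_coeff_def)
    then show ?thesis using sums_divide[OF sin_converges[of "sqrt y * t"], of "sqrt y"] 1 by (simp add: sinq_def)
  next
    case 2
    have "(if even n then 0 else (sqrt (- y) * t) ^ n /\<^sub>R fact n) / sqrt (- y) = (if even n then 0 else (- y) ^ (n div 2) * t ^ n / fact n)" for n
    proof (cases "even n")
      case False
      then obtain m where m: "n = 2 * m + 1" by (auto elim: oddE)
      have "(sqrt (- y)) ^ n = (- y) ^ m * sqrt (- y)" using 2 by (simp add: m power_mult)
      then show ?thesis using m 2 by (simp add: power_mult_distrib divide_inverse mult_ac)
    qed simp
    then show ?thesis using sums_divide[OF sinh_converges[of "sqrt (- y) * t"], of "sqrt (- y)"] 2 by (simp add: sinq_def)
  next
    case 3
    have "(\<lambda>n. if n = 1 then t else 0) sums t" using sums_single[of 1 "\<lambda>_. t"] by simp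
    moreover have "(if even n then 0 else (- y) ^ (n div 2) * t ^ n / fact n) = (if n = 1 then t else 0)" for n
      using 3 by (auto simp: power_0_left elim!: oddE)
    ultimately show ?thesis using 3 by (simp add: sinq_def)
  qed
qed

text \<open>The powers of \<open>X\<close> alternate between multiples of \<open>mat 1\<close> and
  of \<open>X\<close>, and their coefficients are the series of \<open>cosq\<close> and
  \<open>sinq\<close>.\<close>

lemma matrix_exp_quadratic:
  fixes X :: "'a::real_normed_field^'n^'n"
  assumes X: "X ** X = (- y) *\<^sub>R mat 1"
  shows "matrix_exp (t *\<^sub>R X) = cosq y t *\<^sub>R mat 1 + sinq y t *\<^sub>R X"
proof -
  have it: "((\<lambda>Z. (t *\<^sub>R X) ** Z) ^^ n) (mat 1) =
    (if even n then ((- y) ^ (n div 2) * t ^ n) *\<^sub>R mat 1 else ((- y) ^ (n div 2) * t ^ n) *\<^sub>R X)" for n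
  proof (induction n)
    case (Suc n)
    show ?case
    proof (cases "even n")
      case True
      then show ?thesis using Suc by (simp add: matrix_scaleR_left matrix_scalar_ac mult_ac)
    next
      case False
      then obtain m where "n = 2 * m + 1" by (auto elim: oddE)
      then show ?thesis using Suc by (simp add: matrix_scaleR_left matrix_scalar_ac X mult_ac)
    qed
  qed simp
  have "matrix_exp (t *\<^sub>R X) = cosq y t *\<^sub>R mat 1 + sinq y t *\<^sub>R X + 0 *\<^sub>R 0"
    by (rule sums_matrix_exp[OF _ sums_cosq sums_sinq sums_zero]) (simp add: it)
  then show ?thesis by simp
qed

section \<open>The groups SU(2) and SL(2)\<close>

lemma mat2_eq_iff: "(A::'a^2^2) = B \<longleftrightarrow> A$1$1 = B$1$1 \<and> A$1$2 = B$1$2 \<and> A$2$1 = B$2$1 \<and> A$2$2 = B$2$2"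
  by (auto simp: vec_eq_iff forall_2)

lemma mat2_mult: "((A::'a::semiring_1^2^2) ** B) $ i $ j = A$i$1 * B$1$j + A$i$2 * B$2$j"
  by (simp add: matrix_matrix_mult_def sum_2)

lemma mat2_one: "(mat 1 :: 'a::zero_neq_one^2^2)$1$1 = 1" "(mat 1 :: 'a^2^2)$1$2 = 0"
  "(mat 1 :: 'a^2^2)$2$1 = 0" "(mat 1 :: 'a^2^2)$2$2 = 1"
  by (simp_all add: mat_def)

lemmas mat2_simps = mat2_eq_iff mat2_mult mat2_one

lemma has_vector_derivative_vec:
  fixes f :: "real \<Rightarrow> 'a::real_normed_vector^'n"
  assumes "\<And>i. ((\<lambda>t. f t $ i) has_vector_derivative D $ i) (at t within S)"
  shows "(f has_vector_derivative D) (at t within S)"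
  unfolding has_vector_derivative_iff_remainder
proof (rule vec_tendstoI)
  fix i
  show "((\<lambda>y. ((f y - f t - (y - t) *\<^sub>R D) /\<^sub>R norm (y - t)) $ i) \<longlongrightarrow> 0 $ i) (at t within S)"
    using assms[of i] unfolding has_vector_derivative_iff_remainder by simp
qed

definition MSU :: "complex \<Rightarrow> complex \<Rightarrow> complex^2^2" where
  "MSU \<alpha> \<beta> = vector [vector [\<alpha>, \<beta>], vector [- cnj \<beta>, cnj \<alpha>]]"

lemma MSU_nth [simp]: "MSU \<alpha> \<beta> $1$1 = \<alpha>" "MSU \<alpha> \<beta> $1$2 = \<beta>" "MSU \<alpha> \<beta> $2$1 = - cnj \<beta>" "MSU \<alpha> \<beta> $2$2 = cnj \<alpha>"
  by (simp_all add: MSU_def)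

lemma su2_basis_nth [simp]:
  "su2_p1$1$1 = 0" "su2_p1$1$2 = 1/2" "su2_p1$2$1 = -1/2" "su2_p1$2$2 = 0"
  "su2_p2$1$1 = 0" "su2_p2$1$2 = \<i>/2" "su2_p2$2$1 = \<i>/2" "su2_p2$2$2 = 0"
  "su2_k$1$1 = \<i>/2" "su2_k$1$2 = 0" "su2_k$2$1 = 0" "su2_k$2$2 = -\<i>/2"
  by (simp_all add: su2_p1_def su2_p2_def su2_k_def) (simp_all add: scaleR_conv_of_real)

lemma complex_unit_sum_cnj:
  assumes "(cmod \<alpha>)\<^sup>2 + (cmod \<beta>)\<^sup>2 = 1"
  shows "\<alpha> * cnj \<alpha> + \<beta> * cnj \<beta> = 1"
  using assms by (metis complex_norm_square of_real_1 of_real_add)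

lemma MSU_in_SU2:
  assumes "(cmod \<alpha>)\<^sup>2 + (cmod \<beta>)\<^sup>2 = 1"
  shows "MSU \<alpha> \<beta> \<in> SU2"
  using complex_unit_sum_cnj[OF assms]
  by (simp add: SU2_def mat2_simps conj_transpose_def det_2 algebra_simps)

lemma SU2_eq_MSU:
  assumes "A \<in> SU2"
  shows "A = MSU (A$1$1) (A$1$2)" "(cmod (A$1$1))\<^sup>2 + (cmod (A$1$2))\<^sup>2 = 1"
proof -
  define a b c d where "a = A$1$1" "b = A$1$2" "c = A$2$1" "d = A$2$2"
  note abcd = this
  have e: "a * cnj a + b * cnj b = 1" "a * cnj c + b * cnj d = 0" "a * d - b * c = 1"
    using assms by (auto simp: SU2_def mat2_simps conj_transpose_def det_2 abcd)
  have e2: "cnj a * c + cnj b * d = 0" using arg_cong[OF e(2), of cnj] by simp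
  \<comment> \<open>Multiplying by the determinant and exchanging the mixed products by
    orthogonality of the rows solves for the second row.\<close>
  have "cnj a = cnj a * (a * d - b * c)" using e by simp
  also have "\<dots> = (a * cnj a) * d - b * (cnj a * c)" by (simp add: algebra_simps)
  also have "cnj a * c = - (cnj b * d)" using e2 by (simp add: eq_neg_iff_add_eq_0)
  also have "(a * cnj a) * d - b * (- (cnj b * d)) = (a * cnj a + b * cnj b) * d" by (simp add: algebra_simps)
  finally have d: "d = cnj a" using e by simp
  have "- cnj b = - cnj b * (a * d - b * c)" using e by simp
  also have "\<dots> = b * cnj b * c - a * (cnj b * d)" by (simp add: algebra_simps)
  also have "cnj b * d = - (cnj a * c)" using e2 by (simp add: eq_neg_iff_add_eq_0 add.commute)
  also have "b * cnj b * c - a * (- (cnj a * c)) = (a * cnj a + b * cnj b) * c" by (simp add: algebra_simps)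
  finally have c: "c = - cnj b" using e by simp
  show "A = MSU (A$1$1) (A$1$2)" using c d by (simp add: mat2_simps abcd)
  have "complex_of_real ((cmod a)\<^sup>2 + (cmod b)\<^sup>2) = 1" using e(1) unfolding of_real_add complex_norm_square .
  then show "(cmod (A$1$1))\<^sup>2 + (cmod (A$1$2))\<^sup>2 = 1" unfolding abcd using of_real_eq_1_iff by blast
qed

interpretation su2_algebra: kp_algebra SU2 su2_p1 su2_p2
proof
  fix a b assume "a *\<^sub>R su2_p1 + b *\<^sub>R su2_p2 = 0"
  then show "a = 0 \<and> b = 0" by (simp add: mat2_eq_iff complex_eq_iff)
next
  fix g assume "g \<in> SU2" then show "invertible g" by (auto simp: SU2_def invertible_def)
qed

lemma su2_vel: "su2_algebra.vel u = MSU 0 (u / 2)"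
  by (simp add: su2_algebra.vel_def mat2_eq_iff complex_eq_iff)

lemma MSU_mult: "MSU \<alpha> \<beta> ** MSU \<alpha>' \<beta>' = MSU (\<alpha> * \<alpha>' - \<beta> * cnj \<beta>') (\<alpha> * \<beta>' + \<beta> * cnj \<alpha>')"
  by (simp add: mat2_simps algebra_simps)

lemma su2_exp:
  "Exp_geod su2_p1 su2_p2 su2_k \<theta> c t = MSU (geoA 1 c t) (geoB 1 c (cis \<theta>) t)"
proof -
  let ?X = "cos \<theta> *\<^sub>R su2_p1 + sin \<theta> *\<^sub>R su2_p2 + c *\<^sub>R su2_k"
  let ?y = "(c\<^sup>2 + 1) / 4"
  have "?X ** ?X = (- ?y) *\<^sub>R mat 1"
    by (simp add: mat2_simps complex_eq_iff power2_eq_square field_simps)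
      (use sin_cos_squared_add[of \<theta>] in \<open>simp add: power2_eq_square\<close>)
  then have 1: "matrix_exp (t *\<^sub>R ?X) = cosq ?y t *\<^sub>R mat 1 + sinq ?y t *\<^sub>R ?X" by (rule matrix_exp_quadratic)
  have "su2_k ** su2_k = (- (1 / 4)) *\<^sub>R mat 1"
    by (simp add: mat2_simps complex_eq_iff)
  from matrix_exp_quadratic[OF this, of "- (c * t)"]
  have 2: "matrix_exp (- ((c * t) *\<^sub>R su2_k)) = MSU (cis (- (c * t / 2))) 0"
    by (simp add: mat2_simps cosq_def sinq_def complex_eq_iff real_sqrt_divide)
  have 3: "cosq ?y t *\<^sub>R mat 1 + sinq ?y t *\<^sub>R ?X = MSU (Complex (cosq ?y t) (c / 2 * sinq ?y t)) (of_real (sinq ?y t / 2) * cis \<theta>)"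
    by (simp add: mat2_simps complex_eq_iff algebra_simps)
  show ?thesis unfolding Exp_geod_def 1 2 3 MSU_mult
    by (simp add: geoA_def geoB_def cis_cnj mult_ac)
qed

interpretation su2: kp_group SU2 su2_p1 su2_p2 su2_k 1 MSU
proof
  show "MSU 1 0 = mat 1" by (simp add: mat2_simps)
  show "MSU \<alpha> \<beta> \<in> SU2" if "(cmod \<alpha>)\<^sup>2 + 1 * (cmod \<beta>)\<^sup>2 = 1" for \<alpha> \<beta> using MSU_in_SU2 that by simp
  show "Exp_geod su2_p1 su2_p2 su2_k \<theta> c t = MSU (geoA 1 c t) (geoB 1 c (cis \<theta>) t)" for \<theta> c t by (rule su2_exp)
  show "continuous_on S (\<lambda>t. MSU (\<alpha> t) (\<beta> t))" if "continuous_on S \<alpha>" "continuous_on S \<beta>" for \<alpha> \<beta> and S :: "real set"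
  proof -
    have "continuous_on S (\<lambda>t. \<chi> i j. MSU (\<alpha> t) (\<beta> t) $ i $ j)"
    proof (intro continuous_on_vec_lambda)
      show "continuous_on S (\<lambda>t. MSU (\<alpha> t) (\<beta> t) $ i $ j)" for i j
        using exhaust_2[of i] exhaust_2[of j] that by (auto simp: continuous_on_minus continuous_on_cnj)
    qed
    then show ?thesis by (simp only: vec_lambda_eta)
  qed
  show "((\<lambda>t. MSU (\<alpha> t) (\<beta> t)) has_vector_derivative MSU (\<alpha> t) (\<beta> t) ** su2_algebra.vel u) (at t within S)"
    if a: "(\<alpha> has_vector_derivative of_real (- (1 / 2)) * \<beta> t * cnj u) (at t within S)"
      and b: "(\<beta> has_vector_derivative 1 / 2 * \<alpha> t * u) (at t within S)" for \<alpha> \<beta> u and t :: real and S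
  proof (intro has_vector_derivative_vec)
    note c = bounded_linear.has_vector_derivative[OF bounded_linear_cnj a]
      has_vector_derivative_minus[OF bounded_linear.has_vector_derivative[OF bounded_linear_cnj b]]
    show "((\<lambda>t. MSU (\<alpha> t) (\<beta> t) $ i $ j) has_vector_derivative (MSU (\<alpha> t) (\<beta> t) ** su2_algebra.vel u) $ i $ j) (at t within S)" for i j
      using exhaust_2[of i] exhaust_2[of j] a b c by (auto simp: su2_vel MSU_mult mult_ac)
  qed
  show "\<exists>\<alpha> \<beta> u. hcurve 1 0 T \<alpha> \<beta> u \<and> \<alpha> 0 = 1 \<and> \<beta> 0 = 0 \<and> MSU (\<alpha> T) (\<beta> T) = \<gamma> T \<and>
        hlength 0 T u = sr_length su2_p1 su2_p2 T \<gamma>"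
    if T: "0 < T" and h: "horizontal SU2 su2_p1 su2_p2 T \<gamma>" and g0: "\<gamma> 0 = mat 1" for T \<gamma>
  proof -
    obtain u N where N: "negligible N"
      "\<And>t. t \<in> {0..T} - N \<Longrightarrow> (\<gamma> has_vector_derivative \<gamma> t ** su2_algebra.vel (u t)) (at t within {0..T})"
      "sr_length su2_p1 su2_p2 T \<gamma> = hlength 0 T u"
      using su2_algebra.horizontal_control[OF h T] by metis
    have G: "\<gamma> t \<in> SU2" if "t \<in> {0..T}" for t using h that by (auto simp: horizontal_def)
    have lip: "lip_on {0..T} \<gamma>" using h by (auto simp: horizontal_def lip_on_def)
    have bl: "bounded_linear (\<lambda>A::complex^2^2. A $ i $ j)" for i j
      by (rule bounded_linear_compose[OF bounded_linear_vec_nth bounded_linear_vec_nth])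
    have "hcurve 1 0 T (\<lambda>t. \<gamma> t $1$1) (\<lambda>t. \<gamma> t $1$2) u"
      unfolding hcurve_def
    proof (intro conjI exI[of _ N] ballI)
      fix t assume t: "t \<in> {0..<T} - N"
      have D: "(\<gamma> has_vector_derivative \<gamma> t ** su2_algebra.vel (u t)) (at t within {t..T})"
        by (rule has_vector_derivative_within_subset[OF N(2)]) (use t in auto)
      have "\<gamma> t = MSU (\<gamma> t $1$1) (\<gamma> t $1$2)" by (rule SU2_eq_MSU[OF G]) (use t in auto)
      then have "\<gamma> t ** su2_algebra.vel (u t) = MSU (\<gamma> t $1$1) (\<gamma> t $1$2) ** MSU 0 (u t / 2)" by (simp add: su2_vel)
      note D' = D[unfolded this MSU_mult]
      show "((\<lambda>t. \<gamma> t $1$1) has_vector_derivative of_real (- (1 / 2)) * \<gamma> t $1$2 * cnj (u t)) (at t within {t..T})"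
        using bounded_linear.has_vector_derivative[OF bl[of 1 1] D'] by simp
      show "((\<lambda>t. \<gamma> t $1$2) has_vector_derivative 1 / 2 * \<gamma> t $1$1 * u t) (at t within {t..T})"
        using bounded_linear.has_vector_derivative[OF bl[of 1 2] D'] by simp
    qed (use T N SU2_eq_MSU(2)[OF G] lip_on_bounded_linear[OF bl lip] in auto)
    then show ?thesis using g0 N(3) SU2_eq_MSU(1)[OF G[of T]] T
      by (intro exI[of _ "\<lambda>t. \<gamma> t $1$1"] exI[of _ "\<lambda>t. \<gamma> t $1$2"] exI[of _ u]) (simp add: mat2_one)
  qed
qed

text \<open>The coordinates of \<open>SL(2)\<close> come from its Cayley conjugation to \<open>SU(1,1)\<close>.\<close>

definition MSL :: "complex \<Rightarrow> complex \<Rightarrow> real^2^2" where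
  "MSL \<alpha> \<beta> = vector [vector [Re \<alpha> + Re \<beta>, Im \<beta> - Im \<alpha>], vector [Im \<alpha> + Im \<beta>, Re \<alpha> - Re \<beta>]]"

definition slA :: "real^2^2 \<Rightarrow> complex" where
  "slA M = Complex ((M$1$1 + M$2$2) / 2) ((M$2$1 - M$1$2) / 2)"

definition slB :: "real^2^2 \<Rightarrow> complex" where
  "slB M = Complex ((M$1$1 - M$2$2) / 2) ((M$1$2 + M$2$1) / 2)"

lemma MSL_nth [simp]:
  "MSL \<alpha> \<beta> $1$1 = Re \<alpha> + Re \<beta>" "MSL \<alpha> \<beta> $1$2 = Im \<beta> - Im \<alpha>"
  "MSL \<alpha> \<beta> $2$1 = Im \<alpha> + Im \<beta>" "MSL \<alpha> \<beta> $2$2 = Re \<alpha> - Re \<beta>"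
  by (simp_all add: MSL_def)

lemma MSL_coordinates: "MSL (slA M) (slB M) = M"
  by (simp add: mat2_eq_iff slA_def slB_def field_simps)

lemma coordinates_MSL [simp]: "slA (MSL \<alpha> \<beta>) = \<alpha>" "slB (MSL \<alpha> \<beta>) = \<beta>"
  by (simp_all add: slA_def slB_def complex_eq_iff)

lemma MSL_inj: "MSL \<alpha> \<beta> = MSL \<alpha>' \<beta>' \<longleftrightarrow> \<alpha> = \<alpha>' \<and> \<beta> = \<beta>'"
  by (metis coordinates_MSL)

lemma det_MSL: "det (MSL \<alpha> \<beta>) = (cmod \<alpha>)\<^sup>2 - (cmod \<beta>)\<^sup>2"
  by (simp add: det_2 cmod_power2) (simp add: power2_eq_square algebra_simps)

lemma MSL_in_SL2: "(cmod \<alpha>)\<^sup>2 + (-1) * (cmod \<beta>)\<^sup>2 = 1 \<Longrightarrow> MSL \<alpha> \<beta> \<in> SL2"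
  by (simp add: SL2_def det_MSL)

lemma SL2_coordinates: "M \<in> SL2 \<Longrightarrow> (cmod (slA M))\<^sup>2 + (-1) * (cmod (slB M))\<^sup>2 = 1"
  using det_MSL[of "slA M" "slB M"] by (simp add: SL2_def MSL_coordinates)

lemma MSL_mult: "MSL \<alpha> \<beta> ** MSL \<alpha>' \<beta>' = MSL (\<alpha> * \<alpha>' + \<beta> * cnj \<beta>') (\<alpha> * \<beta>' + \<beta> * cnj \<alpha>')"
  by (simp add: mat2_simps algebra_simps)

lemma sl2_basis_nth [simp]:
  "sl2_p1$1$1 = 1/2" "sl2_p1$1$2 = 0" "sl2_p1$2$1 = 0" "sl2_p1$2$2 = -1/2"
  "sl2_p2$1$1 = 0" "sl2_p2$1$2 = 1/2" "sl2_p2$2$1 = 1/2" "sl2_p2$2$2 = 0"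
  "sl2_k$1$1 = 0" "sl2_k$1$2 = -1/2" "sl2_k$2$1 = 1/2" "sl2_k$2$2 = 0"
  by (simp_all add: sl2_p1_def sl2_p2_def sl2_k_def)

interpretation sl2_algebra: kp_algebra SL2 sl2_p1 sl2_p2
proof
  fix a b assume "a *\<^sub>R sl2_p1 + b *\<^sub>R sl2_p2 = 0"
  then show "a = 0 \<and> b = 0" by (simp add: mat2_eq_iff)
next
  fix g assume "g \<in> SL2" then show "invertible g" by (simp add: SL2_def invertible_det_nz)
qed

lemma sl2_vel: "sl2_algebra.vel u = MSL 0 (u / 2)"
  by (simp add: sl2_algebra.vel_def mat2_eq_iff)

lemma sl2_exp:
  "Exp_geod sl2_p1 sl2_p2 sl2_k \<theta> c t = MSL (geoA (-1) c t) (geoB (-1) c (cis \<theta>) t)"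
proof -
  let ?X = "cos \<theta> *\<^sub>R sl2_p1 + sin \<theta> *\<^sub>R sl2_p2 + c *\<^sub>R sl2_k"
  let ?y = "(c\<^sup>2 + -1) / 4"
  have "?X ** ?X = (- ?y) *\<^sub>R mat 1"
    using sin_cos_squared_add[of \<theta>] by (simp add: mat2_simps power2_eq_square field_simps)
  then have 1: "matrix_exp (t *\<^sub>R ?X) = cosq ?y t *\<^sub>R mat 1 + sinq ?y t *\<^sub>R ?X" by (rule matrix_exp_quadratic)
  have "sl2_k ** sl2_k = (- (1 / 4)) *\<^sub>R mat 1"
    by (simp add: mat2_simps)
  from matrix_exp_quadratic[OF this, of "- (c * t)"]
  have 2: "matrix_exp (- ((c * t) *\<^sub>R sl2_k)) = MSL (cis (- (c * t / 2))) 0"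
    by (simp add: mat2_simps cosq_def sinq_def real_sqrt_divide)
  have 3: "cosq ?y t *\<^sub>R mat 1 + sinq ?y t *\<^sub>R ?X = MSL (Complex (cosq ?y t) (c / 2 * sinq ?y t)) (of_real (sinq ?y t / 2) * cis \<theta>)"
    by (simp add: mat2_simps algebra_simps)
  show ?thesis unfolding Exp_geod_def 1 2 3 MSL_mult
    by (simp add: geoA_def geoB_def cis_cnj mult_ac)
qed

lemma bounded_linear_slA: "bounded_linear slA" and bounded_linear_slB: "bounded_linear slB"
  unfolding linear_conv_bounded_linear[symmetric]
  by (auto intro!: linearI simp: slA_def slB_def complex_eq_iff field_simps)

interpretation sl2: kp_group SL2 sl2_p1 sl2_p2 sl2_k "-1" MSL
proof
  show "MSL 1 0 = mat 1" by (simp add: mat2_simps)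
  show "MSL \<alpha> \<beta> \<in> SL2" if "(cmod \<alpha>)\<^sup>2 + (-1) * (cmod \<beta>)\<^sup>2 = 1" for \<alpha> \<beta> using MSL_in_SL2[OF that] .
  show "Exp_geod sl2_p1 sl2_p2 sl2_k \<theta> c t = MSL (geoA (-1) c t) (geoB (-1) c (cis \<theta>) t)" for \<theta> c t by (rule sl2_exp)
  show "continuous_on S (\<lambda>t. MSL (\<alpha> t) (\<beta> t))" if "continuous_on S \<alpha>" "continuous_on S \<beta>" for \<alpha> \<beta> and S :: "real set"
  proof -
    have "continuous_on S (\<lambda>t. \<chi> i j. MSL (\<alpha> t) (\<beta> t) $ i $ j)"
    proof (intro continuous_on_vec_lambda)
      show "continuous_on S (\<lambda>t. MSL (\<alpha> t) (\<beta> t) $ i $ j)" for i j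
        using exhaust_2[of i] exhaust_2[of j] that
        by (auto simp: continuous_on_diff continuous_on_add continuous_on_Re continuous_on_Im)
    qed
    then show ?thesis by (simp only: vec_lambda_eta)
  qed
  show "((\<lambda>t. MSL (\<alpha> t) (\<beta> t)) has_vector_derivative MSL (\<alpha> t) (\<beta> t) ** sl2_algebra.vel u) (at t within S)"
    if a: "(\<alpha> has_vector_derivative of_real (- (-1 / 2)) * \<beta> t * cnj u) (at t within S)"
      and b: "(\<beta> has_vector_derivative 1 / 2 * \<alpha> t * u) (at t within S)" for \<alpha> \<beta> u and t :: real and S
  proof (intro has_vector_derivative_vec)
    have a': "(\<alpha> has_vector_derivative \<beta> t * cnj (u / 2)) (at t within S)" using a by simp
    have b': "(\<beta> has_vector_derivative \<alpha> t * (u / 2)) (at t within S)" using b by simp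
    note ra = bounded_linear.has_vector_derivative[OF bounded_linear_Re a']
    note ia = bounded_linear.has_vector_derivative[OF bounded_linear_Im a']
    note rb = bounded_linear.has_vector_derivative[OF bounded_linear_Re b']
    note ib = bounded_linear.has_vector_derivative[OF bounded_linear_Im b']
    note c = has_vector_derivative_add[OF ra rb] has_vector_derivative_add[OF ia ib]
      has_vector_derivative_diff[OF ib ia] has_vector_derivative_diff[OF ra rb]
    show "((\<lambda>t. MSL (\<alpha> t) (\<beta> t) $ i $ j) has_vector_derivative (MSL (\<alpha> t) (\<beta> t) ** sl2_algebra.vel u) $ i $ j) (at t within S)" for i j
      unfolding sl2_vel MSL_mult using exhaust_2[of i] exhaust_2[of j] c
      by (elim disjE) (simp_all only: MSL_nth mult_zero_right complex_cnj_zero add_0_left add_0_right)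
  qed
  show "\<exists>\<alpha> \<beta> u. hcurve (-1) 0 T \<alpha> \<beta> u \<and> \<alpha> 0 = 1 \<and> \<beta> 0 = 0 \<and> MSL (\<alpha> T) (\<beta> T) = \<gamma> T \<and>
        hlength 0 T u = sr_length sl2_p1 sl2_p2 T \<gamma>"
    if T: "0 < T" and h: "horizontal SL2 sl2_p1 sl2_p2 T \<gamma>" and g0: "\<gamma> 0 = mat 1" for T \<gamma>
  proof -
    obtain u N where N: "negligible N"
      "\<And>t. t \<in> {0..T} - N \<Longrightarrow> (\<gamma> has_vector_derivative \<gamma> t ** sl2_algebra.vel (u t)) (at t within {0..T})"
      "sr_length sl2_p1 sl2_p2 T \<gamma> = hlength 0 T u"
      using sl2_algebra.horizontal_control[OF h T] by metis
    have G: "\<gamma> t \<in> SL2" if "t \<in> {0..T}" for t using h that by (auto simp: horizontal_def)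
    have lip: "lip_on {0..T} \<gamma>" using h by (auto simp: horizontal_def lip_on_def)
    have "hcurve (-1) 0 T (\<lambda>t. slA (\<gamma> t)) (\<lambda>t. slB (\<gamma> t)) u"
      unfolding hcurve_def
    proof (intro conjI exI[of _ N] ballI)
      fix t assume t: "t \<in> {0..<T} - N"
      have D: "(\<gamma> has_vector_derivative \<gamma> t ** sl2_algebra.vel (u t)) (at t within {t..T})"
        by (rule has_vector_derivative_within_subset[OF N(2)]) (use t in auto)
      have "\<gamma> t ** sl2_algebra.vel (u t) = MSL (slA (\<gamma> t)) (slB (\<gamma> t)) ** MSL 0 (u t / 2)"
        by (simp add: sl2_vel MSL_coordinates)
      note D' = D[unfolded this MSL_mult]
      show "((\<lambda>t. slA (\<gamma> t)) has_vector_derivative of_real (- (-1 / 2)) * slB (\<gamma> t) * cnj (u t)) (at t within {t..T})"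
        using bounded_linear.has_vector_derivative[OF bounded_linear_slA D'] by simp
      show "((\<lambda>t. slB (\<gamma> t)) has_vector_derivative 1 / 2 * slA (\<gamma> t) * u t) (at t within {t..T})"
        using bounded_linear.has_vector_derivative[OF bounded_linear_slB D'] by simp
    next
      fix t assume "t \<in> {0..T}"
      then show "(cmod (slA (\<gamma> t)))\<^sup>2 + (-1) * (cmod (slB (\<gamma> t)))\<^sup>2 = 1" by (intro SL2_coordinates G)
    qed (use T N lip_on_bounded_linear[OF bounded_linear_slA lip] lip_on_bounded_linear[OF bounded_linear_slB lip] in auto)
    moreover have "slA (mat 1) = 1" "slB (mat 1) = 0"
      by (simp_all add: slA_def slB_def mat2_one complex_eq_iff)
    ultimately show ?thesis using g0 N(3)
      by (intro exI[of _ "\<lambda>t. slA (\<gamma> t)"] exI[of _ "\<lambda>t. slB (\<gamma> t)"] exI[of _ u])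
         (simp add: MSL_coordinates)
  qed
qed

section \<open>The double covering of SO(3)\<close>

lemma mat3_eq_iff: "(A::'a^3^3) = B \<longleftrightarrow> A$1$1 = B$1$1 \<and> A$1$2 = B$1$2 \<and> A$1$3 = B$1$3 \<and>
    A$2$1 = B$2$1 \<and> A$2$2 = B$2$2 \<and> A$2$3 = B$2$3 \<and> A$3$1 = B$3$1 \<and> A$3$2 = B$3$2 \<and> A$3$3 = B$3$3"
  by (auto simp: vec_eq_iff forall_3)

lemma mat3_mult: "((A::'a::semiring_1^3^3) ** B) $ i $ j = A$i$1 * B$1$j + A$i$2 * B$2$j + A$i$3 * B$3$j"
  by (simp add: matrix_matrix_mult_def sum_3)

lemma mat3_one: "(mat 1 :: 'a::zero_neq_one^3^3)$i$j = (if i = j then 1 else 0)"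
  by (simp add: mat_def)

lemmas mat3_simps = mat3_eq_iff mat3_mult mat3_one

text \<open>The Euler-Rodrigues matrix of the quaternion with real part \<open>x\<close> and vector
  part \<open>(z, w, y)\<close>, whose entries belong to \<open>p1\<close>, \<open>p2\<close> and
  \<open>k\<close> in this order.\<close>

definition RR :: "complex \<Rightarrow> complex \<Rightarrow> real^3^3" where
  "RR \<alpha> \<beta> = (let x = Re \<alpha>; y = Im \<alpha>; z = Re \<beta>; w = Im \<beta> in
     vector [vector [x * x - y * y + z * z - w * w, 2 * (z * w - x * y), 2 * (x * w + y * z)],
             vector [2 * (x * y + z * w), x * x - y * y - z * z + w * w, 2 * (y * w - x * z)],
             vector [2 * (y * z - x * w), 2 * (x * z + y * w), x * x + y * y - z * z - w * w]])"

lemma RR_nth: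
  "RR \<alpha> \<beta> $1$1 = Re \<alpha> * Re \<alpha> - Im \<alpha> * Im \<alpha> + Re \<beta> * Re \<beta> - Im \<beta> * Im \<beta>"
  "RR \<alpha> \<beta> $1$2 = 2 * (Re \<beta> * Im \<beta> - Re \<alpha> * Im \<alpha>)"
  "RR \<alpha> \<beta> $1$3 = 2 * (Re \<alpha> * Im \<beta> + Im \<alpha> * Re \<beta>)"
  "RR \<alpha> \<beta> $2$1 = 2 * (Re \<alpha> * Im \<alpha> + Re \<beta> * Im \<beta>)"
  "RR \<alpha> \<beta> $2$2 = Re \<alpha> * Re \<alpha> - Im \<alpha> * Im \<alpha> - Re \<beta> * Re \<beta> + Im \<beta> * Im \<beta>"
  "RR \<alpha> \<beta> $2$3 = 2 * (Im \<alpha> * Im \<beta> - Re \<alpha> * Re \<beta>)"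
  "RR \<alpha> \<beta> $3$1 = 2 * (Im \<alpha> * Re \<beta> - Re \<alpha> * Im \<beta>)"
  "RR \<alpha> \<beta> $3$2 = 2 * (Re \<alpha> * Re \<beta> + Im \<alpha> * Im \<beta>)"
  "RR \<alpha> \<beta> $3$3 = Re \<alpha> * Re \<alpha> + Im \<alpha> * Im \<alpha> - Re \<beta> * Re \<beta> - Im \<beta> * Im \<beta>"
  by (simp_all add: RR_def Let_def)

lemma RR_mult: "RR \<alpha> \<beta> ** RR \<alpha>' \<beta>' = RR (\<alpha> * \<alpha>' - \<beta> * cnj \<beta>') (\<alpha> * \<beta>' + \<beta> * cnj \<alpha>')"
  unfolding mat3_eq_iff mat3_mult RR_nth by (intro conjI; simp; algebra)

lemma RR_one: "RR 1 0 = mat 1"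
  by (simp add: mat3_simps RR_nth)

lemma RR_minus: "RR (- \<alpha>) (- \<beta>) = RR \<alpha> \<beta>"
  by (simp add: mat3_eq_iff RR_nth)

lemma transpose_RR: "transpose (RR \<alpha> \<beta>) = RR (cnj \<alpha>) (- \<beta>)"
  by (simp add: mat3_eq_iff RR_nth transpose_def)

lemma cmod_unit_parts:
  "(cmod \<alpha>)\<^sup>2 + (cmod \<beta>)\<^sup>2 = Re \<alpha> * Re \<alpha> + Im \<alpha> * Im \<alpha> + Re \<beta> * Re \<beta> + Im \<beta> * Im \<beta>"
  by (simp add: cmod_power2) (simp add: power2_eq_square)

lemma det_RR: "det (RR \<alpha> \<beta>) = ((cmod \<alpha>)\<^sup>2 + (cmod \<beta>)\<^sup>2) ^ 3"
  unfolding cmod_unit_parts det_3 RR_nth by algebra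

lemma RR_in_SO3:
  assumes "(cmod \<alpha>)\<^sup>2 + (cmod \<beta>)\<^sup>2 = 1"
  shows "RR \<alpha> \<beta> \<in> SO3"
proof -
  have "\<alpha> * cnj \<alpha> + \<beta> * cnj \<beta> = 1" by (rule complex_unit_sum_cnj[OF assms])
  then have "RR \<alpha> \<beta> ** transpose (RR \<alpha> \<beta>) = mat 1" "transpose (RR \<alpha> \<beta>) ** RR \<alpha> \<beta> = mat 1"
    unfolding transpose_RR RR_mult by (simp_all add: RR_one mult.commute)
  then show ?thesis using assms by (simp add: SO3_def orthogonal_matrix_def det_RR)
qed

text \<open>The kernel of the covering is \<open>{1, -1}\<close>: the quotient \<open>(a, b)\<close>
  of the two elements has trivial rotation, and the diagonal entries together with the unit norm
  leave \<open>b = 0\<close> and \<open>a = 1\<close> or \<open>a = -1\<close>.\<close>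

lemma RR_eq_iff:
  assumes n: "(cmod \<alpha>)\<^sup>2 + (cmod \<beta>)\<^sup>2 = 1" and n': "(cmod \<alpha>')\<^sup>2 + (cmod \<beta>')\<^sup>2 = 1"
  shows "RR \<alpha> \<beta> = RR \<alpha>' \<beta>' \<longleftrightarrow> \<alpha>' = \<alpha> \<and> \<beta>' = \<beta> \<or> \<alpha>' = - \<alpha> \<and> \<beta>' = - \<beta>"
proof
  assume eq: "RR \<alpha> \<beta> = RR \<alpha>' \<beta>'"
  have u: "\<alpha> * cnj \<alpha> + \<beta> * cnj \<beta> = 1" by (rule complex_unit_sum_cnj[OF n])
  define a b where "a = cnj \<alpha> * \<alpha>' + \<beta> * cnj \<beta>'" "b = cnj \<alpha> * \<beta>' - \<beta> * cnj \<alpha>'"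
  note ab = this
  have "RR (cnj \<alpha>) (- \<beta>) ** RR \<alpha> \<beta> = mat 1"
    unfolding RR_mult using u by (simp add: RR_one mult.commute)
  then have "RR a b = mat 1"
    unfolding eq RR_mult by (simp add: ab)
  then have e: "Re a * Re a + Im a * Im a - Re b * Re b - Im b * Im b = 1"
    "Re a * Re a - Im a * Im a + Re b * Re b - Im b * Im b = 1"
    "Re a * Re a - Im a * Im a - Re b * Re b + Im b * Im b = 1"
    using RR_nth[of a b] by (simp_all add: mat3_one)
  have \<alpha>': "\<alpha>' = \<alpha> * a - \<beta> * cnj b"
  proof -
    have "\<alpha> * a - \<beta> * cnj b = (\<alpha> * cnj \<alpha> + \<beta> * cnj \<beta>) * \<alpha>'" by (simp add: ab algebra_simps)
    then show ?thesis using u by simp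
  qed
  have \<beta>': "\<beta>' = \<alpha> * b + \<beta> * cnj a"
  proof -
    have "\<alpha> * b + \<beta> * cnj a = (\<alpha> * cnj \<alpha> + \<beta> * cnj \<beta>) * \<beta>'" by (simp add: ab algebra_simps)
    then show ?thesis using u by simp
  qed
  have n2: "Re a * Re a + Im a * Im a + Re b * Re b + Im b * Im b = 1"
  proof -
    have "(cmod a)\<^sup>2 + (cmod b)\<^sup>2 = ((cmod \<alpha>)\<^sup>2 + (cmod \<beta>)\<^sup>2) * ((cmod \<alpha>')\<^sup>2 + (cmod \<beta>')\<^sup>2)"
      unfolding cmod_unit_parts ab by simp algebra
    then show ?thesis using n n' cmod_unit_parts by simp
  qed
  have "Re b * Re b + Im b * Im b = 0" "Im a * Im a = 0" "Re a * Re a = 1"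
    using e n2 by linarith+
  then have "b = 0" "Im a = 0" "Re a = 1 \<or> Re a = -1"
    by (auto simp: complex_eq_iff sum_squares_eq_zero_iff square_eq_1_iff)
  then have "b = 0" "a = 1 \<or> a = -1" by (auto simp: complex_eq_iff)
  then show "\<alpha>' = \<alpha> \<and> \<beta>' = \<beta> \<or> \<alpha>' = - \<alpha> \<and> \<beta>' = - \<beta>" using \<alpha>' \<beta>' by auto
qed (auto simp: RR_minus)

lemma so3_basis_nth [simp]:
  "so3_p1$1$1 = 0" "so3_p1$1$2 = 0" "so3_p1$1$3 = 0" "so3_p1$2$1 = 0" "so3_p1$2$2 = 0" "so3_p1$2$3 = -1" "so3_p1$3$1 = 0" "so3_p1$3$2 = 1" "so3_p1$3$3 = 0"
  "so3_p2$1$1 = 0" "so3_p2$1$2 = 0" "so3_p2$1$3 = 1" "so3_p2$2$1 = 0" "so3_p2$2$2 = 0" "so3_p2$2$3 = 0" "so3_p2$3$1 = -1" "so3_p2$3$2 = 0" "so3_p2$3$3 = 0"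
  "so3_k$1$1 = 0" "so3_k$1$2 = -1" "so3_k$1$3 = 0" "so3_k$2$1 = 1" "so3_k$2$2 = 0" "so3_k$2$3 = 0" "so3_k$3$1 = 0" "so3_k$3$2 = 0" "so3_k$3$3 = 0"
  by (simp_all add: so3_p1_def so3_p2_def so3_k_def)

interpretation so3_algebra: kp_algebra SO3 so3_p1 so3_p2
proof
  fix a b assume "a *\<^sub>R so3_p1 + b *\<^sub>R so3_p2 = 0"
  then show "a = 0 \<and> b = 0" by (simp add: mat3_eq_iff)
next
  fix g assume "g \<in> SO3" then show "invertible g" by (simp add: SO3_def invertible_det_nz)
qed

lemma so3_vel: "so3_algebra.vel u = vector [vector [0, 0, Im u], vector [0, 0, - Re u], vector [- Im u, Re u, 0]]"
  by (simp add: so3_algebra.vel_def mat3_eq_iff)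

text \<open>The hypothesis is Cayley-Hamilton for a skew 3 by 3 matrix. All even powers but the
  zeroth are multiples of \<open>X ** X\<close>, and the division by \<open>- y\<close> shifts the
  cosine series accordingly.\<close>

lemma matrix_exp_cubic:
  fixes X :: "'a::real_normed_field^'n^'n"
  assumes X: "X ** (X ** X) = (- y) *\<^sub>R X" and y: "y \<noteq> 0"
  shows "matrix_exp (t *\<^sub>R X) = mat 1 + sinq y t *\<^sub>R X + ((1 - cosq y t) / y) *\<^sub>R (X ** X)"
proof -
  have it: "((\<lambda>Z. (t *\<^sub>R X) ** Z) ^^ n) (mat 1) = (if n = 0 then mat 1 else
    if even n then ((- y) ^ (n div 2) * t ^ n / (- y)) *\<^sub>R (X ** X) else ((- y) ^ (n div 2) * t ^ n) *\<^sub>R X)" for n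
  proof (induction n)
    case (Suc n)
    show ?case
    proof (cases "even n")
      case True
      show ?thesis
      proof (cases "n = 0")
        case n0: False
        have "(t *\<^sub>R X) ** (((- y) ^ (n div 2) * t ^ n / (- y)) *\<^sub>R (X ** X)) = (t * ((- y) ^ (n div 2) * t ^ n / (- y)) * (- y)) *\<^sub>R X"
          by (simp only: matrix_scaleR_left matrix_scalar_ac X scaleR_scaleR) (simp only: mult_ac)
        also have "t * ((- y) ^ (n div 2) * t ^ n / (- y)) * (- y) = (- y) ^ (Suc n div 2) * t ^ Suc n"
          using y True by simp
        finally show ?thesis using Suc True n0 by simp
      qed simp
    next
      case False
      then obtain m where "n = 2 * m + 1" by (auto elim: oddE)
      then show ?thesis using Suc y by (simp add: matrix_scaleR_left matrix_scalar_ac mult_ac)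
    qed
  qed simp
  have s0: "(\<lambda>n. if n = 0 then 1 else 0) sums (1::real)" using sums_single[of 0 "\<lambda>_. 1::real"] by simp
  have "(\<lambda>n. ((if even n then (- y) ^ (n div 2) * t ^ n / fact n else 0) - (if n = 0 then 1 else 0)) / (- y)) sums ((cosq y t - 1) / (- y))"
    by (intro sums_divide sums_diff sums_cosq s0)
  then have s2: "(\<lambda>n. ((if even n then (- y) ^ (n div 2) * t ^ n / fact n else 0) - (if n = 0 then 1 else 0)) / (- y)) sums ((1 - cosq y t) / y)"
    using y by (simp add: minus_divide_left)
  have "matrix_exp (t *\<^sub>R X) = 1 *\<^sub>R mat 1 + sinq y t *\<^sub>R X + ((1 - cosq y t) / y) *\<^sub>R (X ** X)"
    by (rule sums_matrix_exp[OF _ s0 sums_sinq s2]) (simp add: it)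
  then show ?thesis by simp
qed

text \<open>Double-angle formulas: the adjoint representation doubles angles, so exponentials in
  SO(3) have the parameter \<open>y\<close> where the coordinates of SU(2) have
  \<open>y / 4\<close>.\<close>

lemma cosq_sinq_double:
  assumes "0 < y"
  shows "sinq y t = sinq (y / 4) t * cosq (y / 4) t" "(1 - cosq y t) / y = (sinq (y / 4) t)\<^sup>2 / 2"
proof -
  define r where "r = sqrt y"
  have r: "0 < r" "y = r\<^sup>2" using assms by (auto simp: r_def)
  have h: "sqrt (y / 4) = r / 2" by (simp add: r_def real_sqrt_divide)
  have a: "r * t = 2 * (r / 2 * t)" by simp
  show "sinq y t = sinq (y / 4) t * cosq (y / 4) t"
    using assms r unfolding sinq_def cosq_def h r_def[symmetric] a sin_double by simp
  show "(1 - cosq y t) / y = (sinq (y / 4) t)\<^sup>2 / 2"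
    using assms r unfolding sinq_def cosq_def h r_def[symmetric] a cos_double_sin
    by (simp add: power_divide field_simps)
qed

lemma so3_exp:
  "Exp_geod so3_p1 so3_p2 so3_k \<theta> c t = RR (geoA 1 c t) (geoB 1 c (cis \<theta>) t)"
proof -
  define p q where "p = cos \<theta>" "q = sin \<theta>"
  note pq = this
  have pq1: "p * p + q * q = 1" using sin_cos_squared_add[of \<theta>] by (simp add: pq power2_eq_square)
  define X :: "real^3^3" where "X = vector [vector [0, - c, q], vector [c, 0, - p], vector [- q, p, 0 :: real]]"
  have Xe: "cos \<theta> *\<^sub>R so3_p1 + sin \<theta> *\<^sub>R so3_p2 + c *\<^sub>R so3_k = X"
    by (simp add: X_def mat3_eq_iff pq)
  define y where "y = c\<^sup>2 + 1"
  have y: "y = c * c + p * p + q * q" using pq1 by (simp add: y_def power2_eq_square)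
  have y0: "0 < y" by (simp add: y_def add_nonneg_pos)
  define C S where "C = cosq (y / 4) t" "S = sinq (y / 4) t"
  note CS = this
  have CS1: "1 = C\<^sup>2 + y / 4 * S\<^sup>2" using cosq_sinq[of "y / 4" t] by (simp add: CS)
  have "X ** (X ** X) = (- y) *\<^sub>R X"
    unfolding y by (simp add: mat3_eq_iff mat3_mult X_def algebra_simps)
  from matrix_exp_cubic[OF this] y0
  have "matrix_exp (t *\<^sub>R X) = 1 *\<^sub>R mat 1 + (S * C) *\<^sub>R X + (S\<^sup>2 / 2) *\<^sub>R (X ** X)"
    by (simp add: cosq_sinq_double[OF y0] CS)
  \<comment> \<open>Writing 1 as \<open>C\<^sup>2 + y / 4 * S\<^sup>2\<close> makes every entry
    homogeneous of degree 2 in \<open>C\<close> and \<open>S\<close>, like the entries of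
    \<open>RR\<close>.\<close>
  also have "\<dots> = (C\<^sup>2 + y / 4 * S\<^sup>2) *\<^sub>R mat 1 + (S * C) *\<^sub>R X + (S\<^sup>2 / 2) *\<^sub>R (X ** X)"
    using CS1 by (simp only:)
  also have "\<dots> = RR (Complex C (c / 2 * S)) (of_real (S / 2) * cis \<theta>)"
    unfolding y by (simp add: mat3_simps X_def RR_nth pq[symmetric] power2_eq_square field_simps)
  finally have 1: "matrix_exp (t *\<^sub>R X) = RR (Complex C (c / 2 * S)) (of_real (S / 2) * cis \<theta>)" .
  have "so3_k ** (so3_k ** so3_k) = (- 1) *\<^sub>R so3_k"
    by (simp add: mat3_simps)
  from matrix_exp_cubic[OF this, of "- (c * t)"]
  have 2: "matrix_exp (- ((c * t) *\<^sub>R so3_k)) = RR (cis (- (c * t / 2))) 0"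
  proof -
    have d: "c * t = 2 * (c * t / 2)" by simp
    have "matrix_exp (- ((c * t) *\<^sub>R so3_k)) = mat 1 - sin (c * t) *\<^sub>R so3_k + (1 - cos (c * t)) *\<^sub>R (so3_k ** so3_k)"
      using matrix_exp_cubic[OF \<open>so3_k ** (so3_k ** so3_k) = (- 1) *\<^sub>R so3_k\<close>, of "- (c * t)"]
      by (simp add: sinq_def cosq_def)
    also have "\<dots> = RR (cis (- (c * t / 2))) 0"
      apply (subst (1 2) d)
      unfolding sin_double cos_double
      using sin_cos_squared_add[of "c * t / 2"]
      by (simp add: mat3_simps RR_nth power2_eq_square)
    finally show ?thesis .
  qed
  show ?thesis unfolding Exp_geod_def Xe 1 2 RR_mult
    by (simp add: geoA_def geoB_def cis_cnj mult_ac CS y_def)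
qed

lemma RR_derivative:
  assumes a: "(\<alpha> has_vector_derivative of_real (- (1 / 2)) * \<beta> t * cnj u) (at t within S)"
    and b: "(\<beta> has_vector_derivative 1 / 2 * \<alpha> t * u) (at t within S)"
  shows "((\<lambda>t. RR (\<alpha> t) (\<beta> t)) has_vector_derivative RR (\<alpha> t) (\<beta> t) ** so3_algebra.vel u) (at t within S)"
proof (intro has_vector_derivative_vec)
  note ra = bounded_linear.has_vector_derivative[OF bounded_linear_Re a, folded has_real_derivative_iff_has_vector_derivative]
  note ia = bounded_linear.has_vector_derivative[OF bounded_linear_Im a, folded has_real_derivative_iff_has_vector_derivative]
  note rb = bounded_linear.has_vector_derivative[OF bounded_linear_Re b, folded has_real_derivative_iff_has_vector_derivative]
  note ib = bounded_linear.has_vector_derivative[OF bounded_linear_Im b, folded has_real_derivative_iff_has_vector_derivative]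
  show "((\<lambda>t. RR (\<alpha> t) (\<beta> t) $ i $ j) has_vector_derivative (RR (\<alpha> t) (\<beta> t) ** so3_algebra.vel u) $ i $ j) (at t within S)" for i j
    unfolding has_real_derivative_iff_has_vector_derivative[symmetric]
    using exhaust_3[of i] exhaust_3[of j]
    apply (elim disjE)
            apply (simp_all only: RR_nth mat3_mult so3_vel vector_3)
            apply ((rule derivative_eq_intros ra ia rb ib refl)+, simp add: algebra_simps add_divide_distrib diff_divide_distrib)+
    done
qed

section \<open>Lifting horizontal curves through the covering\<close>

lemma SO3_products:
  assumes "S \<in> SO3"
  shows
    "S$1$1 * S$1$1 + S$1$2 * S$1$2 + S$1$3 * S$1$3 = 1" "S$2$1 * S$2$1 + S$2$2 * S$2$2 + S$2$3 * S$2$3 = 1"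
    "S$3$1 * S$3$1 + S$3$2 * S$3$2 + S$3$3 * S$3$3 = 1"
    "S$1$1 * S$2$1 + S$1$2 * S$2$2 + S$1$3 * S$2$3 = 0" "S$1$1 * S$3$1 + S$1$2 * S$3$2 + S$1$3 * S$3$3 = 0"
    "S$2$1 * S$3$1 + S$2$2 * S$3$2 + S$2$3 * S$3$3 = 0"
    "S$1$1 * S$1$1 + S$2$1 * S$2$1 + S$3$1 * S$3$1 = 1" "S$1$2 * S$1$2 + S$2$2 * S$2$2 + S$3$2 * S$3$2 = 1"
    "S$1$3 * S$1$3 + S$2$3 * S$2$3 + S$3$3 * S$3$3 = 1"
    "S$1$1 * S$1$2 + S$2$1 * S$2$2 + S$3$1 * S$3$2 = 0" "S$1$1 * S$1$3 + S$2$1 * S$2$3 + S$3$1 * S$3$3 = 0"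
    "S$1$2 * S$1$3 + S$2$2 * S$2$3 + S$3$2 * S$3$3 = 0"
    "S$1$1 = S$2$2 * S$3$3 - S$2$3 * S$3$2" "S$1$2 = S$2$3 * S$3$1 - S$2$1 * S$3$3" "S$1$3 = S$2$1 * S$3$2 - S$2$2 * S$3$1"
    "S$2$1 = S$1$3 * S$3$2 - S$1$2 * S$3$3" "S$2$2 = S$1$1 * S$3$3 - S$1$3 * S$3$1" "S$2$3 = S$1$2 * S$3$1 - S$1$1 * S$3$2"
    "S$3$1 = S$1$2 * S$2$3 - S$1$3 * S$2$2" "S$3$2 = S$1$3 * S$2$1 - S$1$1 * S$2$3" "S$3$3 = S$1$1 * S$2$2 - S$1$2 * S$2$1"
proof -
  have "S ** transpose S = mat 1" "transpose S ** S = mat 1" and rot: "rotation_matrix S"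
    using assms by (auto simp: SO3_def orthogonal_matrix_def rotation_matrix_def)
  then show
    "S$1$1 * S$1$1 + S$1$2 * S$1$2 + S$1$3 * S$1$3 = 1" "S$2$1 * S$2$1 + S$2$2 * S$2$2 + S$2$3 * S$2$3 = 1"
    "S$3$1 * S$3$1 + S$3$2 * S$3$2 + S$3$3 * S$3$3 = 1"
    "S$1$1 * S$2$1 + S$1$2 * S$2$2 + S$1$3 * S$2$3 = 0" "S$1$1 * S$3$1 + S$1$2 * S$3$2 + S$1$3 * S$3$3 = 0"
    "S$2$1 * S$3$1 + S$2$2 * S$3$2 + S$2$3 * S$3$3 = 0"
    "S$1$1 * S$1$1 + S$2$1 * S$2$1 + S$3$1 * S$3$1 = 1" "S$1$2 * S$1$2 + S$2$2 * S$2$2 + S$3$2 * S$3$2 = 1"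
    "S$1$3 * S$1$3 + S$2$3 * S$2$3 + S$3$3 * S$3$3 = 1"
    "S$1$1 * S$1$2 + S$2$1 * S$2$2 + S$3$1 * S$3$2 = 0" "S$1$1 * S$1$3 + S$2$1 * S$2$3 + S$3$1 * S$3$3 = 0"
    "S$1$2 * S$1$3 + S$2$2 * S$2$3 + S$3$2 * S$3$3 = 0"
    by (simp_all add: mat3_simps transpose_def)
  \<comment> \<open>A rotation preserves the cross product, which says that every entry equals its
    cofactor.\<close>
  have cross: "cross3 (S *v x) (S *v y) = S *v (cross3 x y)" for x y by (rule cross_rotation_matrix[OF rot])
  have col: "S *v (vector [1, 0, 0]) = vector [S$1$1, S$2$1, S$3$1]" "S *v (vector [0, 1, 0]) = vector [S$1$2, S$2$2, S$3$2]"
    "S *v (vector [0, 0, 1]) = vector [S$1$3, S$2$3, S$3$3]"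
    by (simp_all add: vec_eq_iff forall_3 matrix_vector_mult_def sum_3)
  have e: "cross3 (vector [0, 1, 0]) (vector [0, 0, 1]) = vector [1, 0, 0 :: real]"
    "cross3 (vector [0, 0, 1]) (vector [1, 0, 0]) = vector [0, 1, 0 :: real]"
    "cross3 (vector [1, 0, 0]) (vector [0, 1, 0]) = vector [0, 0, 1 :: real]"
    by (simp_all add: cross3_def)
  have "cross3 (vector [S$1$2, S$2$2, S$3$2]) (vector [S$1$3, S$2$3, S$3$3]) = (vector [S$1$1, S$2$1, S$3$1] :: real^3)"
    using cross[of "vector [0, 1, 0]" "vector [0, 0, 1]"] by (simp only: col e)
  moreover have "cross3 (vector [S$1$3, S$2$3, S$3$3]) (vector [S$1$1, S$2$1, S$3$1]) = (vector [S$1$2, S$2$2, S$3$2] :: real^3)"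
    using cross[of "vector [0, 0, 1]" "vector [1, 0, 0]"] by (simp only: col e)
  moreover have "cross3 (vector [S$1$1, S$2$1, S$3$1]) (vector [S$1$2, S$2$2, S$3$2]) = (vector [S$1$3, S$2$3, S$3$3] :: real^3)"
    using cross[of "vector [1, 0, 0]" "vector [0, 1, 0]"] by (simp only: col e)
  ultimately show
    "S$1$1 = S$2$2 * S$3$3 - S$2$3 * S$3$2" "S$1$2 = S$2$3 * S$3$1 - S$2$1 * S$3$3" "S$1$3 = S$2$1 * S$3$2 - S$2$2 * S$3$1"
    "S$2$1 = S$1$3 * S$3$2 - S$1$2 * S$3$3" "S$2$2 = S$1$1 * S$3$3 - S$1$3 * S$3$1" "S$2$3 = S$1$2 * S$3$1 - S$1$1 * S$3$2"
    "S$3$1 = S$1$2 * S$2$3 - S$1$3 * S$2$2" "S$3$2 = S$1$3 * S$2$1 - S$1$1 * S$2$3" "S$3$3 = S$1$1 * S$2$2 - S$1$2 * S$2$1"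
    by (simp_all add: cross3_def vec_eq_iff forall_3 mult.commute)
qed

text \<open>A section of the covering over the rotations of angle less than \<open>\<pi>\<close>.\<close>

definition secx :: "real^3^3 \<Rightarrow> real" where
  "secx S = sqrt (1 + S$1$1 + S$2$2 + S$3$3) / 2"

definition secA :: "real^3^3 \<Rightarrow> complex" where
  "secA S = Complex (secx S) ((S$2$1 - S$1$2) / (4 * secx S))"

definition secB :: "real^3^3 \<Rightarrow> complex" where
  "secB S = Complex ((S$3$2 - S$2$3) / (4 * secx S)) ((S$1$3 - S$3$1) / (4 * secx S))"

text \<open>One plus the trace is \<open>4 * x\<^sup>2\<close>, and the products of the off-diagonal
  differences are multiples of \<open>\<tau>\<close> by orthonormality and the cofactor identities.
  Cancelling \<open>\<tau> > 0\<close> gives all products of the coordinates \<open>x\<close>,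
  \<open>y\<close>, \<open>z\<close>, \<open>w\<close>.\<close>

lemma sec_correct:
  assumes S: "S \<in> SO3" and tr: "0 < 1 + S$1$1 + S$2$2 + S$3$3"
  shows "RR (secA S) (secB S) = S" "(cmod (secA S))\<^sup>2 + (cmod (secB S))\<^sup>2 = 1"
proof -
  note P = SO3_products[OF S]
  define x where "x = secx S"
  define y z w where "y = (S$2$1 - S$1$2) / (4 * x)" "z = (S$3$2 - S$2$3) / (4 * x)" "w = (S$1$3 - S$3$1) / (4 * x)"
  note yzw = this
  have x: "0 < x" "4 * (x * x) = 1 + S$1$1 + S$2$2 + S$3$3"
    using tr by (auto simp: x_def secx_def)
  have e: "S$2$1 - S$1$2 = 4 * (x * y)" "S$3$2 - S$2$3 = 4 * (x * z)" "S$1$3 - S$3$1 = 4 * (x * w)"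
    using x by (auto simp: yzw)
  have A: "secA S = Complex x y" "secB S = Complex z w" by (auto simp: secA_def secB_def x_def yzw)
  define \<tau> where "\<tau> = 1 + S$1$1 + S$2$2 + S$3$3"
  have x\<tau>: "4 * (x * x) = \<tau>" and \<tau>: "0 < \<tau>" using x tr by (auto simp: \<tau>_def)
  have sqy: "(S$2$1 - S$1$2)\<^sup>2 = 2 * \<tau> * (1 + S$3$3) - \<tau>\<^sup>2"
    unfolding \<tau>_def using P(1,2,9,21) by algebra
  have sqz: "(S$3$2 - S$2$3)\<^sup>2 = 2 * \<tau> * (1 + S$1$1) - \<tau>\<^sup>2"
    unfolding \<tau>_def using P(2,3,7,13) by algebra
  have sqw: "(S$1$3 - S$3$1)\<^sup>2 = 2 * \<tau> * (1 + S$2$2) - \<tau>\<^sup>2"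
    unfolding \<tau>_def using P(1,3,8,17) by algebra
  have yz: "(S$2$1 - S$1$2) * (S$3$2 - S$2$3) = \<tau> * (S$1$3 + S$3$1)"
    unfolding \<tau>_def using P(5,11,15,19) by algebra
  have yw: "(S$2$1 - S$1$2) * (S$1$3 - S$3$1) = \<tau> * (S$2$3 + S$3$2)"
    unfolding \<tau>_def using P(6,12,18,20) by algebra
  have zw: "(S$3$2 - S$2$3) * (S$1$3 - S$3$1) = \<tau> * (S$1$2 + S$2$1)"
    unfolding \<tau>_def using P(4,10,14,16) by algebra
  have c: "a = b" if "\<tau> * a = \<tau> * b" for a b using that \<tau> by simp
  have yz': "4 * (y * z) = S$1$3 + S$3$1"
    by (rule c, unfold yz[symmetric], unfold e x\<tau>[symmetric], simp add: algebra_simps)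
  have yw': "4 * (y * w) = S$2$3 + S$3$2"
    by (rule c, unfold yw[symmetric], unfold e x\<tau>[symmetric], simp add: algebra_simps)
  have zw': "4 * (z * w) = S$1$2 + S$2$1"
    by (rule c, unfold zw[symmetric], unfold e x\<tau>[symmetric], simp add: algebra_simps)
  have y2: "4 * (y * y) = 2 * (1 + S$3$3) - \<tau>"
  proof (rule c)
    have "\<tau> * (4 * (y * y)) = (S$2$1 - S$1$2)\<^sup>2" unfolding e x\<tau>[symmetric] by (simp add: power2_eq_square)
    then show "\<tau> * (4 * (y * y)) = \<tau> * (2 * (1 + S$3$3) - \<tau>)" unfolding sqy by (simp add: algebra_simps power2_eq_square)
  qed
  have z2: "4 * (z * z) = 2 * (1 + S$1$1) - \<tau>"
  proof (rule c)
    have "\<tau> * (4 * (z * z)) = (S$3$2 - S$2$3)\<^sup>2" unfolding e x\<tau>[symmetric] by (simp add: power2_eq_square)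
    then show "\<tau> * (4 * (z * z)) = \<tau> * (2 * (1 + S$1$1) - \<tau>)" unfolding sqz by (simp add: algebra_simps power2_eq_square)
  qed
  have w2: "4 * (w * w) = 2 * (1 + S$2$2) - \<tau>"
  proof (rule c)
    have "\<tau> * (4 * (w * w)) = (S$1$3 - S$3$1)\<^sup>2" unfolding e x\<tau>[symmetric] by (simp add: power2_eq_square)
    then show "\<tau> * (4 * (w * w)) = \<tau> * (2 * (1 + S$2$2) - \<tau>)" unfolding sqw by (simp add: algebra_simps power2_eq_square)
  qed
  have n: "x * x + y * y + z * z + w * w = 1"
  proof -
    have lin: "p + q + r + s = 1"
      if "4 * q = 2 * (1 + c) - (1 + a + b + c)" "4 * r = 2 * (1 + a) - (1 + a + b + c)" "4 * s = 2 * (1 + b) - (1 + a + b + c)"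
        "4 * p = 1 + a + b + c" for p q r s a b c :: real using that by argo
    show ?thesis by (rule lin[OF y2[unfolded \<tau>_def] z2[unfolded \<tau>_def] w2[unfolded \<tau>_def] x\<tau>[unfolded \<tau>_def]])
  qed
  show "(cmod (secA S))\<^sup>2 + (cmod (secB S))\<^sup>2 = 1"
    unfolding A cmod_unit_parts using n by simp
  show "RR (secA S) (secB S) = S"
  proof -
    \<comment> \<open>The nine entries are linear in the products of coordinates; with these
      replaced by free variables only linear arithmetic remains.\<close>
    have lin: "xx - yy + zz - ww = a \<and> 2 * (zw - xy) = a' \<and> 2 * (xw + yz) = b \<and> 2 * (xy + zw) = b' \<and>
        xx - yy - zz + ww = c \<and> 2 * (yw - xz) = c' \<and> 2 * (yz - xw) = d \<and> 2 * (xz + yw) = d' \<and>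
        xx + yy - zz - ww = e"
      if "b' - a' = 4 * xy" "d' - c' = 4 * xz" "b - d = 4 * xw" "4 * yz = b + d" "4 * yw = c' + d'" "4 * zw = a' + b'"
        "4 * yy = 2 * (1 + e) - (1 + a + c + e)" "4 * zz = 2 * (1 + a) - (1 + a + c + e)"
        "4 * ww = 2 * (1 + c) - (1 + a + c + e)" "4 * xx = 1 + a + c + e"
      for xx yy zz ww xy xz xw yz yw zw a a' b b' c c' d d' e :: real
      using that by (intro conjI) argo+
    show ?thesis
      unfolding A mat3_eq_iff RR_nth complex.sel
      by (rule lin[OF e yz' yw' zw' y2[unfolded \<tau>_def] z2[unfolded \<tau>_def] w2[unfolded \<tau>_def] x\<tau>[unfolded \<tau>_def]])
  qed
qed

lemma lip_on_bounded_below_inverse: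
  fixes f :: "'a::metric_space \<Rightarrow> real"
  assumes f: "lip_on S f" and m: "0 < m" "\<And>x. x \<in> S \<Longrightarrow> m \<le> f x"
  shows "lip_on S (\<lambda>x. inverse (f x))"
proof (rule lip_on_compose[OF f])
  show "f ` S \<subseteq> {m..}" using m by auto
  show "lip_on {m..} inverse"
  proof (rule lip_on_C1)
    fix x assume x: "x \<in> {m..}"
    then have "0 < x" using m by auto
    then show "(inverse has_real_derivative - (inverse x)\<^sup>2) (at x within {m..})"
      by (auto intro!: derivative_eq_intros simp: power2_eq_square)
    show "\<bar>- (inverse x)\<^sup>2\<bar> \<le> (inverse m)\<^sup>2"
      using x m by (auto intro!: power_mono le_imp_inverse_le)
  qed auto
qed

lemma lip_on_bounded_below_sqrt:
  fixes f :: "'a::metric_space \<Rightarrow> real"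
  assumes f: "lip_on S f" and m: "0 < m" "\<And>x. x \<in> S \<Longrightarrow> m \<le> f x"
  shows "lip_on S (\<lambda>x. sqrt (f x))"
proof (rule lip_on_compose[OF f])
  show "f ` S \<subseteq> {m..}" using m by auto
  show "lip_on {m..} sqrt"
  proof (rule lip_on_C1)
    fix x assume x: "x \<in> {m..}"
    then have "0 < x" using m by auto
    then show "(sqrt has_real_derivative inverse (sqrt x) / 2) (at x within {m..})"
      by (auto intro!: derivative_eq_intros)
    show "\<bar>inverse (sqrt x) / 2\<bar> \<le> inverse (sqrt m) / 2"
      using x m by (auto intro!: le_imp_inverse_le)
  qed (use m in auto)
qed

lemma lip_on_Complex: "lip_on S f \<Longrightarrow> lip_on S g \<Longrightarrow> lip_on S (\<lambda>t. Complex (f t) (g t))"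
proof -
  assume f: "lip_on S f" and g: "lip_on S g"
  have "lip_on S (\<lambda>t. of_real (f t) + \<i> * of_real (g t))"
    by (intro lip_on_add lip_on_bounded_linear[OF bounded_linear_of_real f]
        lip_on_bounded_linear[OF bounded_linear_const_mult[OF bounded_linear_of_real, of \<i>] g])
  then show ?thesis by (simp add: Complex_eq)
qed

lemma bounded_linear_entry: "bounded_linear (\<lambda>X :: real^'n^'m. X $ i $ j)"
  using bounded_linear_compose[OF bounded_linear_vec_nth bounded_linear_vec_nth] .

lemma bounded_linear_matrix_mult: "bounded_linear (\<lambda>X :: real^'n^'m. (C :: real^'m^'k) ** X)"
  unfolding linear_conv_bounded_linear[symmetric]
  by (rule linearI) (simp_all add: matrix_add_ldistrib, simp add: vec_eq_iff matrix_matrix_mult_def sum_distrib_left mult_ac)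

text \<open>The section is built from the entries and the square root of \<open>\<tau>\<close>,
  which has a positive minimum on the compact interval; hence the lifted curve is Lipschitz. Its
  derivative is computed with the entries expressed through the lift itself, and shows the same
  control.\<close>

lemma sec_hcurve:
  assumes ab: "a \<le> b" and S: "\<And>t. t \<in> {a..b} \<Longrightarrow> S t \<in> SO3" and lip: "lip_on {a..b} S"
    and tr: "\<And>t. t \<in> {a..b} \<Longrightarrow> 0 < 1 + S t$1$1 + S t$2$2 + S t$3$3"
    and N: "negligible N"
    and D: "\<And>t. t \<in> {a..<b} - N \<Longrightarrow> (S has_vector_derivative S t ** so3_algebra.vel (u t)) (at t within {t..b})"
  shows "hcurve 1 a b (\<lambda>t. secA (S t)) (\<lambda>t. secB (S t)) u"
proof -
  have l: "lip_on {a..b} (\<lambda>t. S t$i$j)" for i j by (rule lip_on_bounded_linear[OF bounded_linear_entry lip])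
  define \<tau> where "\<tau> t = 1 + S t$1$1 + S t$2$2 + S t$3$3" for t
  have lt: "lip_on {a..b} \<tau>" unfolding \<tau>_def by (intro lip_on_add lip_on_const l)
  have "\<exists>p\<in>{a..b}. \<forall>t\<in>{a..b}. \<tau> p \<le> \<tau> t"
    using ab lip_on_continuous[OF lt] by (intro continuous_attains_inf) auto
  then obtain p where p: "p \<in> {a..b}" "\<And>t. t\<in>{a..b} \<Longrightarrow> \<tau> p \<le> \<tau> t" by auto
  have p0: "0 < \<tau> p" using tr[OF p(1)] by (simp add: \<tau>_def)
  have ls: "lip_on {a..b} (\<lambda>t. sqrt (\<tau> t))" by (rule lip_on_bounded_below_sqrt[OF lt p0 p(2)])
  have li: "lip_on {a..b} (\<lambda>t. inverse (sqrt (\<tau> t)))"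
    by (rule lip_on_bounded_below_inverse[OF ls, of "sqrt (\<tau> p)"]) (use p0 p(2) in auto)
  have lx: "lip_on {a..b} (\<lambda>t. secx (S t))"
    unfolding secx_def using lip_on_bounded_linear[OF bounded_linear_divide[of 2] ls] by (simp add: \<tau>_def)
  have lq: "lip_on {a..b} (\<lambda>t. (S t $i$j - S t$k$l) / (4 * secx (S t)))" for i j k l
  proof -
    have "lip_on {a..b} (\<lambda>t. ((1/2) *\<^sub>R (S t $i$j + (-1) *\<^sub>R S t$k$l)) * inverse (sqrt (\<tau> t)))"
      by (intro lip_on_mult lip_on_add l li lip_on_bounded_linear[OF bounded_linear_scaleR_right] compact_Icc)
    then show ?thesis by (simp add: secx_def \<tau>_def divide_simps)
  qed
  have D': "((\<lambda>t. secA (S t)) has_vector_derivative of_real (- (1 / 2)) * secB (S t) * cnj (u t)) (at t within {t..b}) \<and>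
        ((\<lambda>t. secB (S t)) has_vector_derivative (1 / 2) * secA (S t) * u t) (at t within {t..b})"
    if t: "t \<in> {a..<b} - N" for t
  proof -
    have tt: "t \<in> {a..b}" using t by auto
    have d: "((\<lambda>s. S s$i$j) has_real_derivative (S t ** so3_algebra.vel (u t)) $i$j) (at t within {t..b})" for i j
      unfolding has_real_derivative_iff_has_vector_derivative
      by (rule bounded_linear.has_vector_derivative[OF bounded_linear_entry D[OF t]])
    note d = d[unfolded mat3_mult so3_vel vector_3]
    define x y z w where "x = Re (secA (S t))" "y = Im (secA (S t))" "z = Re (secB (S t))" "w = Im (secB (S t))"
    note xyzw = this
    have xs: "x = secx (S t)" by (simp add: xyzw secA_def)
    have x0: "0 < x" using tr[OF tt] by (simp add: xs secx_def)
    have x2: "sqrt (\<tau> t) = 2 * x" by (simp add: xs secx_def \<tau>_def)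
    have ent: "S t = RR (secA (S t)) (secB (S t))" using sec_correct(1)[OF S[OF tt] tr[OF tt]] by simp
    have e: "S t$1$2 = 2 * (z * w - x * y)" "S t$1$3 = 2 * (x * w + y * z)" "S t$2$1 = 2 * (x * y + z * w)"
      "S t$2$3 = 2 * (y * w - x * z)" "S t$3$1 = 2 * (y * z - x * w)" "S t$3$2 = 2 * (x * z + y * w)"
      "S t$1$1 = x * x - y * y + z * z - w * w" "S t$2$2 = x * x - y * y - z * z + w * w" "S t$3$3 = x * x + y * y - z * z - w * w"
      by (subst ent; simp add: RR_nth xyzw)+
    have yd: "y = (S t$2$1 - S t$1$2) / (4 * x)" "z = (S t$3$2 - S t$2$3) / (4 * x)" "w = (S t$1$3 - S t$3$1) / (4 * x)"
      by (simp_all add: xyzw secA_def secB_def)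
    have dt: "(\<tau> has_real_derivative - 4 * x * (z * Re (u t) + w * Im (u t))) (at t within {t..b})"
    proof -
      have "(\<tau> has_real_derivative 0 + (S t$1$1 * 0 + S t$1$2 * 0 + S t$1$3 * - Im (u t)) + (S t$2$1 * 0 + S t$2$2 * 0 + S t$2$3 * Re (u t))
         + (S t$3$1 * Im (u t) + S t$3$2 * - Re (u t) + S t$3$3 * 0)) (at t within {t..b})"
        unfolding \<tau>_def using d[of 1 1] d[of 2 2] d[of 3 3] by (intro DERIV_add DERIV_const) auto
      then show ?thesis by (rule DERIV_cong) (unfold e, simp add: algebra_simps)
    qed
    have dx: "((\<lambda>s. secx (S s)) has_real_derivative - (1/2) * (z * Re (u t) + w * Im (u t))) (at t within {t..b})"
    proof -
      have "((\<lambda>s. sqrt (\<tau> s)) has_real_derivative (inverse (sqrt (\<tau> t)) / 2) * (- 4 * x * (z * Re (u t) + w * Im (u t)))) (at t within {t..b})"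
        by (rule DERIV_chain2[OF DERIV_real_sqrt dt]) (use x0 x2 in \<open>auto simp: \<tau>_def tr[OF tt]\<close>)
      from DERIV_cdivide[OF this, of 2] show ?thesis
        unfolding secx_def \<tau>_def[symmetric] by (rule DERIV_cong) (use x0 in \<open>simp add: x2 field_simps\<close>)
    qed
    \<comment> \<open>The quotient rule in terms of the expected derivative \<open>E\<close>, so
      that each coordinate only needs a polynomial check.\<close>
    have quot: "((\<lambda>s. f s / (4 * secx (S s))) has_real_derivative E) (at t within {t..b})"
      if "(f has_real_derivative F) (at t within {t..b})" "F = 4 * (E * x) - 2 * (f t / (4 * x)) * (z * Re (u t) + w * Im (u t))" for f E F
    proof -
      have "((\<lambda>s. f s / (4 * secx (S s))) has_real_derivative
         (F * (4 * secx (S t)) - f t * (4 * (- (1/2) * (z * Re (u t) + w * Im (u t))))) / ((4 * secx (S t)) * (4 * secx (S t)))) (at t within {t..b})"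
        by (intro DERIV_divide that DERIV_cmult dx) (use x0 xs in auto)
      then show ?thesis by (rule DERIV_cong) (unfold that(2) xs[symmetric], use x0 in \<open>simp add: field_simps\<close>)
    qed
    have dy: "((\<lambda>s. (S s$2$1 - S s$1$2) / (4 * secx (S s))) has_real_derivative - (1/2) * (w * Re (u t) - z * Im (u t))) (at t within {t..b})"
      by (rule quot[OF DERIV_diff[OF d d]], fold yd, unfold e, simp add: algebra_simps)
    have dz: "((\<lambda>s. (S s$3$2 - S s$2$3) / (4 * secx (S s))) has_real_derivative (1/2) * (x * Re (u t) - y * Im (u t))) (at t within {t..b})"
      by (rule quot[OF DERIV_diff[OF d d]], fold yd, unfold e, simp add: algebra_simps)
    have dw: "((\<lambda>s. (S s$1$3 - S s$3$1) / (4 * secx (S s))) has_real_derivative (1/2) * (x * Im (u t) + y * Re (u t))) (at t within {t..b})"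
      by (rule quot[OF DERIV_diff[OF d d]], fold yd, unfold e, simp add: algebra_simps)
    have parts: "(\<lambda>s. Re (secA (S s))) = (\<lambda>s. secx (S s))"
      "(\<lambda>s. Im (secA (S s))) = (\<lambda>s. (S s$2$1 - S s$1$2) / (4 * secx (S s)))"
      "(\<lambda>s. Re (secB (S s))) = (\<lambda>s. (S s$3$2 - S s$2$3) / (4 * secx (S s)))"
      "(\<lambda>s. Im (secB (S s))) = (\<lambda>s. (S s$1$3 - S s$3$1) / (4 * secx (S s)))"
      by (simp_all add: secA_def secB_def)
    have "((\<lambda>t. secA (S t)) has_vector_derivative of_real (- (1 / 2)) * secB (S t) * cnj (u t)) (at t within {t..b})"
      unfolding has_vector_derivative_complex_iff parts
      by (rule conjI[OF DERIV_cong[OF dx] DERIV_cong[OF dy]])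
        (simp_all add: xyzw algebra_simps add_divide_distrib diff_divide_distrib)
    moreover have "((\<lambda>t. secB (S t)) has_vector_derivative (1 / 2) * secA (S t) * u t) (at t within {t..b})"
      unfolding has_vector_derivative_complex_iff parts
      by (rule conjI[OF DERIV_cong[OF dz] DERIV_cong[OF dw]])
        (simp_all add: xyzw algebra_simps add_divide_distrib diff_divide_distrib)
    ultimately show ?thesis by blast
  qed
  have "(cmod (secA (S t)))\<^sup>2 + 1 * (cmod (secB (S t)))\<^sup>2 = 1" if "t \<in> {a..b}" for t
    using sec_correct(2)[OF S[OF that] tr[OF that]] by simp
  moreover have "lip_on {a..b} (\<lambda>t. secA (S t))" "lip_on {a..b} (\<lambda>t. secB (S t))"
    unfolding secA_def secB_def by (intro lip_on_Complex lx lq)+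
  ultimately show ?thesis unfolding hcurve_def using ab N D' by blast
qed

text \<open>Left invariance: a lift can be translated to any starting point with its control
  unchanged.\<close>

lemma hcurve_left_mult:
  assumes h: "hcurve 1 a b \<alpha> \<beta> u" and AB: "(cmod A)\<^sup>2 + (cmod B)\<^sup>2 = 1"
  shows "hcurve 1 a b (\<lambda>t. A * \<alpha> t - B * cnj (\<beta> t)) (\<lambda>t. A * \<beta> t + B * cnj (\<alpha> t)) u"
proof -
  obtain N where N: "negligible N" and
    D: "\<And>t. t \<in> {a..<b} - N \<Longrightarrow> (\<alpha> has_vector_derivative of_real (- (1 / 2)) * \<beta> t * cnj (u t)) (at t within {t..b})"
      "\<And>t. t \<in> {a..<b} - N \<Longrightarrow> (\<beta> has_vector_derivative (1 / 2) * \<alpha> t * u t) (at t within {t..b})"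
    using h by (auto simp: hcurve_def)
  note bl = bounded_linear.has_vector_derivative[OF bounded_linear_cnj]
  note ml = bounded_linear.has_vector_derivative[OF bounded_linear_mult_right]
  have D': "((\<lambda>t. A * \<alpha> t - B * cnj (\<beta> t)) has_vector_derivative of_real (- (1 / 2)) * (A * \<beta> t + B * cnj (\<alpha> t)) * cnj (u t)) (at t within {t..b}) \<and>
    ((\<lambda>t. A * \<beta> t + B * cnj (\<alpha> t)) has_vector_derivative (1 / 2) * (A * \<alpha> t - B * cnj (\<beta> t)) * u t) (at t within {t..b})"
    if t: "t \<in> {a..<b} - N" for t
  proof -
    note d = D(1)[OF t] D(2)[OF t]
    note e = has_vector_derivative_diff[OF ml[OF d(1), of A] ml[OF bl[OF d(2)], of B]]
      has_vector_derivative_add[OF ml[OF d(2), of A] ml[OF bl[OF d(1)], of B]]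
    show ?thesis
      using e by (simp add: algebra_simps)
  qed
  have lip: "lip_on {a..b} \<alpha>" "lip_on {a..b} \<beta>" using h by (auto simp: hcurve_def)
  have "lip_on {a..b} (\<lambda>t. A * \<alpha> t + (- B) * cnj (\<beta> t))" "lip_on {a..b} (\<lambda>t. A * \<beta> t + B * cnj (\<alpha> t))"
    by (intro lip_on_add lip_on_bounded_linear[OF bounded_linear_mult_right] lip_on_bounded_linear[OF bounded_linear_cnj] lip)+
  moreover have "(cmod (A * \<alpha> t - B * cnj (\<beta> t)))\<^sup>2 + (cmod (A * \<beta> t + B * cnj (\<alpha> t)))\<^sup>2 = 1" if "t \<in> {a..b}" for t
  proof -
    \<comment> \<open>Euler's four-square identity, that is, multiplicativity of the quaternion
      norm.\<close>
    have "(cmod (A * \<alpha> t - B * cnj (\<beta> t)))\<^sup>2 + (cmod (A * \<beta> t + B * cnj (\<alpha> t)))\<^sup>2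
        = ((cmod A)\<^sup>2 + (cmod B)\<^sup>2) * ((cmod (\<alpha> t))\<^sup>2 + (cmod (\<beta> t))\<^sup>2)"
      unfolding cmod_unit_parts by simp algebra
    also have "\<dots> = 1" using h that AB by (simp add: hcurve_def)
    finally show ?thesis .
  qed
  ultimately show ?thesis using h N D' by (auto simp: hcurve_def)
qed

lemma has_right_derivative_transform:
  fixes f g :: "real \<Rightarrow> 'a::real_normed_vector"
  assumes D: "(f has_vector_derivative D) (at t within {t..p})" and pq: "t < p" "t < q"
    and eq: "\<And>s. t \<le> s \<Longrightarrow> s \<le> p \<Longrightarrow> s \<le> q \<Longrightarrow> g s = f s"
  shows "(g has_vector_derivative D) (at t within {t..q})"
proof -
  have at: "at t within {t..q} = at t within {t..min p q}"
    using pq by (simp add: at_within_Icc_at_right)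
  have "(f has_vector_derivative D) (at t within {t..min p q})"
    by (rule has_vector_derivative_within_subset[OF D]) auto
  then show ?thesis unfolding at
    by (rule has_vector_derivative_transform[rotated 2]) (use pq eq in auto)
qed

text \<open>Right derivatives make the junction harmless: from \<open>b\<close> on only the second
  piece is seen, and before \<open>b\<close> only the first.\<close>

lemma hcurve_concat:
  assumes h1: "hcurve 1 a b \<alpha>1 \<beta>1 u" and h2: "hcurve 1 b c \<alpha>2 \<beta>2 u"
    and e: "\<alpha>1 b = \<alpha>2 b" "\<beta>1 b = \<beta>2 b"
  shows "hcurve 1 a c (\<lambda>t. if t \<le> b then \<alpha>1 t else \<alpha>2 t) (\<lambda>t. if t \<le> b then \<beta>1 t else \<beta>2 t) u"
    (is "hcurve 1 a c ?\<alpha> ?\<beta> u")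
proof -
  obtain N where N: "negligible N" and
    D: "\<And>t. t \<in> {a..<b} - N \<Longrightarrow> (\<alpha>1 has_vector_derivative of_real (- (1 / 2)) * \<beta>1 t * cnj (u t)) (at t within {t..b})"
      "\<And>t. t \<in> {a..<b} - N \<Longrightarrow> (\<beta>1 has_vector_derivative (1 / 2) * \<alpha>1 t * u t) (at t within {t..b})"
    using h1 by (auto simp: hcurve_def)
  obtain N' where N': "negligible N'" and
    D': "\<And>t. t \<in> {b..<c} - N' \<Longrightarrow> (\<alpha>2 has_vector_derivative of_real (- (1 / 2)) * \<beta>2 t * cnj (u t)) (at t within {t..c})"
      "\<And>t. t \<in> {b..<c} - N' \<Longrightarrow> (\<beta>2 has_vector_derivative (1 / 2) * \<alpha>2 t * u t) (at t within {t..c})"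
    using h2 by (auto simp: hcurve_def)
  have ab: "a \<le> b" "b \<le> c" using h1 h2 by (auto simp: hcurve_def)
  have lip: "lip_on {a..c} (\<lambda>t. if t \<le> b then f t else g t)" if "lip_on {a..b} f" "lip_on {b..c} g" "f b = g b"
    for f g :: "real \<Rightarrow> complex"
    using that lipschitz_on_concat_max[of _ a b f _ c g] by (auto simp: lip_on_def)
  have l: "lip_on {a..c} ?\<alpha>" "lip_on {a..c} ?\<beta>"
    by (rule lip; use h1 h2 e in \<open>simp add: hcurve_def\<close>)+
  have der: "(?\<alpha> has_vector_derivative of_real (- (1 / 2)) * ?\<beta> t * cnj (u t)) (at t within {t..c}) \<and>
     (?\<beta> has_vector_derivative (1 / 2) * ?\<alpha> t * u t) (at t within {t..c})" if t: "t \<in> {a..<c} - (N \<union> N')" for t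
  proof (cases "t < b")
    case True
    then have t1: "t \<in> {a..<b} - N" using t by auto
    have "(?\<alpha> has_vector_derivative of_real (- (1 / 2)) * \<beta>1 t * cnj (u t)) (at t within {t..c})"
      by (rule has_right_derivative_transform[OF D(1)[OF t1]]) (use True t ab in auto)
    moreover have "(?\<beta> has_vector_derivative (1 / 2) * \<alpha>1 t * u t) (at t within {t..c})"
      by (rule has_right_derivative_transform[OF D(2)[OF t1]]) (use True t ab in auto)
    ultimately show ?thesis using True by simp
  next
    case False
    then have t1: "t \<in> {b..<c} - N'" using t by auto
    have eq: "?\<alpha> s = \<alpha>2 s" "?\<beta> s = \<beta>2 s" if "t \<le> s" for s
      using False that e by (cases "s = b"; auto)+
    have "?\<alpha> t = \<alpha>2 t" "?\<beta> t = \<beta>2 t" using eq by auto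
    moreover have "(?\<alpha> has_vector_derivative of_real (- (1 / 2)) * \<beta>2 t * cnj (u t)) (at t within {t..c})"
      by (rule has_right_derivative_transform[OF D'(1)[OF t1]]) (use t eq in auto)
    moreover have "(?\<beta> has_vector_derivative (1 / 2) * \<alpha>2 t * u t) (at t within {t..c})"
      by (rule has_right_derivative_transform[OF D'(2)[OF t1]]) (use t eq in auto)
    ultimately show ?thesis by simp
  qed
  have "(cmod (?\<alpha> t))\<^sup>2 + 1 * (cmod (?\<beta> t))\<^sup>2 = 1" if "t \<in> {a..c}" for t
    using h1 h2 that by (auto simp: hcurve_def)
  then show ?thesis unfolding hcurve_def using ab l der negligible_Un[OF N N']
    by (intro conjI ballI exI[of _ "N \<union> N'"]) (auto simp only: order.trans)
qed

text \<open>Translation by the inverse of \<open>R a\<close> moves the piece into the domain of the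
  section; left multiplication by the given lift \<open>(A, B)\<close> of \<open>R a\<close> carries
  the result back.\<close>

lemma RR_local_lift:
  assumes ab: "a \<le> b" and R: "\<And>t. t \<in> {a..b} \<Longrightarrow> R t \<in> SO3" and lip: "lip_on {a..b} R"
    and tr: "\<And>t. t \<in> {a..b} \<Longrightarrow> 0 < 1 + trace (transpose (R a) ** R t)"
    and N: "negligible N"
    and D: "\<And>t. t \<in> {a..<b} - N \<Longrightarrow> (R has_vector_derivative R t ** so3_algebra.vel (u t)) (at t within {t..b})"
    and AB: "(cmod A)\<^sup>2 + (cmod B)\<^sup>2 = 1" "RR A B = R a"
  shows "\<exists>\<alpha> \<beta>. hcurve 1 a b \<alpha> \<beta> u \<and> \<alpha> a = A \<and> \<beta> a = B \<and> (\<forall>t\<in>{a..b}. RR (\<alpha> t) (\<beta> t) = R t)"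
proof -
  define S where "S t = transpose (R a) ** R t" for t
  have Ra: "R a \<in> SO3" using R ab by auto
  have orth: "R a ** transpose (R a) = mat 1" "transpose (R a) ** R a = mat 1"
    using Ra by (auto simp: SO3_def orthogonal_matrix_def)
  have S: "S t \<in> SO3" if "t \<in> {a..b}" for t
    using Ra R[OF that] unfolding S_def SO3_def
    by (auto simp: orthogonal_matrix_mul orthogonal_matrix_transpose det_mul det_transpose)
  have tr': "0 < 1 + S t$1$1 + S t$2$2 + S t$3$3" if "t \<in> {a..b}" for t
    using tr[OF that] by (simp add: S_def trace_def sum_3 add_ac)
  have "lip_on {a..b} S" unfolding S_def by (rule lip_on_bounded_linear[OF bounded_linear_matrix_mult lip])
  moreover have "(S has_vector_derivative S t ** so3_algebra.vel (u t)) (at t within {t..b})" if "t \<in> {a..<b} - N" for t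
    using bounded_linear.has_vector_derivative[OF bounded_linear_matrix_mult D[OF that], of "transpose (R a)"]
    by (simp add: S_def[abs_def] matrix_mul_assoc)
  ultimately have h: "hcurve 1 a b (\<lambda>t. secA (S t)) (\<lambda>t. secB (S t)) u"
    using sec_hcurve[of a b S N u, OF ab S _ tr' N] by blast
  have Sa: "S a = mat 1" by (simp add: S_def orth)
  have sec1: "secA (mat 1) = 1" "secB (mat 1) = 0"
    by (simp_all add: secA_def secB_def secx_def mat3_one complex_eq_iff)
  have "RR (A * secA (S t) - B * cnj (secB (S t))) (A * secB (S t) + B * cnj (secA (S t))) = R t" if t: "t \<in> {a..b}" for t
    unfolding RR_mult[symmetric] AB(2) sec_correct(1)[OF S[OF t] tr'[OF t]]
    by (simp add: S_def matrix_mul_assoc orth)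
  then show ?thesis
    using hcurve_left_mult[OF h AB(1)] Sa sec1
    by (intro exI[of _ "\<lambda>t. A * secA (S t) - B * cnj (secB (S t))"] exI[of _ "\<lambda>t. A * secB (S t) + B * cnj (secA (S t))"]) auto
qed

lemma trace_transpose_mult: "trace (transpose A ** B) = (A :: real^3^3) \<bullet> B"
  by (simp add: trace_def matrix_matrix_mult_def transpose_def inner_vec_def sum_3)

lemma SO3_norm: "R \<in> SO3 \<Longrightarrow> R \<bullet> R = 3"
  unfolding trace_transpose_mult[symmetric] by (simp add: SO3_def orthogonal_matrix_def trace_def mat3_one sum_3)

text \<open>A fine subdivision keeps each piece in the domain of the section relative to its own
  starting point, and the local lifts are glued one after the other.\<close>

lemma RR_lift:
  assumes T: "0 < T" and R: "\<And>t. t \<in> {0..T} \<Longrightarrow> R t \<in> SO3" and lip: "lip_on {0..T} R"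
    and N: "negligible N" and R0: "R 0 = mat 1"
    and D: "\<And>t. t \<in> {0..T} - N \<Longrightarrow> (R has_vector_derivative R t ** so3_algebra.vel (u t)) (at t within {0..T})"
  shows "\<exists>\<alpha> \<beta>. hcurve 1 0 T \<alpha> \<beta> u \<and> \<alpha> 0 = 1 \<and> \<beta> 0 = 0 \<and> RR (\<alpha> T) (\<beta> T) = R T"
proof -
  obtain K0 where K0: "K0-lipschitz_on {0..T} R" using lip by (auto simp: lip_on_def)
  define K where "K = K0 + 1"
  have K: "0 < K" "\<And>s t. s \<in> {0..T} \<Longrightarrow> t \<in> {0..T} \<Longrightarrow> norm (R t - R s) \<le> K * \<bar>t - s\<bar>"
  proof -
    have "0 \<le> K0" using K0 lipschitz_on_nonneg by auto
    then show "0 < K" by (simp add: K_def)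
    show "norm (R t - R s) \<le> K * \<bar>t - s\<bar>" if "s \<in> {0..T}" "t \<in> {0..T}" for s t
    proof -
      have "norm (R t - R s) \<le> K0 * \<bar>t - s\<bar>" using lipschitz_onD[OF K0 that(2,1)] by (simp add: dist_norm dist_real_def)
      also have "\<dots> \<le> K * \<bar>t - s\<bar>" by (simp add: K_def mult_right_mono)
      finally show ?thesis .
    qed
  qed
  \<comment> \<open>Each of the \<open>n\<close> pieces moves the rotation by less than 1 in norm.
    That puts the trace of the relative rotation above \<open>5 / 2\<close>, where the section asks
    for more than \<open>-1\<close>.\<close>
  obtain n :: nat where n: "T * K < real n" using reals_Archimedean2 by blast
  have "0 < T * K" using T K(1) by simp
  then have n0: "0 < n" using n by linarith
  define p where "p i = T * real i / real n" for i :: nat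
  have p: "p 0 = 0" "p n = T" "\<And>i. 0 \<le> p i" using n0 T by (auto simp: p_def)
  have pS: "p (Suc i) - p i = T / real n" for i by (simp add: p_def algebra_simps add_divide_distrib)
  have pm: "p i \<le> p (Suc i)" for i using pS[of i] divide_pos_pos[OF T, of "real n"] n0 by simp
  have pT: "p i \<le> T" if "i \<le> n" for i using that n0 T by (simp add: p_def field_simps)
  have "\<exists>\<alpha> \<beta>. hcurve 1 0 (p i) \<alpha> \<beta> u \<and> \<alpha> 0 = 1 \<and> \<beta> 0 = 0 \<and> RR (\<alpha> (p i)) (\<beta> (p i)) = R (p i)" if "i \<le> n" for i
    using that
  proof (induction i)
    case 0
    have "hcurve 1 0 0 (\<lambda>_. 1) (\<lambda>_. 0) u" by (auto simp: hcurve_def lip_on_const)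
    then show ?case using p(1) R0 RR_one by (intro exI[of _ "\<lambda>_. 1"] exI[of _ "\<lambda>_. 0"]) auto
  next
    case (Suc i)
    then obtain \<alpha> \<beta> where h: "hcurve 1 0 (p i) \<alpha> \<beta> u" "\<alpha> 0 = 1" "\<beta> 0 = 0" and Rp: "RR (\<alpha> (p i)) (\<beta> (p i)) = R (p i)" by auto
    have sub: "{p i..p (Suc i)} \<subseteq> {0..T}" using p(3) pT[OF Suc.prems] by auto
    have AB: "(cmod (\<alpha> (p i)))\<^sup>2 + (cmod (\<beta> (p i)))\<^sup>2 = 1" using h(1) p(3) by (auto simp: hcurve_def)
    have "\<exists>\<alpha>2 \<beta>2. hcurve 1 (p i) (p (Suc i)) \<alpha>2 \<beta>2 u \<and> \<alpha>2 (p i) = \<alpha> (p i) \<and> \<beta>2 (p i) = \<beta> (p i)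
        \<and> (\<forall>t\<in>{p i..p (Suc i)}. RR (\<alpha>2 t) (\<beta>2 t) = R t)"
    proof (rule RR_local_lift[where R = R and u = u and a = "p i" and b = "p (Suc i)", OF pm _ _ _ N _ AB Rp])
      show "lip_on {p i..p (Suc i)} R" by (rule lip_on_subset[OF lip sub])
      show "R t \<in> SO3" if "t \<in> {p i..p (Suc i)}" for t using R that sub by auto
      show "(R has_vector_derivative R t ** so3_algebra.vel (u t)) (at t within {t..p (Suc i)})" if t: "t \<in> {p i..<p (Suc i)} - N" for t
      proof -
        have "t \<in> {0..T} - N" "{t..p (Suc i)} \<subseteq> {0..T}" using t sub by auto
        then show ?thesis using D has_vector_derivative_within_subset by blast
      qed
      show "0 < 1 + trace (transpose (R (p i)) ** R t)" if t: "t \<in> {p i..p (Suc i)}" for t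
      proof -
        have m: "p i \<in> {0..T}" "t \<in> {0..T}" using t sub pm[of i] by auto
        have "norm (R t - R (p i)) \<le> K * \<bar>t - p i\<bar>" by (rule K(2)[OF m])
        also have "\<dots> \<le> K * (T / real n)" using t pS[of i] K(1) by (intro mult_left_mono) auto
        also have "\<dots> < 1" using n n0 by (simp add: field_simps)
        finally have "norm (R t - R (p i)) < 1" .
        then have "(norm (R t - R (p i)))\<^sup>2 < 1" by (simp add: abs_square_less_1)
        moreover have "(norm (R t - R (p i)))\<^sup>2 = 6 - 2 * (R (p i) \<bullet> R t)"
          using SO3_norm[OF R[OF m(1)]] SO3_norm[OF R[OF m(2)]]
          by (simp add: power2_norm_eq_inner inner_diff inner_commute)
        ultimately show ?thesis unfolding trace_transpose_mult by linarith
      qed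
    qed
    then obtain \<alpha>2 \<beta>2 where h2: "hcurve 1 (p i) (p (Suc i)) \<alpha>2 \<beta>2 u" "\<alpha>2 (p i) = \<alpha> (p i)" "\<beta>2 (p i) = \<beta> (p i)"
      "\<And>t. t\<in>{p i..p (Suc i)} \<Longrightarrow> RR (\<alpha>2 t) (\<beta>2 t) = R t" by blast
    have lt: "p i < p (Suc i)" using pS[of i] divide_pos_pos[OF T, of "real n"] n0 by simp
    have "R (p (Suc i)) = RR (\<alpha>2 (p (Suc i))) (\<beta>2 (p (Suc i)))" using h2(4)[of "p (Suc i)"] lt by simp
    then show ?case
      using hcurve_concat[OF h(1) h2(1)] h h2 lt p(3)[of i]
      by (intro exI[of _ "\<lambda>t. if t \<le> p i then \<alpha> t else \<alpha>2 t"] exI[of _ "\<lambda>t. if t \<le> p i then \<beta> t else \<beta>2 t"]) auto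
  qed
  from this[of n] show ?thesis using p(2) by simp
qed

interpretation so3: kp_group SO3 so3_p1 so3_p2 so3_k 1 RR
proof
  show "RR 1 0 = mat 1" by (rule RR_one)
  show "RR \<alpha> \<beta> \<in> SO3" if "(cmod \<alpha>)\<^sup>2 + 1 * (cmod \<beta>)\<^sup>2 = 1" for \<alpha> \<beta> using RR_in_SO3 that by simp
  show "Exp_geod so3_p1 so3_p2 so3_k \<theta> c t = RR (geoA 1 c t) (geoB 1 c (cis \<theta>) t)" for \<theta> c t by (rule so3_exp)
  show "continuous_on S (\<lambda>t. RR (\<alpha> t) (\<beta> t))" if c: "continuous_on S \<alpha>" "continuous_on S \<beta>" for \<alpha> \<beta> and S :: "real set"
  proof -
    have "continuous_on S (\<lambda>t. \<chi> i j. RR (\<alpha> t) (\<beta> t) $ i $ j)"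
    proof (intro continuous_on_vec_lambda)
      show "continuous_on S (\<lambda>t. RR (\<alpha> t) (\<beta> t) $ i $ j)" for i j
        using exhaust_3[of i] exhaust_3[of j]
        by (elim disjE; simp only: RR_nth; intro continuous_intros c)
    qed
    then show ?thesis by (simp only: vec_lambda_eta)
  qed
  show "((\<lambda>t. RR (\<alpha> t) (\<beta> t)) has_vector_derivative RR (\<alpha> t) (\<beta> t) ** so3_algebra.vel u) (at t within S)"
    if "(\<alpha> has_vector_derivative of_real (- (1 / 2)) * \<beta> t * cnj u) (at t within S)"
      and "(\<beta> has_vector_derivative 1 / 2 * \<alpha> t * u) (at t within S)" for \<alpha> \<beta> u and t :: real and S
    by (rule RR_derivative[OF that])
  show "\<exists>\<alpha> \<beta> u. hcurve 1 0 T \<alpha> \<beta> u \<and> \<alpha> 0 = 1 \<and> \<beta> 0 = 0 \<and> RR (\<alpha> T) (\<beta> T) = \<gamma> T \<and>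
        hlength 0 T u = sr_length so3_p1 so3_p2 T \<gamma>"
    if T: "0 < T" and h: "horizontal SO3 so3_p1 so3_p2 T \<gamma>" and g0: "\<gamma> 0 = mat 1" for T \<gamma>
  proof -
    obtain u N where N: "negligible N"
      and D: "\<And>t. t \<in> {0..T} - N \<Longrightarrow> (\<gamma> has_vector_derivative \<gamma> t ** so3_algebra.vel (u t)) (at t within {0..T})"
      and len: "sr_length so3_p1 so3_p2 T \<gamma> = hlength 0 T u"
      using so3_algebra.horizontal_control[OF h T] by metis
    have lip: "lip_on {0..T} \<gamma>" and G: "\<And>t. t \<in> {0..T} \<Longrightarrow> \<gamma> t \<in> SO3"
      using h by (auto simp: horizontal_def lip_on_def)
    obtain \<alpha> \<beta> where "hcurve 1 0 T \<alpha> \<beta> u" "\<alpha> 0 = 1" "\<beta> 0 = 0" "RR (\<alpha> T) (\<beta> T) = \<gamma> T"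
      using RR_lift[where R = \<gamma> and u = u, OF T G lip N g0 D] by metis
    then show ?thesis using len by metis
  qed
qed

section \<open>The cut loci in the compact groups\<close>

lemma sqrt_quarter: "sqrt ((c\<^sup>2 + 1) / 4) * t = sqrt (c\<^sup>2 + 1) * t / 2" for c t :: real
  by (simp add: real_sqrt_divide)

text \<open>The geodesic covers half a great circle,
  \<open>sqrt (c\<^sup>2 + 1) * t = 2 * pi\<close>, while \<open>c * t / 2 = pi * k\<close>; the two
  equations give \<open>t\<close> and \<open>c = k / sqrt (1 - k\<^sup>2)\<close>. The end point is
  independent of \<open>w\<close>, so a whole circle of geodesics meets there.\<close>

lemma su2_axis_geodesic:
  assumes k: "\<bar>k\<bar> < 1"
  obtains c where "sqrt (c\<^sup>2 + 1) * (2 * pi * sqrt (1 - k\<^sup>2)) = 2 * pi"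
    "geoA 1 c (2 * pi * sqrt (1 - k\<^sup>2)) = cis (pi - pi * k)" "\<forall>w. geoB 1 c w (2 * pi * sqrt (1 - k\<^sup>2)) = 0"
proof -
  define r where "r = sqrt (1 - k\<^sup>2)"
  have k2: "k\<^sup>2 < 1" using k by (simp add: abs_square_less_1)
  then have r: "0 < r" "r\<^sup>2 = 1 - k\<^sup>2" by (auto simp: r_def)
  define c where "c = k / r"
  have "c\<^sup>2 + 1 = (1 / r)\<^sup>2" using r by (simp add: c_def power_divide field_simps)
  then have s: "sqrt (c\<^sup>2 + 1) = 1 / r" using r by (simp add: real_sqrt_divide)
  have x: "sqrt ((c\<^sup>2 + 1) / 4) * (2 * pi * r) = pi" unfolding sqrt_quarter s using r by simp
  have y: "0 < (c\<^sup>2 + 1) / 4" by (simp add: add_nonneg_pos)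
  have q: "cosq ((c\<^sup>2 + 1) / 4) (2 * pi * r) = -1" "sinq ((c\<^sup>2 + 1) / 4) (2 * pi * r) = 0"
    unfolding cosq_def sinq_def by (simp_all only: y x if_True cos_pi sin_pi div_0)
  have ct: "c * (2 * pi * r) / 2 = pi * k" using r by (simp add: c_def)
  have "geoA 1 c (2 * pi * r) = cis (pi - pi * k)"
    unfolding geoA_def q ct by (simp add: complex_eq_iff cos_diff sin_diff)
  moreover have "\<forall>w. geoB 1 c w (2 * pi * r) = 0" unfolding geoB_def q by simp
  ultimately show thesis using that[of c] s r by (simp add: r_def)
qed

text \<open>The minimizer constructed to the same end point has the same length: it is not longer by
  its minimality and not shorter by \<open>short\<close>. Uniqueness gives both the same
  \<open>c\<close>, and the bound is inherited.\<close>

lemma su2_shortest_in_domain: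
  assumes w: "cmod w = 1" and t: "0 < t" and nz: "geoA 1 c t \<noteq> 0" "geoB 1 c w t \<noteq> 0"
    and short: "\<And>c' w' t'. cmod w' = 1 \<Longrightarrow> 0 \<le> t' \<Longrightarrow> geoA 1 c' t' = geoA 1 c t \<Longrightarrow> geoB 1 c' w' t' = geoB 1 c w t \<Longrightarrow> t \<le> t'"
  shows "sqrt ((c\<^sup>2 + 1) / 4) * t < pi"
proof -
  have "(cmod (geoA 1 c t))\<^sup>2 + (cmod (geoB 1 c w t))\<^sup>2 = 1" using geo_norm[OF w, of 1 c t] by simp
  from su2_geodesic_exists[OF this nz] obtain c0 w0 t0 where
    g: "cmod w0 = 1" "0 < t0" "sqrt ((c0\<^sup>2 + 1) / 4) * t0 < pi" "geoA 1 c0 t0 = geoA 1 c t" "geoB 1 c0 w0 t0 = geoB 1 c w t" .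
  have "t \<le> t0" using short g by auto
  moreover have "t0 \<le> hlength 0 t (\<lambda>t. w * cis (c * t))"
  proof (rule su2_geodesic_minimal[OF hcurve_geo[OF w] t])
    show "sqrt (c0\<^sup>2 + 1) * t0 \<le> 2 * pi" using g(3) unfolding sqrt_quarter by simp
  qed (use t g in auto)
  ultimately have "t = t0" using hlength_geo[OF w, of 0 t c] t by simp
  then have "c = c0" using su2_geodesic_unique[of t0 c0 c] g by simp
  then show ?thesis using g \<open>t = t0\<close> by simp
qed

lemma cmod_geoB: "cmod w = 1 \<Longrightarrow> cmod (geoB \<kappa> c w t) = \<bar>sinq ((c\<^sup>2 + \<kappa>) / 4) t\<bar> / 2"
  by (simp add: geoB_def norm_mult)

text \<open>When \<open>\<alpha>\<close> vanishes, \<open>\<beta>\<close> has modulus 1, so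
  \<open>sinq\<close> is nonzero and its coefficient \<open>c\<close> in the imaginary part must
  vanish.\<close>

lemma geoA_zero:
  assumes "geoA 1 c t = 0"
  shows "c = 0"
proof -
  have e: "cosq ((c\<^sup>2 + 1) / 4) t = 0" "c * sinq ((c\<^sup>2 + 1) / 4) t = 0"
    using assms by (simp_all add: geoA_def) (simp_all add: complex_eq_iff)
  have "geoB 1 c 1 t \<noteq> 0" using geo_norm[of 1 1 c t] assms by auto
  then have "sinq ((c\<^sup>2 + 1) / 4) t \<noteq> 0" by (auto simp: geoB_def)
  then show ?thesis using e by simp
qed

lemma MSU_inj: "MSU \<alpha> \<beta> = MSU \<alpha>' \<beta>' \<longleftrightarrow> \<alpha> = \<alpha>' \<and> \<beta> = \<beta>'"
  by (metis MSU_nth(1,2))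

lemma MSU_one: "MSU 1 0 = mat 1"
  by (simp add: mat2_simps)

lemma su2_optimal:
  assumes t: "0 < t" "sqrt (c\<^sup>2 + 1) * t \<le> 2 * pi"
  shows "optimal SU2 su2_p1 su2_p2 su2_k \<theta> c t"
proof (rule su2.optimal_intro)
  fix T \<alpha> \<beta> u assume "0 < T" "hcurve 1 0 T \<alpha> \<beta> u" "\<alpha> 0 = 1"
    "MSU (\<alpha> T) (\<beta> T) = MSU (geoA 1 c t) (geoB 1 c (cis \<theta>) t)"
  then show "t \<le> hlength 0 T u" using su2_geodesic_minimal[of T \<alpha> \<beta> u c t] t by (simp add: MSU_inj)
qed (use t in simp)

text \<open>Excluding \<open>\<alpha> = 1\<close> excludes the angles 0 and \<open>2 * pi\<close>,
  which would be \<open>k = 1\<close> and \<open>k = -1\<close>.\<close>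

lemma cis_unit_angle:
  assumes "cmod \<alpha> = 1" "\<alpha> \<noteq> 1"
  obtains k where "\<bar>k\<bar> < 1" "cis (pi - pi * k) = \<alpha>"
proof -
  obtain \<phi> where \<phi>: "\<phi> \<in> {0..<2*pi}" "cis \<phi> = \<alpha>" using cis_angle_exists[OF assms(1)] .
  have "\<phi> \<noteq> 0" using \<phi> assms by auto
  then have "0 < \<phi> / pi" "\<phi> / pi < 2" using \<phi> by (auto simp: field_simps)
  then have "\<bar>1 - \<phi> / pi\<bar> < 1" by linarith
  moreover have "pi - pi * (1 - \<phi> / pi) = \<phi>" by (simp add: field_simps)
  ultimately show thesis using that[of "1 - \<phi> / pi"] \<phi> by simp
qed

theorem cut_locus_SU2:
  "cut_locus SU2 su2_p1 su2_p2 su2_k = {MSU \<alpha> 0 |\<alpha>. cmod \<alpha> = 1} - {mat 1}"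
proof (intro set_eqI iffI)
  fix q assume "q \<in> {MSU \<alpha> 0 |\<alpha>. cmod \<alpha> = 1} - {mat 1}"
  then obtain \<alpha> where \<alpha>: "cmod \<alpha> = 1" "\<alpha> \<noteq> 1" "q = MSU \<alpha> 0" using MSU_one by auto
  obtain k where k: "\<bar>k\<bar> < 1" "cis (pi - pi * k) = \<alpha>" using cis_unit_angle[OF \<alpha>(1,2)] .
  obtain c where c: "sqrt (c\<^sup>2 + 1) * (2 * pi * sqrt (1 - k\<^sup>2)) = 2 * pi"
    "geoA 1 c (2 * pi * sqrt (1 - k\<^sup>2)) = cis (pi - pi * k)" "\<forall>w. geoB 1 c w (2 * pi * sqrt (1 - k\<^sup>2)) = 0"
    using su2_axis_geodesic[OF k(1)] .
  define t where "t = 2 * pi * sqrt (1 - k\<^sup>2)"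
  have t: "0 < t" using k(1) by (simp add: t_def abs_square_less_1)
  have opt: "optimal SU2 su2_p1 su2_p2 su2_k \<theta> c t" for \<theta> using su2_optimal[OF t] c(1) by (simp add: t_def)
  have q: "q = MSU (geoA 1 c t) (geoB 1 c (cis \<theta>) t)" for \<theta> using \<alpha> k c by (simp add: t_def)
  \<comment> \<open>Any two distinct directions would do; the angles 0 and 1 are taken.\<close>
  have "0 \<in> {0..<2*pi}" "1 \<in> {0..<2*pi}" "(0 :: real, c) \<noteq> (1, c)" using pi_gt3 by auto
  then show "q \<in> cut_locus SU2 su2_p1 su2_p2 su2_k"
    unfolding su2.cut_locus_iff using t opt q by blast
next
  fix q assume "q \<in> cut_locus SU2 su2_p1 su2_p2 su2_k"
  then obtain \<theta>1 c1 \<theta>2 c2 t where \<theta>: "\<theta>1 \<in> {0..<2*pi}" "\<theta>2 \<in> {0..<2*pi}" and ne: "(\<theta>1, c1) \<noteq> (\<theta>2, c2)" and t: "0 < t"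
    and q: "q = MSU (geoA 1 c1 t) (geoB 1 c1 (cis \<theta>1) t)" "q = MSU (geoA 1 c2 t) (geoB 1 c2 (cis \<theta>2) t)"
    and opt: "optimal SU2 su2_p1 su2_p2 su2_k \<theta>1 c1 t" "optimal SU2 su2_p1 su2_p2 su2_k \<theta>2 c2 t"
    unfolding su2.cut_locus_iff by blast
  have e: "geoA 1 c2 t = geoA 1 c1 t" "geoB 1 c2 (cis \<theta>2) t = geoB 1 c1 (cis \<theta>1) t" using q by (simp_all add: MSU_inj)
  \<comment> \<open>A geodesic of length 0 reaches the identity, so nothing of positive length is
    optimal there.\<close>
  have q1: "q \<noteq> mat 1"
  proof
    assume "q = mat 1"
    then have "t \<le> 0" using su2.optimal_dest[OF opt(1), of 1 0 0] q MSU_one by simp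
    then show False using t by simp
  qed
  have B0: "geoB 1 c1 (cis \<theta>1) t = 0"
  proof (rule ccontr)
    assume nz: "geoB 1 c1 (cis \<theta>1) t \<noteq> 0"
    have "c1 = c2"
    \<comment> \<open>The construction of minimizers requires \<open>\<alpha> \<noteq> 0\<close>;
      points with \<open>\<alpha> = 0\<close> are reached with \<open>c = 0\<close> only.\<close>
    proof (cases "geoA 1 c1 t = 0")
      case True
      then show ?thesis using geoA_zero e by metis
    next
      case False
      have s1: "t \<le> t'" if "cmod w' = 1" "0 \<le> t'" "geoA 1 c' t' = geoA 1 c1 t" "geoB 1 c' w' t' = geoB 1 c1 (cis \<theta>1) t" for c' w' t'
        by (rule su2.optimal_dest[OF opt(1) that(1,2), of c']) (simp add: that)
      have d1: "sqrt ((c1\<^sup>2 + 1) / 4) * t < pi"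
        by (rule su2_shortest_in_domain[OF norm_cis t False nz s1])
      show ?thesis using su2_geodesic_unique[of t c1 c2] t d1 e by simp
    qed
    moreover have "cis \<theta>1 = cis \<theta>2"
      by (rule geoB_inj[of c1 1 t]) (use nz e calculation in \<open>auto simp: geoB_def\<close>)
    ultimately show False using ne cis_angle_unique[OF \<theta>] by simp
  qed
  then have "cmod (geoA 1 c1 t) = 1" using geo_norm[of "cis \<theta>1" 1 c1 t] by (simp add: power2_eq_1_iff) (use norm_ge_zero[of "geoA 1 c1 t"] in linarith)
  then show "q \<in> {MSU \<alpha> 0 |\<alpha>. cmod \<alpha> = 1} - {mat 1}" using q q1 B0 by auto
qed

text \<open>The end point has two lifts, \<open>(\<alpha>, \<beta>)\<close> and its negative, and a
  competitor may end at either.\<close>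

lemma so3_optimal:
  assumes t: "0 < t"
    and lb: "\<And>T \<alpha> \<beta> u. 0 < T \<Longrightarrow> hcurve 1 0 T \<alpha> \<beta> u \<Longrightarrow> \<alpha> 0 = 1 \<Longrightarrow> \<alpha> T = geoA 1 c t \<or> \<alpha> T = - geoA 1 c t \<Longrightarrow> t \<le> hlength 0 T u"
  shows "optimal SO3 so3_p1 so3_p2 so3_k \<theta> c t"
proof (rule so3.optimal_intro)
  fix T \<alpha> \<beta> u assume h: "0 < T" "hcurve 1 0 T \<alpha> \<beta> u" "\<alpha> 0 = 1"
    and e: "RR (\<alpha> T) (\<beta> T) = RR (geoA 1 c t) (geoB 1 c (cis \<theta>) t)"
  have "(cmod (\<alpha> T))\<^sup>2 + (cmod (\<beta> T))\<^sup>2 = 1" using h by (auto simp: hcurve_def)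
  moreover have "(cmod (geoA 1 c t))\<^sup>2 + (cmod (geoB 1 c (cis \<theta>) t))\<^sup>2 = 1" using geo_norm[of "cis \<theta>" 1 c t] by simp
  ultimately have "\<alpha> T = geoA 1 c t \<or> \<alpha> T = - geoA 1 c t" using e RR_eq_iff by auto
  then show "t \<le> hlength 0 T u" using lb h by blast
qed (use t in simp)

lemma so3_cut_locusI:
  assumes w: "cmod w1 = 1" "cmod w2 = 1" and ne: "(w1, c1) \<noteq> (w2, c2)" and t: "0 < t"
    and q: "q = RR (geoA 1 c1 t) (geoB 1 c1 w1 t)" "q = RR (geoA 1 c2 t) (geoB 1 c2 w2 t)"
    and opt: "\<And>\<theta>. optimal SO3 so3_p1 so3_p2 so3_k \<theta> c1 t" "\<And>\<theta>. optimal SO3 so3_p1 so3_p2 so3_k \<theta> c2 t"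
  shows "q \<in> cut_locus SO3 so3_p1 so3_p2 so3_k"
proof -
  obtain \<theta>1 where 1: "\<theta>1 \<in> {0..<2*pi}" "cis \<theta>1 = w1" using cis_angle_exists[OF w(1)] .
  obtain \<theta>2 where 2: "\<theta>2 \<in> {0..<2*pi}" "cis \<theta>2 = w2" using cis_angle_exists[OF w(2)] .
  have ne': "(\<theta>1, c1) \<noteq> (\<theta>2, c2)" using ne 1 2 by auto
  show ?thesis unfolding so3.cut_locus_iff
    by (rule exI[of _ \<theta>1], rule exI[of _ c1], rule exI[of _ \<theta>2], rule exI[of _ c2], rule exI[of _ t])
      (use 1 2 ne' t q opt in auto)
qed

text \<open>Of the lifts \<open>\<alpha>\<close> and \<open>- \<alpha>\<close> the one with
  nonnegative real part is reached sooner: \<open>Re \<alpha> = - cos (pi * k)\<close> makes it the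
  one with the larger \<open>|k|\<close>, and \<open>2 * pi * sqrt (1 - k\<^sup>2)\<close> decreases
  in \<open>|k|\<close>.\<close>

lemma RR_axis_in_cut_locus:
  assumes \<alpha>: "cmod \<alpha> = 1" and q1: "RR \<alpha> 0 \<noteq> mat 1" and re: "0 \<le> Re \<alpha>"
  shows "RR \<alpha> 0 \<in> cut_locus SO3 so3_p1 so3_p2 so3_k"
proof -
  have "\<alpha> \<noteq> 1" using q1 RR_one by auto
  then obtain k where k: "\<bar>k\<bar> < 1" "cis (pi - pi * k) = \<alpha>" using cis_unit_angle[OF \<alpha>] by blast
  obtain c where c: "sqrt (c\<^sup>2 + 1) * (2 * pi * sqrt (1 - k\<^sup>2)) = 2 * pi"
    "geoA 1 c (2 * pi * sqrt (1 - k\<^sup>2)) = cis (pi - pi * k)" "\<forall>w. geoB 1 c w (2 * pi * sqrt (1 - k\<^sup>2)) = 0"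
    using su2_axis_geodesic[OF k(1)] .
  define t where "t = 2 * pi * sqrt (1 - k\<^sup>2)"
  have t: "0 < t" using k(1) by (simp add: t_def abs_square_less_1)
  have "cos (pi * k) \<le> 0" using re k(2)[symmetric] by (simp add: cos_diff)
  have k2: "1 / 2 \<le> \<bar>k\<bar>"
  proof (rule ccontr)
    assume "\<not> 1 / 2 \<le> \<bar>k\<bar>"
    then have "-(1/2) < k" "k < 1/2" by linarith+
    then have "- (pi / 2) < pi * k" "pi * k < pi / 2"
      using mult_strict_left_mono[of "-(1/2)" k pi] mult_strict_left_mono[of k "1/2" pi] by auto
    then have "0 < cos (pi * k)" by (intro cos_gt_zero_pi) auto
    then show False using \<open>cos (pi * k) \<le> 0\<close> by simp
  qed
  \<comment> \<open>A shift by 1 changes \<open>pi * k\<close> by \<open>pi\<close>, hence the sign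
    of the end point; its direction is chosen to keep \<open>|k'| < 1\<close>.\<close>
  define k' where "k' = (if 0 < k then k - 1 else k + 1)"
  have k': "\<bar>k'\<bar> \<le> \<bar>k\<bar>" "\<bar>k'\<bar> < 1" "cis (pi - pi * k') = - \<alpha>"
    using k2 k by (auto simp: k'_def complex_eq_iff algebra_simps cos_diff sin_diff cos_add sin_add)
  obtain c' where c': "sqrt (c'\<^sup>2 + 1) * (2 * pi * sqrt (1 - k'\<^sup>2)) = 2 * pi"
    "geoA 1 c' (2 * pi * sqrt (1 - k'\<^sup>2)) = cis (pi - pi * k')"
    using su2_axis_geodesic[OF k'(2)] by metis
  define t' where "t' = 2 * pi * sqrt (1 - k'\<^sup>2)"
  have "k'\<^sup>2 \<le> k\<^sup>2" using k'(1) abs_le_square_iff by blast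
  then have tt': "t \<le> t'" by (simp add: t_def t'_def)
  have opt: "optimal SO3 so3_p1 so3_p2 so3_k \<theta> c t" for \<theta>
  proof (rule so3_optimal[OF t])
    fix T \<gamma> \<beta> u assume h: "0 < T" "hcurve 1 0 T \<gamma> \<beta> u" "\<gamma> 0 = 1" and e: "\<gamma> T = geoA 1 c t \<or> \<gamma> T = - geoA 1 c t"
    show "t \<le> hlength 0 T u"
    proof (cases "\<gamma> T = geoA 1 c t")
      case True
      show ?thesis by (rule su2_geodesic_minimal[OF h(2,1,3) True t]) (use c in \<open>simp add: t_def\<close>)
    next
      case False
      then have "\<gamma> T = geoA 1 c' t'" using e c c' k k' by (simp add: t_def t'_def)
      then have "t' \<le> hlength 0 T u"
        by (rule su2_geodesic_minimal[OF h(2,1,3)]) (use c' t tt' in \<open>simp_all add: t'_def\<close>)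
      then show ?thesis using tt' by simp
    qed
  qed
  show ?thesis
    by (rule so3_cut_locusI[of 1 "-1" c c t]) (use t opt c k in \<open>auto simp: t_def\<close>)
qed

text \<open>\<open>Re \<alpha> = 0\<close> means \<open>- \<alpha> = cnj \<alpha>\<close>, so the
  mirror geodesic with \<open>- c\<close> ends at the other lift after the same time. Two cases
  degenerate: for \<open>\<beta> = 0\<close> the point lies on the axis, and for
  \<open>\<alpha> = 0\<close> one has \<open>c = 0\<close> and takes the opposite directions
  \<open>\<beta>\<close> and \<open>- \<beta>\<close>.\<close>

lemma RR_plane_in_cut_locus:
  assumes n: "(cmod \<alpha>)\<^sup>2 + (cmod \<beta>)\<^sup>2 = 1" and re: "Re \<alpha> = 0"
  shows "RR \<alpha> \<beta> \<in> cut_locus SO3 so3_p1 so3_p2 so3_k"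
proof -
  consider "\<beta> = 0" | "\<alpha> = 0" | "\<alpha> \<noteq> 0" "\<beta> \<noteq> 0" by blast
  then show ?thesis
  proof cases
    case 1
    have "cmod \<alpha> = 1" using n 1 by (simp add: power2_eq_1_iff) (use norm_ge_zero[of \<alpha>] in linarith)
    moreover have "RR \<alpha> 0 \<noteq> mat 1"
    proof
      assume "RR \<alpha> 0 = mat 1"
      then have "\<alpha> = 1 \<or> \<alpha> = - 1" using RR_eq_iff[of 1 0 \<alpha> 0] calculation RR_one by auto
      then show False using re by auto
    qed
    ultimately show ?thesis using RR_axis_in_cut_locus[of \<alpha>] 1 re by simp
  next
    case 2
    have nb: "cmod \<beta> = 1" using n 2 by (simp add: power2_eq_1_iff) (use norm_ge_zero[of \<beta>] in linarith)
    have A: "geoA 1 0 pi = 0" by (simp add: geoA_def cosq_def real_sqrt_divide complex_eq_iff)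
    have B: "geoB 1 0 w pi = w" for w by (simp add: geoB_def sinq_def real_sqrt_divide)
    have opt: "optimal SO3 so3_p1 so3_p2 so3_k \<theta> 0 pi" for \<theta>
    proof (rule so3_optimal[OF pi_gt_zero])
      fix T \<gamma> \<delta> u assume h: "0 < T" "hcurve 1 0 T \<gamma> \<delta> u" "\<gamma> 0 = 1" and e: "\<gamma> T = geoA 1 0 pi \<or> \<gamma> T = - geoA 1 0 pi"
      then have "\<gamma> T = geoA 1 0 pi" using A by simp
      then show "pi \<le> hlength 0 T u" by (rule su2_geodesic_minimal[OF h(2,1,3)]) auto
    qed
    show ?thesis
      by (rule so3_cut_locusI[of \<beta> "-\<beta>" 0 0 pi]) (use nb 2 A B opt RR_minus[of 0 \<beta>] in auto)
  next
    case 3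
    obtain c w t where g: "cmod w = 1" "0 < t" "sqrt ((c\<^sup>2 + 1) / 4) * t < pi" "geoA 1 c t = \<alpha>" "geoB 1 c w t = \<beta>"
      using su2_geodesic_exists[OF n 3] .
    have dom: "sqrt (c\<^sup>2 + 1) * t \<le> 2 * pi" using g(3) unfolding sqrt_quarter by simp
    have A': "geoA 1 (- c) t = - \<alpha>" unfolding geoA_cnj g(4) using re by (simp add: complex_eq_iff)
    have "0 < sinq ((c\<^sup>2 + 1) / 4) t" using sinq_pos g by simp
    then have "sinq (((- c)\<^sup>2 + 1) / 4) t = 2 * cmod (- \<beta>)" using cmod_geoB[OF g(1), of 1 c t] g(5) by simp
    then obtain w' where w': "cmod w' = 1" "geoB 1 (- c) w' t = - \<beta>" using geoB_surj 3 by (metis neg_equal_0_iff_equal)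
    have "c \<noteq> 0"
    proof
      assume "c = 0"
      then have "\<alpha> = of_real (Re \<alpha>)" using A' g(4) re by (simp add: complex_eq_iff)
      then show False using re 3 by (simp add: complex_eq_iff)
    qed
    have opt: "optimal SO3 so3_p1 so3_p2 so3_k \<theta> d t" if d: "d = c \<or> d = - c" for \<theta> d
    proof (rule so3_optimal[OF g(2)])
      fix T \<gamma> \<delta> u assume h: "0 < T" "hcurve 1 0 T \<gamma> \<delta> u" "\<gamma> 0 = 1" and e: "\<gamma> T = geoA 1 d t \<or> \<gamma> T = - geoA 1 d t"
      then have "\<gamma> T = geoA 1 c t \<or> \<gamma> T = geoA 1 (-c) t" using d A' g(4) by auto
      then show "t \<le> hlength 0 T u"
        using su2_geodesic_minimal[OF h(2,1,3), of c t] su2_geodesic_minimal[OF h(2,1,3), of "-c" t] dom g(2) by auto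
    qed
    show ?thesis
      by (rule so3_cut_locusI[of w w' c "-c" t]) (use g w' A' \<open>c \<noteq> 0\<close> opt RR_minus in auto)
  qed
qed

definition so3_axis :: "(real^3^3) set" where
  "so3_axis = {RR \<alpha> 0 |\<alpha>. cmod \<alpha> = 1}"

definition half_turns :: "(real^3^3) set" where
  "half_turns = {RR \<alpha> \<beta> |\<alpha> \<beta>. (cmod \<alpha>)\<^sup>2 + (cmod \<beta>)\<^sup>2 = 1 \<and> Re \<alpha> = 0}"

theorem cut_locus_SO3:
  "cut_locus SO3 so3_p1 so3_p2 so3_k = half_turns \<union> (so3_axis - {mat 1})"
proof (intro set_eqI iffI)
  fix q assume "q \<in> half_turns \<union> (so3_axis - {mat 1})"
  then show "q \<in> cut_locus SO3 so3_p1 so3_p2 so3_k"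
  proof
    assume "q \<in> half_turns"
    then show ?thesis using RR_plane_in_cut_locus by (auto simp: half_turns_def)
  next
    assume "q \<in> so3_axis - {mat 1}"
    then obtain \<alpha> where \<alpha>: "q = RR \<alpha> 0" "cmod \<alpha> = 1" "q \<noteq> mat 1" by (auto simp: so3_axis_def)
    show ?thesis
    proof (cases "0 \<le> Re \<alpha>")
      case True then show ?thesis using RR_axis_in_cut_locus \<alpha> by simp
    next
      case False then show ?thesis using RR_axis_in_cut_locus[of "-\<alpha>"] RR_minus[of \<alpha> 0] \<alpha> by simp
    qed
  qed
next
  fix q assume "q \<in> cut_locus SO3 so3_p1 so3_p2 so3_k"
  then obtain \<theta>1 c1 \<theta>2 c2 t where \<theta>: "\<theta>1 \<in> {0..<2*pi}" "\<theta>2 \<in> {0..<2*pi}" and ne: "(\<theta>1, c1) \<noteq> (\<theta>2, c2)" and t: "0 < t"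
    and q: "q = RR (geoA 1 c1 t) (geoB 1 c1 (cis \<theta>1) t)" "q = RR (geoA 1 c2 t) (geoB 1 c2 (cis \<theta>2) t)"
    and opt: "optimal SO3 so3_p1 so3_p2 so3_k \<theta>1 c1 t" "optimal SO3 so3_p1 so3_p2 so3_k \<theta>2 c2 t"
    unfolding so3.cut_locus_iff by blast
  define \<alpha> \<beta> where "\<alpha> = geoA 1 c1 t" "\<beta> = geoB 1 c1 (cis \<theta>1) t"
  note ab = this
  have n: "(cmod \<alpha>)\<^sup>2 + (cmod \<beta>)\<^sup>2 = 1" "(cmod (geoA 1 c2 t))\<^sup>2 + (cmod (geoB 1 c2 (cis \<theta>2) t))\<^sup>2 = 1"
    using geo_norm[of "cis \<theta>1" 1 c1 t] geo_norm[of "cis \<theta>2" 1 c2 t] by (simp_all add: ab)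
  have lift: "geoA 1 c2 t = \<alpha> \<and> geoB 1 c2 (cis \<theta>2) t = \<beta> \<or> geoA 1 c2 t = - \<alpha> \<and> geoB 1 c2 (cis \<theta>2) t = - \<beta>"
    using RR_eq_iff[OF n] q by (simp add: ab)
  have q1: "q \<noteq> mat 1"
  proof
    assume "q = mat 1"
    then have "t \<le> 0" using so3.optimal_dest[OF opt(1), of 1 0 0] q RR_one by simp
    then show False using t by simp
  qed
  show "q \<in> half_turns \<union> (so3_axis - {mat 1})"
  proof (cases "\<beta> = 0 \<or> Re \<alpha> = 0")
    case True
    then show ?thesis
    proof
      assume b: "\<beta> = 0"
      then have "cmod \<alpha> = 1" using n(1) by (simp add: power2_eq_1_iff) (use norm_ge_zero[of \<alpha>] in linarith)
      then show ?thesis using q(1) q1 b by (auto simp: so3_axis_def ab)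
    next
      assume "Re \<alpha> = 0"
      then show ?thesis using n(1) q(1) by (auto simp: half_turns_def ab)
    qed
  next
    case False
    then have nz: "\<beta> \<noteq> 0" "\<alpha> \<noteq> 0" by auto
    \<comment> \<open>Equal end points in SU(2) project to equal end points in SO(3), so optimality
      below gives the shortness required upstairs.\<close>
    have s1: "t \<le> t'" if "cmod w' = 1" "0 \<le> t'" "geoA 1 c' t' = geoA 1 c1 t" "geoB 1 c' w' t' = geoB 1 c1 (cis \<theta>1) t" for c' w' t'
      by (rule so3.optimal_dest[OF opt(1) that(1,2), of c']) (simp add: that)
    have d1: "sqrt ((c1\<^sup>2 + 1) / 4) * t < pi"
      by (rule su2_shortest_in_domain[OF norm_cis t _ _ s1]) (use nz in \<open>simp_all add: ab\<close>)
    have s2: "t \<le> t'" if "cmod w' = 1" "0 \<le> t'" "geoA 1 c' t' = geoA 1 c2 t" "geoB 1 c' w' t' = geoB 1 c2 (cis \<theta>2) t" for c' w' t'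
      by (rule so3.optimal_dest[OF opt(2) that(1,2), of c']) (simp add: that)
    have d2: "sqrt ((c2\<^sup>2 + 1) / 4) * t < pi"
      by (rule su2_shortest_in_domain[OF norm_cis t _ _ s2]) (use nz lift in auto)
    have False using lift
    proof
      assume l: "geoA 1 c2 t = \<alpha> \<and> geoB 1 c2 (cis \<theta>2) t = \<beta>"
      have "c2 = c1" using su2_geodesic_unique[of t c1 c2] t d1 l by (simp add: ab)
      moreover have "cis \<theta>1 = cis \<theta>2"
        by (rule geoB_inj[of c1 1 t]) (use nz l calculation in \<open>auto simp: geoB_def ab\<close>)
      ultimately show False using ne cis_angle_unique[OF \<theta>] by simp
    next
      \<comment> \<open>For opposite lifts, equal \<open>cmod \<beta>\<close> forces
        \<open>c2 = c1\<close> or \<open>c2 = - c1\<close>; then the two values of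
        \<open>geoA\<close> have equal real parts, which are also opposite.\<close>
      assume l: "geoA 1 c2 t = - \<alpha> \<and> geoB 1 c2 (cis \<theta>2) t = - \<beta>"
      have p: "0 < sinq ((c1\<^sup>2 + 1) / 4) t" "0 < sinq ((c2\<^sup>2 + 1) / 4) t" using sinq_pos t d1 d2 by simp_all
      have "cmod (geoB 1 c1 (cis \<theta>1) t) = cmod (geoB 1 c2 (cis \<theta>2) t)" using l by (simp add: ab)
      then have eq: "sinq ((c1\<^sup>2 + 1) / 4) t = sinq ((c2\<^sup>2 + 1) / 4) t" using p by (simp add: cmod_geoB)
      have "(c1\<^sup>2 + 1) / 4 = (c2\<^sup>2 + 1) / 4"
        by (rule sinq_inj[OF t _ _ eq]) (use d1 d2 less_imp_le in blast)+
      then have "c2 = c1 \<or> c2 = - c1" using power2_eq_iff[of c2 c1] by simp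
      then have "geoA 1 c2 t = \<alpha> \<or> geoA 1 c2 t = cnj \<alpha>" using ab(1) geoA_cnj by metis
      then have "Re (geoA 1 c2 t) = Re \<alpha>" by auto
      moreover have "Re (geoA 1 c2 t) = - Re \<alpha>" using l by simp
      ultimately show False using False by simp
    qed
    then show ?thesis ..
  qed
qed

section \<open>The cut locus in SL(2)\<close>

lemma sqrt_quarter': "sqrt ((c\<^sup>2 - 1) / 4) * t = sqrt (c\<^sup>2 - 1) * t / 2" for c t :: real
  by (simp add: real_sqrt_divide)

lemma geoA_rotated: "geoA (-1) c t * cis (c * t / 2) = Complex (cosq ((c\<^sup>2 - 1) / 4) t) (c / 2 * sinq ((c\<^sup>2 - 1) / 4) t)"
  by (simp add: geoA_def mult.assoc cis_mult)

text \<open>The phase is only bounded from above, so that one geodesic serves all competitors that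
  wind further in the negative direction.\<close>

lemma su11_minimal:
  assumes h: "hcurve (-1) 0 T \<alpha> \<beta> u" "0 < T" "\<alpha> 0 = 1" "\<beta> 0 = 0"
    and l: "continuous_on {0..T} l" "\<And>t. t \<in> {0..T} \<Longrightarrow> exp (l t) = \<alpha> t" "l 0 = 0"
    and c: "0 \<le> c" "0 < t" "c \<le> 1 \<or> sqrt ((c\<^sup>2 - 1) / 4) * t < pi" and w: "cmod w = 1"
    and fin: "\<alpha> T = geoA (-1) c t" "\<beta> T = geoB (-1) c w t"
    and phase: "Im (l T) \<le> arccos (cosq ((c\<^sup>2 - 1) / 4) t / cmod (\<alpha> T)) - c * t / 2"
  shows "t \<le> hlength 0 T u"
proof (cases "c \<le> 1")
  case True
  show ?thesis by (rule su11_minimal_hyperbolic[OF h l c(1) True w c(2) fin phase])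
next
  case False
  then have c1: "1 < c" and dom: "sqrt ((c\<^sup>2 - 1) / 4) * t < pi" using c by auto
  have y: "0 < (c\<^sup>2 - 1) / 4" using c1 by (simp add: one_less_power)
  have s: "0 < sinq ((c\<^sup>2 - 1) / 4) t" using sinq_pos dom c by blast
  have a: "\<bar>cosq ((c\<^sup>2 - 1) / 4) t\<bar> \<le> cmod (\<alpha> T)"
  proof -
    have "cmod (Complex (cosq ((c\<^sup>2 - 1) / 4) t) (c / 2 * sinq ((c\<^sup>2 - 1) / 4) t)) = cmod (geoA (-1) c t)"
      by (simp only: geoA_rotated[symmetric] norm_mult norm_cis mult_1_right)
    then show ?thesis
      using abs_Re_le_cmod[of "Complex (cosq ((c\<^sup>2 - 1) / 4) t) (c / 2 * sinq ((c\<^sup>2 - 1) / 4) t)"] by (simp add: fin(1))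
  qed
  have "arccos (cosq ((c\<^sup>2 - 1) / 4) t / cmod (\<alpha> T)) \<le> pi"
  proof (rule arccos_ubound)
    have "\<bar>cosq ((c\<^sup>2 - 1) / 4) t / cmod (\<alpha> T)\<bar> \<le> 1"
      using a by (simp add: divide_le_eq_1)
    then show "- 1 \<le> cosq ((c\<^sup>2 - 1) / 4) t / cmod (\<alpha> T)" "cosq ((c\<^sup>2 - 1) / 4) t / cmod (\<alpha> T) \<le> 1"
      by (rule abs_le_D2[THEN minus_le_iff[THEN iffD1]], rule abs_le_D1)
  qed
  then have end1: "Im (l T) + c * t / 2 \<le> pi" using phase by linarith
  have end2: "cmod (\<beta> T) \<le> Im (\<alpha> T * cis (c * t / 2))"
    unfolding fin geoA_rotated cmod_geoB[OF w] using s c1 mult_right_mono[of 1 c "sinq ((c\<^sup>2 - 1) / 4) t"] by simp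
  have end3: "cos (sqrt (c\<^sup>2 - 1) * t / 2) \<le> Re (\<alpha> T * cis (c * t / 2))"
    unfolding fin geoA_rotated using y by (simp add: cosq_def real_sqrt_divide)
  have t2: "sqrt (c\<^sup>2 - 1) * t \<le> 2 * pi" using dom unfolding sqrt_quarter' by simp
  show ?thesis by (rule su11_minimal_elliptic[OF h l c1 c(2) t2 end1 end2 end3])
qed

lemma phase_cnj:
  fixes l :: "real \<Rightarrow> complex"
  assumes "continuous_on {0..T} l" "\<And>t. t \<in> {0..T} \<Longrightarrow> exp (l t) = \<alpha> t" "l 0 = 0"
  shows "continuous_on {0..T} (\<lambda>t. cnj (l t))" "\<And>t. t \<in> {0..T} \<Longrightarrow> exp (cnj (l t)) = cnj (\<alpha> t)" "cnj (l 0) = 0"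
proof -
  show "continuous_on {0..T} (\<lambda>t. cnj (l t))" using assms(1) by (rule continuous_on_cnj)
  show "exp (cnj (l t)) = cnj (\<alpha> t)" if "t \<in> {0..T}" for t using assms(2)[OF that] exp_cnj by metis
  show "cnj (l 0) = 0" using assms(3) by simp
qed

lemma hlength_cnj: "hlength a b (\<lambda>t. cnj (u t)) = hlength a b u"
  by (simp add: hlength_def)

lemma exp_phase: "exp z = of_real (cmod (exp z)) * cis (Im z)"
  unfolding norm_exp_eq_Re by (rule exp_eq_polar)

text \<open>The equations \<open>sqrt (c\<^sup>2 - 1) * t = 2 * pi\<close> and
  \<open>c * t / 2 = pi * k\<close>, now with \<open>k > 1\<close>, give
  \<open>t = 2 * pi * sqrt (k\<^sup>2 - 1)\<close> and the negative final phase
  \<open>pi - pi * k\<close>, again independently of \<open>w\<close>.\<close>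

lemma su11_axis_geodesic:
  assumes k: "1 < k"
  obtains c where "1 < c" "sqrt (c\<^sup>2 - 1) * (2 * pi * sqrt (k\<^sup>2 - 1)) = 2 * pi" "c * (2 * pi * sqrt (k\<^sup>2 - 1)) / 2 = pi * k"
    "geoA (-1) c (2 * pi * sqrt (k\<^sup>2 - 1)) = cis (pi - pi * k)" "\<forall>w. geoB (-1) c w (2 * pi * sqrt (k\<^sup>2 - 1)) = 0"
proof -
  define r where "r = sqrt (k\<^sup>2 - 1)"
  have k2: "1 < k\<^sup>2" using k by (simp add: one_less_power)
  then have r: "0 < r" "r\<^sup>2 = k\<^sup>2 - 1" by (auto simp: r_def)
  have rk: "r < k" unfolding r_def using k by (intro real_less_lsqrt) auto
  define c where "c = k / r"
  have c1: "1 < c" using rk r by (simp add: c_def)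
  have "c\<^sup>2 - 1 = (1 / r)\<^sup>2" using r by (simp add: c_def power_divide field_simps)
  then have s: "sqrt (c\<^sup>2 - 1) = 1 / r" using r by (simp add: real_sqrt_divide)
  have x: "sqrt ((c\<^sup>2 + -1) / 4) * (2 * pi * r) = pi" using sqrt_quarter'[of c "2 * pi * r"] s r by simp
  have y: "0 < (c\<^sup>2 + -1) / 4" using c1 by (simp add: one_less_power)
  have q: "cosq ((c\<^sup>2 + -1) / 4) (2 * pi * r) = -1" "sinq ((c\<^sup>2 + -1) / 4) (2 * pi * r) = 0"
    unfolding cosq_def sinq_def by (simp_all only: y x if_True cos_pi sin_pi div_0)
  have ct: "c * (2 * pi * r) / 2 = pi * k" using r by (simp add: c_def)
  have "geoA (-1) c (2 * pi * r) = cis (pi - pi * k)"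
    unfolding geoA_def q ct by (simp add: complex_eq_iff cos_diff sin_diff)
  moreover have "\<forall>w. geoB (-1) c w (2 * pi * r) = 0" unfolding geoB_def q by simp
  ultimately show thesis using that[of c] s r c1 ct by (simp add: r_def)
qed

text \<open>The limiting case of the elliptic comparison: half a timelike circle is covered, and the
  bound on the final real part is \<open>cos pi\<close>, which every end point on the axis
  satisfies.\<close>

lemma su11_axis_minimal_aux:
  assumes h: "hcurve (-1) 0 T \<alpha> \<beta> u" "0 < T" "\<alpha> 0 = 1" "\<beta> 0 = 0"
    and l: "continuous_on {0..T} l" "\<And>t. t \<in> {0..T} \<Longrightarrow> exp (l t) = \<alpha> t" "l 0 = 0"
    and fin: "\<beta> T = 0" and \<psi>: "0 < \<psi>" "Im (l T) \<le> - \<psi>"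
  shows "2 * pi * sqrt ((1 + \<psi> / pi)\<^sup>2 - 1) \<le> hlength 0 T u"
proof -
  \<comment> \<open>Chosen so that the comparison geodesic ends with phase
    \<open>pi - pi * k = - \<psi>\<close>.\<close>
  define k where "k = 1 + \<psi> / pi"
  have k1: "1 < k" using \<psi> by (simp add: k_def)
  obtain c where c: "1 < c" "sqrt (c\<^sup>2 - 1) * (2 * pi * sqrt (k\<^sup>2 - 1)) = 2 * pi" "c * (2 * pi * sqrt (k\<^sup>2 - 1)) / 2 = pi * k"
    using su11_axis_geodesic[OF k1] by metis
  define t where "t = 2 * pi * sqrt (k\<^sup>2 - 1)"
  have t: "0 < t" using k1 by (simp add: t_def one_less_power)
  have pk: "pi * k = pi + \<psi>" by (simp add: k_def field_simps)
  have ct: "c * t / 2 = pi + \<psi>" using c(3) unfolding t_def pk .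
  have "cmod (\<alpha> T) = 1"
  proof -
    have "(cmod (\<alpha> T))\<^sup>2 + (-1) * (cmod (\<beta> T))\<^sup>2 = 1" using h(1,2) by (auto simp: hcurve_def)
    then show ?thesis using fin norm_ge_zero[of "\<alpha> T"] by (auto simp: power2_eq_1_iff)
  qed
  then have \<alpha>: "\<alpha> T = cis (Im (l T))" using exp_phase[of "l T"] l(2)[of T] h(2) by simp
  have rot: "\<alpha> T * cis (c * t / 2) = cis (Im (l T) + c * t / 2)" by (simp add: \<alpha> cis_mult)
  have end1: "Im (l T) + c * t / 2 \<le> pi" using \<psi> ct by linarith
  show ?thesis unfolding k_def[symmetric] t_def[symmetric]
  proof (rule su11_minimal_elliptic[OF h l c(1) t _ end1])
    have p: "sqrt (c\<^sup>2 - 1) * t = 2 * pi" using c(2) by (simp add: t_def)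
    then show "sqrt (c\<^sup>2 - 1) * t \<le> 2 * pi" by simp
    show "cmod (\<beta> T) \<le> Im (\<alpha> T * cis (c * t / 2))" if "0 < Im (l T) + c * t / 2"
      unfolding rot using fin sin_ge_zero[of "Im (l T) + c * t / 2"] that end1 by simp
    show "cos (sqrt (c\<^sup>2 - 1) * t / 2) \<le> Re (\<alpha> T * cis (c * t / 2))"
      unfolding rot p by simp
  qed
qed

lemma cis_eq_abs_ge:
  assumes "0 < \<psi>" "\<psi> \<le> pi" "cis \<phi> = cis \<psi> \<or> cis \<phi> = cis (- \<psi>)"
  shows "\<phi> \<le> - \<psi> \<or> \<psi> \<le> \<phi>"
proof (rule ccontr)
  assume "\<not> ?thesis"
  then have "\<bar>\<phi>\<bar> < \<psi>" by auto
  then have "cos \<psi> < cos \<bar>\<phi>\<bar>" using assms by (intro cos_monotone_0_pi) auto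
  moreover have "cos \<phi> = cos \<psi>" using assms(3) by (auto simp: complex_eq_iff)
  ultimately show False by simp
qed

text \<open>The final phase of a competitor is \<open>\<psi>\<close> or \<open>- \<psi>\<close> up
  to full turns, hence at least \<open>\<psi>\<close> in absolute value; conjugation makes it
  negative.\<close>

lemma su11_axis_minimal:
  assumes h: "hcurve (-1) 0 T \<alpha> \<beta> u" "0 < T" "\<alpha> 0 = 1" "\<beta> 0 = 0"
    and \<psi>: "0 < \<psi>" "\<psi> \<le> pi" and fin: "\<alpha> T = cis \<psi> \<or> \<alpha> T = cis (- \<psi>)" "\<beta> T = 0"
  shows "2 * pi * sqrt ((1 + \<psi> / pi)\<^sup>2 - 1) \<le> hlength 0 T u"
proof -
  obtain l where l: "continuous_on {0..T} l" "\<And>t. t \<in> {0..T} \<Longrightarrow> exp (l t) = \<alpha> t" "l 0 = 0"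
    using su11_phase_exists[OF h(1,3)] by metis
  have "cmod (\<alpha> T) = 1" using fin(1) by auto
  then have "\<alpha> T = cis (Im (l T))" using exp_phase[of "l T"] l(2)[of T] h(2) by simp
  then have "Im (l T) \<le> - \<psi> \<or> \<psi> \<le> Im (l T)" using cis_eq_abs_ge[OF \<psi>, of "Im (l T)"] fin(1) by metis
  then show ?thesis
  proof
    assume "Im (l T) \<le> - \<psi>"
    show ?thesis by (rule su11_axis_minimal_aux[OF h l fin(2) \<psi>(1) \<open>Im (l T) \<le> - \<psi>\<close>])
  next
    assume "\<psi> \<le> Im (l T)"
    then have "Im (cnj (l T)) \<le> - \<psi>" by simp
    then show ?thesis
      using su11_axis_minimal_aux[OF hcurve_cnj[OF h(1)] h(2) _ _ phase_cnj[OF l] _ \<psi>(1)] h fin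
      by (simp add: hlength_cnj)
  qed
qed

lemma sl2_cut_locusI:
  assumes w: "cmod w1 = 1" "cmod w2 = 1" and ne: "(w1, c1) \<noteq> (w2, c2)" and t: "0 < t"
    and q: "geoA (-1) c1 t = \<alpha>" "geoB (-1) c1 w1 t = \<beta>" "geoA (-1) c2 t = \<alpha>" "geoB (-1) c2 w2 t = \<beta>"
    and lb: "\<And>T \<gamma> \<delta> u. 0 < T \<Longrightarrow> hcurve (-1) 0 T \<gamma> \<delta> u \<Longrightarrow> \<gamma> 0 = 1 \<Longrightarrow> \<delta> 0 = 0 \<Longrightarrow> \<gamma> T = \<alpha> \<Longrightarrow> \<delta> T = \<beta> \<Longrightarrow> t \<le> hlength 0 T u"
  shows "MSL \<alpha> \<beta> \<in> cut_locus SL2 sl2_p1 sl2_p2 sl2_k"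
proof -
  obtain \<theta>1 where 1: "\<theta>1 \<in> {0..<2*pi}" "cis \<theta>1 = w1" using cis_angle_exists[OF w(1)] .
  obtain \<theta>2 where 2: "\<theta>2 \<in> {0..<2*pi}" "cis \<theta>2 = w2" using cis_angle_exists[OF w(2)] .
  have ne': "(\<theta>1, c1) \<noteq> (\<theta>2, c2)" using ne 1 2 by auto
  have opt: "optimal SL2 sl2_p1 sl2_p2 sl2_k \<theta> c t" if "geoA (-1) c t = \<alpha>" "geoB (-1) c (cis \<theta>) t = \<beta>" for \<theta> c
  proof (rule sl2.optimal_intro)
    fix T \<gamma> \<delta> u assume "0 < T" "hcurve (-1) 0 T \<gamma> \<delta> u" "\<gamma> 0 = 1" "\<delta> 0 = 0"
      "MSL (\<gamma> T) (\<delta> T) = MSL (geoA (-1) c t) (geoB (-1) c (cis \<theta>) t)"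
    then show "t \<le> hlength 0 T u" using lb that by (simp add: MSL_inj)
  qed (use t in simp)
  show ?thesis unfolding sl2.cut_locus_iff
    by (rule exI[of _ \<theta>1], rule exI[of _ c1], rule exI[of _ \<theta>2], rule exI[of _ c2], rule exI[of _ t])
      (use 1 2 ne' t q opt in auto)
qed

lemma MSL_one: "MSL 1 0 = mat 1"
  by (simp add: mat2_simps)

text \<open>\<open>\<psi>\<close> is the least absolute value of a phase of \<open>\<alpha>\<close>.
  The geodesics that wind exactly this much are minimal, and they exist in every direction
  \<open>w\<close>.\<close>

lemma MSL_axis_in_cut_locus:
  assumes \<alpha>: "cmod \<alpha> = 1" "\<alpha> \<noteq> 1"
  shows "MSL \<alpha> 0 \<in> cut_locus SL2 sl2_p1 sl2_p2 sl2_k"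
proof -
  define \<psi> where "\<psi> = \<bar>Arg \<alpha>\<bar>"
  have ca: "cis (Arg \<alpha>) = \<alpha>" using \<alpha> cis_Arg[of \<alpha>] by (cases "\<alpha> = 0") (auto simp: sgn_eq)
  then have "Arg \<alpha> \<noteq> 0" using \<alpha> by auto
  then have \<psi>: "0 < \<psi>" "\<psi> \<le> pi" using Arg_bounded[of \<alpha>] by (auto simp: \<psi>_def)
  have \<alpha>\<psi>: "\<alpha> = cis \<psi> \<or> \<alpha> = cis (- \<psi>)" using ca by (auto simp: \<psi>_def abs_if)
  define k where "k = 1 + \<psi> / pi"
  have k1: "1 < k" using \<psi> by (simp add: k_def)
  obtain c where c: "geoA (-1) c (2 * pi * sqrt (k\<^sup>2 - 1)) = cis (pi - pi * k)" "\<forall>w. geoB (-1) c w (2 * pi * sqrt (k\<^sup>2 - 1)) = 0"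
    using su11_axis_geodesic[OF k1] by metis
  define t where "t = 2 * pi * sqrt (k\<^sup>2 - 1)"
  have t: "0 < t" using k1 by (simp add: t_def one_less_power)
  have A: "geoA (-1) c t = cis (- \<psi>)" using c by (simp add: t_def k_def distrib_left)
  then have A': "geoA (-1) (- c) t = cis \<psi>" by (simp add: geoA_cnj cis_cnj)
  have B: "geoB (-1) c w t = 0" for w using c by (simp add: t_def)
  then have B': "geoB (-1) (- c) w t = 0" for w using geoB_cnj[of "-1" c "cnj w" t] by simp
  obtain c' where c': "geoA (-1) c' t = \<alpha>" "\<And>w. geoB (-1) c' w t = 0" using \<alpha>\<psi> A A' B B' by metis
  show ?thesis
  proof (rule sl2_cut_locusI[of 1 "-1" c' c' t])
    fix T \<gamma> \<delta> u assume h: "0 < T" "hcurve (-1) 0 T \<gamma> \<delta> u" "\<gamma> 0 = 1" "\<delta> 0 = 0" "\<gamma> T = \<alpha>" "\<delta> T = 0"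
    show "t \<le> hlength 0 T u"
      using su11_axis_minimal[OF h(2,1,3,4) \<psi> _ h(6)] h(5) \<alpha>\<psi> by (simp add: t_def k_def)
  qed (use t c' in auto)
qed

text \<open>A negative real \<open>\<alpha>\<close> has only odd multiples of \<open>pi\<close> as
  phases and is fixed by conjugation. The minimizer with phase \<open>- pi\<close> and its mirror
  image with \<open>- c\<close> both reach the point, and every competitor winds at least as far as
  one of them.\<close>

lemma MSL_plane_in_cut_locus:
  assumes n: "(cmod \<alpha>)\<^sup>2 + (-1) * (cmod \<beta>)\<^sup>2 = 1" and re: "Im \<alpha> = 0" "Re \<alpha> < 0"
  shows "MSL \<alpha> \<beta> \<in> cut_locus SL2 sl2_p1 sl2_p2 sl2_k"
proof (cases "\<beta> = 0")
  case True
  then have "cmod \<alpha> = 1" using n norm_ge_zero[of \<alpha>] by (auto simp: power2_eq_1_iff)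
  moreover have "\<alpha> \<noteq> 1" using re by auto
  ultimately show ?thesis using MSL_axis_in_cut_locus[of \<alpha>] True by simp
next
  case False
  define b where "b = cmod \<beta>"
  have b: "0 < b" using False by (simp add: b_def)
  have "(cmod \<alpha>)\<^sup>2 = 1 + b\<^sup>2" using n by (simp add: b_def)
  then have ca: "cmod \<alpha> = sqrt (1 + b\<^sup>2)" using real_sqrt_unique[of "cmod \<alpha>" "1 + b\<^sup>2"] by simp
  have "cmod \<alpha> = - Re \<alpha>" using re by (simp add: cmod_eq_Re)
  then have \<alpha>: "\<alpha> = of_real (sqrt (1 + b\<^sup>2)) * cis (- pi)" using re ca by (simp add: complex_eq_iff)
  obtain c t where g: "0 \<le> c" "0 < t" "c \<le> 1 \<or> sqrt ((c\<^sup>2 - 1) / 4) * t < pi"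
    "sinq ((c\<^sup>2 - 1) / 4) t = 2 * b" "geoA (-1) c t = of_real (sqrt (1 + b\<^sup>2)) * cis (- pi)"
    "- pi = arccos (cosq ((c\<^sup>2 - 1) / 4) t / sqrt (1 + b\<^sup>2)) - c * t / 2"
    using su11_geodesic_exists[OF b, of "- pi"] pi_gt_zero by (metis less_imp_le neg_le_0_iff_le)
  have A: "geoA (-1) c t = \<alpha>" using g(5) \<alpha> by simp
  have A': "geoA (-1) (- c) t = \<alpha>" unfolding geoA_cnj A using re by (simp add: complex_eq_iff)
  have surj: "\<exists>w. cmod w = 1 \<and> geoB (-1) d w t = \<beta>'" if "d\<^sup>2 = c\<^sup>2" "cmod \<beta>' = b" for d \<beta>'
    by (rule geoB_surj) (use that g(4) b in auto)
  obtain w where w: "cmod w = 1" "geoB (-1) c w t = \<beta>" using surj[of c \<beta>] by (auto simp: b_def)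
  obtain w' where w': "cmod w' = 1" "geoB (-1) (- c) w' t = \<beta>" using surj[of "- c" \<beta>] by (auto simp: b_def)
  have "c \<noteq> 0"
  proof
    assume "c = 0"
    then have A0: "\<alpha> = of_real (cosq ((c\<^sup>2 - 1) / 4) t)" using A by (simp add: geoA_def complex_eq_iff)
    have "0 < cosq ((c\<^sup>2 - 1) / 4) t" using \<open>c = 0\<close> by (simp add: cosq_def cosh_real_pos)
    then show False using A0 re by simp
  qed
  show ?thesis
  proof (rule sl2_cut_locusI[OF w(1) w'(1) _ g(2) A w(2) A' w'(2)])
    show "(w, c) \<noteq> (w', - c)" using \<open>c \<noteq> 0\<close> by simp
    fix T \<gamma> \<delta> u assume h: "0 < T" "hcurve (-1) 0 T \<gamma> \<delta> u" "\<gamma> 0 = 1" "\<delta> 0 = 0" "\<gamma> T = \<alpha>" "\<delta> T = \<beta>"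
    obtain l where l: "continuous_on {0..T} l" "\<And>t. t \<in> {0..T} \<Longrightarrow> exp (l t) = \<gamma> t" "l 0 = 0"
      using su11_phase_exists[OF h(2,3)] by metis
    have "\<alpha> = of_real (cmod \<alpha>) * cis (Im (l T))" using exp_phase[of "l T"] l(2)[of T] h(1,5) by simp
    then have "of_real (cmod \<alpha>) * cis (Im (l T)) = of_real (cmod \<alpha>) * cis (- pi)" using \<alpha> ca by metis
    moreover have "cmod \<alpha> \<noteq> 0" using re by auto
    ultimately have "cis (Im (l T)) = cis (- pi)" by simp
    then have "Im (l T) \<le> - pi \<or> pi \<le> Im (l T)" using cis_eq_abs_ge[OF pi_gt_zero order_refl] by blast
    then show "t \<le> hlength 0 T u"
    proof
      assume "Im (l T) \<le> - pi"
      then have ph: "Im (l T) \<le> arccos (cosq ((c\<^sup>2 - 1) / 4) t / cmod (\<gamma> T)) - c * t / 2"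
        using g(6) unfolding h(5) ca by simp
      show ?thesis
        by (rule su11_minimal[OF h(2,1,3,4) l g(1,2,3) w(1) _ _ ph]) (use h A w in auto)
    next
      assume "pi \<le> Im (l T)"
      then have ph: "Im (cnj (l T)) \<le> arccos (cosq ((c\<^sup>2 - 1) / 4) t / cmod (cnj (\<gamma> T))) - c * t / 2"
        using g(6) unfolding h(5) complex_mod_cnj ca by simp
      obtain w2 where w2: "cmod w2 = 1" "geoB (-1) c w2 t = cnj \<beta>" using surj[of c "cnj \<beta>"] by (auto simp: b_def)
      have "t \<le> hlength 0 T (\<lambda>t. cnj (u t))"
        by (rule su11_minimal[OF hcurve_cnj[OF h(2)] h(1) _ _ phase_cnj[OF l] g(1,2,3) w2(1) _ _ ph])
          (use h A w2 re in \<open>auto simp: complex_eq_iff\<close>)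
      then show ?thesis by (simp add: hlength_cnj)
    qed
  qed
qed

text \<open>The minimizer is built with the very phase of the given geodesic, so that the comparison
  and the rigidity, both relative to the phase, apply to the pair.\<close>

lemma su11_shortest_in_domain_aux:
  assumes w: "cmod w = 1" and t: "0 < t" and nz: "geoB (-1) c w t \<noteq> 0"
    and short: "\<And>c' w' t'. cmod w' = 1 \<Longrightarrow> 0 \<le> t' \<Longrightarrow> geoA (-1) c' t' = geoA (-1) c t \<Longrightarrow> geoB (-1) c' w' t' = geoB (-1) c w t \<Longrightarrow> t \<le> t'"
    and l: "continuous_on {0..t} l" "\<And>s. s \<in> {0..t} \<Longrightarrow> exp (l s) = geoA (-1) c s" "l 0 = 0"
    and ph: "Im (l t) \<le> 0"
  shows "(c\<^sup>2 - 1) / 4 \<le> 0 \<or> sqrt ((c\<^sup>2 - 1) / 4) * t < pi"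
proof -
  define b where "b = cmod (geoB (-1) c w t)"
  have b: "0 < b" using nz by (simp add: b_def)
  have "(cmod (geoA (-1) c t))\<^sup>2 = 1 + b\<^sup>2" using geo_norm[OF w, of "-1" c t] by (simp add: b_def)
  then have ca: "cmod (geoA (-1) c t) = sqrt (1 + b\<^sup>2)" using real_sqrt_unique[of "cmod (geoA (-1) c t)" "1 + b\<^sup>2"] by simp
  obtain d s where g: "0 \<le> d" "0 < s" "d \<le> 1 \<or> sqrt ((d\<^sup>2 - 1) / 4) * s < pi"
    "sinq ((d\<^sup>2 - 1) / 4) s = 2 * b" "geoA (-1) d s = of_real (sqrt (1 + b\<^sup>2)) * cis (Im (l t))"
    "Im (l t) = arccos (cosq ((d\<^sup>2 - 1) / 4) s / sqrt (1 + b\<^sup>2)) - d * s / 2"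
    using su11_geodesic_exists[OF b ph] by metis
  have A: "geoA (-1) d s = geoA (-1) c t" using g(5) exp_phase[of "l t"] l(2)[of t] t ca by simp
  have "\<exists>w0. cmod w0 = 1 \<and> geoB (-1) d w0 s = geoB (-1) c w t"
    by (rule geoB_surj) (use g(4) nz in \<open>auto simp: b_def\<close>)
  then obtain w0 where w0: "cmod w0 = 1" "geoB (-1) d w0 s = geoB (-1) c w t" by blast
  have "t \<le> s" using short[OF w0(1) _ A w0(2)] g(2) by simp
  moreover have "s \<le> hlength 0 t (\<lambda>t. w * cis (c * t))"
    by (rule su11_minimal[OF hcurve_geo[OF w] t _ _ l g(1,2,3) w0(1)]) (use t A w0 g(6) ca in auto)
  ultimately have st: "s = t" using hlength_geo[OF w, of 0 t c] t by simp
  have "c\<^sup>2 = d\<^sup>2"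
  proof (rule su11_geodesic_unique[OF t g(1) _ _ l])
    show "d \<le> 1 \<or> sqrt ((d\<^sup>2 - 1) / 4) * t < pi" using g(3) st by simp
    show "geoA (-1) c t = geoA (-1) d t" using A st by simp
    show "Im (l t) = arccos (cosq ((d\<^sup>2 - 1) / 4) t / cmod (geoA (-1) d t)) - d * t / 2"
      using g(6) A ca st by simp
    show "cmod (geoB (-1) c 1 t) = cmod (geoB (-1) d 1 t)"
      using arg_cong[OF w0(2), of cmod] w w0(1) st by (simp add: cmod_geoB)
  qed
  then show ?thesis using g(1,3) st by (auto simp: power_le_one)
qed

lemma su11_shortest_in_domain:
  assumes w: "cmod w = 1" and t: "0 < t" and nz: "geoB (-1) c w t \<noteq> 0"
    and short: "\<And>c' w' t'. cmod w' = 1 \<Longrightarrow> 0 \<le> t' \<Longrightarrow> geoA (-1) c' t' = geoA (-1) c t \<Longrightarrow> geoB (-1) c' w' t' = geoB (-1) c w t \<Longrightarrow> t \<le> t'"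
  shows "(c\<^sup>2 - 1) / 4 \<le> 0 \<or> sqrt ((c\<^sup>2 - 1) / 4) * t < pi"
proof -
  have h: "hcurve (-1) 0 t (geoA (-1) c) (geoB (-1) c w) (\<lambda>t. w * cis (c * t))" by (rule hcurve_geo[OF w]) (use t in simp)
  obtain l where l: "continuous_on {0..t} l" "\<And>s. s \<in> {0..t} \<Longrightarrow> exp (l s) = geoA (-1) c s" "l 0 = 0"
    using su11_phase_exists[OF h] by (metis geo_0(1))
  show ?thesis
  proof (cases "Im (l t) \<le> 0")
    case True
    show ?thesis by (rule su11_shortest_in_domain_aux[OF w t nz short l True])
  next
    case False
    have "((- c)\<^sup>2 - 1) / 4 \<le> 0 \<or> sqrt (((- c)\<^sup>2 - 1) / 4) * t < pi"
    proof (rule su11_shortest_in_domain_aux[OF _ t _ _ phase_cnj(1)[OF l]])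
      show "cmod (cnj w) = 1" using w by simp
      show "geoB (-1) (- c) (cnj w) t \<noteq> 0" using nz by (simp add: geoB_cnj)
      show "t \<le> t'" if a: "cmod w' = 1" "0 \<le> t'" "geoA (-1) c' t' = geoA (-1) (- c) t" "geoB (-1) c' w' t' = geoB (-1) (- c) (cnj w) t" for c' w' t'
      proof (rule short[of "cnj w'" t' "- c'"])
        show "geoA (-1) (- c') t' = geoA (-1) c t" using a(3) by (simp add: geoA_cnj)
        show "geoB (-1) (- c') (cnj w') t' = geoB (-1) c w t" using a(4) by (simp add: geoB_cnj)
      qed (use a in auto)
      show "exp (cnj (l s)) = geoA (-1) (- c) s" if "s \<in> {0..t}" for s
        using phase_cnj(2)[OF l that] by (simp add: geoA_cnj)
    qed (use False l in auto)
    then show ?thesis by simp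
  qed
qed

text \<open>\<open>c = 0\<close> gives the smallest parameter \<open>y = - 1 / 4\<close> and thus
  the largest \<open>sinq\<close>, so it attains a prescribed \<open>cmod \<beta>\<close> first. Its
  \<open>\<alpha>\<close> is a hyperbolic cosine, hence it agrees with any positive real
  \<open>\<alpha>\<close> of the same modulus.\<close>

lemma su11_not_shortest:
  assumes w: "cmod w = 1" and t: "0 < t" and nz: "geoB (-1) c w t \<noteq> 0" and c: "c \<noteq> 0"
    and dom: "(c\<^sup>2 - 1) / 4 \<le> 0 \<or> sqrt ((c\<^sup>2 - 1) / 4) * t < pi"
    and re: "Im (geoA (-1) c t) = 0" "0 < Re (geoA (-1) c t)"
  shows "\<exists>w' t'. cmod w' = 1 \<and> 0 \<le> t' \<and> geoA (-1) 0 t' = geoA (-1) c t \<and> geoB (-1) 0 w' t' = geoB (-1) c w t \<and> t' < t"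
proof -
  define b where "b = cmod (geoB (-1) c w t)"
  have b: "0 < b" using nz by (simp add: b_def)
  have s: "sinq ((c\<^sup>2 - 1) / 4) t = 2 * b" using sinq_pos[OF t dom] by (simp add: b_def cmod_geoB w)
  have "(cmod (geoA (-1) c t))\<^sup>2 = 1 + b\<^sup>2" using geo_norm[OF w, of "-1" c t] by (simp add: b_def)
  then have "cmod (geoA (-1) c t) = sqrt (1 + b\<^sup>2)" using real_sqrt_unique[of "cmod (geoA (-1) c t)" "1 + b\<^sup>2"] by simp
  then have A: "geoA (-1) c t = of_real (sqrt (1 + b\<^sup>2))" using re by (simp add: complex_eq_iff cmod_eq_Re)
  define t' where "t' = 2 * arsinh b"
  have sh: "sqrt (1 / 4) = 1 / (2 :: real)" by (simp add: real_sqrt_divide)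
  have t': "0 < t'" using b arsinh_real_strict_mono[of 0 b] by (simp add: t'_def)
  have q: "cosq (-1/4) r = cosh (r / 2)" "sinq (-1/4) r = 2 * sinh (r / 2)" for r
    by (simp_all add: cosq_def sinq_def sh)
  have A0: "geoA (-1) 0 t' = of_real (sqrt (1 + b\<^sup>2))"
    using q[of t'] by (simp add: geoA_def complex_eq_iff t'_def cosh_arsinh_real add.commute)
  have "\<exists>w'. cmod w' = 1 \<and> geoB (-1) 0 w' t' = geoB (-1) c w t"
    by (rule geoB_surj) (use q[of t'] nz in \<open>auto simp: b_def t'_def\<close>)
  moreover have "t' < t"
  proof (rule ccontr)
    assume "\<not> t' < t"
    then have "sinq (-1/4) t \<le> 2 * b" unfolding q t'_def using sinh_real_le_iff[of "t / 2" "arsinh b"] by simp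
    moreover have "sinq ((c\<^sup>2 - 1) / 4) t < sinq (-1/4) t"
      by (rule sinq_strict_antimono[OF t]) (use c dom in auto)
    ultimately show False using s by simp
  qed
  ultimately show ?thesis using A A0 t' by (metis less_imp_le)
qed

definition sl2_axis :: "(real^2^2) set" where
  "sl2_axis = {MSL \<alpha> 0 |\<alpha>. cmod \<alpha> = 1}"

text \<open>\<open>Im \<alpha> = 0\<close> makes the matrix symmetric; with determinant 1 and trace
  \<open>2 * Re \<alpha> < 0\<close> it is negative definite.\<close>

definition negative_definite_SL2 :: "(real^2^2) set" where
  "negative_definite_SL2 = {MSL \<alpha> \<beta> |\<alpha> \<beta>. (cmod \<alpha>)\<^sup>2 + (-1) * (cmod \<beta>)\<^sup>2 = 1 \<and> Im \<alpha> = 0 \<and> Re \<alpha> < 0}"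

theorem cut_locus_SL2:
  "cut_locus SL2 sl2_p1 sl2_p2 sl2_k = negative_definite_SL2 \<union> (sl2_axis - {mat 1})"
proof (intro set_eqI iffI)
  fix q assume "q \<in> negative_definite_SL2 \<union> (sl2_axis - {mat 1})"
  then show "q \<in> cut_locus SL2 sl2_p1 sl2_p2 sl2_k"
  proof
    assume "q \<in> negative_definite_SL2"
    then obtain \<alpha> \<beta> where "q = MSL \<alpha> \<beta>" "(cmod \<alpha>)\<^sup>2 + (-1) * (cmod \<beta>)\<^sup>2 = 1" "Im \<alpha> = 0" "Re \<alpha> < 0"
      unfolding negative_definite_SL2_def by blast
    then show ?thesis using MSL_plane_in_cut_locus by simp
  next
    assume "q \<in> sl2_axis - {mat 1}"
    then obtain \<alpha> where "q = MSL \<alpha> 0" "cmod \<alpha> = 1" "\<alpha> \<noteq> 1" unfolding sl2_axis_def using MSL_one by auto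
    then show ?thesis using MSL_axis_in_cut_locus by simp
  qed
next
  fix q assume "q \<in> cut_locus SL2 sl2_p1 sl2_p2 sl2_k"
  then obtain \<theta>1 c1 \<theta>2 c2 t where \<theta>: "\<theta>1 \<in> {0..<2*pi}" "\<theta>2 \<in> {0..<2*pi}" and ne: "(\<theta>1, c1) \<noteq> (\<theta>2, c2)" and t: "0 < t"
    and q: "q = MSL (geoA (-1) c1 t) (geoB (-1) c1 (cis \<theta>1) t)" "q = MSL (geoA (-1) c2 t) (geoB (-1) c2 (cis \<theta>2) t)"
    and opt: "optimal SL2 sl2_p1 sl2_p2 sl2_k \<theta>1 c1 t" "optimal SL2 sl2_p1 sl2_p2 sl2_k \<theta>2 c2 t"
    unfolding sl2.cut_locus_iff by blast
  have e: "geoA (-1) c2 t = geoA (-1) c1 t" "geoB (-1) c2 (cis \<theta>2) t = geoB (-1) c1 (cis \<theta>1) t"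
    using q by (simp_all add: MSL_inj)
  have n: "(cmod (geoA (-1) c1 t))\<^sup>2 + (-1) * (cmod (geoB (-1) c1 (cis \<theta>1) t))\<^sup>2 = 1" by (rule geo_norm) simp
  show "q \<in> negative_definite_SL2 \<union> (sl2_axis - {mat 1})"
  proof (cases "geoB (-1) c1 (cis \<theta>1) t = 0")
    case True
    have "q \<noteq> mat 1"
    proof
      assume "q = mat 1"
      then have "t \<le> 0" using sl2.optimal_dest[OF opt(1), of 1 0 0] q MSL_one by simp
      then show False using t by simp
    qed
    moreover have "cmod (geoA (-1) c1 t) = 1" using n True norm_ge_zero[of "geoA (-1) c1 t"] by (auto simp: power2_eq_1_iff)
    ultimately show ?thesis using q(1) True by (auto simp: sl2_axis_def)
  next
    case False
    have s1: "t \<le> t'" if "cmod w' = 1" "0 \<le> t'" "geoA (-1) c' t' = geoA (-1) c1 t" "geoB (-1) c' w' t' = geoB (-1) c1 (cis \<theta>1) t" for c' w' t'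
      by (rule sl2.optimal_dest[OF opt(1) that(1,2), of c']) (simp add: that)
    have s2: "t \<le> t'" if "cmod w' = 1" "0 \<le> t'" "geoA (-1) c' t' = geoA (-1) c2 t" "geoB (-1) c' w' t' = geoB (-1) c2 (cis \<theta>2) t" for c' w' t'
      by (rule sl2.optimal_dest[OF opt(2) that(1,2), of c']) (simp add: that)
    have d1: "(c1\<^sup>2 - 1) / 4 \<le> 0 \<or> sqrt ((c1\<^sup>2 - 1) / 4) * t < pi"
      by (rule su11_shortest_in_domain[OF norm_cis t False s1])
    have d2: "(c2\<^sup>2 - 1) / 4 \<le> 0 \<or> sqrt ((c2\<^sup>2 - 1) / 4) * t < pi"
      by (rule su11_shortest_in_domain[OF norm_cis[of \<theta>2] t _ s2]) (use False e in simp_all)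
    have p: "0 < sinq ((c1\<^sup>2 - 1) / 4) t" "0 < sinq ((c2\<^sup>2 - 1) / 4) t" using sinq_pos[OF t] d1 d2 by blast+
    have eq: "sinq ((c1\<^sup>2 - 1) / 4) t = sinq ((c2\<^sup>2 - 1) / 4) t"
      using arg_cong[OF e(2), of cmod] p by (simp add: cmod_geoB)
    have "(c1\<^sup>2 - 1) / 4 = (c2\<^sup>2 - 1) / 4"
      by (rule sinq_inj[OF t _ _ eq]) (use d1 d2 less_imp_le in blast)+
    then have cc: "c2 = c1 \<or> c2 = - c1" using power2_eq_iff[of c2 c1] by simp
    have ne2: "c2 \<noteq> c1"
    proof
      assume "c2 = c1"
      moreover have "cis \<theta>1 = cis \<theta>2"
        by (rule geoB_inj[of c1 "-1" t]) (use False e calculation in \<open>auto simp: geoB_def\<close>)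
      ultimately show False using ne cis_angle_unique[OF \<theta>] by simp
    qed
    \<comment> \<open>Mirror geodesics have conjugate \<open>\<alpha>\<close>, so a common end point
      makes it real; a positive value is excluded by \<open>su11_not_shortest\<close>.\<close>
    then have "c2 = - c1" "c1 \<noteq> 0" using cc by auto
    then have "Im (geoA (-1) c2 t) = - Im (geoA (-1) c1 t)" by (simp add: geoA_cnj)
    then have im: "Im (geoA (-1) c1 t) = 0" using e(1) by simp
    have "Re (geoA (-1) c1 t) < 0"
    proof (rule ccontr)
      assume "\<not> Re (geoA (-1) c1 t) < 0"
      moreover have "geoA (-1) c1 t \<noteq> 0" using su11_alpha_gt(2)[OF n] .
      ultimately have re: "0 < Re (geoA (-1) c1 t)" using im by (simp add: complex_eq_iff)
      obtain w' t' where "cmod w' = 1" "0 \<le> t'" "geoA (-1) 0 t' = geoA (-1) c1 t"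
        "geoB (-1) 0 w' t' = geoB (-1) c1 (cis \<theta>1) t" "t' < t"
        using su11_not_shortest[OF norm_cis t False \<open>c1 \<noteq> 0\<close> d1 im re] by blast
      then show False using s1[of w' t' 0] by simp
    qed
    then show ?thesis unfolding negative_definite_SL2_def using q(1) n im by blast
  qed
qed

section \<open>Smooth maps\<close>

text \<open>On an open set a derivative depends only on nearby values, so equality passes to all
  iterated derivatives.\<close>

lemma Ck_on_cong_imp:
  assumes U: "open U" and eq: "\<And>x. x \<in> U \<Longrightarrow> f x = g x" and f: "Ck_on n U f"
  shows "Ck_on n U g"
  using eq f
proof (induction n arbitrary: f g)
  case 0 then show ?case using continuous_on_cong by auto
next
  case (Suc n)
  have D: "(g has_derivative frechet_derivative f (at x)) (at x)" if x: "x \<in> U" for x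
  proof -
    have "(f has_derivative frechet_derivative f (at x)) (at x)"
      using Suc.prems(2) x frechet_derivative_works by auto
    then show ?thesis using U x Suc.prems(1) by (rule has_derivative_transform_within_open)
  qed
  have eq': "frechet_derivative f (at x) v = frechet_derivative g (at x) v" if "x \<in> U" for x v
    by (simp only: frechet_derivative_at[OF D[OF that], symmetric])
  have "Ck_on n U (\<lambda>x. frechet_derivative g (at x) v)" for v
  proof (rule Suc.IH)
    show "Ck_on n U (\<lambda>x. frechet_derivative f (at x) v)" using Suc.prems(2) by simp
  qed (rule eq')
  then show ?case using D by (auto simp: differentiable_def)
qed

text \<open>Lets the derivative be supplied in closed form, which turns each rule for
  \<open>has_derivative\<close> into an induction step for \<open>Ck_on\<close>.\<close>

lemma Ck_on_SucI:
  assumes U: "open U" and D: "\<And>x. x \<in> U \<Longrightarrow> (f has_derivative f' x) (at x)" and C: "\<And>v. Ck_on n U (\<lambda>x. f' x v)"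
  shows "Ck_on (Suc n) U f"
proof -
  have "Ck_on n U (\<lambda>x. frechet_derivative f (at x) v)" for v
    by (rule Ck_on_cong_imp[OF U _ C[of v]]) (rule fun_cong[OF frechet_derivative_at[OF D]])
  then show ?thesis using D by (auto simp: differentiable_def)
qed

lemma Ck_on_SucD:
  assumes "Ck_on (Suc n) U f"
  shows "x \<in> U \<Longrightarrow> (f has_derivative frechet_derivative f (at x)) (at x)"
    and "Ck_on n U (\<lambda>x. frechet_derivative f (at x) v)"
  using assms frechet_derivative_works by auto

lemma Ck_on_mono: "Ck_on (Suc n) U f \<Longrightarrow> Ck_on n U f"
proof (induction n arbitrary: f)
  case 0
  then show ?case
    using differentiable_imp_continuous_within by (auto intro!: continuous_at_imp_continuous_on)
next
  case (Suc n)
  then show ?case by simp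
qed

lemma Ck_on_const: "Ck_on n U (\<lambda>_. c)"
  by (induction n arbitrary: c) auto

lemma Ck_on_compose_linear:
  assumes U: "open U" and L: "bounded_linear L" and f: "Ck_on n U f"
  shows "Ck_on n U (\<lambda>x. L (f x))"
  using f
proof (induction n arbitrary: f)
  case 0 then show ?case using bounded_linear.continuous_on[OF L] by simp
next
  case (Suc n)
  show ?case
    by (rule Ck_on_SucI[OF U bounded_linear.has_derivative[OF L Ck_on_SucD(1)[OF Suc.prems]]])
      (assumption | rule Suc.IH[OF Ck_on_SucD(2)[OF Suc.prems]])+
qed

lemma Ck_on_linear:
  assumes U: "open U" and L: "bounded_linear L"
  shows "Ck_on n U L"
proof (cases n)
  case 0 then show ?thesis using linear_continuous_on[OF L] by simp
next
  case (Suc m)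
  show ?thesis unfolding Suc
    by (rule Ck_on_SucI[OF U bounded_linear_imp_has_derivative[OF L]]) (rule Ck_on_const)
qed

lemma Ck_on_add:
  assumes U: "open U" and f: "Ck_on n U f" and g: "Ck_on n U g"
  shows "Ck_on n U (\<lambda>x. f x + g x)"
  using f g
proof (induction n arbitrary: f g)
  case 0 then show ?case by (simp add: continuous_on_add)
next
  case (Suc n)
  show ?case
    by (rule Ck_on_SucI[OF U has_derivative_add[OF Ck_on_SucD(1)[OF Suc.prems(1)] Ck_on_SucD(1)[OF Suc.prems(2)]]])
      (auto intro: Suc.IH Ck_on_SucD(2)[OF Suc.prems(1)] Ck_on_SucD(2)[OF Suc.prems(2)])
qed

lemma Ck_on_sum:
  assumes U: "open U" and f: "\<And>i. i \<in> I \<Longrightarrow> Ck_on n U (f i)"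
  shows "Ck_on n U (\<lambda>x. \<Sum>i\<in>I. f i x)"
proof (cases "finite I")
  case True
  then show ?thesis using f by (induction I rule: finite_induct) (auto intro: Ck_on_const Ck_on_add[OF U])
qed (simp add: Ck_on_const)

lemma Ck_on_mult:
  fixes f g :: "'a::real_normed_vector \<Rightarrow> real"
  assumes U: "open U" and f: "Ck_on n U f" and g: "Ck_on n U g"
  shows "Ck_on n U (\<lambda>x. f x * g x)"
  using f g
proof (induction n arbitrary: f g)
  case 0 then show ?case by (simp add: continuous_on_mult)
next
  case (Suc n)
  show ?case
    by (rule Ck_on_SucI[OF U has_derivative_mult[OF Ck_on_SucD(1)[OF Suc.prems(1)] Ck_on_SucD(1)[OF Suc.prems(2)]]])
      (auto intro!: Ck_on_add[OF U] Suc.IH Ck_on_SucD(2)[OF Suc.prems(1)] Ck_on_SucD(2)[OF Suc.prems(2)]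
        Ck_on_mono[OF Suc.prems(1)] Ck_on_mono[OF Suc.prems(2)])
qed

lemma Ck_on_minus:
  assumes "open U" "Ck_on n U f"
  shows "Ck_on n U (\<lambda>x. - f x)"
  by (rule Ck_on_compose_linear[OF assms(1) _ assms(2)]) (rule bounded_linear_minus[OF bounded_linear_ident])

lemma Ck_on_diff:
  assumes "open U" "Ck_on n U f" "Ck_on n U g"
  shows "Ck_on n U (\<lambda>x. f x - g x)"
  using Ck_on_add[OF assms(1,2) Ck_on_minus[OF assms(1,3)]] by simp

text \<open>The derivative of \<open>inverse f\<close> is a product of copies of
  \<open>inverse f\<close> with the derivative of \<open>f\<close>, so the induction feeds on itself
  one order lower.\<close>

lemma Ck_on_inverse:
  fixes f :: "'a::real_normed_vector \<Rightarrow> real"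
  assumes U: "open U" and f: "Ck_on n U f" and nz: "\<And>x. x \<in> U \<Longrightarrow> f x \<noteq> 0"
  shows "Ck_on n U (\<lambda>x. inverse (f x))"
  using f
proof (induction n)
  case 0 then show ?case using nz by (auto intro: continuous_on_inverse)
next
  case (Suc n)
  have i: "Ck_on n U (\<lambda>x. inverse (f x))" by (rule Suc.IH[OF Ck_on_mono[OF Suc.prems]])
  show ?case
    by (rule Ck_on_SucI[OF U Deriv.has_derivative_inverse[OF nz Ck_on_SucD(1)[OF Suc.prems]]])
      (auto intro!: Ck_on_minus[OF U] Ck_on_mult[OF U] i Ck_on_SucD(2)[OF Suc.prems])
qed

lemma Ck_on_divide:
  fixes f g :: "'a::real_normed_vector \<Rightarrow> real"
  assumes U: "open U" and "Ck_on n U f" "Ck_on n U g" "\<And>x. x \<in> U \<Longrightarrow> g x \<noteq> 0"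
  shows "Ck_on n U (\<lambda>x. f x / g x)"
  unfolding divide_inverse using assms by (intro Ck_on_mult Ck_on_inverse) auto

lemma Ck_on_sqrt:
  fixes f :: "'a::real_normed_vector \<Rightarrow> real"
  assumes U: "open U" and f: "Ck_on n U f" and pos: "\<And>x. x \<in> U \<Longrightarrow> 0 < f x"
  shows "Ck_on n U (\<lambda>x. sqrt (f x))"
  using f
proof (induction n)
  case 0 then show ?case by (auto intro: continuous_on_real_sqrt)
next
  case (Suc n)
  have s: "Ck_on n U (\<lambda>x. sqrt (f x))" by (rule Suc.IH[OF Ck_on_mono[OF Suc.prems]])
  have i: "Ck_on n U (\<lambda>x. inverse (sqrt (f x)))" by (rule Ck_on_inverse[OF U s]) (use pos in force)
  have D: "((\<lambda>x. sqrt (f x)) has_derivative (\<lambda>v. frechet_derivative f (at x) v * (inverse (sqrt (f x)) * (1 / 2)))) (at x)"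
    if "x \<in> U" for x
    using has_derivative_real_sqrt[OF pos[OF that] Ck_on_SucD(1)[OF Suc.prems that]]
    by (simp add: field_simps)
  show ?case
    by (rule Ck_on_SucI[OF U D]) (assumption | rule Ck_on_mult[OF U] i Ck_on_const Ck_on_SucD(2)[OF Suc.prems])+
qed

lemma bounded_linear_axis: "bounded_linear (axis i :: 'b::real_normed_vector \<Rightarrow> 'b^'n)"
proof (rule bounded_linear_intro[where K = 1])
  show "axis i (x + y) = axis i x + (axis i y :: 'b^'n)" for x y by (simp add: vec_eq_iff axis_def)
  show "axis i (r *\<^sub>R x) = r *\<^sub>R (axis i x :: 'b^'n)" for r x by (simp add: vec_eq_iff axis_def)
  show "norm (axis i x :: 'b^'n) \<le> norm x * 1" for x
  proof -
    have "norm (axis i x :: 'b^'n) \<le> (\<Sum>j\<in>UNIV. norm ((axis i x :: 'b^'n) $ j))" unfolding norm_vec_def by (rule L2_set_le_sum) simp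
    also have "\<dots> = (\<Sum>j\<in>UNIV. if j = i then norm x else 0)" by (rule sum.cong) (auto simp: axis_def)
    finally show ?thesis by simp
  qed
qed

text \<open>The map is the sum of its components placed along the coordinate axes. Components may be
  vectors themselves, so two applications handle matrices.\<close>

lemma Ck_on_vec:
  fixes f :: "'a::real_normed_vector \<Rightarrow> 'b::real_normed_vector^'n"
  assumes U: "open U" and f: "\<And>i. Ck_on n U (\<lambda>x. f x $ i)"
  shows "Ck_on n U f"
proof -
  have "Ck_on n U (\<lambda>x. \<Sum>i\<in>UNIV. (axis i (f x $ i) :: 'b^'n))"
    by (intro Ck_on_sum[OF U] Ck_on_compose_linear[OF U bounded_linear_axis] f)
  moreover have "(\<Sum>i\<in>UNIV. (axis i (f x $ i) :: 'b^'n)) = f x" for x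
    by (simp add: vec_eq_iff axis_def if_distrib cong: if_cong)
  ultimately show ?thesis by simp
qed

lemma smooth_mapI:
  assumes "open U" "X \<subseteq> U" "\<And>n. Ck_on n U g" "\<And>x. x \<in> X \<Longrightarrow> g x = f x"
  shows "smooth_map X f"
  unfolding smooth_map_def using assms by blast

lemma diffeomorphismI:
  assumes "f ` X \<subseteq> Y" "h ` Y \<subseteq> X" and hf: "\<And>x. x \<in> X \<Longrightarrow> h (f x) = x" and fh: "\<And>y. y \<in> Y \<Longrightarrow> f (h y) = y"
    and U: "open U" "X \<subseteq> U" "\<And>n. Ck_on n U f" and V: "open V" "Y \<subseteq> V" "\<And>n. Ck_on n V h"
  shows "diffeomorphism X Y f"
proof -
  have bij: "bij_betw f X Y" by (rule bij_betw_byWitness[where f' = h]) (use assms in auto)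
  have "h y = inv_into X f y" if "y \<in> Y" for y
  proof (rule inv_into_f_eq[symmetric])
    show "inj_on f X" using bij by (rule bij_betw_imp_inj_on)
  qed (use that assms in auto)
  then have "smooth_map Y (inv_into X f)" by (rule smooth_mapI[OF V])
  moreover have "smooth_map X f" by (rule smooth_mapI[OF U]) simp
  ultimately show ?thesis using bij by (simp add: diffeomorphism_def)
qed

lemma smooth_submanifold_one_chart:
  assumes "diffeomorphism (UNIV :: 'd::euclidean_space set) M f"
  shows "smooth_submanifold TYPE('d) M"
  unfolding smooth_submanifold_def using assms by (metis openin_subtopology_self open_UNIV)

section \<open>The strata\<close>

text \<open>Stereographic projection from 1, transported by the affine embedding \<open>E\<close>.
  The functionals \<open>p\<close> and \<open>q\<close> read off the circle coordinates, and on the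
  circle \<open>1 - p\<close> vanishes only at the removed point.\<close>

lemma circle_minus_point_submanifold:
  fixes P Q S :: "'a::euclidean_space" and p q :: "'a \<Rightarrow> real" and E :: "complex \<Rightarrow> 'a"
  assumes E: "\<And>z. E z = P + Re z *\<^sub>R Q + Im z *\<^sub>R S"
    and lin: "bounded_linear p" "bounded_linear q" and pq: "\<And>z. p (E z) = Re z" "\<And>z. q (E z) = Im z"
  shows "smooth_submanifold TYPE(real) (E ` sphere 0 1 - {E 1})"
proof -
  define f where "f t = E (Complex ((t * t - 1) / (t * t + 1)) (2 * t / (t * t + 1)))" for t :: real
  define h where "h M = q M / (1 - p M)" for M
  have D: "0 < t * t + 1" for t :: real by (simp add: add_nonneg_pos)
  have D': "t * t + 1 \<noteq> 0" for t :: real using D[of t] by simp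
  have pf: "p (f t) = (t * t - 1) / (t * t + 1)" "q (f t) = 2 * t / (t * t + 1)" for t by (simp_all add: f_def pq)
  have p1: "1 - p (f t) = 2 / (t * t + 1)" for t using D[of t] by (simp add: pf field_simps)
  have unit: "Re z * Re z + Im z * Im z = 1" if "z \<in> sphere 0 1" for z
    using that cmod_power2[of z] by (simp add: power2_eq_square)
  have pne: "p M \<noteq> 1" if M: "M \<in> E ` sphere 0 1 - {E 1}" for M
  proof
    assume "p M = 1"
    obtain z where z: "z \<in> sphere 0 1" "M = E z" using M by auto
    have "Re z = 1" using \<open>p M = 1\<close> z pq by simp
    then have "z = 1" using unit[OF z(1)] by (simp add: complex_eq_iff)
    then show False using M z by simp
  qed
  have "diffeomorphism UNIV (E ` sphere 0 1 - {E 1}) f"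
  proof (rule diffeomorphismI[where h = h and U = UNIV and V = "{M. p M \<noteq> 1}"])
    show "f ` UNIV \<subseteq> E ` sphere 0 1 - {E 1}"
    proof (rule image_subsetI)
      fix t :: real
      have "(t * t - 1)\<^sup>2 + (2 * t)\<^sup>2 = (t * t + 1)\<^sup>2" by (simp add: power2_eq_square algebra_simps)
      then have "((t * t - 1) / (t * t + 1))\<^sup>2 + (2 * t / (t * t + 1))\<^sup>2 = 1"
        using D[of t] by (simp add: power_divide add_divide_distrib[symmetric])
      then have "Complex ((t * t - 1) / (t * t + 1)) (2 * t / (t * t + 1)) \<in> sphere 0 1" by (simp add: cmod_def)
      moreover have "f t \<noteq> E 1"
      proof
        assume "f t = E 1"
        then have "1 - p (f t) = 0" using pq(1)[of 1] by simp
        then show False using p1[of t] D[of t] by simp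
      qed
      ultimately show "f t \<in> E ` sphere 0 1 - {E 1}" by (auto simp: f_def)
    qed
    show "h (f t) = t" for t unfolding h_def p1 pf(2) using D[of t] by simp
    show "f (h M) = M" if M: "M \<in> E ` sphere 0 1 - {E 1}" for M
    proof -
      obtain z where z: "z \<in> sphere 0 1" "M = E z" using M by auto
      define x y where "x = Re z" "y = Im z"
      have xy: "x * x + y * y = 1" using unit[OF z(1)] by (simp add: x_y_def)
      have x1: "1 - x \<noteq> 0" using pne[OF M] z pq by (simp add: x_y_def)
      have "h M = y / (1 - x)" by (simp add: h_def z pq x_y_def)
      moreover have "y / (1 - x) * (y / (1 - x)) + 1 = 2 / (1 - x)"
      proof -
        have "y * y + (1 - x) * (1 - x) = 2 * (1 - x)" using xy by (simp add: algebra_simps)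
        then show ?thesis using x1 by (simp add: divide_simps)
      qed
      ultimately have s: "h M * h M + 1 = 2 / (1 - x)" and hM: "h M = y / (1 - x)" by simp_all
      have "h M * h M - 1 = 2 / (1 - x) - 2" using s by linarith
      then have "(h M * h M - 1) / (h M * h M + 1) = x" unfolding s using x1 by (simp add: divide_simps)
      moreover have "2 * h M / (h M * h M + 1) = y" by (unfold s, unfold hM, use x1 in simp)
      ultimately show ?thesis by (simp add: f_def z x_y_def)
    qed
    show "Ck_on n UNIV f" for n
    proof -
      have c: "Ck_on n UNIV (\<lambda>t::real. t)" by (rule Ck_on_linear[OF open_UNIV bounded_linear_ident])
      have "Ck_on n UNIV (\<lambda>t. P + ((t * t - 1) / (t * t + 1)) *\<^sub>R Q + (2 * t / (t * t + 1)) *\<^sub>R S)"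
        by (intro Ck_on_add Ck_on_const Ck_on_compose_linear[OF open_UNIV bounded_linear_scaleR_left] Ck_on_divide
            Ck_on_diff Ck_on_mult c open_UNIV D')
      then show ?thesis by (simp add: f_def[abs_def] E)
    qed
    show "open {M. p M \<noteq> 1}"
      by (intro open_Collect_neq linear_continuous_on lin continuous_intros)
    then show "Ck_on n {M. p M \<noteq> 1} h" for n
      unfolding h_def[abs_def] by (intro Ck_on_divide Ck_on_diff Ck_on_const Ck_on_linear lin) auto
    show "E ` sphere 0 1 - {E 1} \<subseteq> {M. p M \<noteq> 1}" using pne by auto
  qed auto
  then show ?thesis by (rule smooth_submanifold_one_chart)
qed

lemma sl2_axis_eq: "sl2_axis = (\<lambda>z. MSL z 0) ` sphere 0 1"
  by (auto simp: sl2_axis_def)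

lemma sl2_axis_submanifold: "smooth_submanifold TYPE(real) (sl2_axis - {mat 1})"
  unfolding sl2_axis_eq MSL_one[symmetric]
proof (rule circle_minus_point_submanifold[where p = "\<lambda>M. Re (slA M)" and q = "\<lambda>M. Im (slA M)"])
  show "MSL z 0 = 0 + Re z *\<^sub>R MSL 1 0 + Im z *\<^sub>R MSL \<i> 0" for z by (simp add: mat2_eq_iff)
qed (auto intro: bounded_linear_compose[OF bounded_linear_Re bounded_linear_slA] bounded_linear_compose[OF bounded_linear_Im bounded_linear_slA])

lemma circle_diffeomorphic_sl2_axis: "diffeomorphic (sphere (0::real^2) 1) sl2_axis"
proof -
  define f where "f v = MSL (Complex (v$1) (v$2)) 0" for v :: "real^2"
  define h where "h M = (vector [Re (slA M), Im (slA M)] :: real^2)" for M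
  have n: "norm v = cmod (Complex (v$1) (v$2))" for v :: "real^2"
    by (simp add: norm_vec_def L2_set_def sum_2 cmod_def)
  have "diffeomorphism (sphere 0 1) sl2_axis f"
  proof (rule diffeomorphismI[where h = h and U = UNIV and V = UNIV])
    show "f ` sphere 0 1 \<subseteq> sl2_axis" by (auto simp: f_def sl2_axis_def n)
    show "h ` sl2_axis \<subseteq> sphere 0 1" by (auto simp: h_def sl2_axis_def n complex_surj)
    show "h (f v) = v" for v by (simp add: f_def h_def vec_eq_iff forall_2)
    show "f (h M) = M" if "M \<in> sl2_axis" for M using that by (auto simp: f_def h_def sl2_axis_def complex_surj)
    show "Ck_on n UNIV f" for n
    proof -
      have "Ck_on n UNIV (\<lambda>v :: real^2. (v$1) *\<^sub>R MSL 1 0 + (v$2) *\<^sub>R MSL \<i> 0)"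
        by (intro Ck_on_add open_UNIV Ck_on_compose_linear[OF open_UNIV bounded_linear_scaleR_left] Ck_on_linear bounded_linear_vec_nth)
      moreover have "(v$1) *\<^sub>R MSL 1 0 + (v$2) *\<^sub>R MSL \<i> 0 = f v" for v by (simp add: mat2_eq_iff f_def)
      ultimately show ?thesis by simp
    qed
    show "Ck_on n UNIV h" for n
    proof (rule Ck_on_vec[OF open_UNIV])
      fix i :: 2
      show "Ck_on n UNIV (\<lambda>M. h M $ i)" using exhaust_2[of i]
        by (auto simp: h_def intro!: Ck_on_linear bounded_linear_compose[OF bounded_linear_Re bounded_linear_slA]
            bounded_linear_compose[OF bounded_linear_Im bounded_linear_slA])
    qed
  qed auto
  then show ?thesis by (auto simp: diffeomorphic_def)
qed

text \<open>The surface is the graph of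
  \<open>\<alpha> = - sqrt (1 + (cmod \<beta>)\<^sup>2)\<close> over the plane of
  \<open>\<beta>\<close>.\<close>

lemma negative_definite_SL2_chart:
  "diffeomorphism (UNIV :: (real^2) set) negative_definite_SL2
     (\<lambda>v. MSL (of_real (- sqrt (1 + v$1 * v$1 + v$2 * v$2))) (Complex (v$1) (v$2)))"
proof -
  define f where "f v = MSL (of_real (- sqrt (1 + v$1 * v$1 + v$2 * v$2))) (Complex (v$1) (v$2))" for v :: "real^2"
  define h where "h M = (vector [Re (slB M), Im (slB M)] :: real^2)" for M
  have pos: "0 < 1 + v$1 * v$1 + v$2 * v$2" for v :: "real^2" by (simp add: add_pos_nonneg)
  have "diffeomorphism UNIV negative_definite_SL2 f"
  proof (rule diffeomorphismI[where h = h and U = UNIV and V = UNIV])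
    show "f ` UNIV \<subseteq> negative_definite_SL2"
    proof (rule image_subsetI)
      fix v :: "real^2"
      show "f v \<in> negative_definite_SL2" unfolding negative_definite_SL2_def f_def mem_Collect_eq
        by (rule exI, rule exI, rule conjI, rule refl) (use pos[of v] in \<open>simp add: cmod_power2 power2_eq_square[of "_ $ _"]\<close>)
    qed
    show "f (h M) = M" if M: "M \<in> negative_definite_SL2" for M
    proof -
      obtain \<alpha> \<beta> where e: "M = MSL \<alpha> \<beta>" "(cmod \<alpha>)\<^sup>2 + (-1) * (cmod \<beta>)\<^sup>2 = 1" "Im \<alpha> = 0" "Re \<alpha> < 0"
        using M unfolding negative_definite_SL2_def by blast
      have "1 + Re \<beta> * Re \<beta> + Im \<beta> * Im \<beta> = (- Re \<alpha>)\<^sup>2"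
        using e(2,3) by (simp add: cmod_power2) (simp add: power2_eq_square)
      then have "sqrt (1 + Re \<beta> * Re \<beta> + Im \<beta> * Im \<beta>) = - Re \<alpha>" using e(4) by simp
      then show ?thesis using e(3) by (simp add: f_def h_def e(1) complex_surj MSL_inj complex_eq_iff)
    qed
    show "h (f v) = v" for v by (simp add: f_def h_def vec_eq_iff forall_2)
    show "Ck_on n UNIV f" for n
    proof -
      have c: "Ck_on n UNIV (\<lambda>v :: real^2. v$i)" for i by (rule Ck_on_linear[OF open_UNIV bounded_linear_vec_nth])
      have "Ck_on n UNIV (\<lambda>v :: real^2. (sqrt (1 + v$1 * v$1 + v$2 * v$2)) *\<^sub>R MSL (- 1) 0 + ((v$1) *\<^sub>R MSL 0 1 + (v$2) *\<^sub>R MSL 0 \<i>))"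
        by (intro Ck_on_add open_UNIV Ck_on_compose_linear[OF open_UNIV bounded_linear_scaleR_left] Ck_on_sqrt Ck_on_mult Ck_on_const c pos)
      moreover have "(sqrt (1 + v$1 * v$1 + v$2 * v$2)) *\<^sub>R MSL (- 1) 0 + ((v$1) *\<^sub>R MSL 0 1 + (v$2) *\<^sub>R MSL 0 \<i>) = f v" for v
        by (simp add: mat2_eq_iff f_def)
      ultimately show ?thesis by simp
    qed
    show "Ck_on n UNIV h" for n
    proof (rule Ck_on_vec[OF open_UNIV])
      fix i :: 2
      show "Ck_on n UNIV (\<lambda>M. h M $ i)" using exhaust_2[of i]
        by (auto simp: h_def intro!: Ck_on_linear bounded_linear_compose[OF bounded_linear_Re bounded_linear_slB]
            bounded_linear_compose[OF bounded_linear_Im bounded_linear_slB])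
    qed
  qed auto
  then show ?thesis by (simp add: f_def[abs_def])
qed

text \<open>The only negative real \<open>\<alpha>\<close> of modulus 1 is
  \<open>-1\<close>.\<close>

lemma SL2_strata_meet: "negative_definite_SL2 \<inter> (sl2_axis - {mat 1}) = {MSL (- 1) 0}"
proof (intro equalityI subsetI)
  fix q assume "q \<in> negative_definite_SL2 \<inter> (sl2_axis - {mat 1})"
  then obtain \<alpha> \<beta> \<gamma> where e: "q = MSL \<alpha> \<beta>" "Im \<alpha> = 0" "Re \<alpha> < 0" "q = MSL \<gamma> 0" "cmod \<gamma> = 1"
    unfolding negative_definite_SL2_def sl2_axis_def by blast
  then have "\<alpha> = \<gamma>" "\<beta> = 0" by (auto simp: MSL_inj)
  then have "\<bar>Re \<alpha>\<bar> = 1" using e by (simp add: cmod_eq_Re)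
  then have "\<alpha> = - 1" using e by (simp add: complex_eq_iff)
  then show "q \<in> {MSL (- 1) 0}" using e \<open>\<beta> = 0\<close> by simp
next
  fix q assume "q \<in> {MSL (- 1) 0}"
  moreover have "MSL (- 1) 0 \<noteq> mat 1" unfolding MSL_one[symmetric] MSL_inj by simp
  moreover have "MSL (- 1) 0 \<in> negative_definite_SL2" unfolding negative_definite_SL2_def mem_Collect_eq
    by (rule exI, rule exI, rule conjI, rule refl) simp
  ultimately show "q \<in> negative_definite_SL2 \<inter> (sl2_axis - {mat 1})" by (auto simp: sl2_axis_def)
qed

definition rotation_z :: "complex \<Rightarrow> real^3^3" where
  "rotation_z z = vector [vector [Re z, - Im z, 0], vector [Im z, Re z, 0], vector [0, 0, 1]]"

text \<open>Passing to \<open>\<alpha>\<^sup>2\<close> removes the ambiguity of sign, so that the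
  circle is parametrized injectively.\<close>

lemma RR_axis_eq: "cmod \<alpha> = 1 \<Longrightarrow> RR \<alpha> 0 = rotation_z (\<alpha>\<^sup>2)"
  using cmod_power2[of \<alpha>] by (simp add: mat3_eq_iff RR_nth rotation_z_def power2_eq_square)

lemma so3_axis_eq: "so3_axis = rotation_z ` sphere 0 1"
proof (intro equalityI subsetI)
  fix q assume "q \<in> so3_axis"
  then obtain \<alpha> where a: "q = RR \<alpha> 0" "cmod \<alpha> = 1" by (auto simp: so3_axis_def)
  then show "q \<in> rotation_z ` sphere 0 1" using RR_axis_eq[of \<alpha>] by (auto simp: norm_power)
next
  fix q assume "q \<in> rotation_z ` sphere 0 1"
  then obtain z where z: "cmod z = 1" "q = rotation_z z" by auto
  have "cmod (csqrt z) = 1" using z by (simp add: norm_csqrt)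
  then show "q \<in> so3_axis" unfolding so3_axis_def mem_Collect_eq using RR_axis_eq[of "csqrt z"] z
    by (intro exI[of _ "csqrt z"]) simp
qed

lemma rotation_z_one: "rotation_z 1 = mat 1"
  by (simp add: rotation_z_def mat3_simps)

lemma so3_axis_submanifold: "smooth_submanifold TYPE(real) (so3_axis - {mat 1})"
  unfolding so3_axis_eq rotation_z_one[symmetric]
proof (rule circle_minus_point_submanifold[where p = "\<lambda>M. M$1$1" and q = "\<lambda>M. M$2$1"])
  show "rotation_z z = rotation_z 0 + Re z *\<^sub>R (rotation_z 1 - rotation_z 0) + Im z *\<^sub>R (rotation_z \<i> - rotation_z 0)" for z
    by (simp add: mat3_eq_iff rotation_z_def)
qed (auto simp: rotation_z_def bounded_linear_entry)

section \<open>Half-turns as the real projective plane\<close>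

definition half_turn :: "real^3 \<Rightarrow> real^3^3" where
  "half_turn n = (\<chi> a b. 2 * n$a * n$b / (n \<bullet> n) - (if a = b then 1 else 0))"

lemma half_turn_nth: "half_turn n $ a $ b = 2 * n$a * n$b / (n \<bullet> n) - (if a = b then 1 else 0)"
  by (simp add: half_turn_def)

text \<open>Division by \<open>n \<bullet> n\<close> makes the formula homogeneous of degree 0: it
  depends on the line only and can be evaluated in affine charts without normalizing.\<close>

lemma half_turn_scale: "c \<noteq> 0 \<Longrightarrow> half_turn (c *\<^sub>R n) = half_turn n"
  by (simp add: half_turn_def vec_eq_iff)

text \<open>The quaternion of a half-turn is purely imaginary, namely its unit axis vector.\<close>

lemma half_turn_unit:
  assumes "n \<bullet> n = 1"
  shows "half_turn n = RR (Complex 0 (n$3)) (Complex (n$1) (n$2))"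
proof -
  have "n$1 * n$1 + n$2 * n$2 + n$3 * n$3 = 1" using assms by (simp add: inner_vec_def sum_3)
  then show ?thesis by (simp add: mat3_eq_iff half_turn_nth assms RR_nth)
qed

lemma half_turns_eq: "half_turns = half_turn ` (- {0})"
proof (intro equalityI subsetI)
  fix q assume "q \<in> half_turns"
  then obtain \<alpha> \<beta> where e: "q = RR \<alpha> \<beta>" "(cmod \<alpha>)\<^sup>2 + (cmod \<beta>)\<^sup>2 = 1" "Re \<alpha> = 0" by (auto simp: half_turns_def)
  define n :: "real^3" where "n = vector [Re \<beta>, Im \<beta>, Im \<alpha>]"
  have "n \<bullet> n = 1" using e(2,3) unfolding cmod_unit_parts by (simp add: n_def inner_vec_def sum_3 add_ac)
  moreover have "Complex 0 (Im \<alpha>) = \<alpha>" using e(3) by (simp add: complex_eq_iff)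
  ultimately have "half_turn n = q" using half_turn_unit[of n] e(1) by (simp add: n_def complex_surj)
  moreover have "n \<noteq> 0" using \<open>n \<bullet> n = 1\<close> by auto
  ultimately show "q \<in> half_turn ` (- {0})" by auto
next
  fix q assume "q \<in> half_turn ` (- {0})"
  then obtain m where m: "m \<noteq> 0" "q = half_turn m" by auto
  define n where "n = (1 / norm m) *\<^sub>R m"
  have n: "n \<bullet> n = 1" using m by (simp add: n_def power2_norm_eq_inner[symmetric] power2_eq_square)
  have q: "q = half_turn n" using m half_turn_scale[of "1 / norm m" m] by (simp add: n_def)
  have "n$1 * n$1 + n$2 * n$2 + n$3 * n$3 = 1" using n by (simp add: inner_vec_def sum_3)
  then show "q \<in> half_turns" unfolding q half_turn_unit[OF n] half_turns_def mem_Collect_eq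
    by (intro exI[of _ "Complex 0 (n$3)"] exI[of _ "Complex (n$1) (n$2)"]) (simp add: cmod_unit_parts)
qed

lemma half_turn_eq_imp:
  assumes eq: "half_turn n = half_turn m" and nz: "n \<noteq> 0" "m \<noteq> 0"
  shows "span {n} = span {m}"
proof -
  have pos: "0 < n \<bullet> n" "0 < m \<bullet> m" using nz by auto
  have e: "n$a * n$b / (n \<bullet> n) = m$a * m$b / (m \<bullet> m)" for a b
    using arg_cong[OF eq, of "\<lambda>X. X $ a $ b"] by (simp add: half_turn_nth)
  define c where "c = (m \<bullet> n) / (m \<bullet> m)"
  have "n = c *\<^sub>R m"
  proof -
    have "n$a = c * m$a" for a
    proof -
      \<comment> \<open>Both matrices contain the projection to the line; applied to
        \<open>n\<close> it gives \<open>n\<close> in one form and a multiple of \<open>m\<close> in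
        the other.\<close>
      have "n$a * (n \<bullet> n) / (n \<bullet> n) = (\<Sum>b\<in>UNIV. n$a * n$b / (n \<bullet> n) * n$b)"
        by (simp add: inner_vec_def[of n n] sum_distrib_left sum_divide_distrib mult_ac)
      also have "\<dots> = (\<Sum>b\<in>UNIV. m$a * m$b / (m \<bullet> m) * n$b)" by (simp only: e)
      also have "\<dots> = m$a * (m \<bullet> n) / (m \<bullet> m)"
        by (simp add: inner_vec_def[of m n] sum_distrib_left sum_divide_distrib mult_ac)
      finally show ?thesis using pos by (simp add: c_def)
    qed
    then show ?thesis by (simp add: vec_eq_iff)
  qed
  moreover then have "c \<noteq> 0" using nz by auto
  ultimately have "n \<in> span {m}" "m = (1 / c) *\<^sub>R n" by (auto intro: span_scale span_base)
  then have "m \<in> span {n}" by (metis span_scale span_base singletonI)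
  then show ?thesis using \<open>n \<in> span {m}\<close> by (simp add: span_eq)
qed

lemma RP2_iff: "L \<in> RP2 \<longleftrightarrow> (\<exists>n. n \<noteq> 0 \<and> L = span {n})"
proof
  assume L: "L \<in> RP2"
  obtain B where B: "B \<subseteq> L" "independent B" "L \<subseteq> span B" "card B = dim L" using basis_exists by blast
  have sub: "subspace L" and "dim L = 1" using L by (auto simp: RP2_def)
  then obtain n where n: "B = {n}" using B(4) card_1_singletonE by metis
  moreover have "n \<noteq> 0" using B(2) n dependent_zero by blast
  moreover have "L = span B" using B sub by (simp add: span_minimal subset_antisym)
  ultimately show "\<exists>n. n \<noteq> 0 \<and> L = span {n}" by blast
next
  assume "\<exists>n. n \<noteq> 0 \<and> L = span {n}"
  then obtain n where n: "n \<noteq> 0" "L = span {n}" by blast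
  then have "dim L = 1" using dim_eq_card_independent[of "{n}"] by simp
  then show "L \<in> RP2" using n by (simp add: RP2_def)
qed

definition line_half_turn :: "(real^3) set \<Rightarrow> real^3^3" where
  "line_half_turn L = half_turn (SOME n. n \<in> L \<and> n \<noteq> 0)"

lemma line_half_turn_span:
  assumes "n \<noteq> 0"
  shows "line_half_turn (span {n}) = half_turn n"
proof -
  define m where "m = (SOME m. m \<in> span {n} \<and> m \<noteq> 0)"
  have "m \<in> span {n} \<and> m \<noteq> 0" unfolding m_def
    by (rule someI[of _ n]) (use assms in \<open>auto intro: span_base\<close>)
  then obtain c where "m = c *\<^sub>R n" "c \<noteq> 0" by (auto simp: span_singleton)
  then show ?thesis using half_turn_scale[of c n] by (simp add: line_half_turn_def m_def[symmetric])
qed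

lemma line_half_turn_bij: "bij_betw line_half_turn RP2 half_turns"
  unfolding bij_betw_def
proof
  show "inj_on line_half_turn RP2"
  proof (rule inj_onI)
    fix L K assume LK: "L \<in> RP2" "K \<in> RP2" and eq: "line_half_turn L = line_half_turn K"
    obtain n m where nm: "n \<noteq> 0" "L = span {n}" "m \<noteq> 0" "K = span {m}" using LK unfolding RP2_iff by blast
    then have "half_turn n = half_turn m" using eq by (simp add: line_half_turn_span)
    from half_turn_eq_imp[OF this nm(1,3)] show "L = K" unfolding nm(2,4) .
  qed
  show "line_half_turn ` RP2 = half_turns"
  proof (intro equalityI subsetI)
    fix q assume "q \<in> line_half_turn ` RP2"
    then obtain n where "n \<noteq> 0" "q = line_half_turn (span {n})" unfolding RP2_iff image_iff Bex_def by blast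
    then show "q \<in> half_turns" unfolding half_turns_eq using line_half_turn_span[of n] by simp
  next
    fix q assume "q \<in> half_turns"
    then obtain n where n: "n \<noteq> 0" "q = half_turn n" unfolding half_turns_eq by auto
    have "span {n} \<in> RP2" unfolding RP2_iff using n(1) by blast
    then show "q \<in> line_half_turn ` RP2" using line_half_turn_span[OF n(1)] n(2) by (intro image_eqI) simp_all
  qed
qed

text \<open>For the half-turn \<open>M\<close> about \<open>n\<close>, \<open>M$i$i + 1\<close> is
  \<open>2 * n$i * n$i / (n \<bullet> n)\<close>, so the chart domain consists of the lines with
  \<open>n$i \<noteq> 0\<close>. There the axis is scaled to \<open>n$i = 1\<close>, and
  \<open>M$i$j / (M$i$i + 1)\<close> is the affine coordinate \<open>n$j / n$i\<close>.\<close>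

lemma half_turn_chart:
  fixes i j k :: 3
  assumes d: "i \<noteq> j" "i \<noteq> k" "j \<noteq> k"
  defines "nu u \<equiv> (\<chi> a. if a = i then 1 else if a = j then (u :: real^2)$1 else u$2)"
  defines "W \<equiv> half_turns \<inter> {M. M$i$i \<noteq> -1}"
  shows "openin (top_of_set half_turns) W" "diffeomorphism UNIV W (\<lambda>u. half_turn (nu u))"
proof -
  have V: "open {M :: real^3^3. M$i$i \<noteq> -1}"
    by (intro open_Collect_neq linear_continuous_on bounded_linear_entry continuous_on_const)
  show "openin (top_of_set half_turns) W" unfolding W_def by (rule openin_open_Int[OF V])
  have U: "UNIV = {i, j, k}" using exhaust_3[of i] exhaust_3[of j] exhaust_3[of k] d by (auto simp: UNIV_3)
  define h where "h M = (vector [M$i$j / (M$i$i + 1), M$i$k / (M$i$i + 1)] :: real^2)" for M :: "real^3^3"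
  have nn: "nu u $ i = 1" "nu u $ j = u$1" "nu u $ k = u$2" for u using d by (simp_all add: nu_def)
  have D: "nu u \<bullet> nu u = 1 + u$1 * u$1 + u$2 * u$2" for u
    unfolding inner_vec_def U using d by (simp add: nn)
  have pos: "0 < nu u \<bullet> nu u" for u unfolding D by (simp add: add_pos_nonneg)
  have pos': "nu u \<bullet> nu u \<noteq> 0" for u using pos[of u] by simp
  show "diffeomorphism UNIV W (\<lambda>u. half_turn (nu u))"
  proof (rule diffeomorphismI[where h = h and U = UNIV and V = "{M. M$i$i \<noteq> -1}"])
    show "(\<lambda>u. half_turn (nu u)) ` UNIV \<subseteq> W"
    proof (rule image_subsetI)
      fix u
      have "nu u \<noteq> 0" using pos[of u] by auto
      moreover have "half_turn (nu u) $ i $ i \<noteq> -1" using pos[of u] by (simp add: half_turn_nth nn)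
      ultimately show "half_turn (nu u) \<in> W" by (auto simp: W_def half_turns_eq)
    qed
    show "h (half_turn (nu u)) = u" for u
      using pos[of u] d by (simp add: h_def half_turn_nth nn vec_eq_iff forall_2)
    show "half_turn (nu (h M)) = M" if M: "M \<in> W" for M
    proof -
      obtain m where m: "m \<noteq> 0" "M = half_turn m" "M$i$i \<noteq> -1" using M by (auto simp: W_def half_turns_eq)
      have p: "0 < m \<bullet> m" using m(1) by simp
      have mi: "m$i \<noteq> 0" using m(2,3) by (auto simp: half_turn_nth)
      have "h M $ 1 = m$j / m$i" "h M $ 2 = m$k / m$i" using d mi p by (simp_all add: h_def m(2) half_turn_nth)
      then have "nu (h M) $ a = ((1 / m$i) *\<^sub>R m) $ a" for a
        using U mi by (cases "a = i"; cases "a = j"; cases "a = k") (auto simp: nu_def)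
      then have "nu (h M) = (1 / m$i) *\<^sub>R m" by (subst vec_eq_iff) (rule allI)
      then show ?thesis using half_turn_scale[of "1 / m$i" m] mi m(2) by simp
    qed
    show "Ck_on n UNIV (\<lambda>u. half_turn (nu u))" for n
    proof -
      have c: "Ck_on n UNIV (\<lambda>u. nu u $ a)" for a
        by (cases "a = i"; cases "a = j") (auto simp: nu_def intro!: Ck_on_const Ck_on_linear bounded_linear_vec_nth)
      have cD: "Ck_on n UNIV (\<lambda>u. nu u \<bullet> nu u)" unfolding inner_vec_def inner_real_def
        by (intro Ck_on_sum Ck_on_mult c open_UNIV)
      show ?thesis
      proof (intro Ck_on_vec[OF open_UNIV])
        fix a b
        show "Ck_on n UNIV (\<lambda>u. half_turn (nu u) $ a $ b)" unfolding half_turn_nth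
          by (intro Ck_on_diff Ck_on_divide Ck_on_mult Ck_on_const c cD open_UNIV pos')
      qed
    qed
    show "Ck_on n {M. M$i$i \<noteq> -1} h" for n
    proof (rule Ck_on_vec[OF V])
      fix a :: 2
      have "Ck_on n {M. M$i$i \<noteq> -1} (\<lambda>M :: real^3^3. M$i$l / (M$i$i + 1))" for l
      proof -
        have c: "Ck_on n {M. M$i$i \<noteq> -1} (\<lambda>M :: real^3^3. M$i$l)" for l by (rule Ck_on_linear[OF V bounded_linear_entry])
        show ?thesis by (intro Ck_on_divide Ck_on_add Ck_on_const c V) (simp add: eq_neg_iff_add_eq_0)
      qed
      then show "Ck_on n {M. M$i$i \<noteq> -1} (\<lambda>M. h M $ a)" using exhaust_2[of a] by (auto simp: h_def)
    qed
    show "open {M :: real^3^3. M$i$i \<noteq> -1}" by (rule V)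
  qed (auto simp: W_def)
qed

lemma half_turns_submanifold: "smooth_submanifold TYPE(real^2) half_turns"
  unfolding smooth_submanifold_def
proof
  fix M assume M: "M \<in> half_turns"
  have ex: "\<exists>W (U::(real^2) set) f. openin (top_of_set half_turns) W \<and> M \<in> W \<and> open U \<and> diffeomorphism U W f"
    if "i \<noteq> j" "i \<noteq> k" "j \<noteq> k" "M$i$i \<noteq> -1" for i j k :: 3
    using half_turn_chart[OF that(1-3)] M that(4) open_UNIV by blast
  obtain m where m: "m \<noteq> 0" "M = half_turn m" using M by (auto simp: half_turns_eq)
  \<comment> \<open>If all three diagonal entries were \<open>-1\<close>, the axis would be
    0.\<close>
  have "M$1$1 \<noteq> -1 \<or> M$2$2 \<noteq> -1 \<or> M$3$3 \<noteq> -1"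
    using m by (auto simp: half_turn_nth vec_eq_iff forall_3)
  then show "\<exists>W (U::(real^2) set) f. openin (top_of_set half_turns) W \<and> M \<in> W \<and> open U \<and> diffeomorphism U W f"
    using ex[of 1 2 3] ex[of 2 1 3] ex[of 3 1 2] by (elim disjE) auto
qed

lemma half_turns_RP2: "diffeomorphic_RP2 half_turns"
  unfolding diffeomorphic_RP2_def
proof (intro exI[of _ line_half_turn] conjI line_half_turn_bij ballI)
  fix \<psi> assume "\<psi> \<in> RP2_params"
  \<comment> \<open>The charts differ only in the coordinate \<open>i\<close> that is set to 1, so
    one chart lemma serves all three.\<close>
  have "\<exists>i j k :: 3. i \<noteq> j \<and> i \<noteq> k \<and> j \<noteq> k \<and>
      \<psi> = (\<lambda>u. span {\<chi> a. if a = i then 1 else if a = j then u$1 else u$2})"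
  proof -
    have v: "vector [1, u$1, u$2] = (\<chi> a::3. if a = 1 then 1 else if a = 2 then u$1 else u$2)"
      "vector [u$1, 1, u$2] = (\<chi> a::3. if a = 2 then 1 else if a = 1 then u$1 else u$2)"
      "vector [u$1, u$2, 1] = (\<chi> a::3. if a = 3 then 1 else if a = 1 then u$1 else u$2)" for u :: "real^2"
      by (simp_all add: vec_eq_iff forall_3)
    show ?thesis using \<open>\<psi> \<in> RP2_params\<close> unfolding RP2_params_def v
      by (elim insertE emptyE) (rule exI[of _ 1] exI[of _ 2] exI[of _ 3], rule exI[of _ 1] exI[of _ 2], rule exI[of _ 2] exI[of _ 3], simp)+
  qed
  then obtain i j k :: 3 where d: "i \<noteq> j" "i \<noteq> k" "j \<noteq> k"
    and \<psi>: "\<psi> = (\<lambda>u. span {\<chi> a. if a = i then 1 else if a = j then u$1 else u$2})" by blast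
  define nu where "nu u = (\<chi> a. if a = i then 1 else if a = j then (u :: real^2)$1 else u$2)" for u
  have "nu u \<noteq> 0" for u by (auto simp: nu_def vec_eq_iff intro!: exI[of _ i])
  then have c: "line_half_turn \<circ> \<psi> = (\<lambda>u. half_turn (nu u))"
    unfolding \<psi> nu_def[symmetric] by (simp add: fun_eq_iff line_half_turn_span)
  note ch = half_turn_chart[OF d, folded nu_def]
  have "range (\<lambda>u. half_turn (nu u)) = half_turns \<inter> {M. M$i$i \<noteq> -1}"
    using ch(2) by (simp add: diffeomorphism_def bij_betw_def)
  then show "openin (top_of_set half_turns) (range (line_half_turn \<circ> \<psi>))"
    "diffeomorphism UNIV (range (line_half_turn \<circ> \<psi>)) (line_half_turn \<circ> \<psi>)"
    using ch unfolding c by simp_all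
qed

text \<open>On the axis \<open>\<alpha>\<close> has modulus 1, and a vanishing real part leaves
  \<open>\<i>\<close> and \<open>- \<i>\<close>, the two lifts of one half-turn.\<close>

lemma SO3_strata_meet: "half_turns \<inter> (so3_axis - {mat 1}) = {RR \<i> 0}"
proof (intro equalityI subsetI)
  fix q assume "q \<in> half_turns \<inter> (so3_axis - {mat 1})"
  then obtain \<alpha> \<beta> \<gamma> where e: "q = RR \<alpha> \<beta>" "(cmod \<alpha>)\<^sup>2 + (cmod \<beta>)\<^sup>2 = 1" "Re \<alpha> = 0" "q = RR \<gamma> 0" "cmod \<gamma> = 1"
    unfolding half_turns_def so3_axis_def by blast
  have b: "\<beta> = 0" using RR_eq_iff[OF e(2), of \<gamma> 0] e by auto
  then have "(Im \<alpha>)\<^sup>2 = 1" using e(2,3) by (simp add: cmod_power2)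
  then have "\<alpha> = \<i> \<or> \<alpha> = - \<i>" using e(3) by (auto simp: power2_eq_1_iff complex_eq_iff)
  then show "q \<in> {RR \<i> 0}" using e(1) b RR_minus[of \<i> 0] by auto
next
  fix q assume "q \<in> {RR \<i> 0}"
  moreover have "RR \<i> 0 \<noteq> mat 1"
  proof
    assume "RR \<i> 0 = mat 1"
    then have "RR \<i> 0 $1$1 = (mat 1 :: real^3^3)$1$1" by simp
    then show False by (simp add: RR_nth mat3_one)
  qed
  moreover have "RR \<i> 0 \<in> half_turns" unfolding half_turns_def mem_Collect_eq
    by (rule exI, rule exI, rule conjI, rule refl) simp
  ultimately show "q \<in> half_turns \<inter> (so3_axis - {mat 1})" by (auto simp: so3_axis_def)
qed

section \<open>Maximal circles\<close>

text \<open>The circle is cut out of the three-sphere by \<open>v$2 = 0\<close>, a real plane with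
  basis \<open>(1, 0)\<close> and \<open>(\<i>, 0)\<close>.\<close>

lemma maximal_circle_diagonal: "maximal_circle_SU2 {MSU \<alpha> 0 |\<alpha>. cmod \<alpha> = 1}"
  unfolding maximal_circle_SU2_def great_circle_def
proof (intro conjI exI)
  show "{MSU \<alpha> 0 |\<alpha>. cmod \<alpha> = 1} \<subseteq> SU2" using MSU_in_SU2[of _ 0] by auto
  define V where "V = {v :: complex^2. v$2 = 0}"
  show "subspace V" by (auto simp: V_def subspace_def)
  let ?B = "{vector [1, 0], vector [\<i>, 0]} :: (complex^2) set"
  have ne: "vector [1, 0] \<noteq> (vector [\<i>, 0] :: complex^2)" by (simp add: vec_eq_iff forall_2 complex_eq_iff)
  have sp: "v \<in> span ?B \<longleftrightarrow> (\<exists>a b. v = a *\<^sub>R vector [1, 0] + b *\<^sub>R vector [\<i>, 0])" for v by (rule span_pair)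
  have ind: "independent ?B"
  proof -
    have "vector [1, 0] \<notin> span {vector [\<i>, 0] :: complex^2}"
      by (auto simp: span_singleton vec_eq_iff forall_2 complex_eq_iff)
    moreover have "vector [\<i>, 0] \<noteq> (0 :: complex^2)" by (simp add: vec_eq_iff forall_2)
    ultimately show ?thesis using ne by (simp add: independent_insert)
  qed
  show "dim V = 2"
  proof (rule dim_unique[OF _ _ ind])
    show "?B \<subseteq> V" by (simp add: V_def)
    show "V \<subseteq> span ?B"
    proof
      fix v assume "v \<in> V"
      then have "v = Re (v$1) *\<^sub>R vector [1, 0] + Im (v$1) *\<^sub>R vector [\<i>, 0]"
        by (simp add: V_def vec_eq_iff forall_2 complex_eq_iff)
      then show "v \<in> span ?B" unfolding sp by blast
    qed
    show "card ?B = 2" using ne by simp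
  qed
  show "SU2_to_S3 ` {MSU \<alpha> 0 |\<alpha>. cmod \<alpha> = 1} = sphere 0 1 \<inter> V"
  proof (intro equalityI subsetI)
    fix v assume "v \<in> SU2_to_S3 ` {MSU \<alpha> 0 |\<alpha>. cmod \<alpha> = 1}"
    then show "v \<in> sphere 0 1 \<inter> V"
      by (auto simp: SU2_to_S3_def V_def norm_vec_def L2_set_def sum_2)
  next
    fix v assume v: "v \<in> sphere 0 1 \<inter> V"
    then have "v$2 = 0" "norm v = 1" by (auto simp: V_def)
    then have "cmod (v$1) = 1" by (simp add: norm_vec_def L2_set_def sum_2)
    moreover have "v = SU2_to_S3 (MSU (v$1) 0)" using v by (simp add: SU2_to_S3_def V_def vec_eq_iff forall_2)
    ultimately show "v \<in> SU2_to_S3 ` {MSU \<alpha> 0 |\<alpha>. cmod \<alpha> = 1}" by blast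
  qed
qed

lemma representation_su2_basis:
  fixes a b c :: real
  defines "v \<equiv> a *\<^sub>R su2_p1 + b *\<^sub>R su2_p2 + c *\<^sub>R su2_k"
  shows "representation {su2_p1, su2_p2, su2_k} v su2_p1 = a"
    "representation {su2_p1, su2_p2, su2_k} v su2_p2 = b"
    "representation {su2_p1, su2_p2, su2_k} v su2_k = c"
proof -
  let ?B = "{su2_p1, su2_p2, su2_k}"
  have ne: "su2_p1 \<noteq> su2_p2" "su2_p1 \<noteq> su2_k" "su2_p2 \<noteq> su2_k"
    by (auto simp: mat2_eq_iff complex_eq_iff)
  have "su2_k \<noteq> 0" by (auto simp: mat2_eq_iff complex_eq_iff)
  moreover have "su2_p2 \<notin> span {su2_k}" by (auto simp: span_singleton mat2_eq_iff complex_eq_iff)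
  moreover have "su2_p1 \<notin> span {su2_p2, su2_k}" unfolding span_pair by (auto simp: mat2_eq_iff complex_eq_iff)
  ultimately have I: "independent ?B" using ne by (simp add: independent_insert)
  have s: "x \<in> span ?B" if "x \<in> ?B" for x using that by (rule span_base)
  have "representation ?B v = (\<lambda>x. a * (if x = su2_p1 then 1 else 0) + b * (if x = su2_p2 then 1 else 0) + c * (if x = su2_k then 1 else 0))"
    unfolding v_def using s
    by (simp add: representation_add[OF I] span_add span_scale representation_scale[OF I] representation_basis[OF I])
  then show "representation ?B v su2_p1 = a" "representation ?B v su2_p2 = b" "representation ?B v su2_k = c"
    using ne by auto
qed

text \<open>Conjugation by a diagonal matrix fixes \<open>k\<close> and turns the plane of
  \<open>p1\<close> and \<open>p2\<close> by twice the argument of \<open>\<alpha>\<close>. This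
  identifies the image of the diagonal circle with the axis stratum of SO(3).\<close>

lemma SU2_to_SO3_diagonal:
  assumes a: "cmod \<alpha> = 1"
  shows "SU2_to_SO3 (MSU \<alpha> 0) = RR \<alpha> 0"
proof -
  have u: "\<alpha> * cnj \<alpha> = 1" using a complex_norm_square[of \<alpha>] by simp
  have inv: "matrix_inv (MSU \<alpha> 0) = MSU (cnj \<alpha>) 0"
  proof -
    have m: "MSU \<alpha> 0 ** MSU (cnj \<alpha>) 0 = mat 1" "MSU (cnj \<alpha>) 0 ** MSU \<alpha> 0 = mat 1"
      using u by (simp_all add: MSU_mult MSU_one mult.commute)
    then have "invertible (MSU \<alpha> 0)" by (auto simp: invertible_def)
    from matrix_inv_mult_cancel[OF this, of "MSU (cnj \<alpha>) 0"] show ?thesis by (simp add: m)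
  qed
  define c s where "c = Re \<alpha> * Re \<alpha> - Im \<alpha> * Im \<alpha>" "s = 2 * (Re \<alpha> * Im \<alpha>)"
  have n: "Re \<alpha> * Re \<alpha> + Im \<alpha> * Im \<alpha> = 1" using a cmod_power2[of \<alpha>] by (simp add: power2_eq_square)
  have conj: "MSU \<alpha> 0 ** su2_p1 ** MSU (cnj \<alpha>) 0 = c *\<^sub>R su2_p1 + s *\<^sub>R su2_p2 + 0 *\<^sub>R su2_k"
    "MSU \<alpha> 0 ** su2_p2 ** MSU (cnj \<alpha>) 0 = (- s) *\<^sub>R su2_p1 + c *\<^sub>R su2_p2 + 0 *\<^sub>R su2_k"
    "MSU \<alpha> 0 ** su2_k ** MSU (cnj \<alpha>) 0 = 0 *\<^sub>R su2_p1 + 0 *\<^sub>R su2_p2 + 1 *\<^sub>R su2_k"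
    using n by (simp_all add: mat2_simps complex_eq_iff c_s_def algebra_simps diff_divide_distrib)
  show ?thesis
    unfolding SU2_to_SO3_def inv mat3_eq_iff
    by (simp only: vec_lambda_beta su2_basis_def vector_3 conj representation_su2_basis RR_nth)
      (use n in \<open>simp add: c_s_def\<close>)
qed

lemma maximal_circle_so3_axis: "maximal_circle_SO3 so3_axis"
proof -
  have "SU2_to_SO3 ` {MSU \<alpha> 0 |\<alpha>. cmod \<alpha> = 1} = so3_axis"
    using SU2_to_SO3_diagonal by (auto simp: so3_axis_def image_iff) metis
  then show ?thesis using maximal_circle_diagonal by (auto simp: maximal_circle_SO3_def)
qed

theorem theorem1:
  shows "(\<exists>C. maximal_circle_SU2 C \<and> mat 1 \<in> C \<and>
            cut_locus SU2 su2_p1 su2_p2 su2_k = C - {mat 1}) \<and>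
         (\<exists>M N. cut_locus SO3 so3_p1 so3_p2 so3_k = M \<union> N \<and> (\<exists>q. M \<inter> N = {q}) \<and>
            smooth_submanifold TYPE(real^2) M \<and> diffeomorphic_RP2 M \<and>
            smooth_submanifold TYPE(real) N \<and>
            (\<exists>C. maximal_circle_SO3 C \<and> mat 1 \<in> C \<and> N = C - {mat 1})) \<and>
         (\<exists>M N. cut_locus SL2 sl2_p1 sl2_p2 sl2_k = M \<union> N \<and> (\<exists>q. M \<inter> N = {q}) \<and>
            smooth_submanifold TYPE(real^2) M \<and> diffeomorphic (UNIV :: (real^2) set) M \<and>
            smooth_submanifold TYPE(real) N \<and>
            (\<exists>C. C \<subseteq> SL2 \<and> diffeomorphic (sphere (0::real^2) 1) C \<and> mat 1 \<in> C \<and>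
                 N = C - {mat 1}))"
proof (intro conjI)
  have "mat 1 \<in> {MSU \<alpha> 0 |\<alpha>. cmod \<alpha> = 1}" using MSU_one[symmetric] by auto
  then show "\<exists>C. maximal_circle_SU2 C \<and> mat 1 \<in> C \<and> cut_locus SU2 su2_p1 su2_p2 su2_k = C - {mat 1}"
    using cut_locus_SU2 maximal_circle_diagonal by blast
  have "mat 1 \<in> so3_axis" using RR_one[symmetric] by (auto simp: so3_axis_def)
  then show "\<exists>M N. cut_locus SO3 so3_p1 so3_p2 so3_k = M \<union> N \<and> (\<exists>q. M \<inter> N = {q}) \<and>
            smooth_submanifold TYPE(real^2) M \<and> diffeomorphic_RP2 M \<and>
            smooth_submanifold TYPE(real) N \<and>
            (\<exists>C. maximal_circle_SO3 C \<and> mat 1 \<in> C \<and> N = C - {mat 1})"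
    using cut_locus_SO3 SO3_strata_meet half_turns_submanifold half_turns_RP2 so3_axis_submanifold maximal_circle_so3_axis
    by blast
  have "mat 1 \<in> sl2_axis" using MSL_one[symmetric] by (auto simp: sl2_axis_def)
  moreover have "sl2_axis \<subseteq> SL2" using MSL_in_SL2[of _ 0] by (auto simp: sl2_axis_def)
  moreover have "smooth_submanifold TYPE(real^2) negative_definite_SL2" "diffeomorphic (UNIV :: (real^2) set) negative_definite_SL2"
    using smooth_submanifold_one_chart[OF negative_definite_SL2_chart] negative_definite_SL2_chart by (auto simp: diffeomorphic_def)
  ultimately show "\<exists>M N. cut_locus SL2 sl2_p1 sl2_p2 sl2_k = M \<union> N \<and> (\<exists>q. M \<inter> N = {q}) \<and>
            smooth_submanifold TYPE(real^2) M \<and> diffeomorphic (UNIV :: (real^2) set) M \<and>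
            smooth_submanifold TYPE(real) N \<and>
            (\<exists>C. C \<subseteq> SL2 \<and> diffeomorphic (sphere (0::real^2) 1) C \<and> mat 1 \<in> C \<and> N = C - {mat 1})"
    using cut_locus_SL2 SL2_strata_meet sl2_axis_submanifold circle_diffeomorphic_sl2_axis
    by blast
qed

end
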